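(* Let $(W_1,s_1,\gamma_1)$ be an autonomous system such that, for the dynamics $\dot w_1=s_1(w_1)$ on $W_1$, the origin is a Lyapunov stable equilibrium point and every $w_0\in W_1$ is nonwandering. Let $(W_1,s_1,\gamma_1)$ be locally immersed into an autonomous system $(W_2,s_2,\gamma_2)$ of order $r_2$ via the map $\tau$. Denote $S_2=\left[\frac{\partial s_2}{\partial\zeta}\right]_{(0)}$ and $\Gamma_2=\left[\frac{\partial\gamma_2}{\partial\zeta}\right]_{(0)}$. Then there exists an autonomous system $(W_3,s_3,\gamma_3)$, with linearization $S_3=\left[\frac{\partial s_3}{\partial\zeta}\right]_{(0)}$ and $\Gamma_3=\left[\frac{\partial\gamma_3}{\partial\zeta}\right]_{(0)}$, such that $(W_1,s_1,\gamma_1)$ is locally immersed into $(W_3,s_3,\gamma_3)$, $S_3$ is isomorphic to the restriction of $S_2$ to one of its invariant subspaces, and all the eigenvalues of $S_3$ are on the imaginary axis. Furthermore, if the pair $(\Gamma_2,S_2)$ is detectable, then so is the pair $(\Gamma_3,S_3)$.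
   Context: An autonomous system of order $r_1$ is a triple $(W_1,s_1,\gamma_1)$, where $W_1\subset\mathbb{R}^{r_1}$ is an open set containing the origin and $s_1:W_1\to\mathbb{R}^{r_1}$, $\gamma_1:W_1\to\mathbb{R}$ are of class $C^2$ with $s_1(0)=0$, $\gamma_1(0)=0$ (it represents $\dot w_1=s_1(w_1)$, $u_1=\gamma_1(w_1)$). The system $(W_1,s_1,\gamma_1)$ is locally immersed into $(W_2,s_2,\gamma_2)$ (via $\tau$) if there exist an open set $\widetilde W_1\subset W_1$ containing the origin and a $C^2$ map $\tau:\widetilde W_1\to W_2$ with $\tau(0)=0$ and $\frac{\partial\tau}{\partial w_1}s_1(w_1)=s_2(\tau(w_1))$, $\gamma_1(w_1)=\gamma_2(\tau(w_1))$ for all $w_1\in\widetilde W_1$. Let $\phi_t$ denote the flow of $s_1$ on $W_1$. A point $w_0\in W_1$ is nonwandering if $\phi_t(w_0)$ is defined for all $t>0$ and for every neighborhood $\mathcal{O}$ of $w_0$ and every $T>0$ there exists $\tau'>T$ such that $\phi_{\tau'}(\mathcal{O})\cap\mathcal{O}\neq\emptyset$ (equivalently, there are sequences $t_n\to\infty$ in $(0,\infty)$ and $w_n\to w_0$ in $W_1$ such that $\phi_{t_n}(w_n)$ exists and $\phi_{t_n}(w_n)\to w_0$). A pair $(\Gamma,S)$ of matrices ($S$ square) is detectable if no $v\neq0$ satisfies $Sv=pv$, $\Gamma v=0$ for some $p\in\mathbb{C}$ with $\mathrm{Re}\,p\ge0$. *)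

theory Defs
  imports
    "HOL-Analysis.Analysis"
    "Jordan_Normal_Form.Char_Poly"
    "Jordan_Normal_Form.VS_Connect"
begin

text \<open>
  The orders of the systems are natural numbers, since the order of a system can itself be
  existentially quantified, and may be \<open>0\<close>. Hence \<open>\<real>\<^sup>r\<close> is the library's \<open>Euclidean_space r\<close>: sequences
  \<^typ>\<open>nat \<Rightarrow> real\<close> vanishing from index \<open>r\<close> on. Matrices are those of
  Jordan_Normal_Form, whose dimensions are natural numbers as well.
\<close>

abbreviation origin :: "nat \<Rightarrow> real" where
  "origin \<equiv> (\<lambda>_. 0)"

abbreviation cmat :: "real mat \<Rightarrow> complex mat" where
  "cmat \<equiv> map_mat complex_of_real"


subsection \<open>Differentiability on open subsets of Euclidean space\<close>

text \<open>For \<open>x\<close> in an open \<open>W \<subseteq> \<real>\<^sup>r\<close> and \<open>i < r\<close>, this depends on the values of \<open>f\<close> on \<open>W\<close> only.\<close>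

definition partial_deriv :: "nat \<Rightarrow> ((nat \<Rightarrow> real) \<Rightarrow> real) \<Rightarrow> (nat \<Rightarrow> real) \<Rightarrow> real" where
  "partial_deriv i f x = deriv (\<lambda>t. f (x(i := t))) (x i)"

text \<open>\<open>C\<^sup>k\<close> for real-valued functions: all iterated partial derivatives up to order \<open>k\<close> exist
  and are continuous on \<open>W\<close>.\<close>

fun Ck_scalar :: "nat \<Rightarrow> nat \<Rightarrow> (nat \<Rightarrow> real) set \<Rightarrow> ((nat \<Rightarrow> real) \<Rightarrow> real) \<Rightarrow> bool" where
  "Ck_scalar 0 r W f \<longleftrightarrow>
     continuous_map (subtopology (Euclidean_space r) W) euclideanreal f"
| "Ck_scalar (Suc k) r W f \<longleftrightarrow>
     continuous_map (subtopology (Euclidean_space r) W) euclideanreal f \<and>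
     (\<forall>i<r. (\<forall>x\<in>W. (\<lambda>t. f (x(i := t))) field_differentiable at (x i)) \<and>
            Ck_scalar k r W (partial_deriv i f))"

definition Ck_map ::
  "nat \<Rightarrow> nat \<Rightarrow> nat \<Rightarrow> (nat \<Rightarrow> real) set \<Rightarrow> ((nat \<Rightarrow> real) \<Rightarrow> nat \<Rightarrow> real) \<Rightarrow> bool" where
  "Ck_map k r m W f \<longleftrightarrow>
     f ` W \<subseteq> topspace (Euclidean_space m) \<and> (\<forall>i<m. Ck_scalar k r W (\<lambda>x. f x i))"

definition jacobian ::
  "nat \<Rightarrow> nat \<Rightarrow> ((nat \<Rightarrow> real) \<Rightarrow> nat \<Rightarrow> real) \<Rightarrow> (nat \<Rightarrow> real) \<Rightarrow> real mat" where
  "jacobian m r f x = mat m r (\<lambda>(i, j). partial_deriv j (\<lambda>y. f y i) x)"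


subsection \<open>Autonomous systems\<close>

type_synonym asystem =
  "(nat \<Rightarrow> real) set \<times> ((nat \<Rightarrow> real) \<Rightarrow> nat \<Rightarrow> real) \<times> ((nat \<Rightarrow> real) \<Rightarrow> real)"

fun autonomous_system :: "nat \<Rightarrow> asystem \<Rightarrow> bool" where
  "autonomous_system r (W, s, \<gamma>) \<longleftrightarrow>
     openin (Euclidean_space r) W \<and> origin \<in> W \<and>
     Ck_map 2 r r W s \<and> Ck_scalar 2 r W \<gamma> \<and>
     s origin = origin \<and> \<gamma> origin = 0"

fun lin_dyn :: "nat \<Rightarrow> asystem \<Rightarrow> real mat" where
  "lin_dyn r (W, s, \<gamma>) = jacobian r r s origin"

fun lin_out :: "nat \<Rightarrow> asystem \<Rightarrow> real mat" where
  "lin_out r (W, s, \<gamma>) = jacobian 1 r (\<lambda>x _. \<gamma> x) origin"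

text \<open>\<open>Matrix.vec r\<close> turns a point of \<open>\<real>\<^sup>r\<close> into a vector to which matrices can be applied.\<close>

fun locally_immersed_via ::
  "((nat \<Rightarrow> real) \<Rightarrow> nat \<Rightarrow> real) \<Rightarrow> nat \<Rightarrow> asystem \<Rightarrow> nat \<Rightarrow> asystem \<Rightarrow> bool" where
  "locally_immersed_via \<tau> r1 (W1, s1, \<gamma>1) r2 (W2, s2, \<gamma>2) \<longleftrightarrow>
     (\<exists>U. openin (Euclidean_space r1) U \<and> U \<subseteq> W1 \<and> origin \<in> U \<and>
        Ck_map 2 r1 r2 U \<tau> \<and> \<tau> ` U \<subseteq> W2 \<and> \<tau> origin = origin \<and>
        (\<forall>w\<in>U. jacobian r2 r1 \<tau> w *\<^sub>v Matrix.vec r1 (s1 w) = Matrix.vec r2 (s2 (\<tau> w)) \<and>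
               \<gamma>1 w = \<gamma>2 (\<tau> w)))"

definition locally_immersed :: "nat \<Rightarrow> asystem \<Rightarrow> nat \<Rightarrow> asystem \<Rightarrow> bool" where
  "locally_immersed r1 \<Sigma>1 r2 \<Sigma>2 \<longleftrightarrow> (\<exists>\<tau>. locally_immersed_via \<tau> r1 \<Sigma>1 r2 \<Sigma>2)"


subsection \<open>Flow, stability, nonwandering points\<close>

text \<open>\<open>flows_to r W s t w v\<close> means that \<open>\<phi>\<^sub>t(w)\<close>, for \<open>t \<ge> 0\<close>, is defined and equal to \<open>v\<close>: some
  solution of \<open>x' = s(x)\<close> staying in \<open>W\<close> on \<open>[0, t]\<close> leads from \<open>w\<close> to \<open>v\<close>. For \<open>s\<close> of class
  \<open>C\<^sup>1\<close> such a \<open>v\<close> is unique, so \<open>\<phi>\<^sub>t\<close> is represented by its graph.\<close>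

definition flows_to ::
  "nat \<Rightarrow> (nat \<Rightarrow> real) set \<Rightarrow> ((nat \<Rightarrow> real) \<Rightarrow> nat \<Rightarrow> real) \<Rightarrow> real \<Rightarrow>
   (nat \<Rightarrow> real) \<Rightarrow> (nat \<Rightarrow> real) \<Rightarrow> bool" where
  "flows_to r W s t w v \<longleftrightarrow> 0 \<le> t \<and>
     (\<exists>x :: real \<Rightarrow> nat \<Rightarrow> real. x 0 = w \<and> x t = v \<and>
        (\<forall>u\<in>{0..t}. x u \<in> W \<and>
           (\<forall>i<r. ((\<lambda>u. x u i) has_real_derivative s (x u) i) (at u within {0..t}))))"

definition flow_image ::
  "nat \<Rightarrow> (nat \<Rightarrow> real) set \<Rightarrow> ((nat \<Rightarrow> real) \<Rightarrow> nat \<Rightarrow> real) \<Rightarrow> real \<Rightarrow>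
   (nat \<Rightarrow> real) set \<Rightarrow> (nat \<Rightarrow> real) set" where
  "flow_image r W s t A = {v. \<exists>w\<in>A. flows_to r W s t w v}"

text \<open>On \<open>\<real>\<^sup>r\<close>, \<open>L2_set w {..<r}\<close> is the Euclidean norm of \<open>w\<close>. Stability includes existence of
  the solution for all future times.\<close>

fun lyapunov_stable_origin :: "nat \<Rightarrow> asystem \<Rightarrow> bool" where
  "lyapunov_stable_origin r (W, s, \<gamma>) \<longleftrightarrow> s origin = origin \<and>
     (\<forall>\<epsilon>>0. \<exists>\<delta>>0. \<forall>w\<in>W. L2_set w {..<r} < \<delta> \<longrightarrow>
        (\<forall>t\<ge>0. \<exists>v. flows_to r W s t w v \<and> L2_set v {..<r} < \<epsilon>))"

fun nonwandering :: "nat \<Rightarrow> asystem \<Rightarrow> (nat \<Rightarrow> real) \<Rightarrow> bool" where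
  "nonwandering r (W, s, \<gamma>) w0 \<longleftrightarrow>
     (\<forall>t>0. \<exists>v. flows_to r W s t w0 v) \<and>
     (\<forall>N. openin (Euclidean_space r) N \<and> w0 \<in> N \<longrightarrow>
        (\<forall>T>0. \<exists>t>T. flow_image r W s t N \<inter> N \<noteq> {}))"


subsection \<open>Linear algebra\<close>

definition isomorphic_to_restriction :: "real mat \<Rightarrow> nat \<Rightarrow> real mat \<Rightarrow> (real Matrix.vec) set \<Rightarrow> bool" where
  "isomorphic_to_restriction A n B V \<longleftrightarrow>
     (\<exists>f. bij_betw f (carrier_vec n) V \<and>
        (\<forall>x\<in>carrier_vec n. \<forall>y\<in>carrier_vec n. f (x + y) = f x + f y) \<and>
        (\<forall>c. \<forall>x\<in>carrier_vec n. f (c \<cdot>\<^sub>v x) = c \<cdot>\<^sub>v f x) \<and>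
        (\<forall>x\<in>carrier_vec n. f (A *\<^sub>v x) = B *\<^sub>v f x))"

definition invariant_subspace :: "nat \<Rightarrow> real mat \<Rightarrow> (real Matrix.vec) set \<Rightarrow> bool" where
  "invariant_subspace n B V \<longleftrightarrow>
     VectorSpace.subspace class_ring V (module_vec TYPE(real) n) \<and> (\<forall>v\<in>V. B *\<^sub>v v \<in> V)"

definition detectable :: "real mat \<Rightarrow> real mat \<Rightarrow> bool" where
  "detectable \<Gamma> S \<longleftrightarrow>
     \<not> (\<exists>v p. eigenvector (cmat S) v p \<and> cmat \<Gamma> *\<^sub>v v = 0\<^sub>v (dim_row \<Gamma>) \<and> 0 \<le> Re p)"

end

theory Submission
  imports Defs "Jordan_Normal_Form.Jordan_Normal_Form_Existence"
begin

text \<open>Let \<open>L\<close> and \<open>Q\<close> be the projection of \<open>\<real>\<^sup>n\<close>, \<open>n = r2\<close>, onto coordinates \<open>\<real>\<^sup>m\<close> of the centre subspace of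
\<open>S\<^sub>2\<close> (the sum of the generalized eigenspaces for eigenvalues on the imaginary axis) and the inclusion
back, so that \<open>L Q = 1\<close> and \<open>S\<^sub>2 Q = Q (L S\<^sub>2 Q)\<close>. The reduced system is
\<open>s\<^sub>3(\<xi>) = L s\<^sub>2(p(\<xi>))\<close>, \<open>\<gamma>\<^sub>3 = \<gamma>\<^sub>2 \<circ> p\<close>, where \<open>p\<close> is a \<open>C\<^sup>2\<close> map with \<open>p(0) = 0\<close> and derivative \<open>Q\<close> at
\<open>0\<close> whose graph over the centre subspace contains every complete orbit of \<open>s\<^sub>2\<close> that stays close to the
origin. Its linearization is \<open>L S\<^sub>2 Q\<close>, the restriction of \<open>S\<^sub>2\<close> to the range of \<open>Q\<close>, and its linear
output is \<open>\<Gamma>\<^sub>2 Q\<close> (\<open>pullback_system\<close>), so an undetectable eigenvector \<open>v\<close> of the reduced pair would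
give the undetectable eigenvector \<open>Q v\<close> of the given one (\<open>detectable_factor\<close>).

The immersion is \<open>L \<circ> \<tau>\<close>, and all that has to be known about \<open>p\<close> is \<open>\<tau> = p \<circ> L \<circ> \<tau>\<close> near the origin
(\<open>factor_immersion\<close>): then \<open>(L \<circ> \<tau>)' s\<^sub>1 = L s\<^sub>2(\<tau>) = s\<^sub>3(L \<tau>)\<close>.
The identity follows from two facts.

\<^item> Every \<open>w\<close> near the origin of \<open>W1\<close> lies on a solution that is defined for all positive and
negative times and stays small (\<open>complete_orbit\<close>). Forward in time this is stability. Backward, a nonwandering
point is a limit of end points of orbit segments of length tending to infinity that also start near it and
hence stay small; reading these segments backwards from their end points and passing to the limit gives
the past of \<open>w\<close>. The map \<open>\<tau>\<close> carries this solution to a small complete orbit of \<open>s\<^sub>2\<close>.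

\<^item> A small complete orbit \<open>\<zeta>\<close> of \<open>s\<^sub>2\<close> satisfies \<open>\<zeta>(0) = p(L \<zeta>(0))\<close> (\<open>center_graph\<close>). This is the
construction of the centre manifold by Lyapunov and Perron. Far from the origin the nonlinearity of \<open>s\<^sub>2\<close> is cut off,
so that it becomes globally small in the Lipschitz sense (\<open>cutoff\<close>), and \<open>S\<^sub>2\<close> is brought to a diagonal
form with small off-diagonal terms (\<open>center_coordinates\<close>). A scalar equation \<open>y' = \<lambda> y + f\<close> whose
right-hand side grows slowly has exactly one slowly growing solution if \<open>Re \<lambda> \<noteq> 0\<close>, and one for each initial value
if \<open>Re \<lambda> = 0\<close>. By the contraction principle the full equation then has exactly one slowly growing
solution \<open>\<Psi> c\<close> for each initial value \<open>c\<close> of the centre components, and \<open>p\<close> is \<open>\<Psi> c\<close> at time \<open>0\<close>. A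
small complete orbit grows slowly, hence is one of these solutions.

That \<open>p\<close> is \<open>C\<^sup>2\<close> is seen by differentiating the equation for \<open>\<Psi>\<close> formally twice, solving the
resulting linear equations by the same contraction principle, and comparing. A product of two solutions
adds their growth rates: first derivatives grow at the rate \<open>\<eta>\<close>, their differences and second derivatives at the
rate \<open>2 \<eta>\<close>, differences of second derivatives at the rate \<open>3 \<eta>\<close>. The spectral gap is wide enough for all of these.\<close>

section \<open>Calculus in coordinates\<close>

abbreviation Eucl :: "nat \<Rightarrow> (nat \<Rightarrow> real) set" where
  "Eucl r \<equiv> topspace (Euclidean_space r)"

text \<open>Points that vanish outside the first \<open>r\<close> coordinates are compared coordinate by coordinate; this turns all
topological statements below into finitely many inequalities between real numbers.\<close>

definition box_close :: "nat \<Rightarrow> real \<Rightarrow> (nat \<Rightarrow> real) \<Rightarrow> (nat \<Rightarrow> real) \<Rightarrow> bool" where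
  "box_close r d x y \<longleftrightarrow> (\<forall>i<r. \<bar>y i - x i\<bar> < d)"

lemma Eucl_iff: "x \<in> Eucl r \<longleftrightarrow> (\<forall>i\<ge>r. x i = 0)"
  by (simp add: topspace_Euclidean_space)

text \<open>The metric of \<^typ>\<open>nat \<Rightarrow> real\<close> is a weighted sum over all coordinates, so up to a tail
of size \<open>2\<^sup>-\<^sup>N\<close> it is controlled by finitely many of them.\<close>

lemma box_close_imp_dist:
  assumes "0 < e"
  shows "\<exists>d>0. \<forall>x\<in>Eucl r. \<forall>y\<in>Eucl r. box_close r d x y \<longrightarrow> dist x y < e"
proof -
  obtain N where N: "(1 / 2 :: real) ^ N < e / 2"
    using real_arch_pow_inv[of "e / 2" "1 / 2"] assms by auto
  show ?thesis
  proof (intro exI[of _ "e / 4"] conjI ballI impI)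
    fix x y assume x: "x \<in> Eucl r" "y \<in> Eucl r" and c: "box_close r (e / 4) x y"
    have le: "dist (x i) (y i) < e / 4" for i
      using x c assms by (cases "i < r") (auto simp: box_close_def Eucl_iff dist_real_def abs_minus_commute)
    have "dist x y \<le> 2 * Max {dist (x (from_nat n)) (y (from_nat n)) | n. n \<le> N} + (1 / 2) ^ N"
      by (rule dist_fun_le_dist_first_terms)
    also have "Max {dist (x (from_nat n)) (y (from_nat n)) | n. n \<le> N} < e / 4"
      using le by (subst Max_less_iff) auto
    finally show "dist x y < e" using N by simp
  qed (use assms in auto)
qed

lemma dist_imp_box_close:
  assumes "0 < d"
  shows "\<exists>e>0. \<forall>y. dist y x < e \<longrightarrow> box_close r d x y"
proof -
  have o: "open {y :: nat \<Rightarrow> real. \<bar>y i - x i\<bar> < d}" for i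
    by (intro open_Collect_less continuous_intros continuous_on_product_coordinates)
  define B where "B = (\<Inter>i\<in>{..<r}. {y :: nat \<Rightarrow> real. \<bar>y i - x i\<bar> < d})"
  have "open B" unfolding B_def using o by (intro open_INT) auto
  moreover have "x \<in> B" using assms by (auto simp: B_def)
  ultimately obtain e where e: "e > 0" "\<forall>y. dist y x < e \<longrightarrow> y \<in> B" unfolding open_dist by blast
  moreover have "y \<in> B \<longleftrightarrow> box_close r d x y" for y by (auto simp: B_def box_close_def)
  ultimately show ?thesis by auto
qed

lemma openin_Eucl_iff:
  "openin (Euclidean_space r) W \<longleftrightarrow>
    W \<subseteq> Eucl r \<and> (\<forall>x\<in>W. \<exists>d>0. \<forall>y\<in>Eucl r. box_close r d x y \<longrightarrow> y \<in> W)"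
proof -
  have E: "Euclidean_space r = top_of_set (Eucl r)"
    unfolding Euclidean_space_def euclidean_product_topology by simp
  have "(\<exists>e>0. \<forall>y\<in>Eucl r. dist y x < e \<longrightarrow> y \<in> W) \<longleftrightarrow> (\<exists>d>0. \<forall>y\<in>Eucl r. box_close r d x y \<longrightarrow> y \<in> W)"
    if x: "x \<in> Eucl r" for x
  proof
    assume "\<exists>e>0. \<forall>y\<in>Eucl r. dist y x < e \<longrightarrow> y \<in> W"
    then obtain e where e: "e > 0" "\<forall>y\<in>Eucl r. dist y x < e \<longrightarrow> y \<in> W" by blast
    obtain d where "d > 0" "\<forall>y\<in>Eucl r. box_close r d x y \<longrightarrow> dist x y < e"
      using box_close_imp_dist[OF e(1), of r] x by blast
    with e show "\<exists>d>0. \<forall>y\<in>Eucl r. box_close r d x y \<longrightarrow> y \<in> W" by (metis dist_commute)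
  next
    assume "\<exists>d>0. \<forall>y\<in>Eucl r. box_close r d x y \<longrightarrow> y \<in> W"
    then obtain d where d: "d > 0" "\<forall>y\<in>Eucl r. box_close r d x y \<longrightarrow> y \<in> W" by blast
    obtain e where "e > 0" "\<forall>y. dist y x < e \<longrightarrow> box_close r d x y"
      using dist_imp_box_close[OF d(1), of x r] by blast
    with d show "\<exists>e>0. \<forall>y\<in>Eucl r. dist y x < e \<longrightarrow> y \<in> W" by blast
  qed
  note eq = this
  have "openin (Euclidean_space r) W \<longleftrightarrow> openin (top_of_set (Eucl r)) W" by (subst E) (rule refl)
  also have "\<dots> \<longleftrightarrow> W \<subseteq> Eucl r \<and> (\<forall>x\<in>W. \<exists>e>0. \<forall>y\<in>Eucl r. dist y x < e \<longrightarrow> y \<in> W)"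
    by (rule openin_euclidean_subtopology_iff)
  finally show ?thesis using eq by (auto simp: subset_iff)
qed

lemma continuous_Eucl_iff:
  assumes "W \<subseteq> Eucl r"
  shows "continuous_map (subtopology (Euclidean_space r) W) euclideanreal f \<longleftrightarrow>
    (\<forall>x\<in>W. \<forall>e>0. \<exists>d>0. \<forall>y\<in>W. box_close r d x y \<longrightarrow> \<bar>f y - f x\<bar> < e)"
proof -
  have E: "subtopology (Euclidean_space r) W = top_of_set W"
    unfolding Euclidean_space_def euclidean_product_topology subtopology_subtopology
    using assms by (simp add: topspace_Euclidean_space Int_absorb1)
  have "(\<exists>d>0. \<forall>y\<in>W. dist y x < d \<longrightarrow> dist (f y) (f x) < e) \<longleftrightarrow>
      (\<exists>d>0. \<forall>y\<in>W. box_close r d x y \<longrightarrow> \<bar>f y - f x\<bar> < e)" if x: "x \<in> W" for x e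
  proof
    assume "\<exists>d>0. \<forall>y\<in>W. dist y x < d \<longrightarrow> dist (f y) (f x) < e"
    then obtain d where d: "d > 0" "\<forall>y\<in>W. dist y x < d \<longrightarrow> dist (f y) (f x) < e" by blast
    obtain d' where "d' > 0" "\<forall>y\<in>Eucl r. box_close r d' x y \<longrightarrow> dist x y < d"
      using box_close_imp_dist[OF d(1), of r] x assms by blast
    with d show "\<exists>d>0. \<forall>y\<in>W. box_close r d x y \<longrightarrow> \<bar>f y - f x\<bar> < e"
      using assms by (metis dist_commute dist_real_def subsetD)
  next
    assume "\<exists>d>0. \<forall>y\<in>W. box_close r d x y \<longrightarrow> \<bar>f y - f x\<bar> < e"
    then obtain d where d: "d > 0" "\<forall>y\<in>W. box_close r d x y \<longrightarrow> \<bar>f y - f x\<bar> < e" by blast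
    obtain e' where "e' > 0" "\<forall>y. dist y x < e' \<longrightarrow> box_close r d x y"
      using dist_imp_box_close[OF d(1), of x r] by blast
    with d show "\<exists>d>0. \<forall>y\<in>W. dist y x < d \<longrightarrow> dist (f y) (f x) < e" by (metis dist_real_def)
  qed
  then show ?thesis unfolding E continuous_map_iff_continuous continuous_on_iff by blast
qed

lemma box_close_mono: "box_close r d x y \<Longrightarrow> d \<le> d' \<Longrightarrow> box_close r d' x y"
  unfolding box_close_def by force

lemma Eucl_upd: "x \<in> Eucl r \<Longrightarrow> i < r \<Longrightarrow> x(i := t) \<in> Eucl r"
  by (auto simp: Eucl_iff)

lemma eventually_line_in:
  assumes W: "openin (Euclidean_space r) W" "x \<in> W" "i < r"
  shows "\<forall>\<^sub>F t in nhds (x i). x(i := t) \<in> W"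
proof -
  obtain d where d: "d > 0" "\<forall>y\<in>Eucl r. box_close r d x y \<longrightarrow> y \<in> W" and x: "x \<in> Eucl r"
    using W unfolding openin_Eucl_iff by blast
  show ?thesis
    unfolding eventually_nhds_metric
  proof (intro exI[of _ d] conjI allI impI d(1))
    fix t assume "dist t (x i) < d"
    then have "box_close r d x (x(i := t))" using d(1) by (auto simp: box_close_def dist_real_def)
    then show "x(i := t) \<in> W" using d(2) Eucl_upd[OF x \<open>i < r\<close>] by blast
  qed
qed

text \<open>A partial derivative at a point of an open set only sees the values on that set.\<close>

lemma line_cong:
  assumes W: "openin (Euclidean_space r) W" "x \<in> W" "i < r" and eq: "\<And>y. y \<in> W \<Longrightarrow> f y = g y"
  shows "partial_deriv i f x = partial_deriv i g x"
    and "(\<lambda>t. f (x(i := t))) field_differentiable at (x i) \<longleftrightarrow> (\<lambda>t. g (x(i := t))) field_differentiable at (x i)"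
proof -
  have ev: "\<forall>\<^sub>F t in nhds (x i). f (x(i := t)) = g (x(i := t))"
    using eventually_line_in[OF W] by eventually_elim (rule eq)
  show "partial_deriv i f x = partial_deriv i g x"
    unfolding partial_deriv_def by (rule deriv_cong_ev[OF ev refl])
  show "(\<lambda>t. f (x(i := t))) field_differentiable at (x i) \<longleftrightarrow> (\<lambda>t. g (x(i := t))) field_differentiable at (x i)"
    unfolding field_differentiable_def using DERIV_cong_ev[OF refl ev refl] by blast
qed

lemma Ck_scalar_cong:
  assumes "openin (Euclidean_space r) W" "\<And>x. x \<in> W \<Longrightarrow> f x = g x"
  shows "Ck_scalar k r W f \<longleftrightarrow> Ck_scalar k r W g"
  using assms(2)
proof (induction k arbitrary: f g)
  case (0 f g)
  have "W \<subseteq> Eucl r" using assms(1) openin_subset by blast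
  then show ?case using 0 by (simp add: continuous_Eucl_iff)
next
  case (Suc k f g)
  have "W \<subseteq> Eucl r" using assms(1) openin_subset by blast
  then have "continuous_map (subtopology (Euclidean_space r) W) euclideanreal f \<longleftrightarrow>
      continuous_map (subtopology (Euclidean_space r) W) euclideanreal g"
    using Suc.prems by (simp add: continuous_Eucl_iff)
  moreover have "Ck_scalar k r W (partial_deriv i f) \<longleftrightarrow> Ck_scalar k r W (partial_deriv i g)" if "i < r" for i
    using line_cong(1)[OF assms(1) _ that Suc.prems] by (intro Suc.IH) auto
  moreover have "(\<lambda>t. f (x(i := t))) field_differentiable at (x i) \<longleftrightarrow> (\<lambda>t. g (x(i := t))) field_differentiable at (x i)"
    if "i < r" "x \<in> W" for i x
    using line_cong(2)[OF assms(1) that(2,1) Suc.prems] .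
  ultimately show ?case by auto
qed

lemma Ck_scalar_congI:
  assumes "openin (Euclidean_space r) W" "Ck_scalar k r W g" "\<And>x. x \<in> W \<Longrightarrow> f x = g x"
  shows "Ck_scalar k r W f"
  using Ck_scalar_cong[OF assms(1,3)] assms(2) by simp

lemma Ck_scalar_SucD: "Ck_scalar (Suc k) r W f \<Longrightarrow> Ck_scalar k r W f"
  by (induction k arbitrary: f) auto

lemma Ck_scalar_continuous:
  "Ck_scalar k r W f \<Longrightarrow> continuous_map (subtopology (Euclidean_space r) W) euclideanreal f"
  by (cases k) auto

lemma Ck_scalar_subset:
  assumes "W' \<subseteq> W" "Ck_scalar k r W f" shows "Ck_scalar k r W' f"
  using assms(2)
proof (induction k arbitrary: f)
  case 0 then show ?case using assms(1) by (auto intro: continuous_map_from_subtopology_mono)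
next
  case (Suc k) then show ?case using assms(1) by (auto intro: continuous_map_from_subtopology_mono)
qed

lemma partial_DERIV:
  assumes "Ck_scalar (Suc k) r W f" "x \<in> W" "i < r"
  shows "((\<lambda>t. f (x(i := t))) has_real_derivative partial_deriv i f x) (at (x i))"
  using assms by (simp add: partial_deriv_def field_differentiable_derivI)

text \<open>Total differentiability from continuous partial derivatives: move from \<open>x\<close> to \<open>y\<close> along the coordinate
directions one after the other and apply the mean value estimate on each piece.\<close>

lemma C1_increment:
  assumes W: "openin (Euclidean_space r) W" and f: "Ck_scalar 1 r W f" and x: "x \<in> W" and "0 < e"
  shows "\<exists>d>0. \<forall>y\<in>Eucl r. box_close r d x y \<longrightarrow> y \<in> W \<and>
    \<bar>f y - f x - (\<Sum>i<r. partial_deriv i f x * (y i - x i))\<bar> \<le> e * (\<Sum>i<r. \<bar>y i - x i\<bar>)"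
proof -
  have WE: "W \<subseteq> Eucl r" using W openin_subset by blast
  obtain d0 where d0: "d0 > 0" "\<forall>y\<in>Eucl r. box_close r d0 x y \<longrightarrow> y \<in> W"
    using W x unfolding openin_Eucl_iff by blast
  have "\<exists>d>0. \<forall>y\<in>W. box_close r d x y \<longrightarrow> \<bar>partial_deriv i f y - partial_deriv i f x\<bar> < e" if "i < r" for i
    using f that x \<open>0 < e\<close> continuous_Eucl_iff[OF WE, of "partial_deriv i f"] by auto
  then obtain D where D: "\<And>i. i < r \<Longrightarrow> D i > 0 \<and> (\<forall>y\<in>W. box_close r (D i) x y \<longrightarrow> \<bar>partial_deriv i f y - partial_deriv i f x\<bar> < e)"
    by metis
  define d where "d = Min (insert d0 (D ` {..<r}))"
  have d: "d > 0" "d \<le> d0" "\<And>i. i < r \<Longrightarrow> d \<le> D i" using d0 D by (auto simp: d_def)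
  have main: "y \<in> W \<and> \<bar>f y - f x - (\<Sum>i<r. partial_deriv i f x * (y i - x i))\<bar> \<le> e * (\<Sum>i<r. \<bar>y i - x i\<bar>)"
    if y: "y \<in> Eucl r" "box_close r d x y" for y
  proof -
    have xE: "x \<in> Eucl r" using x WE by blast
    \<comment> \<open>The corners of the path from \<open>x\<close> to \<open>y\<close> along the coordinate directions.\<close>
    define p where "p k = (\<lambda>i. if i < k then y i else x i)" for k :: nat
    have p0: "p 0 = x" by (simp add: p_def)
    have pr: "p r = y" using xE y(1) by (auto simp: p_def Eucl_iff)
    have seg: "(p k)(k := t) \<in> W \<and> (\<forall>i<r. \<bar>partial_deriv i f ((p k)(k := t)) - partial_deriv i f x\<bar> < e)"
      if "k < r" "t \<in> closed_segment (x k) (y k)" for k t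
    proof -
      have "\<bar>t - x k\<bar> \<le> \<bar>y k - x k\<bar>" using that(2) by (auto simp: closed_segment_eq_real_ivl split: if_splits)
      then have bc: "box_close r d x ((p k)(k := t))" using y(2) d(1) that(1) by (auto simp: box_close_def p_def)
      moreover have "(p k)(k := t) \<in> Eucl r" using xE y(1) that(1) by (auto simp: p_def Eucl_iff)
      ultimately have "(p k)(k := t) \<in> W" using d0 box_close_mono[OF bc d(2)] by blast
      moreover have "\<bar>partial_deriv i f ((p k)(k := t)) - partial_deriv i f x\<bar> < e" if "i < r" for i
        using D[OF that] calculation box_close_mono[OF bc d(3)[OF that]] by blast
      ultimately show ?thesis by blast
    qed
    have step: "\<bar>f (p (Suc k)) - f (p k) - partial_deriv k f x * (y k - x k)\<bar> \<le> e * \<bar>y k - x k\<bar>" if k: "k < r" for k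
    proof -
      define h where "h t = f ((p k)(k := t)) - partial_deriv k f x * t" for t
      have "norm (h (y k) - h (x k)) \<le> e * norm (y k - x k)"
      proof (rule field_differentiable_bound[where S = "closed_segment (x k) (y k)"
            and f' = "\<lambda>t. partial_deriv k f ((p k)(k := t)) - partial_deriv k f x"])
        fix t assume t: "t \<in> closed_segment (x k) (y k)"
        have "Ck_scalar (Suc 0) r W f" "(p k)(k := t) \<in> W" using f seg[OF k t] by simp_all
        from partial_DERIV[OF this k]
        have "((\<lambda>s. f ((p k)(k := s))) has_real_derivative partial_deriv k f ((p k)(k := t))) (at t)"
          by (simp only: fun_upd_upd fun_upd_same)
        then show "(h has_real_derivative partial_deriv k f ((p k)(k := t)) - partial_deriv k f x) (at t within closed_segment (x k) (y k))"
          unfolding h_def[abs_def] by (auto intro!: derivative_eq_intros intro: has_field_derivative_at_within)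
        show "norm (partial_deriv k f ((p k)(k := t)) - partial_deriv k f x) \<le> e"
          using seg[OF k t] k by (auto intro: less_imp_le)
      qed auto
      moreover have "(p k)(k := y k) = p (Suc k)" "(p k)(k := x k) = p k" by (auto simp: p_def)
      ultimately show ?thesis by (simp add: h_def algebra_simps)
    qed
    have "f y - f x - (\<Sum>i<r. partial_deriv i f x * (y i - x i)) =
        (\<Sum>k<r. f (p (Suc k)) - f (p k) - partial_deriv k f x * (y k - x k))"
      using sum_lessThan_telescope[of "\<lambda>k. f (p k)" r] by (simp add: p0 pr sum_subtractf)
    then have "\<bar>f y - f x - (\<Sum>i<r. partial_deriv i f x * (y i - x i))\<bar>
        \<le> (\<Sum>k<r. \<bar>f (p (Suc k)) - f (p k) - partial_deriv k f x * (y k - x k)\<bar>)" by simp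
    also have "\<dots> \<le> (\<Sum>k<r. e * \<bar>y k - x k\<bar>)" using step by (intro sum_mono) auto
    finally show ?thesis using y d0 box_close_mono[OF y(2) d(2)] by (simp add: sum_distrib_left)
  qed
  then show ?thesis using d(1) by blast
qed

text \<open>The derivative may be one-sided or relative to a set \<open>S\<close>, as in the definition of the flow; and \<open>x\<close> must stay
in \<open>\<real>\<^sup>r\<close>, since only there \<open>f\<close> is controlled by its first \<open>r\<close> partial derivatives.\<close>

lemma C1_chain:
  assumes W: "openin (Euclidean_space r) W" and f: "Ck_scalar 1 r W f" and x: "x t0 \<in> W"
    and x': "\<And>i. i < r \<Longrightarrow> ((\<lambda>t. x t i) has_real_derivative v i) (at t0 within S)"
    and E: "\<forall>\<^sub>F t in at t0 within S. x t \<in> Eucl r"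
  shows "((\<lambda>t. f (x t)) has_real_derivative (\<Sum>i<r. partial_deriv i f (x t0) * v i)) (at t0 within S)"
  unfolding has_field_derivative_iff
proof (rule LIM_zero_cancel)
  define L where "L t = (\<Sum>i<r. partial_deriv i f (x t0) * ((x t i - x t0 i) / (t - t0)))" for t
  have q: "((\<lambda>t. (x t i - x t0 i) / (t - t0)) \<longlongrightarrow> v i) (at t0 within S)" if "i < r" for i
    using x'[OF that] unfolding has_field_derivative_iff .
  have "(L \<longlongrightarrow> (\<Sum>i<r. partial_deriv i f (x t0) * v i)) (at t0 within S)"
    unfolding L_def[abs_def] by (intro tendsto_intros q) auto
  then have L: "((\<lambda>t. L t - (\<Sum>i<r. partial_deriv i f (x t0) * v i)) \<longlongrightarrow> 0) (at t0 within S)"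
    by (rule LIM_zero)
  have "((\<lambda>t. (f (x t) - f (x t0)) / (t - t0) - L t) \<longlongrightarrow> 0) (at t0 within S)"
    unfolding tendsto_iff
  proof (intro allI impI)
    fix e :: real assume "0 < e"
    define B where "B = (\<Sum>i<r. \<bar>v i\<bar>) + 1"
    have B: "0 < B" unfolding B_def by (intro add_nonneg_pos sum_nonneg) auto
    obtain d where d: "d > 0" "\<forall>y\<in>Eucl r. box_close r d (x t0) y \<longrightarrow> y \<in> W \<and>
        \<bar>f y - f (x t0) - (\<Sum>i<r. partial_deriv i f (x t0) * (y i - x t0 i))\<bar> \<le> e / B * (\<Sum>i<r. \<bar>y i - x t0 i\<bar>)"
      using C1_increment[OF W f x, of "e / B"] \<open>0 < e\<close> B by auto
    have "((\<lambda>t. \<Sum>i<r. \<bar>(x t i - x t0 i) / (t - t0)\<bar>) \<longlongrightarrow> (\<Sum>i<r. \<bar>v i\<bar>)) (at t0 within S)"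
      by (intro tendsto_intros q) auto
    then have 1: "\<forall>\<^sub>F t in at t0 within S. (\<Sum>i<r. \<bar>(x t i - x t0 i) / (t - t0)\<bar>) < B"
      by (rule order_tendstoD) (simp add: B_def)
    have "\<forall>\<^sub>F t in at t0 within S. \<bar>x t i - x t0 i\<bar> < d" if "i < r" for i
    proof -
      have "((\<lambda>t. x t i) \<longlongrightarrow> x t0 i) (at t0 within S)"
        using DERIV_continuous[OF x'[OF that]] by (simp add: continuous_within)
      from tendstoD[OF this d(1)] show ?thesis by (simp add: dist_real_def)
    qed
    then have 2: "\<forall>\<^sub>F t in at t0 within S. \<forall>i\<in>{..<r}. \<bar>x t i - x t0 i\<bar> < d"
      by (intro eventually_ball_finite) auto
    have 3: "\<forall>\<^sub>F t in at t0 within S. t \<noteq> t0" by (simp add: eventually_at_filter)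
    show "\<forall>\<^sub>F t in at t0 within S. dist ((f (x t) - f (x t0)) / (t - t0) - L t) 0 < e"
      using 1 2 3 E
    proof eventually_elim
      case (elim t)
      let ?R = "f (x t) - f (x t0) - (\<Sum>i<r. partial_deriv i f (x t0) * (x t i - x t0 i))"
      have "\<bar>?R\<bar> \<le> e / B * (\<Sum>i<r. \<bar>x t i - x t0 i\<bar>)"
        using d(2) elim by (auto simp: box_close_def)
      then have "\<bar>?R\<bar> / \<bar>t - t0\<bar> \<le> e / B * (\<Sum>i<r. \<bar>x t i - x t0 i\<bar>) / \<bar>t - t0\<bar>"
        by (intro divide_right_mono) auto
      also have "\<dots> = e / B * (\<Sum>i<r. \<bar>(x t i - x t0 i) / (t - t0)\<bar>)"
        by (simp add: abs_divide flip: sum_divide_distrib)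
      also have "\<dots> < e / B * B" using elim(1) \<open>0 < e\<close> B by (intro mult_strict_left_mono) auto
      finally have "\<bar>?R / (t - t0)\<bar> < e" using B by simp
      moreover have "?R / (t - t0) = (f (x t) - f (x t0)) / (t - t0) - L t"
      proof -
        have "(\<Sum>i<r. partial_deriv i f (x t0) * (x t i - x t0 i)) / (t - t0) = L t"
          by (simp add: L_def sum_divide_distrib)
        then show ?thesis by (simp add: diff_divide_distrib)
      qed
      ultimately show ?case by simp
    qed
  qed
  from tendsto_add[OF this L]
  show "((\<lambda>t. (f (x t) - f (x t0)) / (t - t0) - (\<Sum>i<r. partial_deriv i f (x t0) * v i)) \<longlongrightarrow> 0) (at t0 within S)"
    by simp
qed

lemma C1_mvt:
  assumes W: "openin (Euclidean_space r) W" and f: "Ck_scalar 1 r W f" and x: "x \<in> Eucl r" "y \<in> Eucl r"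
    and seg: "\<And>t. 0 \<le> t \<Longrightarrow> t \<le> 1 \<Longrightarrow> (\<lambda>i. x i + t * (y i - x i)) \<in> W"
  shows "\<exists>t. 0 < t \<and> t < 1 \<and>
    f y - f x = (\<Sum>i<r. partial_deriv i f (\<lambda>i. x i + t * (y i - x i)) * (y i - x i))"
proof -
  define p where "p t = (\<lambda>i. x i + t * (y i - x i))" for t :: real
  have p: "p t \<in> Eucl r" for t using x by (auto simp: p_def Eucl_iff)
  have "((\<lambda>t. f (p t)) has_real_derivative (\<Sum>i<r. partial_deriv i f (p t) * (y i - x i))) (at t)"
    if "0 \<le> t" "t \<le> 1" for t
  proof (rule C1_chain[OF W f])
    show "p t \<in> W" using seg that by (simp add: p_def)
    show "((\<lambda>t. p t i) has_real_derivative y i - x i) (at t)" for i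
      unfolding p_def by (auto intro!: derivative_eq_intros)
  qed (simp add: p)
  then obtain t where t: "0 < t" "t < 1" "f (p 1) - f (p 0) = (1 - 0) * (\<Sum>i<r. partial_deriv i f (p t) * (y i - x i))"
    using MVT2[of 0 1 "\<lambda>t. f (p t)" "\<lambda>t. \<Sum>i<r. partial_deriv i f (p t) * (y i - x i)"] by auto
  moreover have "p 1 = y" "p 0 = x" by (auto simp: p_def)
  ultimately show ?thesis by (auto simp: p_def)
qed

lemma Ck_scalar_const: "Ck_scalar k r W (\<lambda>x. c)"
proof (induction k arbitrary: c)
  case (Suc k)
  have "partial_deriv i (\<lambda>x. c) = (\<lambda>x. 0)" for i by (simp add: partial_deriv_def[abs_def])
  then show ?case using Suc by simp
qed simp

lemma Ck_scalar_coordinate: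
  assumes W: "openin (Euclidean_space r) W"
  shows "Ck_scalar k r W (\<lambda>x. x j)"
proof (cases k)
  have WE: "W \<subseteq> Eucl r" using W openin_subset by blast
  have "\<exists>d>0. \<forall>y\<in>W. box_close r d x y \<longrightarrow> \<bar>y j - x j\<bar> < e" if "x \<in> W" "0 < e" for x and e :: real
  proof (intro exI[of _ e] conjI ballI impI)
    fix y assume y: "y \<in> W" "box_close r e x y"
    then have "y \<in> Eucl r" "x \<in> Eucl r" using WE that by auto
    then show "\<bar>y j - x j\<bar> < e" using y(2) that(2) by (cases "j < r") (auto simp: box_close_def Eucl_iff)
  qed (use that in auto)
  then have c: "continuous_map (subtopology (Euclidean_space r) W) euclideanreal (\<lambda>x. x j)"
    by (simp add: continuous_Eucl_iff[OF WE])
  {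
    case 0 then show ?thesis using c by simp
  next
    case (Suc k)
    have "((\<lambda>t. (x(i := t)) j) has_real_derivative (if i = j then 1 else 0)) (at (x i))" for x :: "nat \<Rightarrow> real" and i
      by (auto intro!: derivative_eq_intros)
    then have "(\<lambda>t. (x(i := t)) j) field_differentiable at (x i)"
      "partial_deriv i (\<lambda>x. x j) x = (if i = j then 1 else 0)" for x i
      by (auto simp: field_differentiable_def partial_deriv_def intro: DERIV_imp_deriv)
    then show ?thesis using c Suc by (auto simp: Ck_scalar_const fun_eq_iff[symmetric] partial_deriv_def[abs_def])
  }
qed

lemma
  assumes W: "openin (Euclidean_space r) W"
    and "Ck_scalar (Suc k) r W f" "Ck_scalar (Suc k) r W g" "x \<in> W" "i < r"
  shows partial_deriv_add: "partial_deriv i (\<lambda>x. f x + g x) x = partial_deriv i f x + partial_deriv i g x"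
    and differentiable_add: "(\<lambda>t. f (x(i := t)) + g (x(i := t))) field_differentiable at (x i)"
    and partial_deriv_mult: "partial_deriv i (\<lambda>x. f x * g x) x = partial_deriv i f x * g x + f x * partial_deriv i g x"
    and differentiable_mult: "(\<lambda>t. f (x(i := t)) * g (x(i := t))) field_differentiable at (x i)"
proof -
  note D = partial_DERIV[OF assms(2,4,5)] partial_DERIV[OF assms(3,4,5)]
  have 1: "((\<lambda>t. f (x(i := t)) + g (x(i := t))) has_real_derivative partial_deriv i f x + partial_deriv i g x) (at (x i))"
    by (rule DERIV_add[OF D])
  have 2: "((\<lambda>t. f (x(i := t)) * g (x(i := t))) has_real_derivative partial_deriv i f x * g x + f x * partial_deriv i g x) (at (x i))"
    using DERIV_mult[OF D] by (simp add: algebra_simps)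
  from 1 2 show "partial_deriv i (\<lambda>x. f x + g x) x = partial_deriv i f x + partial_deriv i g x"
    "(\<lambda>t. f (x(i := t)) + g (x(i := t))) field_differentiable at (x i)"
    "partial_deriv i (\<lambda>x. f x * g x) x = partial_deriv i f x * g x + f x * partial_deriv i g x"
    "(\<lambda>t. f (x(i := t)) * g (x(i := t))) field_differentiable at (x i)"
    unfolding field_differentiable_def partial_deriv_def[of i "\<lambda>x. f x + g x"] partial_deriv_def[of i "\<lambda>x. f x * g x"]
    using DERIV_imp_deriv by blast+
qed

lemma Ck_scalar_add:
  assumes W: "openin (Euclidean_space r) W"
  shows "Ck_scalar k r W f \<Longrightarrow> Ck_scalar k r W g \<Longrightarrow> Ck_scalar k r W (\<lambda>x. f x + g x)"
proof (induction k arbitrary: f g)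
  case 0 then show ?case by (simp add: continuous_map_add)
next
  case (Suc k)
  have "Ck_scalar k r W (partial_deriv i (\<lambda>x. f x + g x))" if "i < r" for i
  proof -
    have "Ck_scalar k r W (\<lambda>x. partial_deriv i f x + partial_deriv i g x)"
      using Suc.prems that by (intro Suc.IH) auto
    then show ?thesis
      by (rule Ck_scalar_congI[OF W]) (rule partial_deriv_add[OF W Suc.prems _ that])
  qed
  moreover have "continuous_map (subtopology (Euclidean_space r) W) euclideanreal (\<lambda>x. f x + g x)"
    using Suc.prems by (intro continuous_map_add Ck_scalar_continuous)
  ultimately show ?case unfolding Ck_scalar.simps(2)
    by (intro conjI allI impI ballI differentiable_add[OF W Suc.prems])
qed

lemma Ck_scalar_mult:
  assumes W: "openin (Euclidean_space r) W"
  shows "Ck_scalar k r W f \<Longrightarrow> Ck_scalar k r W g \<Longrightarrow> Ck_scalar k r W (\<lambda>x. f x * g x)"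
proof (induction k arbitrary: f g)
  case 0 then show ?case by (simp add: continuous_map_real_mult)
next
  case (Suc k)
  have "Ck_scalar k r W (partial_deriv i (\<lambda>x. f x * g x))" if "i < r" for i
  proof -
    have "Ck_scalar k r W (\<lambda>x. partial_deriv i f x * g x + f x * partial_deriv i g x)"
      using Suc.prems that Ck_scalar_SucD by (intro Ck_scalar_add[OF W] Suc.IH) auto
    then show ?thesis
      by (rule Ck_scalar_congI[OF W]) (rule partial_deriv_mult[OF W Suc.prems _ that])
  qed
  moreover have "continuous_map (subtopology (Euclidean_space r) W) euclideanreal (\<lambda>x. f x * g x)"
    using Suc.prems by (intro continuous_map_real_mult Ck_scalar_continuous)
  ultimately show ?case unfolding Ck_scalar.simps(2)
    by (intro conjI allI impI ballI differentiable_mult[OF W Suc.prems])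
qed

lemma Ck_scalar_cmult:
  "openin (Euclidean_space r) W \<Longrightarrow> Ck_scalar k r W f \<Longrightarrow> Ck_scalar k r W (\<lambda>x. c * f x)"
  by (intro Ck_scalar_mult Ck_scalar_const)

lemma Ck_scalar_diff:
  "openin (Euclidean_space r) W \<Longrightarrow> Ck_scalar k r W f \<Longrightarrow> Ck_scalar k r W g \<Longrightarrow> Ck_scalar k r W (\<lambda>x. f x - g x)"
  using Ck_scalar_add[of r W k f "\<lambda>x. - 1 * g x"] Ck_scalar_cmult[of r W k g "- 1"] by simp

lemma Ck_scalar_sum:
  assumes "openin (Euclidean_space r) W" "\<And>a. a \<in> A \<Longrightarrow> Ck_scalar k r W (f a)"
  shows "Ck_scalar k r W (\<lambda>x. \<Sum>a\<in>A. f a x)"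
  using assms(2)
  by (induction A rule: infinite_finite_induct) (auto intro: Ck_scalar_const Ck_scalar_add[OF assms(1)])

lemma chain_line:
  assumes W: "openin (Euclidean_space r) W" and V: "openin (Euclidean_space m) V"
    and p: "Ck_map (Suc k) r m W p" "p ` W \<subseteq> V" and f: "Ck_scalar 1 m V f" and x: "x \<in> W" "i < r"
  shows "((\<lambda>t. f (p (x(i := t)))) has_real_derivative
      (\<Sum>j<m. partial_deriv j f (p x) * partial_deriv i (\<lambda>x. p x j) x)) (at (x i))"
proof -
  have "((\<lambda>t. f (p (x(i := t)))) has_real_derivative
      (\<Sum>j<m. partial_deriv j f (p (x(i := x i))) * partial_deriv i (\<lambda>x. p x j) x)) (at (x i))"
  proof (rule C1_chain[OF V f])
    show "p (x(i := x i)) \<in> V" using p x by auto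
    show "((\<lambda>t. p (x(i := t)) j) has_real_derivative partial_deriv i (\<lambda>x. p x j) x) (at (x i))" if "j < m" for j
      using p(1) that x by (intro partial_DERIV[of k r W]) (auto simp: Ck_map_def)
    have "\<forall>\<^sub>F t in at (x i). x(i := t) \<in> W"
      using eventually_line_in[OF W x] by (rule filter_leD[OF at_within_le_nhds])
    then show "\<forall>\<^sub>F t in at (x i). p (x(i := t)) \<in> Eucl m"
      by eventually_elim (use p(1) in \<open>auto simp: Ck_map_def\<close>)
  qed
  then show ?thesis by simp
qed

lemma Ck_map_SucD: "Ck_map (Suc k) r m W p \<Longrightarrow> Ck_map k r m W p"
  unfolding Ck_map_def using Ck_scalar_SucD by blast

text \<open>Induction on the order: by the chain rule the partial derivatives of \<open>f \<circ> p\<close> are sums of products of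
functions \<open>f' \<circ> p\<close> and partial derivatives of \<open>p\<close>, all of one order less.\<close>

lemma Ck_scalar_compose:
  assumes W: "openin (Euclidean_space r) W" and V: "openin (Euclidean_space m) V"
    and "p ` W \<subseteq> V"
  shows "Ck_map k r m W p \<Longrightarrow> Ck_scalar k m V f \<Longrightarrow> Ck_scalar k r W (\<lambda>x. f (p x))"
proof (induction k arbitrary: f)
  case 0
  have WE: "W \<subseteq> Eucl r" and VE: "V \<subseteq> Eucl m" using W V openin_subset by blast+
  have "\<exists>d>0. \<forall>y\<in>W. box_close r d x y \<longrightarrow> \<bar>f (p y) - f (p x)\<bar> < e" if x: "x \<in> W" and "0 < e" for x and e :: real
  proof -
    obtain d where d: "d > 0" "\<forall>z\<in>V. box_close m d (p x) z \<longrightarrow> \<bar>f z - f (p x)\<bar> < e"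
      using 0(2) imageI[OF x, of p] assms(3) \<open>0 < e\<close> by (simp add: continuous_Eucl_iff[OF VE]) (meson subsetD)
    have "\<exists>d'>0. \<forall>y\<in>W. box_close r d' x y \<longrightarrow> \<bar>p y j - p x j\<bar> < d" if "j < m" for j
      using 0(1) x d(1) that by (auto simp: Ck_map_def continuous_Eucl_iff[OF WE])
    then obtain D where D: "\<And>j. j < m \<Longrightarrow> D j > 0 \<and> (\<forall>y\<in>W. box_close r (D j) x y \<longrightarrow> \<bar>p y j - p x j\<bar> < d)"
      by metis
    define d' where "d' = Min (insert 1 (D ` {..<m}))"
    have d': "d' > 0" "\<And>j. j < m \<Longrightarrow> d' \<le> D j" using D by (auto simp: d'_def)
    have "\<bar>f (p y) - f (p x)\<bar> < e" if "y \<in> W" "box_close r d' x y" for y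
    proof -
      have "\<bar>p y j - p x j\<bar> < d" if "j < m" for j
        using D[OF that] \<open>y \<in> W\<close> box_close_mono[OF \<open>box_close r d' x y\<close> d'(2)[OF that]] by blast
      then show ?thesis using d(2) assms(3) \<open>y \<in> W\<close> by (auto simp: box_close_def)
    qed
    then show ?thesis using d'(1) by blast
  qed
  then show ?case by (simp add: continuous_Eucl_iff[OF WE])
next
  case (Suc k)
  have p: "Ck_map k r m W p" using Suc.prems(1) by (rule Ck_map_SucD)
  have f1: "Ck_scalar 1 m V f" using Suc.prems(2) Ck_scalar_SucD by (cases k) auto
  note D = chain_line[OF W V Suc.prems(1) assms(3) f1]
  have "Ck_scalar k r W (partial_deriv i (\<lambda>x. f (p x)))" if i: "i < r" for i
  proof -
    have "Ck_scalar k r W (\<lambda>x. \<Sum>j<m. partial_deriv j f (p x) * partial_deriv i (\<lambda>x. p x j) x)"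
    proof (intro Ck_scalar_sum[OF W] Ck_scalar_mult[OF W])
      fix j assume "j \<in> {..<m}"
      then show "Ck_scalar k r W (\<lambda>x. partial_deriv j f (p x))" "Ck_scalar k r W (partial_deriv i (\<lambda>x. p x j))"
        using Suc.prems i by (auto intro!: Suc.IH[OF p] simp: Ck_map_def)
    qed
    moreover have "partial_deriv i (\<lambda>x. f (p x)) x = (\<Sum>j<m. partial_deriv j f (p x) * partial_deriv i (\<lambda>x. p x j) x)" if "x \<in> W" for x
      unfolding partial_deriv_def[of i "\<lambda>x. f (p x)"] by (rule DERIV_imp_deriv[OF D[OF that i]])
    ultimately show ?thesis by (rule Ck_scalar_congI[OF W])
  qed
  moreover have "continuous_map (subtopology (Euclidean_space r) W) euclideanreal (\<lambda>x. f (p x))"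
    using Suc.IH[OF p Ck_scalar_SucD[OF Suc.prems(2)]] by (rule Ck_scalar_continuous)
  moreover have "(\<lambda>t. f (p (x(i := t)))) field_differentiable at (x i)" if "x \<in> W" "i < r" for x i
    using D[OF that] by (auto simp: field_differentiable_def)
  ultimately show ?case by simp
qed

lemma partial_deriv_compose:
  assumes "openin (Euclidean_space r) W" "openin (Euclidean_space m) V"
    "Ck_map (Suc k) r m W p" "p ` W \<subseteq> V" "Ck_scalar (Suc l) m V f" "x \<in> W" "i < r"
  shows "partial_deriv i (\<lambda>x. f (p x)) x = (\<Sum>j<m. partial_deriv j f (p x) * partial_deriv i (\<lambda>x. p x j) x)"
proof -
  have "Ck_scalar 1 m V f" using assms(5) by auto (metis Ck_scalar_continuous)
  from chain_line[OF assms(1-4) this assms(6,7)] show ?thesis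
    unfolding partial_deriv_def[of i "\<lambda>x. f (p x)"] by (rule DERIV_imp_deriv)
qed

section \<open>Complete orbits through stable nonwandering points\<close>

text \<open>Compact cubes rather than balls, because the nonlinearity will be cut off in each coordinate
separately.\<close>

definition cube :: "nat \<Rightarrow> real \<Rightarrow> (nat \<Rightarrow> real) set" where
  "cube r \<rho> = {x \<in> Eucl r. \<forall>i<r. \<bar>x i\<bar> \<le> \<rho>}"

lemma origin_Eucl: "origin \<in> Eucl r"
  by (simp add: Eucl_iff)

lemma cube_segment:
  assumes "x \<in> cube r \<rho>" "y \<in> cube r \<rho>" "0 \<le> t" "t \<le> 1"
  shows "(\<lambda>i. x i + t * (y i - x i)) \<in> cube r \<rho>"
proof -
  have "\<bar>x i + t * (y i - x i)\<bar> \<le> \<rho>" if "i < r" for i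
  proof -
    have "\<bar>(1 - t) * x i + t * y i\<bar> \<le> \<bar>(1 - t) * x i\<bar> + \<bar>t * y i\<bar>" by (rule abs_triangle_ineq)
    also have "\<dots> \<le> (1 - t) * \<rho> + t * \<rho>"
      using assms that by (auto simp: abs_mult cube_def intro!: add_mono mult_left_mono)
    finally show ?thesis by (simp add: algebra_simps)
  qed
  then show ?thesis using assms by (auto simp: cube_def Eucl_iff)
qed

text \<open>Continuity bounds the partial derivatives near the origin, and the mean value theorem turns the bound
into a Lipschitz constant.\<close>

lemma lipschitz_on_cube:
  assumes W: "openin (Euclidean_space r) W" "origin \<in> W" and s: "Ck_map 1 r m W s"
  shows "\<exists>\<rho>>0. \<exists>\<Lambda>\<ge>0. cube r \<rho> \<subseteq> W \<and> (\<forall>x\<in>cube r \<rho>. \<forall>y\<in>cube r \<rho>. \<forall>i<m. \<bar>s x i - s y i\<bar> \<le> \<Lambda> * (\<Sum>j<r. \<bar>x j - y j\<bar>))"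
proof -
  have WE: "W \<subseteq> Eucl r" using W openin_subset by blast
  obtain d0 where d0: "d0 > 0" "\<forall>y\<in>Eucl r. box_close r d0 origin y \<longrightarrow> y \<in> W"
    using W unfolding openin_Eucl_iff by blast
  have "\<exists>d>0. \<forall>y\<in>W. box_close r d origin y \<longrightarrow> \<bar>partial_deriv j (\<lambda>x. s x i) y - partial_deriv j (\<lambda>x. s x i) origin\<bar> < 1"
    if "i < m" "j < r" for i j
    using s that W(2) continuous_Eucl_iff[OF WE, of "partial_deriv j (\<lambda>x. s x i)"] by (auto simp: Ck_map_def)
  then obtain D where D: "\<And>i j. i < m \<Longrightarrow> j < r \<Longrightarrow> D i j > 0 \<and>
      (\<forall>y\<in>W. box_close r (D i j) origin y \<longrightarrow> \<bar>partial_deriv j (\<lambda>x. s x i) y - partial_deriv j (\<lambda>x. s x i) origin\<bar> < 1)"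
    by metis
  define d where "d = Min (insert d0 ((\<lambda>(i, j). D i j) ` ({..<m} \<times> {..<r})))"
  have d: "d > 0" "d \<le> d0" "\<And>i j. i < m \<Longrightarrow> j < r \<Longrightarrow> d \<le> D i j"
    using d0 D by (auto simp: d_def intro!: Min_le)
  define \<Lambda> where "\<Lambda> = (\<Sum>i<m. \<Sum>j<r. \<bar>partial_deriv j (\<lambda>x. s x i) origin\<bar>) + 1"
  have \<Lambda>: "\<bar>partial_deriv j (\<lambda>x. s x i) origin\<bar> + 1 \<le> \<Lambda>" if "i < m" "j < r" for i j
  proof -
    have "\<bar>partial_deriv j (\<lambda>x. s x i) origin\<bar> \<le> (\<Sum>j<r. \<bar>partial_deriv j (\<lambda>x. s x i) origin\<bar>)"
      using that by (intro member_le_sum) auto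
    also have "\<dots> \<le> (\<Sum>i<m. \<Sum>j<r. \<bar>partial_deriv j (\<lambda>x. s x i) origin\<bar>)"
      using that by (intro member_le_sum[of i "{..<m}" "\<lambda>i. \<Sum>j<r. \<bar>partial_deriv j (\<lambda>x. s x i) origin\<bar>"] sum_nonneg) auto
    finally show ?thesis by (simp add: \<Lambda>_def)
  qed
  have in_cube: "box_close r d origin x \<and> x \<in> W" if "x \<in> cube r (d / 2)" for x
  proof -
    have "\<bar>x i\<bar> < d" if "i < r" for i
      using \<open>x \<in> cube r (d / 2)\<close> that d(1) unfolding cube_def by (auto dest!: spec[of _ i])
    then have "box_close r d origin x" by (simp add: box_close_def)
    moreover from this have "x \<in> W" using d0(2) box_close_mono[OF _ d(2)] that by (auto simp: cube_def)
    ultimately show ?thesis by blast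
  qed
  have "\<bar>s x i - s y i\<bar> \<le> \<Lambda> * (\<Sum>j<r. \<bar>x j - y j\<bar>)" if xy: "x \<in> cube r (d / 2)" "y \<in> cube r (d / 2)" and i: "i < m" for x y i
  proof -
    have "\<exists>t. 0 < t \<and> t < 1 \<and> s x i - s y i = (\<Sum>j<r. partial_deriv j (\<lambda>x. s x i) (\<lambda>i. y i + t * (x i - y i)) * (x j - y j))"
      using in_cube cube_segment[OF xy(2,1)] xy s i
      by (intro C1_mvt[OF W(1)]) (auto simp: Ck_map_def cube_def)
    then obtain t where t: "0 < t" "t < 1"
      "s x i - s y i = (\<Sum>j<r. partial_deriv j (\<lambda>x. s x i) (\<lambda>i. y i + t * (x i - y i)) * (x j - y j))" by blast
    have c: "(\<lambda>i. y i + t * (x i - y i)) \<in> cube r (d / 2)" using cube_segment[OF xy(2,1)] t by simp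
    have "\<bar>partial_deriv j (\<lambda>x. s x i) (\<lambda>i. y i + t * (x i - y i))\<bar> \<le> \<Lambda>" if j: "j < r" for j
    proof -
      have "\<bar>partial_deriv j (\<lambda>x. s x i) (\<lambda>i. y i + t * (x i - y i)) - partial_deriv j (\<lambda>x. s x i) origin\<bar> < 1"
        using D[OF i j] in_cube[OF c] box_close_mono[OF _ d(3)[OF i j]] by blast
      then show ?thesis using \<Lambda>[OF i j] by linarith
    qed
    then have "\<bar>partial_deriv j (\<lambda>x. s x i) (\<lambda>i. y i + t * (x i - y i)) * (x j - y j)\<bar> \<le> \<Lambda> * \<bar>x j - y j\<bar>" if "j < r" for j
      using that by (auto simp: abs_mult intro!: mult_right_mono)
    then have "(\<Sum>j<r. \<bar>partial_deriv j (\<lambda>x. s x i) (\<lambda>i. y i + t * (x i - y i)) * (x j - y j)\<bar>) \<le> (\<Sum>j<r. \<Lambda> * \<bar>x j - y j\<bar>)"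
      by (intro sum_mono) auto
    then show ?thesis unfolding t(3) sum_distrib_left by (rule order_trans[OF sum_abs])
  qed
  moreover have "0 \<le> \<Lambda>" unfolding \<Lambda>_def by (intro add_nonneg_nonneg sum_nonneg) auto
  moreover have "cube r (d / 2) \<subseteq> W" using in_cube by blast
  ultimately show ?thesis using d(1) by (intro exI[of _ "d / 2"] conjI exI[of _ \<Lambda>]) auto
qed

abbreviation eucl_norm :: "nat \<Rightarrow> (nat \<Rightarrow> real) \<Rightarrow> real" where
  "eucl_norm r x \<equiv> L2_set x {..<r}"

lemma eucl_norm_box:
  assumes "box_close r \<kappa> w v"
  shows "eucl_norm r v \<le> eucl_norm r w + real r * \<kappa>"
proof -
  have "eucl_norm r v = eucl_norm r (\<lambda>i. w i + (v i - w i))" by simp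
  also have "\<dots> \<le> eucl_norm r w + eucl_norm r (\<lambda>i. v i - w i)" by (rule L2_set_triangle_ineq)
  also have "eucl_norm r (\<lambda>i. v i - w i) \<le> (\<Sum>i<r. \<bar>v i - w i\<bar>)" by (rule L2_set_le_sum_abs)
  also have "\<dots> \<le> real r * \<kappa>"
    using assms sum_bounded_above[of "{..<r}" "\<lambda>i. \<bar>v i - w i\<bar>" \<kappa>] by (simp add: box_close_def less_imp_le)
  finally show ?thesis by simp
qed

text \<open>Solutions on an arbitrary time set with relative derivatives, so that the same notion covers the flow on \<open>[0, t]\<close> and
shifted copies \<open>[-t, 0]\<close>.\<close>

definition solution ::
  "nat \<Rightarrow> ((nat \<Rightarrow> real) \<Rightarrow> nat \<Rightarrow> real) \<Rightarrow> real set \<Rightarrow> (real \<Rightarrow> nat \<Rightarrow> real) \<Rightarrow> bool" where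
  "solution r s I x \<longleftrightarrow> (\<forall>u\<in>I. \<forall>i<r. ((\<lambda>u. x u i) has_real_derivative s (x u) i) (at u within I))"

lemma flows_to_iff:
  "flows_to r W s t w v \<longleftrightarrow> 0 \<le> t \<and> (\<exists>x. x 0 = w \<and> x t = v \<and> (\<forall>u\<in>{0..t}. x u \<in> W) \<and> solution r s {0..t} x)"
  unfolding flows_to_def solution_def by blast

lemma solution_subset: "solution r s I x \<Longrightarrow> J \<subseteq> I \<Longrightarrow> solution r s J x"
  unfolding solution_def using DERIV_subset by blast

lemma solution_shift:
  assumes "solution r s {a..b} x" shows "solution r s {a - c..b - c} (\<lambda>u. x (c + u))"
  unfolding solution_def
proof (intro ballI allI impI)
  fix u i assume u: "u \<in> {a - c..b - c}" and i: "i < r"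
  have "((\<lambda>u. x u i) has_real_derivative s (x (c + u)) i) (at (c + u) within (+) c ` {a - c..b - c})"
    using assms u i by (simp add: solution_def)
  from DERIV_at_within_shift[THEN iffD1, OF this]
  show "((\<lambda>u. x (c + u) i) has_real_derivative s (x (c + u)) i) (at u within {a - c..b - c})" .
qed

text \<open>The square of the Euclidean distance, which unlike the distance itself is differentiable along solutions.\<close>

definition sqdist :: "nat \<Rightarrow> (nat \<Rightarrow> real) \<Rightarrow> (nat \<Rightarrow> real) \<Rightarrow> real" where
  "sqdist r x y = (\<Sum>i<r. (x i - y i)\<^sup>2)"

lemma antimono_from_derivative:
  fixes f :: "real \<Rightarrow> real"
  assumes f: "\<And>u. u \<in> {a..b} \<Longrightarrow> (f has_real_derivative f' u) (at u within {a..b})"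
    and "\<And>u. u \<in> {a..b} \<Longrightarrow> f' u \<le> 0" and "a \<le> v" "v \<le> u" "u \<le> b"
  shows "f u \<le> f v"
proof -
  have "(f has_derivative (\<lambda>h. f' t * h)) (at t within {v..u})" if "v \<le> t" "t \<le> u" for t
    using DERIV_subset[OF f, of t "{v..u}"] assms that by (auto simp: has_field_derivative_def mult_commute_abs)
  from mvt_very_simple[OF \<open>v \<le> u\<close> this] obtain t where "t \<in> {v..u}" "f u - f v = f' t * (u - v)" by blast
  then show ?thesis using assms mult_nonpos_nonneg[of "f' t" "u - v"] by auto
qed

text \<open>An estimate with \<open>(v - u)\<^sup>2\<close> survives pointwise limits, whereas derivatives do not; this is how limits of
solutions are recognized as solutions.\<close>

lemma derivative_from_second_order:
  fixes f :: "real \<Rightarrow> real"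
  assumes "0 < d" and f: "\<And>v. \<bar>v - u\<bar> < d \<Longrightarrow> \<bar>f v - f u - (v - u) * m\<bar> \<le> K * (v - u)\<^sup>2"
  shows "(f has_real_derivative m) (at u)"
  unfolding has_field_derivative_iff
proof (rule LIM_zero_cancel, rule Lim_null_comparison)
  have "((\<lambda>v. K * \<bar>v - u\<bar>) \<longlongrightarrow> K * \<bar>u - u\<bar>) (at u)" by (intro tendsto_intros)
  then show "((\<lambda>v. K * \<bar>v - u\<bar>) \<longlongrightarrow> 0) (at u)" by simp
  show "\<forall>\<^sub>F v in at u. norm ((f v - f u) / (v - u) - m) \<le> K * \<bar>v - u\<bar>"
    unfolding eventually_at
  proof (intro exI[of _ d] conjI ballI impI \<open>0 < d\<close>)
    fix v assume v: "v \<noteq> u \<and> dist v u < d"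
    have "norm ((f v - f u) / (v - u) - m) = \<bar>f v - f u - (v - u) * m\<bar> / \<bar>v - u\<bar>"
      using v by (simp add: field_simps flip: abs_divide)
    also have "\<dots> \<le> K * (v - u)\<^sup>2 / \<bar>v - u\<bar>"
      using f v by (intro divide_right_mono) (auto simp: dist_real_def)
    also have "(v - u)\<^sup>2 = \<bar>v - u\<bar> * \<bar>v - u\<bar>" by (simp add: power2_eq_square)
    also have "K * (\<bar>v - u\<bar> * \<bar>v - u\<bar>) / \<bar>v - u\<bar> = K * \<bar>v - u\<bar>"
      using v by (simp del: abs_mult_self_eq)
    finally show "norm ((f v - f u) / (v - u) - m) \<le> K * \<bar>v - u\<bar>" .
  qed
qed

text \<open>A vector field that is Lipschitz on a cube around an equilibrium at the origin.\<close>

locale lipschitz_field =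
  fixes r :: nat and s :: "(nat \<Rightarrow> real) \<Rightarrow> nat \<Rightarrow> real" and \<rho> \<Lambda> :: real
  assumes \<rho>: "0 < \<rho>" and \<Lambda>: "0 \<le> \<Lambda>"
    and lip: "\<And>x y i. x \<in> cube r \<rho> \<Longrightarrow> y \<in> cube r \<rho> \<Longrightarrow> i < r \<Longrightarrow> \<bar>s x i - s y i\<bar> \<le> \<Lambda> * (\<Sum>j<r. \<bar>x j - y j\<bar>)"
    and s0: "\<And>i. i < r \<Longrightarrow> s origin i = 0"
begin

lemma sqdist_derivative_bound:
  assumes "x \<in> cube r \<rho>" "y \<in> cube r \<rho>"
  shows "\<bar>\<Sum>i<r. 2 * (x i - y i) * (s x i - s y i)\<bar> \<le> 2 * \<Lambda> * real r * sqdist r x y"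
proof -
  let ?S = "\<Sum>j<r. \<bar>x j - y j\<bar>"
  have "\<bar>\<Sum>i<r. 2 * (x i - y i) * (s x i - s y i)\<bar> \<le> (\<Sum>i<r. \<bar>2 * (x i - y i) * (s x i - s y i)\<bar>)"
    by (rule sum_abs)
  also have "\<dots> \<le> (\<Sum>i<r. 2 * \<bar>x i - y i\<bar> * (\<Lambda> * ?S))"
  proof (rule sum_mono)
    fix i assume "i \<in> {..<r}"
    then have "\<bar>s x i - s y i\<bar> \<le> \<Lambda> * ?S" using lip[OF assms] by simp
    moreover have "0 \<le> 2 * \<bar>x i - y i\<bar>" by simp
    ultimately have "2 * \<bar>x i - y i\<bar> * \<bar>s x i - s y i\<bar> \<le> 2 * \<bar>x i - y i\<bar> * (\<Lambda> * ?S)" by (rule mult_left_mono)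
    then show "\<bar>2 * (x i - y i) * (s x i - s y i)\<bar> \<le> 2 * \<bar>x i - y i\<bar> * (\<Lambda> * ?S)"
      by (simp only: abs_mult abs_numeral)
  qed
  also have "\<dots> = 2 * \<Lambda> * ?S\<^sup>2"
    unfolding sum_distrib_right[symmetric] sum_distrib_left[symmetric] by (simp add: power2_eq_square)
  also have "\<dots> \<le> 2 * \<Lambda> * (real r * sqdist r x y)"
    using sum_squared_le_sum_of_squares[of "\<lambda>j. \<bar>x j - y j\<bar>" "{..<r}"] \<Lambda>
    by (intro mult_left_mono) (auto simp: sqdist_def mult.commute)
  finally show ?thesis by (simp add: mult.assoc)
qed

text \<open>The squared distance \<open>D\<close> of two solutions satisfies \<open>\<bar>D'\<bar> \<le> c D\<close>, so that \<open>e\<^sup>-\<^sup>c\<^sup>t D\<close> decreases and \<open>e\<^sup>c\<^sup>t D\<close>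
increases. Both time directions occur, since solutions are later compared backwards from a common
end point.\<close>

lemma gronwall:
  assumes x: "solution r s {a..b} x" "\<And>u. u \<in> {a..b} \<Longrightarrow> x u \<in> cube r \<rho>"
    and y: "solution r s {a..b} y" "\<And>u. u \<in> {a..b} \<Longrightarrow> y u \<in> cube r \<rho>"
    and uv: "u \<in> {a..b}" "v \<in> {a..b}"
  shows "sqdist r (x u) (y u) \<le> exp (2 * \<Lambda> * real r * \<bar>u - v\<bar>) * sqdist r (x v) (y v)"
proof -
  define c where "c = 2 * \<Lambda> * real r"
  define D where "D t = sqdist r (x t) (y t)" for t
  define D' where "D' t = (\<Sum>i<r. 2 * (x t i - y t i) * (s (x t) i - s (y t) i))" for t
  have D: "(D has_real_derivative D' t) (at t within {a..b})" if "t \<in> {a..b}" for t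
    unfolding D_def[abs_def] D'_def sqdist_def using x(1) y(1) that unfolding solution_def
    by (auto intro!: derivative_eq_intros sum.cong)
  have D': "\<bar>D' t\<bar> \<le> c * D t" if "t \<in> {a..b}" for t
    using sqdist_derivative_bound[OF x(2)[OF that] y(2)[OF that]] by (simp add: D'_def D_def c_def)
  have 1: "((\<lambda>t. exp (- c * t) * D t) has_real_derivative exp (- c * t) * (D' t - c * D t)) (at t within {a..b})"
    if "t \<in> {a..b}" for t
    using D[OF that] by (auto intro!: derivative_eq_intros simp: algebra_simps)
  have 2: "((\<lambda>t. - exp (c * t) * D t) has_real_derivative exp (c * t) * (- D' t - c * D t)) (at t within {a..b})"
    if "t \<in> {a..b}" for t
    using D[OF that] by (auto intro!: derivative_eq_intros simp: algebra_simps)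
  have "D u \<le> exp (c * \<bar>u - v\<bar>) * D v"
  proof (cases "v \<le> u")
    case True
    have "exp (- c * u) * D u \<le> exp (- c * v) * D v"
      by (rule antimono_from_derivative[OF 1]) (use D' uv True in \<open>auto intro!: mult_nonneg_nonpos simp: abs_le_iff\<close>)
    then have "exp (c * u) * (exp (- c * u) * D u) \<le> exp (c * u) * (exp (- c * v) * D v)" by (intro mult_left_mono) auto
    then show ?thesis using True unfolding mult.assoc[symmetric] exp_add[symmetric] by (simp add: algebra_simps)
  next
    case False
    have "- exp (c * v) * D v \<le> - exp (c * u) * D u"
      by (rule antimono_from_derivative[OF 2])
         (use D' uv False in \<open>auto intro!: mult_nonneg_nonpos simp: abs_le_iff\<close>)
    then have "exp (- c * u) * (exp (c * u) * D u) \<le> exp (- c * u) * (exp (c * v) * D v)" by (intro mult_left_mono) auto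
    then show ?thesis using False unfolding mult.assoc[symmetric] exp_add[symmetric] by (simp add: algebra_simps)
  qed
  then show ?thesis by (simp add: D_def c_def)
qed

lemma eucl_norm_cube: "x \<in> Eucl r \<Longrightarrow> eucl_norm r x \<le> \<rho> \<Longrightarrow> x \<in> cube r \<rho>"
proof -
  assume x: "x \<in> Eucl r" "eucl_norm r x \<le> \<rho>"
  have "\<bar>x i\<bar> \<le> eucl_norm r x" if "i < r" for i
    using member_le_L2_set[of "{..<r}" i "\<lambda>i. \<bar>x i\<bar>"] that by (simp add: L2_set_def)
  then show ?thesis using x by (force simp: cube_def)
qed

lemma sqdist_zero: "sqdist r x y = 0 \<Longrightarrow> eucl_norm r x = eucl_norm r y"
  by (auto simp: sqdist_def L2_set_def sum_nonneg_eq_0_iff intro!: arg_cong[where f = sqrt] sum.cong)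

lemma continuous_eucl_norm:
  assumes "solution r s I x" shows "continuous_on I (\<lambda>u. eucl_norm r (x u))"
proof -
  have "continuous_on I (\<lambda>u. x u i)" if "i < r" for i
    using assms that unfolding solution_def continuous_on_eq_continuous_within
    by (blast intro: DERIV_continuous)
  then show ?thesis unfolding L2_set_def by (intro continuous_intros) auto
qed

text \<open>A continuous function that starts below a level and exceeds it has a first time at which it is attained.\<close>

lemma first_hit:
  fixes h :: "real \<Rightarrow> real"
  assumes h: "continuous_on {0..T} h" and "h 0 < e" and u: "u \<in> {0..T}" "e \<le> h u"
  shows "\<exists>v\<in>{0..T}. h v = e \<and> (\<forall>u\<in>{0..v}. h u \<le> e)"
proof -
  define A where "A = {u \<in> {0..T}. h u = e}"
  have ivt: "\<exists>v\<in>{0..w}. h v = e" if "w \<in> {0..T}" "e \<le> h w" for w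
    using IVT'[of h 0 e w] that \<open>h 0 < e\<close> continuous_on_subset[OF h, of "{0..w}"] by auto
  have "A \<noteq> {}"
  proof -
    obtain v where "v \<in> {0..u}" "h v = e" using ivt[OF u] by blast
    then have "v \<in> A" using u(1) by (auto simp: A_def)
    then show ?thesis by blast
  qed
  moreover have "compact A"
  proof -
    have "closedin (top_of_set {0..T}) ({0..T} \<inter> h -` {e})"
      using h by (intro continuous_closedin_preimage) auto
    then have "compact ({0..T} \<inter> h -` {e})" by (rule closedin_compact[OF compact_Icc])
    moreover have "{0..T} \<inter> h -` {e} = A" by (auto simp: A_def)
    ultimately show ?thesis by simp
  qed
  ultimately obtain v where v: "v \<in> A" "\<forall>w\<in>A. v \<le> w" using compact_attains_inf by blast
  have "h w \<le> e" if w: "w \<in> {0..v}" for w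
  proof (rule ccontr)
    assume "\<not> h w \<le> e"
    moreover have wT: "w \<in> {0..T}" using w v by (auto simp: A_def)
    ultimately obtain w' where w': "w' \<in> {0..w}" "h w' = e" using ivt[of w] by auto
    then have "w' \<in> A" using wT by (auto simp: A_def)
    then have "v \<le> w'" using v by blast
    then have "w' = w" using w w' by auto
    then show False using w' \<open>\<not> h w \<le> e\<close> by simp
  qed
  then show ?thesis using v by (auto simp: A_def)
qed

text \<open>Stability speaks of some solution for each single time \<open>t\<close>; uniqueness of solutions in the cube transfers
its smallness to the given solution \<open>y\<close>. If \<open>y\<close> reached norm \<open>\<epsilon>\<close> at a first time \<open>a\<close>, the solution of
norm less than \<open>\<epsilon>\<close> at time \<open>a\<close> would coincide with \<open>y\<close> up to \<open>a\<close>: it cannot leave the cube before, because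
it would still agree with \<open>y\<close> when doing so.\<close>

lemma stays_small:
  assumes W: "W \<subseteq> Eucl r" and \<epsilon>: "\<epsilon> < \<rho>"
    and stable: "\<And>t. 0 \<le> t \<Longrightarrow> \<exists>v. flows_to r W s t w v \<and> eucl_norm r v < \<epsilon>"
    and y: "solution r s {0..T} y" "\<And>u. u \<in> {0..T} \<Longrightarrow> y u \<in> W" "y 0 = w" and u: "u \<in> {0..T}"
  shows "eucl_norm r (y u) < \<epsilon>"
proof (rule ccontr)
  assume "\<not> eucl_norm r (y u) < \<epsilon>"
  have w: "eucl_norm r w < \<epsilon>" using stable[of 0] by (auto simp: flows_to_def)
  have "\<exists>v\<in>{0..T}. eucl_norm r (y v) = \<epsilon> \<and> (\<forall>u\<in>{0..v}. eucl_norm r (y u) \<le> \<epsilon>)"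
    by (rule first_hit[OF continuous_eucl_norm[OF y(1)] _ u]) (use w y(3) \<open>\<not> eucl_norm r (y u) < \<epsilon>\<close> in auto)
  then obtain a where a: "a \<in> {0..T}" "eucl_norm r (y a) = \<epsilon>" "\<And>u. u \<in> {0..a} \<Longrightarrow> eucl_norm r (y u) \<le> \<epsilon>"
    by blast
  have "0 \<le> a" using a(1) by simp
  then obtain x where x: "x 0 = w" "\<And>u. u \<in> {0..a} \<Longrightarrow> x u \<in> W" "solution r s {0..a} x" "eucl_norm r (x a) < \<epsilon>"
    using stable[of a] unfolding flows_to_iff by blast
  have ya: "solution r s {0..a} y" using solution_subset[OF y(1)] a(1) by auto
  have y_cube: "y u \<in> cube r \<rho>" if "u \<in> {0..a}" for u
    using a(3)[OF that] y(2)[of u] a(1) that W \<epsilon> by (intro eucl_norm_cube) auto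
  \<comment> \<open>As long as \<open>x\<close> stays in the cube, it coincides with \<open>y\<close>.\<close>
  have eq: "eucl_norm r (x b) = eucl_norm r (y b)" if b: "b \<in> {0..a}" and x_cube: "\<And>u. u \<in> {0..b} \<Longrightarrow> eucl_norm r (x u) \<le> \<rho>" for b
  proof (rule sqdist_zero)
    have sub: "{0..b} \<subseteq> {0..a}" using b by auto
    have "sqdist r (x b) (y b) \<le> exp (2 * \<Lambda> * real r * \<bar>b - 0\<bar>) * sqdist r (x 0) (y 0)"
    proof (rule gronwall[OF solution_subset[OF x(3) sub] _ solution_subset[OF ya sub]])
      fix u assume u: "u \<in> {0..b}"
      show "x u \<in> cube r \<rho>" using x(2)[of u] sub u W x_cube[OF u] by (intro eucl_norm_cube) auto
      show "y u \<in> cube r \<rho>" using y_cube sub u by blast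
    qed (use b in auto)
    moreover have "sqdist r (x 0) (y 0) = 0" using x(1) y(3) by (simp add: sqdist_def)
    ultimately show "sqdist r (x b) (y b) = 0"
      by (simp add: sqdist_def order_antisym sum_nonneg)
  qed
  have "eucl_norm r (x u) \<le> \<rho>" if u: "u \<in> {0..a}" for u
  proof (rule ccontr)
    assume "\<not> eucl_norm r (x u) \<le> \<rho>"
    then have "\<exists>b\<in>{0..a}. eucl_norm r (x b) = \<rho> \<and> (\<forall>u\<in>{0..b}. eucl_norm r (x u) \<le> \<rho>)"
      by (intro first_hit[OF continuous_eucl_norm[OF x(3)] _ u]) (use w x(1) \<epsilon> in auto)
    then obtain b where b: "b \<in> {0..a}" "eucl_norm r (x b) = \<rho>" "\<forall>u\<in>{0..b}. eucl_norm r (x u) \<le> \<rho>" by blast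
    then have "eucl_norm r (y b) = \<rho>" using eq by auto
    then show False using a(3)[OF b(1)] \<epsilon> by simp
  qed
  then have "eucl_norm r (x a) = eucl_norm r (y a)" using \<open>0 \<le> a\<close> by (intro eq) auto
  then show False using a(2) x(4) by simp
qed

text \<open>A bound for the second derivative of solutions in the cube.\<close>

definition accel_bound :: real where "accel_bound = \<Lambda> * (real r * (\<Lambda> * (real r * \<rho>)))"

lemma field_bound: "x \<in> cube r \<rho> \<Longrightarrow> i < r \<Longrightarrow> \<bar>s x i\<bar> \<le> \<Lambda> * (real r * \<rho>)"
proof -
  assume x: "x \<in> cube r \<rho>" and i: "i < r"
  have "origin \<in> cube r \<rho>" using \<rho> by (simp add: cube_def origin_Eucl)
  from lip[OF x this i] have "\<bar>s x i\<bar> \<le> \<Lambda> * (\<Sum>j<r. \<bar>x j\<bar>)" using s0[OF i] by simp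
  also have "\<dots> \<le> \<Lambda> * (real r * \<rho>)"
    using sum_bounded_above[of "{..<r}" "\<lambda>j. \<bar>x j\<bar>" \<rho>] x \<Lambda> by (intro mult_left_mono) (auto simp: cube_def)
  finally show ?thesis .
qed

lemma second_order:
  assumes y: "solution r s {a..b} y" "\<And>u. u \<in> {a..b} \<Longrightarrow> y u \<in> cube r \<rho>"
    and uv: "u \<in> {a..b}" "v \<in> {a..b}" and i: "i < r"
  shows "\<bar>y v i - y u i - (v - u) * s (y u) i\<bar> \<le> accel_bound * (v - u)\<^sup>2"
proof -
  let ?S = "closed_segment u v"
  have S: "?S \<subseteq> {a..b}" using uv by (auto simp: closed_segment_eq_real_ivl split: if_splits)
  have d: "((\<lambda>t. y t j) has_real_derivative s (y t) j) (at t within ?S)" if "t \<in> ?S" "j < r" for t j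
    using y(1) S that unfolding solution_def by (meson DERIV_subset subsetD)
  have near: "\<bar>y t j - y u j\<bar> \<le> \<Lambda> * (real r * \<rho>) * \<bar>v - u\<bar>" if t: "t \<in> ?S" and j: "j < r" for t j
  proof -
    have "norm (y t j - y u j) \<le> \<Lambda> * (real r * \<rho>) * norm (t - u)"
      by (rule field_differentiable_bound[where S = ?S and f' = "\<lambda>t. s (y t) j"])
        (use d j t S y(2) field_bound in \<open>auto\<close>)
    also have "\<dots> \<le> \<Lambda> * (real r * \<rho>) * \<bar>v - u\<bar>"
      using t \<Lambda> \<rho> by (intro mult_left_mono) (auto simp: closed_segment_eq_real_ivl split: if_splits)
    finally show ?thesis by simp
  qed
  have "norm ((y v i - v * s (y u) i) - (y u i - u * s (y u) i)) \<le> accel_bound * \<bar>v - u\<bar> * norm (v - u)"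
  proof (rule field_differentiable_bound[where S = ?S and f' = "\<lambda>t. s (y t) i - s (y u) i"])
    fix t assume t: "t \<in> ?S"
    show "((\<lambda>t. y t i - t * s (y u) i) has_real_derivative s (y t) i - s (y u) i) (at t within ?S)"
      using d[OF t i] by (auto intro!: derivative_eq_intros)
    have "\<bar>s (y t) i - s (y u) i\<bar> \<le> \<Lambda> * (\<Sum>j<r. \<bar>y t j - y u j\<bar>)"
      using t S uv y(2) i by (intro lip) auto
    also have "\<dots> \<le> \<Lambda> * (real r * (\<Lambda> * (real r * \<rho>) * \<bar>v - u\<bar>))"
      using near[OF t] \<Lambda> sum_bounded_above[of "{..<r}" "\<lambda>j. \<bar>y t j - y u j\<bar>" "\<Lambda> * (real r * \<rho>) * \<bar>v - u\<bar>"]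
      by (intro mult_left_mono) auto
    finally show "norm (s (y t) i - s (y u) i) \<le> accel_bound * \<bar>v - u\<bar>" by (simp add: accel_bound_def mult_ac)
  qed auto
  also have "accel_bound * \<bar>v - u\<bar> * norm (v - u) = accel_bound * (v - u)\<^sup>2"
    by (simp only: real_norm_def mult.assoc abs_mult_self_eq power2_eq_square)
  also have "(y v i - v * s (y u) i) - (y u i - u * s (y u) i) = y v i - y u i - (v - u) * s (y u) i"
    by (simp add: algebra_simps)
  finally show ?thesis by (simp only: real_norm_def)
qed

text \<open>Solutions on growing intervals whose values at time \<open>0\<close> converge form Cauchy sequences at every later or
earlier time, by Gronwall's inequality. The limit inherits the second-order estimate, which makes it a solution.\<close>

lemma limit_of_solutions:
  fixes J :: "real set"
  assumes \<epsilon>: "\<epsilon> < \<rho>" and w: "w \<in> Eucl r"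
    and y: "\<And>n. solution r s {a n..b n} (y n)" "\<And>n u. u \<in> {a n..b n} \<Longrightarrow> y n u \<in> Eucl r \<and> eucl_norm r (y n u) < \<epsilon>"
    and cover: "\<And>u. u \<in> J \<Longrightarrow> \<forall>\<^sub>F n in sequentially. u \<in> {a n..b n}" and zero: "\<And>n. 0 \<in> {a n..b n}"
    and lim: "\<And>i. i < r \<Longrightarrow> (\<lambda>n. y n 0 i) \<longlonglongrightarrow> w i"
  shows "\<exists>Y. (0 \<in> J \<longrightarrow> Y 0 = w) \<and> (\<forall>u\<in>J. Y u \<in> Eucl r \<and> eucl_norm r (Y u) \<le> \<epsilon>) \<and>
    (\<forall>u\<in>J. \<forall>v\<in>J. \<forall>i<r. \<bar>Y v i - Y u i - (v - u) * s (Y u) i\<bar> \<le> accel_bound * (v - u)\<^sup>2)"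
proof -
  have cube: "y n u \<in> cube r \<rho>" if "u \<in> {a n..b n}" for n u
    using y(2)[OF that] \<epsilon> by (intro eucl_norm_cube) auto
  have gr: "sqdist r (y n u) (y m u) \<le> exp (2 * \<Lambda> * real r * \<bar>u\<bar>) * sqdist r (y n 0) (y m 0)"
    if u: "u \<in> {a n..b n}" "u \<in> {a m..b m}" for n m u
  proof -
    let ?I = "{max (a n) (a m)..min (b n) (b m)}"
    have "?I \<subseteq> {a n..b n}" "?I \<subseteq> {a m..b m}" by auto
    then have "sqdist r (y n u) (y m u) \<le> exp (2 * \<Lambda> * real r * \<bar>u - 0\<bar>) * sqdist r (y n 0) (y m 0)"
      using u zero[of n] zero[of m]
      by (intro gronwall[OF solution_subset[OF y(1)] _ solution_subset[OF y(1)], of "max (a n) (a m)" "min (b n) (b m)" n m]) (auto intro!: cube)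
    then show ?thesis by simp
  qed
  have conv: "convergent (\<lambda>n. y n u i)" if u: "u \<in> J" and i: "i < r" for u i
  proof -
    define A where "A = exp (2 * \<Lambda> * real r * \<bar>u\<bar>)"
    have "Cauchy (\<lambda>n. y n u i)"
    proof (rule metric_CauchyI)
      fix e :: real assume e: "0 < e"
      \<comment> \<open>Chosen such that \<open>A r d < e\<^sup>2\<close>: Gronwall's inequality amplifies squared distances by at most \<open>A\<close>.\<close>
      define d where "d = e\<^sup>2 / (A * (real r + 1))"
      have d: "0 < d" using e by (simp add: d_def A_def)
      have "\<forall>\<^sub>F n in sequentially. \<bar>y n 0 j - w j\<bar> < sqrt d / 2" if "j < r" for j
        using tendstoD[OF lim[OF that], of "sqrt d / 2"] d by (simp add: dist_real_def)
      then have "\<forall>\<^sub>F n in sequentially. \<forall>j\<in>{..<r}. \<bar>y n 0 j - w j\<bar> < sqrt d / 2"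
        by (intro eventually_ball_finite) auto
      with cover[OF u] have "\<forall>\<^sub>F n in sequentially. u \<in> {a n..b n} \<and> (\<forall>j\<in>{..<r}. \<bar>y n 0 j - w j\<bar> < sqrt d / 2)"
        by (rule eventually_conj)
      then obtain N where N: "\<And>n. n \<ge> N \<Longrightarrow> u \<in> {a n..b n} \<and> (\<forall>j\<in>{..<r}. \<bar>y n 0 j - w j\<bar> < sqrt d / 2)"
        unfolding eventually_sequentially by blast
      have "dist (y m u i) (y n u i) < e" if mn: "m \<ge> N" "n \<ge> N" for m n
      proof -
        have "(y m 0 j - y n 0 j)\<^sup>2 \<le> d" if "j < r" for j
        proof -
          have "\<bar>y m 0 j - w j\<bar> < sqrt d / 2" "\<bar>y n 0 j - w j\<bar> < sqrt d / 2" using N mn that by auto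
          then have "\<bar>y m 0 j - y n 0 j\<bar> \<le> sqrt d" by linarith
          then have "\<bar>y m 0 j - y n 0 j\<bar>\<^sup>2 \<le> (sqrt d)\<^sup>2" by (intro power_mono) auto
          then show ?thesis using d by simp
        qed
        then have "sqdist r (y m 0) (y n 0) \<le> real r * d"
          unfolding sqdist_def using sum_bounded_above[of "{..<r}" "\<lambda>j. (y m 0 j - y n 0 j)\<^sup>2" d] by simp
        have "(y m u i - y n u i)\<^sup>2 \<le> sqdist r (y m u) (y n u)"
          unfolding sqdist_def using i by (intro member_le_sum) auto
        also have "\<dots> \<le> A * sqdist r (y m 0) (y n 0)" unfolding A_def using N mn by (intro gr) auto
        also have "\<dots> \<le> A * (real r * d)" using \<open>sqdist r (y m 0) (y n 0) \<le> real r * d\<close>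
          by (intro mult_left_mono) (auto simp: A_def)
        also have "\<dots> < A * ((real r + 1) * d)" using d by (intro mult_strict_left_mono) (auto simp: A_def)
        also have "\<dots> = e\<^sup>2" by (simp add: d_def A_def)
        finally have "\<bar>y m u i - y n u i\<bar>\<^sup>2 < e\<^sup>2" by simp
        then have "\<bar>y m u i - y n u i\<bar> < e" by (rule power_less_imp_less_base) (use e in simp)
        then show ?thesis by (simp add: dist_real_def)
      qed
      then show "\<exists>M. \<forall>m\<ge>M. \<forall>n\<ge>M. dist (y m u i) (y n u i) < e" by blast
    qed
    then show ?thesis by (rule Cauchy_convergent)
  qed
  define Y where "Y u i = (if i < r then Lim sequentially (\<lambda>n. y n u i) else 0)" for u i
  have Y: "(\<lambda>n. y n u i) \<longlonglongrightarrow> Y u i" if "u \<in> J" "i < r" for u i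
    using conv[OF that] that(2) by (simp add: Y_def convergent_LIMSEQ_iff lim_def)
  have YE: "Y u \<in> Eucl r" for u by (simp add: Y_def Eucl_iff)
  have nmY: "eucl_norm r (Y u) \<le> \<epsilon>" if u: "u \<in> J" for u
  proof (rule tendsto_upperbound)
    show "(\<lambda>n. eucl_norm r (y n u)) \<longlonglongrightarrow> eucl_norm r (Y u)"
      unfolding L2_set_def by (intro tendsto_intros Y u) auto
    show "\<forall>\<^sub>F n in sequentially. eucl_norm r (y n u) \<le> \<epsilon>"
      using cover[OF u] by eventually_elim (use y(2) in \<open>auto intro: less_imp_le\<close>)
  qed simp
  have cubeY: "Y u \<in> cube r \<rho>" if "u \<in> J" for u using eucl_norm_cube[OF YE] nmY[OF that] \<epsilon> by simp
  have sY: "(\<lambda>n. s (y n u) i) \<longlonglongrightarrow> s (Y u) i" if u: "u \<in> J" and i: "i < r" for u i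
  proof -
    have "(\<lambda>n. \<Lambda> * (\<Sum>j<r. \<bar>y n u j - Y u j\<bar>)) \<longlonglongrightarrow> \<Lambda> * (\<Sum>j<r. \<bar>Y u j - Y u j\<bar>)"
      by (intro tendsto_intros Y u) auto
    then have l: "(\<lambda>n. \<Lambda> * (\<Sum>j<r. \<bar>y n u j - Y u j\<bar>)) \<longlonglongrightarrow> 0" by simp
    have "\<forall>\<^sub>F n in sequentially. norm (s (y n u) i - s (Y u) i) \<le> \<Lambda> * (\<Sum>j<r. \<bar>y n u j - Y u j\<bar>)"
      using cover[OF u] by eventually_elim (use lip cube cubeY[OF u] i in auto)
    from Lim_null_comparison[OF this l] show ?thesis by (rule LIM_zero_cancel)
  qed
  have "\<bar>Y v i - Y u i - (v - u) * s (Y u) i\<bar> \<le> accel_bound * (v - u)\<^sup>2" if "u \<in> J" "v \<in> J" "i < r" for u v i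
  proof (rule tendsto_upperbound)
    show "(\<lambda>n. \<bar>y n v i - y n u i - (v - u) * s (y n u) i\<bar>) \<longlonglongrightarrow> \<bar>Y v i - Y u i - (v - u) * s (Y u) i\<bar>"
      using that by (intro tendsto_intros Y sY)
    show "\<forall>\<^sub>F n in sequentially. \<bar>y n v i - y n u i - (v - u) * s (y n u) i\<bar> \<le> accel_bound * (v - u)\<^sup>2"
      using cover[OF that(1)] cover[OF that(2)]
    proof eventually_elim
      case (elim n)
      show ?case by (rule second_order[OF y(1) cube elim that(3)])
    qed
  qed simp
  moreover have "Y 0 = w" if "0 \<in> J"
  proof
    fix i show "Y 0 i = w i"
    proof (cases "i < r")
      case True then show ?thesis using LIMSEQ_unique[OF Y[OF that True] lim[OF True]] by simp
    next
      case False then show ?thesis using w by (simp add: Y_def Eucl_iff)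
    qed
  qed
  ultimately show ?thesis using YE nmY by blast
qed

text \<open>Shrinking neighbourhoods of \<open>w\<close> give orbit segments \<open>x n\<close> on \<open>[0, t n]\<close> with \<open>t n \<rightarrow> \<infinity>\<close> whose two end points converge to
\<open>w\<close>. By stability the segments remain small. Their limit from the left end points is a forward orbit of \<open>w\<close>; their limit
from the right end points, after shifting time to \<open>[-t n, 0]\<close>, is a backward orbit.\<close>

lemma complete_orbit:
  assumes W: "openin (Euclidean_space r) W" and \<epsilon>: "\<epsilon> < \<rho>"
    and stable: "\<And>w t. w \<in> W \<Longrightarrow> eucl_norm r w < \<delta> \<Longrightarrow> 0 \<le> t \<Longrightarrow> \<exists>v. flows_to r W s t w v \<and> eucl_norm r v < \<epsilon>"
    and nw: "nonwandering r (W, s, \<gamma>) w" and w: "w \<in> W" "eucl_norm r w < \<delta>"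
  shows "\<exists>X. X 0 = w \<and> (\<forall>t. X t \<in> Eucl r \<and> eucl_norm r (X t) \<le> \<epsilon> \<and>
    (\<forall>i<r. ((\<lambda>u. X u i) has_real_derivative s (X t) i) (at t)))"
proof -
  have WE: "W \<subseteq> Eucl r" using W openin_subset by blast
  then have wE: "w \<in> Eucl r" using w by blast
  define \<kappa> where "\<kappa> = (\<delta> - eucl_norm r w) / (real r + 1)"
  have \<kappa>: "0 < \<kappa>" using w by (simp add: \<kappa>_def)
  have small: "eucl_norm r v < \<delta>" if "box_close r \<kappa> w v" for v
  proof -
    have "eucl_norm r v \<le> eucl_norm r w + real r * \<kappa>" by (rule eucl_norm_box[OF that])
    also have "\<dots> < eucl_norm r w + (real r + 1) * \<kappa>" using \<kappa> by simp
    also have "(real r + 1) * \<kappa> = \<delta> - eucl_norm r w" by (simp add: \<kappa>_def)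
    finally show ?thesis by simp
  qed
  \<comment> \<open>Neighbourhoods of \<open>w\<close> inside the region of stability, shrinking to \<open>w\<close>.\<close>
  define N where "N n = {v \<in> W. box_close r (\<kappa> / real (Suc n)) w v}" for n :: nat
  have N: "openin (Euclidean_space r) (N n)" "w \<in> N n" for n
  proof -
    show "w \<in> N n" using w \<kappa> by (simp add: N_def box_close_def)
    show "openin (Euclidean_space r) (N n)"
      unfolding openin_Eucl_iff
    proof (intro conjI ballI)
      show "N n \<subseteq> Eucl r" using WE by (auto simp: N_def)
      fix x assume x: "x \<in> N n"
      then obtain d where d: "d > 0" "\<forall>y\<in>Eucl r. box_close r d x y \<longrightarrow> y \<in> W"
        using W unfolding openin_Eucl_iff N_def by blast
      define d' where "d' = Min (insert d ((\<lambda>i. \<kappa> / real (Suc n) - \<bar>x i - w i\<bar>) ` {..<r}))"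
      have d': "d' > 0" "d' \<le> d" "\<And>i. i < r \<Longrightarrow> d' \<le> \<kappa> / real (Suc n) - \<bar>x i - w i\<bar>"
        using x d(1) by (auto simp: d'_def N_def box_close_def)
      have "y \<in> N n" if y: "y \<in> Eucl r" "box_close r d' x y" for y
      proof -
        have "\<bar>y i - w i\<bar> < \<kappa> / real (Suc n)" if "i < r" for i
        proof -
          have "\<bar>y i - x i\<bar> < d'" using y(2) that by (simp add: box_close_def)
          then show ?thesis using d'(3)[OF that] by linarith
        qed
        moreover have "y \<in> W" using d(2) y box_close_mono[OF y(2) d'(2)] by blast
        ultimately show ?thesis unfolding N_def box_close_def by blast
      qed
      then show "\<exists>d>0. \<forall>y\<in>Eucl r. box_close r d x y \<longrightarrow> y \<in> N n" using d'(1) by blast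
    qed
  qed
  have "\<exists>t x. t > real (Suc n) \<and> x 0 \<in> N n \<and> x t \<in> N n \<and> (\<forall>u\<in>{0..t}. x u \<in> W) \<and> solution r s {0..t} x" for n
  proof -
    have "\<exists>t>real (Suc n). flow_image r W s t (N n) \<inter> N n \<noteq> {}"
      using nw N[of n] by simp
    then obtain t v w' where "t > real (Suc n)" "w' \<in> N n" "flows_to r W s t w' v" "v \<in> N n"
      unfolding flow_image_def by blast
    then show ?thesis unfolding flows_to_iff by blast
  qed
  then obtain t x where tx: "\<And>n. t n > real (Suc n)" "\<And>n. x n 0 \<in> N n" "\<And>n. x n (t n) \<in> N n"
    "\<And>n u. u \<in> {0..t n} \<Longrightarrow> x n u \<in> W" "\<And>n. solution r s {0..t n} (x n)"
    by metis
  have xs: "x n u \<in> Eucl r \<and> eucl_norm r (x n u) < \<epsilon>" if "u \<in> {0..t n}" for n u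
  proof -
    have "box_close r \<kappa> w (x n 0)"
      using tx(2)[of n] \<kappa> box_close_mono[of r "\<kappa> / real (Suc n)" w "x n 0" \<kappa>]
      by (simp add: N_def divide_le_eq)
    then have "eucl_norm r (x n 0) < \<delta>" by (rule small)
    moreover have "x n 0 \<in> W" using tx(2)[of n] by (simp add: N_def)
    ultimately have "eucl_norm r (x n u) < \<epsilon>"
      using stays_small[OF WE \<epsilon> _ tx(5)[of n] tx(4) refl that] stable by blast
    then show ?thesis using tx(4)[OF that] WE by blast
  qed
  have close: "(\<lambda>n. v n i) \<longlonglongrightarrow> w i" if v: "\<And>n. v n \<in> N n" and i: "i < r" for v :: "nat \<Rightarrow> nat \<Rightarrow> real" and i
  proof (rule LIM_zero_cancel, rule Lim_null_comparison)
    show "\<forall>\<^sub>F n in sequentially. norm (v n i - w i) \<le> \<kappa> * inverse (real (Suc n))"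
      using v i by (intro always_eventually allI) (auto simp: N_def box_close_def divide_inverse intro: less_imp_le)
    show "(\<lambda>n. \<kappa> * inverse (real (Suc n))) \<longlonglongrightarrow> 0"
      by (intro tendsto_mult_right_zero LIMSEQ_inverse_real_of_nat)
  qed
  have tpos: "0 < t n" for n using tx(1)[of n] by (meson of_nat_0_le_iff order_le_less_trans)
  have big: "\<forall>\<^sub>F n in sequentially. u < t n" for u
    using eventually_ge_at_top[of "nat \<lceil>u\<rceil>"]
  proof eventually_elim
    case (elim n)
    then show ?case using tx(1)[of n] by linarith
  qed
  have fw: "\<exists>Y. ((0::real) \<in> {0..} \<longrightarrow> Y 0 = w) \<and> (\<forall>u\<in>{0..}. Y u \<in> Eucl r \<and> eucl_norm r (Y u) \<le> \<epsilon>) \<and>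
    (\<forall>u\<in>{0..}. \<forall>v\<in>{0..}. \<forall>i<r. \<bar>Y v i - Y u i - (v - u) * s (Y u) i\<bar> \<le> accel_bound * (v - u)\<^sup>2)"
  proof (rule limit_of_solutions[OF \<epsilon> wE tx(5)])
    show "\<forall>\<^sub>F n in sequentially. u \<in> {0..t n}" if "u \<in> {0..}" for u
      using big[of u] by eventually_elim (use that in auto)
    show "(\<lambda>n. x n 0 i) \<longlonglongrightarrow> w i" if "i < r" for i using close[OF tx(2) that] .
  qed (use xs tpos in \<open>auto intro: less_imp_le\<close>)
  have bw: "\<exists>Y. ((0::real) \<in> {..0} \<longrightarrow> Y 0 = w) \<and> (\<forall>u\<in>{..0}. Y u \<in> Eucl r \<and> eucl_norm r (Y u) \<le> \<epsilon>) \<and>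
    (\<forall>u\<in>{..0}. \<forall>v\<in>{..0}. \<forall>i<r. \<bar>Y v i - Y u i - (v - u) * s (Y u) i\<bar> \<le> accel_bound * (v - u)\<^sup>2)"
  proof (rule limit_of_solutions[OF \<epsilon> wE solution_shift[OF tx(5)]])
    show "\<forall>\<^sub>F n in sequentially. u \<in> {0 - t n..t n - t n}" if "u \<in> {..0}" for u
      using big[of "- u"] by eventually_elim (use that in auto)
    show "(\<lambda>n. x n (t n + 0) i) \<longlonglongrightarrow> w i" if "i < r" for i using close[OF tx(3) that] by simp
  qed (use xs tpos in \<open>auto intro: less_imp_le\<close>)
  obtain F where F: "F 0 = w" "\<And>u. 0 \<le> u \<Longrightarrow> F u \<in> Eucl r \<and> eucl_norm r (F u) \<le> \<epsilon>"
    "\<And>u v i. 0 \<le> u \<Longrightarrow> 0 \<le> v \<Longrightarrow> i < r \<Longrightarrow> \<bar>F v i - F u i - (v - u) * s (F u) i\<bar> \<le> accel_bound * (v - u)\<^sup>2"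
    using fw by auto
  obtain B where B: "B 0 = w" "\<And>u. u \<le> 0 \<Longrightarrow> B u \<in> Eucl r \<and> eucl_norm r (B u) \<le> \<epsilon>"
    "\<And>u v i. u \<le> 0 \<Longrightarrow> v \<le> 0 \<Longrightarrow> i < r \<Longrightarrow> \<bar>B v i - B u i - (v - u) * s (B u) i\<bar> \<le> accel_bound * (v - u)\<^sup>2"
    using bw by auto
  \<comment> \<open>The two halves fit together differentiably at \<open>0\<close>, because each satisfies the second-order estimate with the same slope.\<close>
  define X where "X u = (if 0 \<le> u then F u else B u)" for u
  have XB: "X u = B u" if "u \<le> 0" for u using that F(1) B(1) by (auto simp: X_def)
  have "((\<lambda>u. X u i) has_real_derivative s (X u) i) (at u)" if i: "i < r" for u i
  proof (rule derivative_from_second_order[where d = "if u = 0 then 1 else \<bar>u\<bar>" and K = accel_bound])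
    fix v assume v: "\<bar>v - u\<bar> < (if u = 0 then 1 else \<bar>u\<bar>)"
    then consider "0 \<le> u" "0 \<le> v" | "u \<le> 0" "v \<le> 0" by (cases "u = 0") (auto split: if_splits simp: abs_if)
    then show "\<bar>X v i - X u i - (v - u) * s (X u) i\<bar> \<le> accel_bound * (v - u)\<^sup>2"
    proof cases
      case 1 then show ?thesis using F(3)[OF 1 i] by (simp add: X_def)
    next
      case 2 then show ?thesis using B(3)[OF 2 i] by (simp add: XB)
    qed
  qed auto
  moreover have "X u \<in> Eucl r \<and> eucl_norm r (X u) \<le> \<epsilon>" for u using F(2) B(2) by (simp add: X_def)
  moreover have "X 0 = w" using F(1) by (simp add: X_def)
  ultimately show ?thesis by blast
qed

end

section \<open>Scalar linear equations with solutions of bounded growth\<close>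

text \<open>The solutions of \<open>y' = l y + f\<close> that are given by integrating \<open>f\<close> against a Green function: those of growth at most \<open>4 \<eta>\<close>.
For \<open>\<bar>Re l\<bar> > 4 \<eta>\<close> this growth condition determines \<open>y\<close>, while for \<open>Re l = 0\<close> all solutions grow slowly and the
initial value \<open>c\<close> selects one.\<close>

definition green :: "real \<Rightarrow> complex \<Rightarrow> complex \<Rightarrow> (real \<Rightarrow> complex) \<Rightarrow> (real \<Rightarrow> complex) \<Rightarrow> bool" where
  "green \<eta> l c f y \<longleftrightarrow>
     (\<forall>t. (y has_vector_derivative l * y t + f t) (at t)) \<and> (Re l = 0 \<longrightarrow> y 0 = c) \<and>
     (\<exists>C. \<forall>t. cmod (y t) \<le> C * exp (4 * \<eta> * \<bar>t\<bar>))"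

lemma unfolded_derivative:
  fixes l :: complex
  assumes "(y has_vector_derivative l * y t + f t) (at t)"
  shows "((\<lambda>t. exp (- l * of_real t) * y t) has_vector_derivative exp (- l * of_real t) * f t) (at t)"
proof -
  have "((\<lambda>t. exp (- l * of_real t)) has_vector_derivative (- l * exp (- l * of_real t))) (at t)"
    by (rule has_vector_derivative_real_field[where f = "\<lambda>z. exp (- l * z)"])
      (auto intro!: derivative_eq_intros)
  from has_vector_derivative_mult[OF this assms] show ?thesis
    by (simp add: algebra_simps)
qed

lemma folded_derivative:
  fixes l :: complex
  assumes "(F has_vector_derivative exp (- l * of_real t) * f t) (at t)"
  shows "((\<lambda>t. exp (l * of_real t) * (F t - c)) has_vector_derivative
           l * (exp (l * of_real t) * (F t - c)) + f t) (at t)"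
proof -
  have 1: "((\<lambda>t. exp (l * of_real t)) has_vector_derivative (l * exp (l * of_real t))) (at t)"
    by (rule has_vector_derivative_real_field[where f = "\<lambda>z. exp (l * z)"])
      (auto intro!: derivative_eq_intros)
  have 2: "((\<lambda>t. F t - c) has_vector_derivative exp (- l * of_real t) * f t) (at t)"
    using has_vector_derivative_diff[OF assms has_vector_derivative_const[of c]] by simp
  have "exp (l * complex_of_real t) * exp (- l * complex_of_real t) = 1"
    by (simp flip: exp_add)
  then have "exp (l * complex_of_real t) * (exp (- l * complex_of_real t) * f t) = f t"
    by (simp flip: mult.assoc)
  from has_vector_derivative_mult[OF 1 2, unfolded this] show ?thesis
    by (simp add: algebra_simps)
qed

lemma increment_bound:
  fixes F :: "real \<Rightarrow> complex"
  assumes "a \<le> b" and F: "\<And>t. (F has_vector_derivative d t) (at t)"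
    and P: "\<And>t. (P has_real_derivative p t) (at t)"
    and le: "\<And>t. a < t \<Longrightarrow> t < b \<Longrightarrow> cmod (d t) \<le> p t"
  shows "cmod (F b - F a) \<le> P b - P a"
proof (cases "a = b")
  case False
  with \<open>a \<le> b\<close> have "a < b" by simp
  then show ?thesis
  proof (rule differentiable_bound_general)
    show "continuous_on {a..b} F" "continuous_on {a..b} P"
      using F P by (auto intro!: continuous_at_imp_continuous_on
          intro: has_vector_derivative_continuous DERIV_isCont)
    show "(P has_vector_derivative p t) (at t)" for t
      using P by (simp add: has_real_derivative_iff_has_vector_derivative)
  qed (use F le in auto)
qed auto

text \<open>The integral of \<open>K e\<^sup>-\<^sup>r\<^sup>s e\<^sup>\<mu>\<^sup>\<bar>\<^sup>s\<^sup>\<bar>\<close> over \<open>[t, b]\<close> is bounded independently of \<open>b\<close> because \<open>\<mu> < r\<close>; on that interval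
\<open>\<bar>s\<bar> \<le> \<bar>t\<bar> + (s - t)\<close>, which works for either sign of \<open>t\<close>.\<close>

lemma exp_tail_bound:
  fixes F :: "real \<Rightarrow> complex"
  assumes F: "\<And>t. (F has_vector_derivative d t) (at t)" and "\<mu> < r" "0 \<le> \<mu>"
    and d: "\<And>s. cmod (d s) \<le> K * exp (- r * s) * exp (\<mu> * \<bar>s\<bar>)" and "t \<le> b"
  shows "cmod (F b - F t) \<le> K / (r - \<mu>) * exp (\<mu> * \<bar>t\<bar> - r * t)"
proof -
  have K: "0 \<le> K"
    using order_trans[OF norm_ge_zero d[of 0]] by simp
  \<comment> \<open>The constant with which \<open>A e\<^sup>-\<^sup>(\<^sup>r\<^sup>-\<^sup>\<mu>\<^sup>)\<^sup>s\<close> dominates the integrand for all \<open>s \<ge> t\<close>.\<close>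
  define A where "A = K * exp (\<mu> * \<bar>t\<bar> - \<mu> * t)"
  have A: "0 \<le> A" using K by (simp add: A_def)
  have "cmod (F b - F t) \<le> - (A / (r - \<mu>)) * exp (- (r - \<mu>) * b) - - (A / (r - \<mu>)) * exp (- (r - \<mu>) * t)"
  proof (rule increment_bound[OF \<open>t \<le> b\<close> F])
    fix s show "((\<lambda>s. - (A / (r - \<mu>)) * exp (- (r - \<mu>) * s)) has_real_derivative A * exp (- (r - \<mu>) * s)) (at s)"
    proof -
      obtain k where k: "r - \<mu> = k" "k \<noteq> 0" using \<open>\<mu> < r\<close> by auto
      then show ?thesis unfolding k by (auto intro!: derivative_eq_intros)
    qed
  next
    fix s assume "t < s" "s < b"
    then have "\<mu> * \<bar>s\<bar> \<le> \<mu> * (\<bar>t\<bar> + (s - t))" using \<open>0 \<le> \<mu>\<close>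
      by (intro mult_left_mono) auto
    then have "- r * s + \<mu> * \<bar>s\<bar> \<le> (\<mu> * \<bar>t\<bar> - \<mu> * t) + (- (r - \<mu>) * s)"
      by (simp add: algebra_simps)
    then have "K * exp (- r * s + \<mu> * \<bar>s\<bar>) \<le> K * exp ((\<mu> * \<bar>t\<bar> - \<mu> * t) + (- (r - \<mu>) * s))"
      using K by (intro mult_left_mono) auto
    then show "cmod (d s) \<le> A * exp (- (r - \<mu>) * s)"
      using d[of s] unfolding A_def exp_add by (simp add: mult.assoc)
  qed
  also have "\<dots> \<le> (A / (r - \<mu>)) * exp (- (r - \<mu>) * t)"
    using A \<open>\<mu> < r\<close> by auto
  also have "\<dots> = K / (r - \<mu>) * exp (\<mu> * \<bar>t\<bar> - r * t)"
  proof -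
    have "exp (\<mu> * \<bar>t\<bar> - \<mu> * t) * exp (- (r - \<mu>) * t) = exp (\<mu> * \<bar>t\<bar> - r * t)"
      by (simp add: algebra_simps flip: exp_add)
    then show ?thesis by (simp add: A_def)
  qed
  finally show ?thesis .
qed

text \<open>Time reversal exchanges positive and negative real parts, so only \<open>Re l > 0\<close> has to be treated.\<close>

lemma green_reflect:
  assumes "green \<eta> l c f y"
  shows "green \<eta> (- l) c (\<lambda>t. - f (- t)) (\<lambda>t. y (- t))"
proof -
  have "((\<lambda>t. y (- t)) has_vector_derivative - (l * y (- t) + f (- t))) (at t)" for t
    using vector_diff_chain_at[of uminus "-1" t y "l * y (- t) + f (- t)"] assms
    unfolding green_def o_def
    using has_vector_derivative_minus[OF has_vector_derivative_id[of "at t"]] by (simp add: algebra_simps)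
  moreover obtain C where "\<And>t. cmod (y t) \<le> C * exp (4 * \<eta> * \<bar>t\<bar>)" using assms unfolding green_def by auto
  then have "cmod (y (- t)) \<le> C * exp (4 * \<eta> * \<bar>t\<bar>)" for t by (metis abs_minus_cancel)
  ultimately show ?thesis using assms unfolding green_def by auto
qed

lemma weighted_decay:
  assumes "0 < \<eta>" "8 * \<eta> \<le> r"
  shows "(\<lambda>n. C * exp (4 * \<eta> * real n) * exp (- r * real n)) \<longlonglongrightarrow> 0"
proof -
  have "(\<lambda>n. C * (exp (- (r - 4 * \<eta>))) ^ n) \<longlonglongrightarrow> C * 0"
    by (intro tendsto_intros LIMSEQ_power_zero) (use assms in auto)
  then show ?thesis
    by (simp add: exp_of_nat_mult[symmetric] algebra_simps flip: exp_add)
qed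

text \<open>Multiplied by \<open>e\<^sup>-\<^sup>l\<^sup>t\<close>, a solution of growth \<open>4 \<eta>\<close> tends to \<open>0\<close> at \<open>+\<infinity>\<close>; so its value at \<open>t\<close> is the
integral of \<open>e\<^sup>-\<^sup>l\<^sup>s f(s)\<close> over \<open>[t, \<infinity>)\<close> up to sign.\<close>

lemma green_bound_unstable:
  assumes y: "green \<eta> l c f y" and \<mu>: "0 < \<eta>" "\<eta> \<le> \<mu>" "\<mu> \<le> 4 * \<eta>" and l: "8 * \<eta> \<le> Re l"
    and f: "\<And>t. cmod (f t) \<le> K * exp (\<mu> * \<bar>t\<bar>)"
  shows "cmod (y t) \<le> K / \<eta> * exp (\<mu> * \<bar>t\<bar>)"
proof -
  have K: "0 \<le> K"
    using order_trans[OF norm_ge_zero f[of 0]] by simp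
  define F where "F = (\<lambda>t. exp (- l * of_real t) * y t)"
  obtain C where C: "\<And>t. cmod (y t) \<le> C * exp (4 * \<eta> * \<bar>t\<bar>)" using y unfolding green_def by auto
  have F: "(F has_vector_derivative exp (- l * of_real t) * f t) (at t)" for t
    unfolding F_def using y by (intro unfolded_derivative) (auto simp: green_def)
  have d: "cmod (exp (- l * of_real s) * f s) \<le> K * exp (- Re l * s) * exp (\<mu> * \<bar>s\<bar>)" for s
    using mult_left_mono[OF f[of s], of "exp (- Re l * s)"] by (simp add: norm_mult algebra_simps)
  have "(\<lambda>n. F (real n)) \<longlonglongrightarrow> 0"
  proof (rule tendsto_norm_zero_cancel, rule tendsto_sandwich[OF _ _ tendsto_const])
    show "\<forall>\<^sub>F n in sequentially. cmod (F (real n)) \<le> C * exp (4 * \<eta> * real n) * exp (- Re l * real n)"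
      using C mult_left_mono[OF C, of "exp (- Re l * real n)" "real n" for n]
      by (auto simp: F_def norm_mult algebra_simps)
  qed (use weighted_decay[OF \<mu>(1) l] in auto)
  then have "(\<lambda>n. cmod (F (real n) - F t)) \<longlonglongrightarrow> cmod (0 - F t)"
    by (intro tendsto_intros)
  moreover have "\<forall>\<^sub>F n in sequentially. cmod (F (real n) - F t) \<le> K / (Re l - \<mu>) * exp (\<mu> * \<bar>t\<bar> - Re l * t)"
    using eventually_ge_at_top[of "nat \<lceil>t\<rceil>"]
  proof eventually_elim
    case (elim n)
    then have "t \<le> real n" by linarith
    from exp_tail_bound[OF F _ _ d this] show ?case using \<mu> l by auto
  qed
  ultimately have "cmod (F t) \<le> K / (Re l - \<mu>) * exp (\<mu> * \<bar>t\<bar> - Re l * t)"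
    using tendsto_upperbound[of "\<lambda>n. cmod (F (real n) - F t)" "cmod (0 - F t)" sequentially] by simp
  also have "\<dots> \<le> K / \<eta> * exp (\<mu> * \<bar>t\<bar> - Re l * t)"
    using K \<mu> l by (intro mult_right_mono divide_left_mono) auto
  finally have "cmod (F t) * exp (Re l * t) \<le> K / \<eta> * exp (\<mu> * \<bar>t\<bar> - Re l * t) * exp (Re l * t)"
    by (intro mult_right_mono) auto
  then have "cmod (F t) * exp (Re l * t) \<le> K / \<eta> * exp (\<mu> * \<bar>t\<bar>)"
    by (simp add: mult.assoc flip: exp_add)
  moreover have "cmod (F t) * exp (Re l * t) = cmod (y t)"
    using exp_minus_inverse[of "Re l * t"] by (simp add: F_def norm_mult mult_ac)
  ultimately show ?thesis by simp
qed

lemma green_bound_center_pos: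
  assumes y: "green \<eta> l c f y" and \<mu>: "0 < \<eta>" "\<eta> \<le> \<mu>" and l: "Re l = 0"
    and f: "\<And>t. cmod (f t) \<le> K * exp (\<mu> * \<bar>t\<bar>)" and "0 \<le> t"
  shows "cmod (y t) \<le> cmod c + K / \<eta> * exp (\<mu> * \<bar>t\<bar>)"
proof -
  have K: "0 \<le> K"
    using order_trans[OF norm_ge_zero f[of 0]] by simp
  define F where "F = (\<lambda>t. exp (- l * of_real t) * y t)"
  have F: "(F has_vector_derivative exp (- l * of_real t) * f t) (at t)" for t
    unfolding F_def using y by (intro unfolded_derivative) (auto simp: green_def)
  have "cmod (F t - F 0) \<le> K / \<mu> * exp (\<mu> * t) - K / \<mu> * exp (\<mu> * 0)"
  proof (rule increment_bound[OF \<open>0 \<le> t\<close> F])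
    fix s show "((\<lambda>s. K / \<mu> * exp (\<mu> * s)) has_real_derivative K * exp (\<mu> * s)) (at s)"
      using \<mu> by (auto intro!: derivative_eq_intros simp: field_simps)
  next
    fix s :: real assume "0 < s" "s < t"
    then show "cmod (exp (- l * of_real s) * f s) \<le> K * exp (\<mu> * s)"
      using f[of s] l by (simp add: norm_mult)
  qed
  also have "\<dots> \<le> K / \<mu> * exp (\<mu> * t)" using K \<mu> by simp
  also have "\<dots> \<le> K / \<eta> * exp (\<mu> * t)"
    using K \<mu> by (intro mult_right_mono divide_left_mono) auto
  finally have *: "cmod (F t - F 0) \<le> K / \<eta> * exp (\<mu> * t)" .
  have "cmod (y t) = cmod (F t)" using l by (simp add: F_def norm_mult)
  also have "\<dots> \<le> cmod (F 0) + cmod (F t - F 0)"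
    using norm_triangle_ineq[of "F 0" "F t - F 0"] by simp
  finally show ?thesis using * \<open>0 \<le> t\<close> y l by (simp add: F_def green_def)
qed

text \<open>Growth rates up to \<open>4 \<eta>\<close> will be used, and the distance from a rate to a nonzero real part has to be at
least \<open>\<eta>\<close> in order to give the bound \<open>K / \<eta>\<close> below; \<open>8 \<eta>\<close> leaves ample room.\<close>

definition gap :: "real \<Rightarrow> complex \<Rightarrow> bool" where
  "gap \<eta> l \<longleftrightarrow> 0 < \<eta> \<and> (Re l = 0 \<or> 8 * \<eta> \<le> \<bar>Re l\<bar>)"

text \<open>One constant \<open>1 / \<eta>\<close> for all growth rates \<open>\<mu>\<close> between \<open>\<eta>\<close> and \<open>4 \<eta>\<close>, and for all positions of \<open>l\<close>, is what allows
the same contraction argument to be used in spaces of different growth.\<close>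

lemma green_bound:
  assumes y: "green \<eta> l c f y" and \<mu>: "\<eta> \<le> \<mu>" "\<mu> \<le> 4 * \<eta>" and l: "gap \<eta> l"
    and f: "\<And>t. cmod (f t) \<le> K * exp (\<mu> * \<bar>t\<bar>)"
  shows "cmod (y t) \<le> ((if Re l = 0 then cmod c else 0) + K / \<eta>) * exp (\<mu> * \<bar>t\<bar>)"
proof -
  have K: "0 \<le> K"
    using order_trans[OF norm_ge_zero f[of 0]] by simp
  have \<eta>: "0 < \<eta>" using l by (simp add: gap_def)
  have f': "cmod (- f (- t)) \<le> K * exp (\<mu> * \<bar>t\<bar>)" for t using f[of "- t"] by simp
  note y' = green_reflect[OF y]
  consider "Re l = 0" | "8 * \<eta> \<le> Re l" | "8 * \<eta> \<le> Re (- l)" using l by (auto simp: gap_def abs_if split: if_splits)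
  then show ?thesis
  proof cases
    case 1
    have "cmod (y t) \<le> cmod c + K / \<eta> * exp (\<mu> * \<bar>t\<bar>)"
    proof (cases "0 \<le> t")
      case True then show ?thesis using green_bound_center_pos[OF y \<eta> \<mu>(1) 1 f] by simp
    next
      case False then show ?thesis
        using green_bound_center_pos[OF y' \<eta> \<mu>(1) _ f', of "- t"] 1 by simp
    qed
    moreover have "cmod c * 1 \<le> cmod c * exp (\<mu> * \<bar>t\<bar>)" using \<eta> \<mu> by (intro mult_left_mono) auto
    ultimately show ?thesis using 1 by (simp add: algebra_simps)
  next
    case 2
    then show ?thesis using green_bound_unstable[OF y \<eta> \<mu> 2 f, of t] \<eta> by auto
  next
    case 3
    then show ?thesis using green_bound_unstable[OF y' \<eta> \<mu> 3 f', of "- t"] \<eta> by auto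
  qed
qed

text \<open>The solution is \<open>e\<^sup>l\<^sup>t (F(t) - lim F)\<close> for an antiderivative \<open>F\<close> of \<open>e\<^sup>-\<^sup>l\<^sup>s f(s)\<close>, whose limit at \<open>+\<infinity>\<close> exists
by the tail bound.\<close>

lemma green_exists_unstable:
  assumes \<mu>: "0 < \<eta>" "\<eta> \<le> \<mu>" "\<mu> \<le> 4 * \<eta>" and l: "8 * \<eta> \<le> Re l"
    and cont: "continuous_on UNIV f" and f: "\<And>t. cmod (f t) \<le> K * exp (\<mu> * \<bar>t\<bar>)"
  shows "\<exists>y. green \<eta> l c f y"
proof -
  have K: "0 \<le> K"
    using order_trans[OF norm_ge_zero f[of 0]] by simp
  have "\<exists>F. \<forall>t. -\<infinity> < ereal t \<longrightarrow> ereal t < \<infinity> \<longrightarrow> (F has_vector_derivative exp (- l * of_real t) * f t) (at t)"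
    by (rule einterval_antiderivative)
      (use cont in \<open>auto simp: continuous_on_eq_continuous_at intro!: continuous_intros\<close>)
  then obtain F where F: "\<And>t. (F has_vector_derivative exp (- l * of_real t) * f t) (at t)" by auto
  have d: "cmod (exp (- l * of_real s) * f s) \<le> K * exp (- Re l * s) * exp (\<mu> * \<bar>s\<bar>)" for s
    using mult_left_mono[OF f[of s], of "exp (- Re l * s)"] by (simp add: norm_mult algebra_simps)
  have tail: "cmod (F b - F t) \<le> K / (Re l - \<mu>) * exp (\<mu> * \<bar>t\<bar> - Re l * t)" if "t \<le> b" for b t
    using exp_tail_bound[OF F _ _ d that] \<mu> l by auto
  have dec: "(\<lambda>n. K / (Re l - \<mu>) * exp (4 * \<eta> * real n) * exp (- Re l * real n)) \<longlonglongrightarrow> 0"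
    using weighted_decay[OF \<mu>(1) l] .
  have "Cauchy (\<lambda>n. F (real n))"
  proof (rule metric_CauchyI)
    fix e :: real assume "0 < e"
    have "\<forall>\<^sub>F n in sequentially. K / (Re l - \<mu>) * exp (4 * \<eta> * real n) * exp (- Re l * real n) < e / 2"
      using order_tendstoD(2)[OF dec, of "e/2"] \<open>0 < e\<close> by simp
    then obtain N where N: "K / (Re l - \<mu>) * exp (4 * \<eta> * real N) * exp (- Re l * real N) < e / 2"
      by (auto simp: eventually_sequentially)
    have *: "cmod (F (real n) - F (real N)) < e / 2" if "n \<ge> N" for n
    proof -
      have "cmod (F (real n) - F (real N)) \<le> K / (Re l - \<mu>) * exp (\<mu> * real N - Re l * real N)"
        using tail[of "real N" "real n"] that by simp
      also have "\<dots> \<le> K / (Re l - \<mu>) * exp (4 * \<eta> * real N - Re l * real N)"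
        using K \<mu> l by (intro mult_left_mono) (auto intro!: mult_right_mono)
      also have "\<dots> < e / 2" using N by (simp add: mult.assoc algebra_simps flip: exp_add)
      finally show ?thesis .
    qed
    have "dist (F (real m)) (F (real n)) < e" if "m \<ge> N" "n \<ge> N" for m n
      using dist_triangle_half_l[of "F (real m)" "F (real N)" e "F (real n)"] *[OF that(1)] *[OF that(2)]
      by (simp add: dist_norm)
    then show "\<exists>M. \<forall>m\<ge>M. \<forall>n\<ge>M. dist (F (real m)) (F (real n)) < e" by blast
  qed
  then obtain L where L: "(\<lambda>n. F (real n)) \<longlonglongrightarrow> L" using Cauchy_convergent convergent_def by blast
  have tL: "cmod (L - F t) \<le> K / (Re l - \<mu>) * exp (\<mu> * \<bar>t\<bar> - Re l * t)" for t
  proof (rule tendsto_upperbound)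
    show "(\<lambda>n. cmod (F (real n) - F t)) \<longlonglongrightarrow> cmod (L - F t)" using L by (intro tendsto_intros)
    show "\<forall>\<^sub>F n in sequentially. cmod (F (real n) - F t) \<le> K / (Re l - \<mu>) * exp (\<mu> * \<bar>t\<bar> - Re l * t)"
      using eventually_ge_at_top[of "nat \<lceil>t\<rceil>"]
    proof eventually_elim
      case (elim n)
      then have "t \<le> real n" by linarith
      then show ?case by (rule tail)
    qed
  qed auto
  define y where "y = (\<lambda>t. exp (l * of_real t) * (F t - L))"
  have "cmod (y t) \<le> K / (Re l - \<mu>) * exp (4 * \<eta> * \<bar>t\<bar>)" for t
  proof -
    have "cmod (y t) = exp (Re l * t) * cmod (L - F t)"
      by (simp add: y_def norm_mult norm_minus_commute)
    also have "\<dots> \<le> exp (Re l * t) * (K / (Re l - \<mu>) * exp (\<mu> * \<bar>t\<bar> - Re l * t))"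
      by (intro mult_left_mono tL) auto
    also have "\<dots> = K / (Re l - \<mu>) * (exp (Re l * t) * exp (\<mu> * \<bar>t\<bar> - Re l * t))" by (simp add: mult_ac)
    also have "\<dots> = K / (Re l - \<mu>) * exp (\<mu> * \<bar>t\<bar>)" by (simp flip: exp_add)
    also have "\<dots> \<le> K / (Re l - \<mu>) * exp (4 * \<eta> * \<bar>t\<bar>)"
      using K \<mu> l by (intro mult_left_mono) (auto intro!: mult_right_mono)
    finally show ?thesis .
  qed
  moreover have "(y has_vector_derivative l * y t + f t) (at t)" for t
    unfolding y_def by (rule folded_derivative[where f = f, OF F])
  ultimately have "green \<eta> l c f y" using \<mu> l unfolding green_def
    by (auto intro!: exI[of _ "K / (Re l - \<mu>)"])
  then show ?thesis by blast
qed

text \<open>On the imaginary axis \<open>\<bar>e\<^sup>l\<^sup>t\<bar> = 1\<close>, so every solution grows no faster than the integral of \<open>f\<close>.\<close>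

lemma green_exists_center:
  assumes \<mu>: "0 < \<eta>" "\<eta> \<le> \<mu>" "\<mu> \<le> 4 * \<eta>" and l: "Re l = 0"
    and cont: "continuous_on UNIV f" and f: "\<And>t. cmod (f t) \<le> K * exp (\<mu> * \<bar>t\<bar>)"
  shows "\<exists>y. green \<eta> l c f y"
proof -
  have K: "0 \<le> K"
    using order_trans[OF norm_ge_zero f[of 0]] by simp
  have "\<exists>F. \<forall>t. -\<infinity> < ereal t \<longrightarrow> ereal t < \<infinity> \<longrightarrow> (F has_vector_derivative exp (- l * of_real t) * f t) (at t)"
    by (rule einterval_antiderivative)
      (use cont in \<open>auto simp: continuous_on_eq_continuous_at intro!: continuous_intros\<close>)
  then obtain F where F: "\<And>t. (F has_vector_derivative exp (- l * of_real t) * f t) (at t)" by auto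
  define y where "y = (\<lambda>t. exp (l * of_real t) * (F t - (F 0 - c)))"
  have y': "(y has_vector_derivative l * y t + f t) (at t)" for t
    unfolding y_def by (rule folded_derivative[where f = f, OF F])
  have d: "cmod (exp (- l * of_real s) * f s) \<le> K * exp (4 * \<eta> * \<bar>s\<bar>)" for s
  proof -
    have "cmod (exp (- l * of_real s) * f s) \<le> K * exp (\<mu> * \<bar>s\<bar>)"
      using f[of s] l by (simp add: norm_mult)
    also have "\<dots> \<le> K * exp (4 * \<eta> * \<bar>s\<bar>)"
      using K \<mu> by (intro mult_left_mono) (auto intro!: mult_right_mono)
    finally show ?thesis .
  qed
  have *: "cmod (F t - F 0) \<le> K / (4*\<eta>) * exp (4 * \<eta> * \<bar>t\<bar>)" for t
  proof (cases "0 \<le> t")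
    case True
    have "cmod (F t - F 0) \<le> K / (4*\<eta>) * exp (4 * \<eta> * t) - K / (4*\<eta>) * exp (4 * \<eta> * 0)"
    proof (rule increment_bound[OF True F])
      fix s show "((\<lambda>s. K / (4*\<eta>) * exp (4*\<eta> * s)) has_real_derivative K * exp (4*\<eta> * s)) (at s)"
        using \<mu> by (auto intro!: derivative_eq_intros simp: field_simps)
      show "cmod (exp (- l * of_real s) * f s) \<le> K * exp (4*\<eta> * s)" if "0 < s" for s
        using d[of s] that by simp
    qed
    then show ?thesis using True K \<mu> by (simp add: order_trans)
  next
    case False
    have "cmod (F 0 - F t) \<le> - (K / (4*\<eta>) * exp (- (4 * \<eta>) * 0)) - - (K / (4*\<eta>) * exp (- (4 * \<eta>) * t))"
    proof (rule increment_bound[OF _ F])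
      fix s show "((\<lambda>s. - (K / (4*\<eta>) * exp (- (4 * \<eta>) * s))) has_real_derivative K * exp (- (4*\<eta>) * s)) (at s)"
        using \<mu> by (auto intro!: derivative_eq_intros simp: field_simps)
      show "cmod (exp (- l * of_real s) * f s) \<le> K * exp (- (4*\<eta>) * s)" if "s < 0" for s
        using d[of s] that by simp
    qed (use False in auto)
    then show ?thesis using False K \<mu> by (simp add: order_trans norm_minus_commute)
  qed
  have "cmod (y t) \<le> (K / (4*\<eta>) + cmod c) * exp (4 * \<eta> * \<bar>t\<bar>)" for t
  proof -
    have "cmod (y t) = cmod (F t - F 0 + c)" using l by (simp add: y_def norm_mult diff_diff_eq2 add.commute add_diff_eq)
    also have "\<dots> \<le> cmod (F t - F 0) + cmod c" by (rule norm_triangle_ineq)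
    also have "\<dots> \<le> K / (4*\<eta>) * exp (4 * \<eta> * \<bar>t\<bar>) + cmod c * exp (4 * \<eta> * \<bar>t\<bar>)"
    proof (rule add_mono[OF *])
      show "cmod c \<le> cmod c * exp (4 * \<eta> * \<bar>t\<bar>)"
        using mult_left_mono[of 1 "exp (4 * \<eta> * \<bar>t\<bar>)" "cmod c"] \<mu> by simp
    qed
    finally show ?thesis by (simp add: algebra_simps)
  qed
  then have "green \<eta> l c f y" using y' unfolding green_def by (auto simp: y_def)
  then show ?thesis by blast
qed

lemma green_exists:
  assumes l: "gap \<eta> l" and \<mu>: "\<eta> \<le> \<mu>" "\<mu> \<le> 4 * \<eta>"
    and cont: "continuous_on UNIV f" and f: "\<And>t. cmod (f t) \<le> K * exp (\<mu> * \<bar>t\<bar>)"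
  shows "\<exists>y. green \<eta> l c f y"
proof -
  have \<eta>: "0 < \<eta>" using l by (simp add: gap_def)
  consider "Re l = 0" | "8 * \<eta> \<le> Re l" | "8 * \<eta> \<le> Re (- l)" using l by (auto simp: gap_def abs_if split: if_splits)
  then show ?thesis
  proof cases
    case 1 then show ?thesis using green_exists_center[OF \<eta> \<mu> 1 cont f] by blast
  next
    case 2 then show ?thesis using green_exists_unstable[OF \<eta> \<mu> 2 cont f] by blast
  next
    case 3
    have "continuous_on UNIV (\<lambda>t. - f (- t))"
      by (intro continuous_intros continuous_on_compose2[OF cont]) auto
    moreover have "cmod (- f (- t)) \<le> K * exp (\<mu> * \<bar>t\<bar>)" for t using f[of "- t"] by simp
    ultimately obtain y where "green \<eta> (- l) c (\<lambda>t. - f (- t)) y"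
      using green_exists_unstable[OF \<eta> \<mu> 3] by blast
    from green_reflect[OF this] show ?thesis by auto
  qed
qed

lemma green_lincomb:
  assumes "green \<eta> l c f y" "green \<eta> l c' f' y'"
  shows "green \<eta> l (a * c + b * c') (\<lambda>t. a * f t + b * f' t) (\<lambda>t. a * y t + b * y' t)"
proof -
  from assms obtain C C' where C: "\<And>t. cmod (y t) \<le> C * exp (4 * \<eta> * \<bar>t\<bar>)"
    "\<And>t. cmod (y' t) \<le> C' * exp (4 * \<eta> * \<bar>t\<bar>)" unfolding green_def by auto
  have "cmod (a * y t + b * y' t) \<le> (cmod a * C + cmod b * C') * exp (4 * \<eta> * \<bar>t\<bar>)" for t
  proof -
    have "cmod (a * y t + b * y' t) \<le> cmod a * cmod (y t) + cmod b * cmod (y' t)"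
      using norm_triangle_ineq[of "a * y t" "b * y' t"] by (simp add: norm_mult)
    also have "\<dots> \<le> cmod a * (C * exp (4 * \<eta> * \<bar>t\<bar>)) + cmod b * (C' * exp (4 * \<eta> * \<bar>t\<bar>))"
      using C by (intro add_mono mult_left_mono) auto
    finally show ?thesis by (simp add: algebra_simps)
  qed
  moreover have "((\<lambda>t. a * y t + b * y' t) has_vector_derivative
      l * (a * y t + b * y' t) + (a * f t + b * f' t)) (at t)" for t
    using assms unfolding green_def
    by (auto intro!: derivative_eq_intros simp: algebra_simps)
  ultimately show ?thesis using assms unfolding green_def by auto
qed

lemma green_continuous:
  assumes "green \<eta> l c f y" shows "continuous_on UNIV y"
  using assms unfolding green_def
  by (auto simp: continuous_on_eq_continuous_at intro: has_vector_derivative_continuous)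

section \<open>Diagonal systems with a spectral gap\<close>

definition nrm :: "nat \<Rightarrow> (nat \<Rightarrow> complex) \<Rightarrow> real" where
  "nrm n z = (\<Sum>i<n. cmod (z i))"

lemma nrm_nonneg [simp]: "0 \<le> nrm n z"
  by (simp add: nrm_def sum_nonneg)

lemma nrm_zero [simp]: "nrm n (\<lambda>i. 0) = 0"
  by (simp add: nrm_def)

lemma cmod_le_nrm: "i < n \<Longrightarrow> cmod (z i) \<le> nrm n z"
  unfolding nrm_def by (rule member_le_sum) auto

lemma nrm_le: "(\<And>i. i < n \<Longrightarrow> cmod (z i) \<le> B) \<Longrightarrow> nrm n z \<le> real n * B"
  unfolding nrm_def using sum_bounded_above[of "{..<n}" "\<lambda>i. cmod (z i)" B] by simp

lemma nrm_scale: "nrm n (\<lambda>i. a * z i) = cmod a * nrm n z"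
  by (simp add: nrm_def norm_mult sum_distrib_left)

text \<open>A diagonal linear part with eigenvalues \<open>lam i\<close>, each on the imaginary axis or away from it.\<close>

locale gapped =
  fixes n :: nat and lam :: "nat \<Rightarrow> complex" and \<eta> :: real
  assumes gap: "\<And>i. i < n \<Longrightarrow> gap \<eta> (lam i)" and eta: "0 < \<eta>"
begin

definition growth :: "real \<Rightarrow> real \<Rightarrow> (real \<Rightarrow> nat \<Rightarrow> complex) \<Rightarrow> bool" where
  "growth \<mu> C u \<longleftrightarrow> (\<forall>t. \<forall>i<n. cmod (u t i) \<le> C * exp (\<mu> * \<bar>t\<bar>))"

definition response ::
  "(nat \<Rightarrow> complex) \<Rightarrow> (real \<Rightarrow> nat \<Rightarrow> complex) \<Rightarrow> (real \<Rightarrow> nat \<Rightarrow> complex) \<Rightarrow> bool" where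
  "response c f u \<longleftrightarrow> (\<forall>i<n. green \<eta> (lam i) (c i) (\<lambda>t. f t i) (\<lambda>t. u t i))"

lemma growthI: "(\<And>t i. i < n \<Longrightarrow> cmod (u t i) \<le> C * exp (\<mu> * \<bar>t\<bar>)) \<Longrightarrow> growth \<mu> C u"
  by (simp add: growth_def)

lemma growthD: "growth \<mu> C u \<Longrightarrow> i < n \<Longrightarrow> cmod (u t i) \<le> C * exp (\<mu> * \<bar>t\<bar>)"
  by (simp add: growth_def)

lemma growth_nonneg:
  assumes "growth \<mu> C u" "i < n" shows "0 \<le> C"
  using order_trans[OF norm_ge_zero growthD[OF assms, of 0]] by simp

lemma growth_mono:
  assumes "growth \<mu> C u" "C \<le> C'" shows "growth \<mu> C' u"
  using assms unfolding growth_def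
  by (meson dual_order.trans exp_ge_zero mult_right_mono)

lemma growth_weight_mono:
  assumes "growth \<mu> C u" "\<mu> \<le> \<mu>'" shows "growth \<mu>' C u"
proof (rule growthI)
  fix t i assume i: "i < n"
  have "cmod (u t i) \<le> C * exp (\<mu> * \<bar>t\<bar>)" using growthD[OF assms(1) i] .
  also have "\<dots> \<le> C * exp (\<mu>' * \<bar>t\<bar>)"
    using growth_nonneg[OF assms(1) i] assms(2) by (auto intro!: mult_left_mono mult_right_mono)
  finally show "cmod (u t i) \<le> C * exp (\<mu>' * \<bar>t\<bar>)" .
qed

lemma growth_nrm: "growth \<mu> C u \<Longrightarrow> nrm n (u t) \<le> real n * C * exp (\<mu> * \<bar>t\<bar>)"
  using nrm_le[of n "u t" "C * exp (\<mu> * \<bar>t\<bar>)"] by (simp add: growth_def mult.assoc)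

lemma growth_diff:
  assumes "growth \<mu> C u" "growth \<mu> C' u'" shows "growth \<mu> (C + C') (\<lambda>t i. u t i - u' t i)"
proof (rule growthI)
  fix t i assume i: "i < n"
  show "cmod (u t i - u' t i) \<le> (C + C') * exp (\<mu> * \<bar>t\<bar>)"
    using norm_triangle_ineq4[of "u t i" "u' t i"] growthD[OF assms(1) i, of t] growthD[OF assms(2) i, of t]
    by (simp add: algebra_simps)
qed

lemma response_bound:
  assumes "response c f u" "\<eta> \<le> \<mu>" "\<mu> \<le> 4 * \<eta>" "growth \<mu> K f"
    and c: "\<And>i. i < n \<Longrightarrow> Re (lam i) = 0 \<Longrightarrow> cmod (c i) \<le> c0" and "0 \<le> c0"
  shows "growth \<mu> (c0 + K / \<eta>) u"
proof (rule growthI)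
  fix t i assume i: "i < n"
  have "cmod (u t i) \<le> ((if Re (lam i) = 0 then cmod (c i) else 0) + K / \<eta>) * exp (\<mu> * \<bar>t\<bar>)"
    using assms i unfolding response_def growth_def
    by (intro green_bound[OF _ _ _ gap[OF i], where f = "\<lambda>t. f t i"]) auto
  also have "\<dots> \<le> (c0 + K / \<eta>) * exp (\<mu> * \<bar>t\<bar>)"
    using c[OF i] \<open>0 \<le> c0\<close> by (intro mult_right_mono) auto
  finally show "cmod (u t i) \<le> (c0 + K / \<eta>) * exp (\<mu> * \<bar>t\<bar>)" .
qed

lemma response_exists:
  assumes "\<eta> \<le> \<mu>" "\<mu> \<le> 4 * \<eta>" "growth \<mu> K f"
    and "\<And>i. i < n \<Longrightarrow> continuous_on UNIV (\<lambda>t. f t i)"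
  shows "\<exists>u. response c f u"
proof -
  have "\<forall>i. \<exists>y. i < n \<longrightarrow> green \<eta> (lam i) (c i) (\<lambda>t. f t i) y"
    using green_exists[OF gap assms(1,2)] assms(3,4) unfolding growth_def by meson
  then obtain y where "\<And>i. i < n \<Longrightarrow> green \<eta> (lam i) (c i) (\<lambda>t. f t i) (y i)" by metis
  then have "response c f (\<lambda>t i. y i t)" by (simp add: response_def)
  then show ?thesis by blast
qed

lemma response_lincomb:
  assumes "response c f u" "response c' f' u'"
  shows "response (\<lambda>i. a * c i + b * c' i) (\<lambda>t i. a * f t i + b * f' t i) (\<lambda>t i. a * u t i + b * u' t i)"
  using assms green_lincomb unfolding response_def by blast

lemma response_diff:
  assumes "response c f u" "response c' f' u'"
  shows "response (\<lambda>i. c i - c' i) (\<lambda>t i. f t i - f' t i) (\<lambda>t i. u t i - u' t i)"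
  using response_lincomb[OF assms, of 1 "-1"] by simp

lemma response_continuous:
  "response c f u \<Longrightarrow> i < n \<Longrightarrow> continuous_on UNIV (\<lambda>t. u t i)"
  unfolding response_def using green_continuous by blast

text \<open>The a priori estimate behind every comparison below. If the difference \<open>d\<close> of the solutions is bounded by
\<open>B\<close>, then its feedback through the term \<open>\<epsilon> nrm d\<close> contributes at most \<open>B / 2\<close>, since \<open>\<epsilon> n / \<eta> \<le> 1/2\<close>. So the bound
improves to \<open>A + B / 2\<close> with \<open>A = c0 + \<kappa> / \<eta>\<close>, and iteration from \<open>C + C'\<close> leads to \<open>2 A\<close>.\<close>

lemma response_stable:
  assumes u: "response c f u" "growth \<mu> C u" and u': "response c' f' u'" "growth \<mu> C' u'"
    and \<mu>: "\<eta> \<le> \<mu>" "\<mu> \<le> 4 * \<eta>"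
    and c: "\<And>i. i < n \<Longrightarrow> Re (lam i) = 0 \<Longrightarrow> cmod (c i - c' i) \<le> c0" "0 \<le> c0"
    and f: "\<And>t i. i < n \<Longrightarrow>
      cmod (f t i - f' t i) \<le> \<kappa> * exp (\<mu> * \<bar>t\<bar>) + \<epsilon> * nrm n (\<lambda>i. u t i - u' t i)"
    and \<epsilon>: "0 \<le> \<epsilon>" "\<epsilon> * real n \<le> \<eta> / 2" and \<kappa>: "0 \<le> \<kappa>"
  shows "growth \<mu> (2 * (c0 + \<kappa> / \<eta>)) (\<lambda>t i. u t i - u' t i)"
proof -
  define A where "A = c0 + \<kappa> / \<eta>"
  define d where "d = (\<lambda>t i. u t i - u' t i)"
  have A: "0 \<le> A" using c(2) \<kappa> eta by (simp add: A_def)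
  have k: "growth \<mu> (2 * A + (C + C') / 2 ^ k) d" for k
  proof (induction k)
    case 0
    show ?case using growth_mono[OF growth_diff[OF u(2) u'(2)], of "2 * A + (C + C')"] A by (simp add: d_def)
  next
    case (Suc k)
    let ?B = "2 * A + (C + C') / 2 ^ k"
    have "growth \<mu> (\<kappa> + \<epsilon> * real n * ?B) (\<lambda>t i. f t i - f' t i)"
    proof (rule growthI)
      fix t i assume i: "i < n"
      have "cmod (f t i - f' t i) \<le> \<kappa> * exp (\<mu> * \<bar>t\<bar>) + \<epsilon> * nrm n (d t)" using f[OF i] by (simp add: d_def)
      also have "\<dots> \<le> \<kappa> * exp (\<mu> * \<bar>t\<bar>) + \<epsilon> * (real n * ?B * exp (\<mu> * \<bar>t\<bar>))"
        using growth_nrm[OF Suc] \<epsilon> by (intro add_left_mono mult_left_mono) auto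
      finally show "cmod (f t i - f' t i) \<le> (\<kappa> + \<epsilon> * real n * ?B) * exp (\<mu> * \<bar>t\<bar>)"
        by (simp add: algebra_simps)
    qed
    from response_bound[OF response_diff[OF u(1) u'(1)] \<mu> this c]
    have g: "growth \<mu> (c0 + (\<kappa> + \<epsilon> * real n * ?B) / \<eta>) d" by (simp add: d_def)
    show ?case
    proof (cases "n = 0")
      case False
      then have "0 \<le> ?B" using growth_nonneg[OF Suc, of 0] by simp
      then have "\<epsilon> * real n * ?B \<le> \<eta> / 2 * ?B" using \<epsilon> by (intro mult_right_mono)
      then have "(\<kappa> + \<epsilon> * real n * ?B) / \<eta> \<le> (\<kappa> + \<eta> / 2 * ?B) / \<eta>"
        using eta by (intro divide_right_mono) auto
      also have "\<dots> = \<kappa> / \<eta> + ?B / 2" using eta by (simp add: field_simps)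
      finally have "c0 + (\<kappa> + \<epsilon> * real n * ?B) / \<eta> \<le> A + ?B / 2" by (simp add: A_def)
      also have "\<dots> = 2 * A + (C + C') / 2 ^ Suc k" by (simp add: field_simps)
      finally show ?thesis using growth_mono[OF g] by blast
    next
      case True then show ?thesis unfolding growth_def by simp
    qed
  qed
  show ?thesis
  proof (rule growthI)
    fix t i assume i: "i < n"
    have "(\<lambda>k. (2 * A + (C + C') * (1/2) ^ k) * exp (\<mu> * \<bar>t\<bar>)) \<longlonglongrightarrow> (2 * A + (C + C') * 0) * exp (\<mu> * \<bar>t\<bar>)"
      by (intro tendsto_intros LIMSEQ_power_zero) auto
    then have "cmod (d t i) \<le> (2 * A + (C + C') * 0) * exp (\<mu> * \<bar>t\<bar>)"
      using growthD[OF k i, of t] by (intro tendsto_lowerbound) (auto simp: power_divide divide_simps)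
    then show "cmod (u t i - u' t i) \<le> 2 * (c0 + \<kappa> / \<eta>) * exp (\<mu> * \<bar>t\<bar>)"
      by (simp add: d_def A_def)
  qed
qed

text \<open>Contraction principle with weight \<open>e\<^sup>-\<^sup>\<mu>\<^sup>\<bar>\<^sup>t\<^sup>\<bar>\<close>. The iterates \<open>U k\<close> stay below \<open>M\<close> in the
weighted norm and their differences halve in each step, so they converge uniformly after weighting.\<close>

lemma fixed_point_exists:
  assumes \<mu>: "\<eta> \<le> \<mu>" "\<mu> \<le> 4 * \<eta>"
    and cont: "\<And>u i. (\<And>i. i < n \<Longrightarrow> continuous_on UNIV (\<lambda>t. u t i)) \<Longrightarrow> i < n \<Longrightarrow>
          continuous_on UNIV (\<lambda>t. G t (u t) i)"
    and lip: "\<And>t z z' i. i < n \<Longrightarrow> cmod (G t z i - G t z' i) \<le> \<epsilon> * nrm n (\<lambda>i. z i - z' i)"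
    and zero: "growth \<mu> K (\<lambda>t. G t (\<lambda>_. 0))"
    and \<epsilon>: "0 \<le> \<epsilon>" "\<epsilon> * real n \<le> \<eta> / 2"
  shows "\<exists>u C. response c (\<lambda>t. G t (u t)) u \<and> growth \<mu> C u"
proof (cases "n = 0")
  case True
  then have "response c (\<lambda>t. G t (\<lambda>_. 0)) (\<lambda>t _. 0) \<and> growth \<mu> 0 (\<lambda>t _. 0)"
    unfolding response_def growth_def by simp
  then show ?thesis by (intro exI[of _ "\<lambda>t _. 0"] exI[of _ 0])
next
  case False
  then have n: "0 < n" by simp
  have K: "0 \<le> K" using growth_nonneg[OF zero n] .
  define c0 where "c0 = nrm n c"
  \<comment> \<open>The ball of radius \<open>M\<close> is mapped to itself: \<open>c0 + K / \<eta> + M / 2 \<le> M\<close>.\<close>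
  define M where "M = 2 * (c0 + K / \<eta>)"
  have c0: "0 \<le> c0" "cmod (c i) \<le> c0" if "i < n" for i using cmod_le_nrm[OF that] by (auto simp: c0_def)
  have c00: "0 \<le> c0" using c0 n by blast
  have M: "0 \<le> M" using K eta c00 by (simp add: M_def)
  have shrink: "\<epsilon> * real n * B / \<eta> \<le> B / 2" if "0 \<le> B" for B
  proof -
    have "\<epsilon> * real n * B \<le> \<eta> / 2 * B" using \<epsilon> that by (intro mult_right_mono)
    then have "\<epsilon> * real n * B / \<eta> \<le> (\<eta> / 2 * B) / \<eta>" using eta by (intro divide_right_mono) auto
    then show ?thesis using eta by simp
  qed
  have lipg: "growth \<mu> (\<epsilon> * real n * D) (\<lambda>t i. G t (v t) i - G t (v' t) i)"
    if "growth \<mu> D (\<lambda>t i. v t i - v' t i)" for D v v'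
  proof (rule growthI)
    fix t i assume i: "i < n"
    have "cmod (G t (v t) i - G t (v' t) i) \<le> \<epsilon> * nrm n (\<lambda>i. v t i - v' t i)" using lip[OF i] .
    also have "\<dots> \<le> \<epsilon> * (real n * D * exp (\<mu> * \<bar>t\<bar>))"
      using growth_nrm[OF that] \<epsilon> by (intro mult_left_mono) auto
    finally show "cmod (G t (v t) i - G t (v' t) i) \<le> \<epsilon> * real n * D * exp (\<mu> * \<bar>t\<bar>)" by (simp add: mult.assoc)
  qed
  define good where "good v \<longleftrightarrow> growth \<mu> M v \<and> (\<forall>i<n. continuous_on UNIV (\<lambda>t. v t i))" for v
  have Gg: "growth \<mu> (K + \<epsilon> * real n * M) (\<lambda>t. G t (v t))" if "growth \<mu> M v" for v
  proof -
    have "growth \<mu> (\<epsilon> * real n * M) (\<lambda>t i. G t (v t) i - G t (\<lambda>_. 0) i)"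
      using that by (intro lipg) (simp add: growth_def)
    show ?thesis
    proof (rule growthI)
      fix t i assume i: "i < n"
      show "cmod (G t (v t) i) \<le> (K + \<epsilon> * real n * M) * exp (\<mu> * \<bar>t\<bar>)"
        using norm_triangle_ineq[of "G t (v t) i - G t (\<lambda>_. 0) i" "G t (\<lambda>_. 0) i"]
          growthD[OF \<open>growth \<mu> (\<epsilon> * real n * M) _\<close> i, of t] growthD[OF zero i, of t]
        by (simp add: algebra_simps)
    qed
  qed
  have step: "\<exists>u. response c (\<lambda>t. G t (v t)) u \<and> good u" if "good v" for v
  proof -
    from that have v: "growth \<mu> M v" "\<And>i. i < n \<Longrightarrow> continuous_on UNIV (\<lambda>t. v t i)"
      by (auto simp: good_def)
    obtain u where u: "response c (\<lambda>t. G t (v t)) u"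
      using response_exists[OF \<mu> Gg[OF v(1)] cont[OF v(2)], of c] by blast
    have "growth \<mu> (c0 + (K + \<epsilon> * real n * M) / \<eta>) u"
      using that c0 c00 by (intro response_bound[OF u \<mu>] Gg) (auto simp: good_def)
    moreover have "c0 + (K + \<epsilon> * real n * M) / \<eta> \<le> M"
      using shrink[OF M] by (simp add: add_divide_distrib M_def)
    ultimately have "growth \<mu> M u" by (rule growth_mono)
    then show ?thesis using u response_continuous[OF u] by (auto simp: good_def)
  qed
  define U where "U = rec_nat (\<lambda>t i. 0) (\<lambda>k v. SOME u. response c (\<lambda>t. G t (v t)) u \<and> good u)"
  have U0: "U 0 = (\<lambda>t i. 0)" and USuc: "U (Suc k) = (SOME u. response c (\<lambda>t. G t (U k t)) u \<and> good u)" for k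
    by (simp_all add: U_def)
  have good: "good (U k)" for k
  proof (induction k)
    case 0 show ?case using M by (simp add: U0 good_def growth_def)
  next
    case (Suc k) then show ?case unfolding USuc using someI_ex[OF step[OF Suc]] by simp
  qed
  have resp: "response c (\<lambda>t. G t (U k t)) (U (Suc k))" for k
    unfolding USuc using someI_ex[OF step[OF good[of k]]] by simp
  have D: "growth \<mu> (2 * M * (1 / 2) ^ k) (\<lambda>t i. U (Suc k) t i - U k t i)" for k
  proof (induction k)
    case 0
    show ?case using growth_diff[of \<mu> M "U (Suc 0)" M "U 0"] good unfolding good_def by simp
  next
    case (Suc k)
    have "growth \<mu> (0 + \<epsilon> * real n * (2 * M * (1 / 2) ^ k) / \<eta>) (\<lambda>t i. U (Suc (Suc k)) t i - U (Suc k) t i)"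
      by (rule response_bound[OF response_diff[OF resp resp] \<mu> lipg[OF Suc]]) auto
    then show ?case
      by (rule growth_mono) (use shrink[of "2 * M * (1 / 2) ^ k"] M in simp)
  qed
  \<comment> \<open>The limit of the weighted iterates, as a telescoping series dominated by a geometric one.\<close>
  define w where "w i t = (\<Sum>k. exp (- \<mu> * \<bar>t\<bar>) * (U (Suc k) t i - U k t i))" for i t
  have lim: "uniform_limit UNIV (\<lambda>k t. exp (- \<mu> * \<bar>t\<bar>) * U k t i) (w i) sequentially" if i: "i < n" for i
  proof -
    have "uniform_limit UNIV (\<lambda>N t. \<Sum>k<N. exp (- \<mu> * \<bar>t\<bar>) * (U (Suc k) t i - U k t i))
        (\<lambda>t. \<Sum>k. exp (- \<mu> * \<bar>t\<bar>) * (U (Suc k) t i - U k t i)) sequentially"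
    proof (rule Weierstrass_m_test)
      show "summable (\<lambda>k. 2 * M * (1 / 2) ^ k :: real)" by (intro summable_mult summable_geometric) auto
      fix k t
      have "exp (- \<mu> * \<bar>t\<bar>) * cmod (U (Suc k) t i - U k t i) \<le> exp (- \<mu> * \<bar>t\<bar>) * (2 * M * (1 / 2) ^ k * exp (\<mu> * \<bar>t\<bar>))"
        using growthD[OF D i] by (intro mult_left_mono) auto
      moreover have "exp (- \<mu> * \<bar>t\<bar>) * (x * exp (\<mu> * \<bar>t\<bar>)) = x" for x
        by (simp add: exp_minus)
      ultimately show "cmod (exp (- \<mu> * \<bar>t\<bar>) * (U (Suc k) t i - U k t i)) \<le> 2 * M * (1 / 2) ^ k"
        by (simp only: norm_mult norm_of_real abs_exp_cancel)
    qed
    moreover have "(\<Sum>k<N. exp (- \<mu> * \<bar>t\<bar>) * (U (Suc k) t i - U k t i)) = exp (- \<mu> * \<bar>t\<bar>) * U N t i" for N t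
      using sum_lessThan_telescope[of "\<lambda>k. U k t i" N]
      by (simp add: sum_distrib_left[symmetric] U0)
    ultimately show ?thesis by (simp add: w_def[abs_def])
  qed
  define u where "u t i = exp (\<mu> * \<bar>t\<bar>) * w i t" for t i
  have u_cont: "continuous_on UNIV (\<lambda>t. u t i)" if i: "i < n" for i
  proof -
    have "continuous_on UNIV (w i)"
    proof (rule uniform_limit_theorem[OF _ lim[OF i]])
      show "\<forall>\<^sub>F k in sequentially. continuous_on UNIV (\<lambda>t. exp (- \<mu> * \<bar>t\<bar>) * U k t i)"
        using good i by (intro always_eventually allI continuous_intros) (auto simp: good_def)
    qed simp
    then show ?thesis unfolding u_def by (intro continuous_intros)
  qed
  have close: "\<exists>N. \<forall>k\<ge>N. growth \<mu> e (\<lambda>t i. U k t i - u t i)" if "0 < e" for e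
  proof -
    have "\<forall>\<^sub>F k in sequentially. \<forall>i\<in>{..<n}. \<forall>t\<in>UNIV. dist (exp (- \<mu> * \<bar>t\<bar>) * U k t i) (w i t) < e"
    proof (rule eventually_ball_finite)
      show "\<forall>i\<in>{..<n}. \<forall>\<^sub>F k in sequentially. \<forall>t\<in>UNIV. dist (exp (- \<mu> * \<bar>t\<bar>) * U k t i) (w i t) < e"
        using lim that unfolding uniform_limit_iff by blast
    qed simp
    then obtain N where N: "\<And>k i t. k \<ge> N \<Longrightarrow> i < n \<Longrightarrow> dist (exp (- \<mu> * \<bar>t\<bar>) * U k t i) (w i t) < e"
      unfolding eventually_sequentially by blast
    have "growth \<mu> e (\<lambda>t i. U k t i - u t i)" if "k \<ge> N" for k
    proof (rule growthI)
      fix t i assume i: "i < n"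
      have "U k t i = exp (\<mu> * \<bar>t\<bar>) * (exp (- \<mu> * \<bar>t\<bar>) * U k t i)"
        by (simp flip: mult.assoc of_real_mult exp_add)
      then have "U k t i - u t i = exp (\<mu> * \<bar>t\<bar>) * (exp (- \<mu> * \<bar>t\<bar>) * U k t i - w i t)"
        unfolding u_def right_diff_distrib by (rule arg_cong)
      then have "cmod (U k t i - u t i) = exp (\<mu> * \<bar>t\<bar>) * cmod (exp (- \<mu> * \<bar>t\<bar>) * U k t i - w i t)"
        by (simp add: norm_mult)
      also have "\<dots> \<le> exp (\<mu> * \<bar>t\<bar>) * e"
        using N[OF that i, of t] by (intro mult_left_mono) (auto simp: dist_norm)
      finally show "cmod (U k t i - u t i) \<le> e * exp (\<mu> * \<bar>t\<bar>)" by (simp add: mult.commute)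
    qed
    then show ?thesis by blast
  qed
  have gu: "growth \<mu> (M + 1) u"
  proof -
    obtain k where "growth \<mu> 1 (\<lambda>t i. U k t i - u t i)" using close[of 1] by auto
    then have "growth \<mu> (M + 1) (\<lambda>t i. U k t i - (U k t i - u t i))"
      using good by (intro growth_diff) (auto simp: good_def)
    then show ?thesis by simp
  qed
  have "growth \<mu> (K + \<epsilon> * real n * (M + 1)) (\<lambda>t. G t (u t))"
  proof (rule growthI)
    fix t i assume i: "i < n"
    have "growth \<mu> (\<epsilon> * real n * (M + 1)) (\<lambda>t i. G t (u t) i - G t (\<lambda>_. 0) i)"
      using gu by (intro lipg) (simp add: growth_def)
    from growthD[OF this i, of t] show "cmod (G t (u t) i) \<le> (K + \<epsilon> * real n * (M + 1)) * exp (\<mu> * \<bar>t\<bar>)"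
      using norm_triangle_ineq[of "G t (u t) i - G t (\<lambda>_. 0) i" "G t (\<lambda>_. 0) i"]
          growthD[OF zero i, of t]
      by (simp add: algebra_simps)
  qed
  \<comment> \<open>The limit \<open>u\<close> is a fixed point: the response \<open>v\<close> to \<open>G t (u t)\<close> exists and is a limit of the same iterates.\<close>
  from response_exists[OF \<mu> this cont[OF u_cont], of c]
  obtain v where v: "response c (\<lambda>t. G t (u t)) v" by blast
  have "v t i = u t i" if i: "i < n" for t i
  proof -
    have "cmod (v t i - u t i) \<le> 0 + e" if "0 < e" for e
    proof -
      define e' where "e' = e / (2 * exp (\<mu> * \<bar>t\<bar>))"
      have e': "0 < e'" using that by (simp add: e'_def)
      then obtain N where N: "\<And>k. k \<ge> N \<Longrightarrow> growth \<mu> e' (\<lambda>t i. U k t i - u t i)" using close by blast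
      have "growth \<mu> (0 + \<epsilon> * real n * e' / \<eta>) (\<lambda>t i. U (Suc N) t i - v t i)"
        by (rule response_bound[OF response_diff[OF resp v] \<mu> lipg[OF N]]) auto
      moreover have "0 + \<epsilon> * real n * e' / \<eta> \<le> e'" using shrink[of e'] e' by linarith
      ultimately have "growth \<mu> e' (\<lambda>t i. U (Suc N) t i - v t i)" by (rule growth_mono)
      from growthD[OF this i, of t]
      have "cmod (U (Suc N) t i - v t i) \<le> e' * exp (\<mu> * \<bar>t\<bar>)" by simp
      moreover have "cmod (U (Suc N) t i - u t i) \<le> e' * exp (\<mu> * \<bar>t\<bar>)"
        using growthD[OF N i, of "Suc N"] by simp
      ultimately have "cmod (v t i - u t i) \<le> 2 * (e' * exp (\<mu> * \<bar>t\<bar>))"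
        using norm_triangle_ineq4[of "U (Suc N) t i - u t i" "U (Suc N) t i - v t i"] by simp
      then show ?thesis by (simp add: e'_def)
    qed
    then have "cmod (v t i - u t i) \<le> 0" by (rule field_le_epsilon)
    then show ?thesis by simp
  qed
  then have "(\<lambda>t. v t i) = (\<lambda>t. u t i)" if "i < n" for i using that by auto
  with v have "response c (\<lambda>t. G t (u t)) u" by (simp add: response_def)
  then show ?thesis using gu by blast
qed

end

section \<open>Dependence of slowly growing solutions on their centre data\<close>

lemma cmod_triangle: "cmod (a - c) \<le> cmod (a - b) + cmod (b - c)"
  using dist_triangle[of a c b] by (simp add: dist_norm)

lemma cmod_triangle3: "cmod (a - d) \<le> cmod (a - b) + cmod (b - c) + cmod (c - d)"
  using cmod_triangle[of a d b] cmod_triangle[of b d c] by linarith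

lemma small_factor:
  fixes X r :: real
  assumes "0 \<le> X" "0 < r" shows "\<exists>r'>0. r' * X \<le> r"
proof (intro exI conjI)
  show "0 < r / (X + 1)" using assms by simp
  have "r / (X + 1) * X \<le> r / (X + 1) * (X + 1)" using assms by (intro mult_left_mono) auto
  then show "r / (X + 1) * X \<le> r" using assms by simp
qed

text \<open>A globally small \<open>C\<^sup>2\<close> perturbation \<open>g\<close> of the diagonal part, with first and second derivatives \<open>g1\<close> and \<open>g2\<close>. The
vectors are complex but the field is only real differentiable, so linearity of \<open>g1\<close> and \<open>g2\<close> is required for
real scalars only. Continuity of the second derivative is expressed by the affine modulus \<open>e + K \<delta>\<close>, \<open>e\<close>
arbitrarily small: it needs no case distinction between small and large \<open>\<delta>\<close>, which matters because \<open>\<delta>\<close> will be a distance of two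
solutions that grow with time.\<close>

locale perturbed = gapped +
  fixes \<epsilon> M :: real
    and g :: "(nat \<Rightarrow> complex) \<Rightarrow> nat \<Rightarrow> complex"
    and g1 :: "(nat \<Rightarrow> complex) \<Rightarrow> (nat \<Rightarrow> complex) \<Rightarrow> nat \<Rightarrow> complex"
    and g2 :: "(nat \<Rightarrow> complex) \<Rightarrow> (nat \<Rightarrow> complex) \<Rightarrow> (nat \<Rightarrow> complex) \<Rightarrow> nat \<Rightarrow> complex"
  assumes eps: "0 \<le> \<epsilon>" "\<epsilon> * real n \<le> \<eta> / 2" and M: "0 \<le> M"
    and g_zero: "\<And>i. i < n \<Longrightarrow> g (\<lambda>_. 0) i = 0"
    and g_lip: "\<And>z z' i. i < n \<Longrightarrow> cmod (g z' i - g z i) \<le> \<epsilon> * nrm n (\<lambda>i. z' i - z i)"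
    and g_deriv: "\<And>z z' i. i < n \<Longrightarrow> cmod (g z' i - g z i - g1 z (\<lambda>i. z' i - z i) i) \<le> M * (nrm n (\<lambda>i. z' i - z i))\<^sup>2"
    and g1_diff: "\<And>z v v' i. i < n \<Longrightarrow> g1 z (\<lambda>i. v' i - v i) i = g1 z v' i - g1 z v i"
    and g1_scale: "\<And>z v a i. i < n \<Longrightarrow> g1 z (\<lambda>i. of_real a * v i) i = of_real a * g1 z v i"
    and g1_bound: "\<And>z v i. i < n \<Longrightarrow> cmod (g1 z v i) \<le> \<epsilon> * nrm n v"
    and g1_lip: "\<And>z z' v i. i < n \<Longrightarrow> cmod (g1 z' v i - g1 z v i) \<le> M * nrm n (\<lambda>i. z' i - z i) * nrm n v"
    and g1_deriv: "\<And>e. 0 < e \<Longrightarrow> \<exists>K\<ge>0. \<forall>z z' v. \<forall>i<n.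
          cmod (g1 z' v i - g1 z v i - g2 z (\<lambda>i. z' i - z i) v i)
            \<le> (e + K * nrm n (\<lambda>i. z' i - z i)) * nrm n (\<lambda>i. z' i - z i) * nrm n v"
    and g2_diff_left: "\<And>z v v' w i. i < n \<Longrightarrow> g2 z (\<lambda>i. v' i - v i) w i = g2 z v' w i - g2 z v w i"
    and g2_diff_right: "\<And>z v w w' i. i < n \<Longrightarrow> g2 z v (\<lambda>i. w' i - w i) i = g2 z v w' i - g2 z v w i"
    and g2_scale_left: "\<And>z v w a i. i < n \<Longrightarrow> g2 z (\<lambda>i. of_real a * v i) w i = of_real a * g2 z v w i"
    and g2_bound: "\<And>z v w i. i < n \<Longrightarrow> cmod (g2 z v w i) \<le> M * nrm n v * nrm n w"
    and g2_cont: "\<And>e. 0 < e \<Longrightarrow> \<exists>K\<ge>0. \<forall>z z' v w. \<forall>i<n.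
          cmod (g2 z' v w i - g2 z v w i) \<le> (e + K * nrm n (\<lambda>i. z' i - z i)) * nrm n v * nrm n w"
begin

lemma tendsto_nrm_diff:
  assumes "\<And>i. i < n \<Longrightarrow> continuous_on UNIV (\<lambda>t :: real. p t i)"
  shows "((\<lambda>t. nrm n (\<lambda>i. p t i - p s i)) \<longlongrightarrow> 0) (at s)"
proof -
  have "((\<lambda>t. \<Sum>i<n. cmod (p t i - p s i)) \<longlongrightarrow> (\<Sum>i<n. cmod (p s i - p s i))) (at s)"
    using assms by (intro tendsto_intros) (auto simp: continuous_on_def)
  then show ?thesis by (simp add: nrm_def)
qed

lemma tendsto_nrm:
  assumes "\<And>i. i < n \<Longrightarrow> continuous_on UNIV (\<lambda>t :: real. p t i)"
  shows "((\<lambda>t. nrm n (p t)) \<longlongrightarrow> nrm n (p s)) (at s)"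
  using assms unfolding nrm_def by (intro tendsto_intros) (auto simp: continuous_on_def)

lemma continuous_g:
  assumes p: "\<And>i. i < n \<Longrightarrow> continuous_on UNIV (\<lambda>t :: real. p t i)" and i: "i < n"
  shows "continuous_on UNIV (\<lambda>t. g (p t) i)"
  unfolding continuous_on_def
proof
  fix s
  have "\<forall>\<^sub>F t in at s. cmod (g (p t) i - g (p s) i) \<le> \<epsilon> * nrm n (\<lambda>i. p t i - p s i)"
    by (intro always_eventually allI g_lip[OF i])
  from Lim_null_comparison[OF this tendsto_mult_right_zero[OF tendsto_nrm_diff[OF p]]]
  have "((\<lambda>t. g (p t) i - g (p s) i) \<longlongrightarrow> 0) (at s)" .
  then show "((\<lambda>t. g (p t) i) \<longlongrightarrow> g (p s) i) (at s)" by (rule LIM_zero_cancel)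
qed

lemma continuous_g1:
  assumes p: "\<And>i. i < n \<Longrightarrow> continuous_on UNIV (\<lambda>t :: real. p t i)"
    and v: "\<And>i. i < n \<Longrightarrow> continuous_on UNIV (\<lambda>t. v t i)" and i: "i < n"
  shows "continuous_on UNIV (\<lambda>t. g1 (p t) (v t) i)"
  unfolding continuous_on_def
proof
  fix s
  have L: "((\<lambda>t. M * nrm n (\<lambda>i. p t i - p s i) * nrm n (v t) + \<epsilon> * nrm n (\<lambda>i. v t i - v s i)) \<longlongrightarrow> 0) (at s)"
    using tendsto_add[OF tendsto_mult[OF tendsto_mult_right_zero[OF tendsto_nrm_diff[OF p]] tendsto_nrm[OF v]]
        tendsto_mult_right_zero[OF tendsto_nrm_diff[OF v]]]
    by (simp only: mult_zero_left add_0_right)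
  have b: "cmod (g1 (p t) (v t) i - g1 (p s) (v s) i)
      \<le> M * nrm n (\<lambda>i. p t i - p s i) * nrm n (v t) + \<epsilon> * nrm n (\<lambda>i. v t i - v s i)" for t
  proof -
    have "cmod (g1 (p t) (v t) i - g1 (p s) (v s) i)
        \<le> cmod (g1 (p t) (v t) i - g1 (p s) (v t) i) + cmod (g1 (p s) (v t) i - g1 (p s) (v s) i)"
      by (rule cmod_triangle)
    then show ?thesis
      using g1_lip[OF i, of "p t" "v t" "p s"] g1_bound[OF i, of "p s" "\<lambda>i. v t i - v s i"]
      unfolding g1_diff[OF i] by linarith
  qed
  have "\<forall>\<^sub>F t in at s. cmod (g1 (p t) (v t) i - g1 (p s) (v s) i)
      \<le> M * nrm n (\<lambda>i. p t i - p s i) * nrm n (v t) + \<epsilon> * nrm n (\<lambda>i. v t i - v s i)"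
    by (intro always_eventually allI b)
  from Lim_null_comparison[OF this L]
  have "((\<lambda>t. g1 (p t) (v t) i - g1 (p s) (v s) i) \<longlongrightarrow> 0) (at s)" .
  then show "((\<lambda>t. g1 (p t) (v t) i) \<longlongrightarrow> g1 (p s) (v s) i) (at s)" by (rule LIM_zero_cancel)
qed

lemma continuous_g2:
  assumes p: "\<And>i. i < n \<Longrightarrow> continuous_on UNIV (\<lambda>t :: real. p t i)"
    and v: "\<And>i. i < n \<Longrightarrow> continuous_on UNIV (\<lambda>t. v t i)"
    and w: "\<And>i. i < n \<Longrightarrow> continuous_on UNIV (\<lambda>t. w t i)" and i: "i < n"
  shows "continuous_on UNIV (\<lambda>t. g2 (p t) (v t) (w t) i)"
  unfolding continuous_on_def
proof
  fix s
  show "((\<lambda>t. g2 (p t) (v t) (w t) i) \<longlongrightarrow> g2 (p s) (v s) (w s) i) (at s)"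
    unfolding tendsto_iff dist_norm
  proof (intro allI impI)
    fix r :: real assume r: "0 < r"
    define e where "e = r / (nrm n (v s) * nrm n (w s) + 1)"
    have pos: "0 < nrm n (v s) * nrm n (w s) + 1"
      using mult_nonneg_nonneg[OF nrm_nonneg nrm_nonneg, of n "v s" n "w s"] by linarith
    have "0 < e" using r pos by (simp add: e_def)
    have "e * (nrm n (v s) * nrm n (w s) + 1) = r" using pos by (simp add: e_def)
    with \<open>0 < e\<close> have e: "e * nrm n (v s) * nrm n (w s) < r" by (simp add: algebra_simps)
    obtain K where K0: "0 \<le> K \<and> (\<forall>z z' v w. \<forall>i<n. cmod (g2 z' v w i - g2 z v w i)
        \<le> (e + K * nrm n (\<lambda>i. z' i - z i)) * nrm n v * nrm n w)"
      by (rule exE[OF g2_cont[OF \<open>0 < e\<close>]])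
    have K: "cmod (g2 z' v w i - g2 z v w i)
        \<le> (e + K * nrm n (\<lambda>i. z' i - z i)) * nrm n v * nrm n w" for z z' v w
      by (rule K0[THEN conjunct2, rule_format, OF i])
    have "((\<lambda>t. (e + K * nrm n (\<lambda>i. p t i - p s i)) * nrm n (v t) * nrm n (w t)
        + M * nrm n (\<lambda>i. v t i - v s i) * nrm n (w t) + M * nrm n (v s) * nrm n (\<lambda>i. w t i - w s i))
      \<longlongrightarrow> (e + K * 0) * nrm n (v s) * nrm n (w s) + M * 0 * nrm n (w s) + M * nrm n (v s) * 0) (at s)"
      by (intro tendsto_add tendsto_mult tendsto_const tendsto_nrm_diff[OF p] tendsto_nrm_diff[OF v]
          tendsto_nrm_diff[OF w] tendsto_nrm[OF v] tendsto_nrm[OF w])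
    then have "\<forall>\<^sub>F t in at s. (e + K * nrm n (\<lambda>i. p t i - p s i)) * nrm n (v t) * nrm n (w t)
        + M * nrm n (\<lambda>i. v t i - v s i) * nrm n (w t) + M * nrm n (v s) * nrm n (\<lambda>i. w t i - w s i) < r"
      by (rule order_tendstoD(2)) (use e in \<open>simp only: mult_zero_left mult_zero_right add_0_right\<close>)
    then show "\<forall>\<^sub>F t in at s. cmod (g2 (p t) (v t) (w t) i - g2 (p s) (v s) (w s) i) < r"
    proof eventually_elim
      case (elim t)
      have "cmod (g2 (p t) (v t) (w t) i - g2 (p s) (v s) (w s) i)
         \<le> (e + K * nrm n (\<lambda>i. p t i - p s i)) * nrm n (v t) * nrm n (w t)
        + M * nrm n (\<lambda>i. v t i - v s i) * nrm n (w t) + M * nrm n (v s) * nrm n (\<lambda>i. w t i - w s i)"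
      proof -
        have "cmod (g2 (p t) (v t) (w t) i - g2 (p s) (v s) (w s) i)
          \<le> cmod (g2 (p t) (v t) (w t) i - g2 (p s) (v t) (w t) i) + cmod (g2 (p s) (v t) (w t) i - g2 (p s) (v s) (w t) i)
            + cmod (g2 (p s) (v s) (w t) i - g2 (p s) (v s) (w s) i)"
          by (rule cmod_triangle3)
        then show ?thesis
          using K[of "p t" "v t" "w t" "p s"] g2_bound[OF i, of "p s" "\<lambda>i. v t i - v s i" "w t"]
            g2_bound[OF i, of "p s" "v s" "\<lambda>i. w t i - w s i"]
          unfolding g2_diff_left[OF i] g2_diff_right[OF i] by linarith
      qed
      with elim show ?case by linarith
    qed
  qed
qed

lemma g1_zero: "i < n \<Longrightarrow> g1 z (\<lambda>_. 0) i = 0"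
  using g1_diff[of i z "\<lambda>_. 0" "\<lambda>_. 0"] by simp

text \<open>The slowly growing solution of \<open>z' = lam z + g(z)\<close> with centre data \<open>c\<close>.\<close>

definition \<Psi> :: "(nat \<Rightarrow> complex) \<Rightarrow> real \<Rightarrow> nat \<Rightarrow> complex" where
  "\<Psi> c = (SOME u. response c (\<lambda>t. g (u t)) u \<and> (\<exists>C. growth \<eta> C u))"

text \<open>The derivative of \<open>\<Psi>\<close> at \<open>c\<close> in direction \<open>d\<close>: the equation is the variational equation along \<open>\<Psi> c\<close>.\<close>

definition D :: "(nat \<Rightarrow> complex) \<Rightarrow> (nat \<Rightarrow> complex) \<Rightarrow> real \<Rightarrow> nat \<Rightarrow> complex" where
  "D c d = (SOME v. response d (\<lambda>t. g1 (\<Psi> c t) (v t)) v \<and> (\<exists>C. growth \<eta> C v))"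

text \<open>The second derivative of \<open>\<Psi>\<close> at \<open>c\<close>, from differentiating the variational equation once more. The product of two
first derivatives makes it grow twice as fast.\<close>

definition E :: "(nat \<Rightarrow> complex) \<Rightarrow> (nat \<Rightarrow> complex) \<Rightarrow> (nat \<Rightarrow> complex) \<Rightarrow> real \<Rightarrow> nat \<Rightarrow> complex" where
  "E c d e = (SOME w. response (\<lambda>_. 0) (\<lambda>t i. g1 (\<Psi> c t) (w t) i + g2 (\<Psi> c t) (D c d t) (D c e t) i) w \<and>
     (\<exists>C. growth (2 * \<eta>) C w))"

lemma Psi_ex: "\<exists>u. response c (\<lambda>t. g (u t)) u \<and> (\<exists>C. growth \<eta> C u)"
proof -
  have "\<exists>u C. response c (\<lambda>t. g (u t)) u \<and> growth \<eta> C u"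
  proof (rule fixed_point_exists[where K = 0 and G = "\<lambda>t z. g z", OF _ _ continuous_g g_lip _ eps])
    show "growth \<eta> 0 (\<lambda>t. g (\<lambda>_. 0))" using g_zero by (simp add: growth_def)
  qed (use eta in auto)
  then show ?thesis by (elim exE conjE, intro exI conjI)
qed

lemma Psi_spec: "response c (\<lambda>t. g (\<Psi> c t)) (\<Psi> c) \<and> (\<exists>C. growth \<eta> C (\<Psi> c))"
  unfolding \<Psi>_def using someI_ex[OF Psi_ex[of c]] .

lemmas Psi_response = Psi_spec[THEN conjunct1]
  and Psi_growth = Psi_spec[THEN conjunct2]

lemma Psi_continuous: "i < n \<Longrightarrow> continuous_on UNIV (\<lambda>t. \<Psi> c t i)"
  using response_continuous[OF Psi_response] .

lemma D_ex: "\<exists>v. response d (\<lambda>t. g1 (\<Psi> c t) (v t)) v \<and> (\<exists>C. growth \<eta> C v)"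
proof -
  have "\<exists>v C. response d (\<lambda>t. g1 (\<Psi> c t) (v t)) v \<and> growth \<eta> C v"
  proof (rule fixed_point_exists[where K = 0 and G = "\<lambda>t. g1 (\<Psi> c t)", OF _ _ continuous_g1[OF Psi_continuous] _ _ eps])
    show "cmod (g1 (\<Psi> c t) z i - g1 (\<Psi> c t) z' i) \<le> \<epsilon> * nrm n (\<lambda>i. z i - z' i)" if "i < n" for t z z' i
      using g1_bound[OF that, of "\<Psi> c t" "\<lambda>i. z i - z' i"] by (simp add: g1_diff that)
    show "growth \<eta> 0 (\<lambda>t. g1 (\<Psi> c t) (\<lambda>_. 0))" using g1_zero by (simp add: growth_def)
  qed (use eta in auto)
  then show ?thesis by (elim exE conjE, intro exI conjI)
qed

lemma D_spec: "response d (\<lambda>t. g1 (\<Psi> c t) (D c d t)) (D c d) \<and> (\<exists>C. growth \<eta> C (D c d))"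
  unfolding D_def using someI_ex[OF D_ex[of d c]] .

lemmas D_response = D_spec[THEN conjunct1]
  and D_growth_ex = D_spec[THEN conjunct2]

lemma D_continuous: "i < n \<Longrightarrow> continuous_on UNIV (\<lambda>t. D c d t i)"
  using response_continuous[OF D_response] .

lemma zero_response: "response (\<lambda>_. 0) (\<lambda>t i. 0) (\<lambda>t i. 0)" "growth \<mu> 0 (\<lambda>t i. 0)"
  by (auto simp: response_def green_def growth_def intro!: exI[of _ 0])

lemma D_growth: "growth \<eta> (2 * nrm n d) (D c d)"
proof -
  obtain C where C: "growth \<eta> C (D c d)" using D_growth_ex by blast
  have "growth \<eta> (2 * (nrm n d + 0 / \<eta>)) (\<lambda>t i. D c d t i - 0)"
    by (rule response_stable[OF D_response C zero_response])
      (use eta eps g1_bound in \<open>auto simp: cmod_le_nrm\<close>)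
  then show ?thesis by simp
qed

text \<open>The a priori estimate, where the two solutions differ in their centre data only.\<close>

lemma Psi_growth_diff: "growth \<eta> (2 * nrm n (\<lambda>i. c' i - c i)) (\<lambda>t i. \<Psi> c' t i - \<Psi> c t i)"
proof -
  obtain C C' where C: "growth \<eta> C (\<Psi> c')" "growth \<eta> C' (\<Psi> c)" using Psi_growth by blast
  have "growth \<eta> (2 * (nrm n (\<lambda>i. c' i - c i) + 0 / \<eta>)) (\<lambda>t i. \<Psi> c' t i - \<Psi> c t i)"
    by (rule response_stable[OF Psi_response C(1) Psi_response C(2)])
      (use eta eps g_lip in \<open>auto intro!: cmod_le_nrm[of _ n "\<lambda>i. c' i - c i"]\<close>)
  then show ?thesis by simp
qed

lemma growth_scale:
  assumes "growth \<mu> C u" shows "growth \<mu> (\<bar>s\<bar> * C) (\<lambda>t i. of_real s * u t i)"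
proof (rule growthI)
  fix t i assume "i < n"
  from mult_left_mono[OF growthD[OF assms this, of t], of "\<bar>s\<bar>"]
  show "cmod (of_real s * u t i) \<le> \<bar>s\<bar> * C * exp (\<mu> * \<bar>t\<bar>)" by (simp add: norm_mult mult.assoc)
qed

abbreviation W :: "real \<Rightarrow> real" where "W t \<equiv> exp (\<eta> * \<bar>t\<bar>)"

lemma W_ge_1: "1 \<le> W t" using eta by simp

lemma W_sq: "W t ^ 2 = exp (2 * \<eta> * \<bar>t\<bar>)"
  by (simp add: mult.assoc flip: exp_double)

lemma W_cube: "W t ^ 3 = exp (3 * \<eta> * \<bar>t\<bar>)"
  by (simp add: mult.assoc flip: exp_of_nat_mult)

lemma growth_pow: "growth (real k * \<eta>) C u \<longleftrightarrow> (\<forall>t. \<forall>i<n. cmod (u t i) \<le> C * W t ^ k)"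
  by (simp add: growth_def mult.assoc exp_of_nat_mult[symmetric])

lemma nrm_pow: "growth (real k * \<eta>) C u \<Longrightarrow> nrm n (u t) \<le> real n * C * W t ^ k"
  using growth_nrm[of "real k * \<eta>" C u t] by (simp add: mult.assoc exp_of_nat_mult[symmetric])

lemma W_pow_mono: "j \<le> k \<Longrightarrow> 0 \<le> C \<Longrightarrow> C * W t ^ j \<le> C * W t ^ k"
  using W_ge_1[of t] by (intro mult_left_mono power_increasing) auto

text \<open>Products of quantities of growth \<open>i \<eta>\<close> and \<open>j \<eta>\<close> have growth \<open>(i + j) \<eta>\<close>.\<close>

lemma bilinear_weight:
  assumes "x \<le> a * W t ^ i" "y \<le> b * W t ^ j" "0 \<le> x" "0 \<le> y" "0 \<le> m" "m' \<le> m"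
    and "i + j \<le> k" "0 \<le> a" "0 \<le> b"
  shows "m' * x * y \<le> m * a * b * W t ^ k"
proof -
  have "m' * x * y \<le> m * x * y" using assms by (intro mult_right_mono) auto
  also have "\<dots> \<le> m * ((a * W t ^ i) * (b * W t ^ j))"
    unfolding mult.assoc[of m] using assms by (intro mult_left_mono mult_mono) auto
  also have "\<dots> = m * a * b * W t ^ (i + j)" by (simp add: power_add mult_ac)
  also have "\<dots> \<le> m * a * b * W t ^ k" using assms by (intro W_pow_mono) auto
  finally show ?thesis .
qed

lemma E_ex: "\<exists>w. response (\<lambda>_. 0) (\<lambda>t i. g1 (\<Psi> c t) (w t) i + g2 (\<Psi> c t) (D c d t) (D c e t) i) w \<and>
    (\<exists>C. growth (2 * \<eta>) C w)"
proof -
  have Dn: "nrm n (D c d t) \<le> real n * (2 * nrm n d) * W t ^ 1" for t d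
    using nrm_pow[of 1 "2 * nrm n d" "D c d"] D_growth by simp
  have "growth (real 2 * \<eta>) (M * (real n * (2 * nrm n d)) * (real n * (2 * nrm n e)))
      (\<lambda>t i. g1 (\<Psi> c t) (\<lambda>_. 0) i + g2 (\<Psi> c t) (D c d t) (D c e t) i)"
    unfolding growth_pow
  proof (intro allI impI)
    fix t i assume i: "i < n"
    have "cmod (g2 (\<Psi> c t) (D c d t) (D c e t) i) \<le> M * nrm n (D c d t) * nrm n (D c e t)"
      using g2_bound[OF i] .
    also have "\<dots> \<le> M * (real n * (2 * nrm n d)) * (real n * (2 * nrm n e)) * W t ^ 2"
      by (rule bilinear_weight[OF Dn Dn]) (use M in auto)
    finally show "cmod (g1 (\<Psi> c t) (\<lambda>_. 0) i + g2 (\<Psi> c t) (D c d t) (D c e t) i)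
      \<le> M * (real n * (2 * nrm n d)) * (real n * (2 * nrm n e)) * W t ^ 2"
      using i by (simp add: g1_zero)
  qed
  then have 0: "growth (2 * \<eta>) (M * (real n * (2 * nrm n d)) * (real n * (2 * nrm n e)))
      (\<lambda>t i. g1 (\<Psi> c t) (\<lambda>_. 0) i + g2 (\<Psi> c t) (D c d t) (D c e t) i)" by simp
  have "\<exists>v C. response (\<lambda>_. 0) (\<lambda>t i. g1 (\<Psi> c t) (v t) i + g2 (\<Psi> c t) (D c d t) (D c e t) i) v \<and> growth (2 * \<eta>) C v"
  proof (rule fixed_point_exists[where \<mu> = "2 * \<eta>" and
      G = "\<lambda>t v i. g1 (\<Psi> c t) v i + g2 (\<Psi> c t) (D c d t) (D c e t) i", OF _ _ _ _ 0 eps])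
    show "cmod (g1 (\<Psi> c t) z i + g2 (\<Psi> c t) (D c d t) (D c e t) i -
        (g1 (\<Psi> c t) z' i + g2 (\<Psi> c t) (D c d t) (D c e t) i)) \<le> \<epsilon> * nrm n (\<lambda>i. z i - z' i)" if "i < n" for t z z' i
      using g1_bound[OF that, of "\<Psi> c t" "\<lambda>i. z i - z' i"] by (simp add: g1_diff that)
  qed (use eta continuous_on_add[OF continuous_g1[OF Psi_continuous] continuous_g2[OF Psi_continuous D_continuous D_continuous]] in auto)
  then show ?thesis by (elim exE conjE, intro exI conjI)
qed

lemma E_spec: "response (\<lambda>_. 0) (\<lambda>t i. g1 (\<Psi> c t) (E c d e t) i + g2 (\<Psi> c t) (D c d t) (D c e t) i) (E c d e) \<and>
    (\<exists>C. growth (2 * \<eta>) C (E c d e))"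
  unfolding E_def using someI_ex[OF E_ex[of c d e]] .

lemmas E_response = E_spec[THEN conjunct1]
  and E_growth_ex = E_spec[THEN conjunct2]

lemma Psi_nrm: "nrm n (\<lambda>i. \<Psi> c' t i - \<Psi> c t i) \<le> 2 * real n * nrm n (\<lambda>i. c' i - c i) * W t"
  using growth_nrm[OF Psi_growth_diff[of c' c], of t] by (simp add: mult_ac)

lemma D_nrm: "nrm n (D c d t) \<le> 2 * real n * nrm n d * W t"
  using growth_nrm[OF D_growth[of d c], of t] by (simp add: mult_ac)

lemma E_growth: "growth (2 * \<eta>) (8 * M * (real n)\<^sup>2 * nrm n d * nrm n e / \<eta>) (E c d e)"
proof -
  obtain C where C: "growth (2 * \<eta>) C (E c d e)" using E_growth_ex by blast
  let ?\<kappa> = "M * (2 * real n * nrm n d) * (2 * real n * nrm n e)"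
  have "growth (2 * \<eta>) (2 * (0 + ?\<kappa> / \<eta>)) (\<lambda>t i. E c d e t i - 0)"
  proof (rule response_stable[OF E_response C zero_response])
    fix t i assume i: "i < n"
    have "cmod (g2 (\<Psi> c t) (D c d t) (D c e t) i) \<le> M * nrm n (D c d t) * nrm n (D c e t)"
      using g2_bound[OF i] .
    also have "\<dots> \<le> ?\<kappa> * W t ^ 2"
      using D_nrm[of c _ t] M by (intro bilinear_weight[where i = 1 and j = 1]) auto
    finally have "cmod (g2 (\<Psi> c t) (D c d t) (D c e t) i) \<le> ?\<kappa> * exp (2 * \<eta> * \<bar>t\<bar>)"
      by (simp only: W_sq)
    from norm_triangle_le[OF add_mono[OF this g1_bound[OF i, of "\<Psi> c t" "E c d e t"]]]
    show "cmod (g1 (\<Psi> c t) (E c d e t) i + g2 (\<Psi> c t) (D c d t) (D c e t) i - 0)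
        \<le> ?\<kappa> * exp (2 * \<eta> * \<bar>t\<bar>) + \<epsilon> * nrm n (\<lambda>i. E c d e t i - 0)"
      by (simp add: add.commute)
  qed (use eta eps M in auto)
  then show ?thesis by (simp add: power2_eq_square mult_ac)
qed

text \<open>The forcing \<open>(g1 (\<Psi> c') - g1 (\<Psi> c)) (D c' d)\<close> is a product of two quantities of growth \<open>\<eta>\<close>; this is where
derivatives with respect to \<open>c\<close> lose one \<open>\<eta>\<close>.\<close>

lemma D_growth_diff:
  "growth (2 * \<eta>) (8 * M * (real n)\<^sup>2 * nrm n (\<lambda>i. c' i - c i) * nrm n d / \<eta>) (\<lambda>t i. D c' d t i - D c d t i)"
proof -
  let ?\<kappa> = "M * (2 * real n * nrm n (\<lambda>i. c' i - c i)) * (2 * real n * nrm n d)"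
  have g: "growth (2 * \<eta>) (2 * nrm n d) (D c d)" for c
    using growth_weight_mono[OF D_growth] eta by simp
  have "growth (2 * \<eta>) (2 * (0 + ?\<kappa> / \<eta>)) (\<lambda>t i. D c' d t i - D c d t i)"
  proof (rule response_stable[OF D_response g D_response g])
    fix t i assume i: "i < n"
    have "cmod (g1 (\<Psi> c' t) (D c' d t) i - g1 (\<Psi> c t) (D c' d t) i)
        \<le> M * nrm n (\<lambda>i. \<Psi> c' t i - \<Psi> c t i) * nrm n (D c' d t)"
      using g1_lip[OF i] .
    also have "\<dots> \<le> ?\<kappa> * W t ^ 2"
      using D_nrm[of c' d t] Psi_nrm[of c' t c] M by (intro bilinear_weight[where i = 1 and j = 1]) auto
    finally have "cmod (g1 (\<Psi> c' t) (D c' d t) i - g1 (\<Psi> c t) (D c' d t) i) \<le> ?\<kappa> * exp (2 * \<eta> * \<bar>t\<bar>)"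
      by (simp only: W_sq)
    from norm_triangle_le[OF add_mono[OF this g1_bound[OF i, of "\<Psi> c t" "\<lambda>i. D c' d t i - D c d t i"]]]
    show "cmod (g1 (\<Psi> c' t) (D c' d t) i - g1 (\<Psi> c t) (D c d t) i)
        \<le> ?\<kappa> * exp (2 * \<eta> * \<bar>t\<bar>) + \<epsilon> * nrm n (\<lambda>i. D c' d t i - D c d t i)"
      by (simp add: g1_diff[OF i])
  qed (use eta eps M in auto)
  then show ?thesis by (simp add: power2_eq_square mult_ac)
qed

text \<open>The remainder of the first-order expansion solves the variational equation with the Taylor remainder of \<open>g\<close>, of second
order, as forcing.\<close>

lemma Psi_expansion:
  "growth (2 * \<eta>) (8 * M * (real n)\<^sup>2 * (nrm n d)\<^sup>2 / \<eta> * s\<^sup>2)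
     (\<lambda>t i. \<Psi> (\<lambda>i. c i + of_real s * d i) t i - \<Psi> c t i - of_real s * D c d t i)"
proof -
  define c' where "c' = (\<lambda>i. c i + of_real s * d i)"
  have c': "nrm n (\<lambda>i. c' i - c i) = \<bar>s\<bar> * nrm n d" by (simp add: c'_def nrm_scale)
  let ?\<kappa> = "M * (2 * real n * (\<bar>s\<bar> * nrm n d)) * (2 * real n * (\<bar>s\<bar> * nrm n d))"
  have sD: "response (\<lambda>i. of_real s * d i) (\<lambda>t i. of_real s * g1 (\<Psi> c t) (D c d t) i) (\<lambda>t i. of_real s * D c d t i)"
    using response_lincomb[OF D_response D_response, where a = "of_real s" and b = 0] by simp
  have sDg: "growth (2 * \<eta>) (\<bar>s\<bar> * (2 * nrm n d)) (\<lambda>t i. of_real s * D c d t i)"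
    using eta by (intro growth_scale growth_weight_mono[OF D_growth]) simp
  have g: "growth (2 * \<eta>) (2 * (\<bar>s\<bar> * nrm n d)) (\<lambda>t i. \<Psi> c' t i - \<Psi> c t i)"
    using growth_weight_mono[OF Psi_growth_diff, of "2 * \<eta>" c' c] eta by (simp add: c')
  have "growth (2 * \<eta>) (2 * (0 + ?\<kappa> / \<eta>)) (\<lambda>t i. (\<Psi> c' t i - \<Psi> c t i) - of_real s * D c d t i)"
  proof (rule response_stable[OF response_diff[OF Psi_response Psi_response] g sD sDg])
    fix t i assume i: "i < n"
    have "cmod (g (\<Psi> c' t) i - g (\<Psi> c t) i - g1 (\<Psi> c t) (\<lambda>i. \<Psi> c' t i - \<Psi> c t i) i)
        \<le> M * nrm n (\<lambda>i. \<Psi> c' t i - \<Psi> c t i) * nrm n (\<lambda>i. \<Psi> c' t i - \<Psi> c t i)"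
      using g_deriv[OF i] by (simp add: power2_eq_square mult.assoc)
    also have "\<dots> \<le> ?\<kappa> * W t ^ 2"
      using Psi_nrm[of c' t c] M unfolding c' by (intro bilinear_weight[where i = 1 and j = 1]) auto
    finally have "cmod (g (\<Psi> c' t) i - g (\<Psi> c t) i - g1 (\<Psi> c t) (\<lambda>i. \<Psi> c' t i - \<Psi> c t i) i) \<le> ?\<kappa> * exp (2 * \<eta> * \<bar>t\<bar>)"
      by (simp only: W_sq)
    from norm_triangle_le[OF add_mono[OF this g1_bound[OF i, of "\<Psi> c t" "\<lambda>i. (\<Psi> c' t i - \<Psi> c t i) - of_real s * D c d t i"]]]
    show "cmod (g (\<Psi> c' t) i - g (\<Psi> c t) i - of_real s * g1 (\<Psi> c t) (D c d t) i)
        \<le> ?\<kappa> * exp (2 * \<eta> * \<bar>t\<bar>) + \<epsilon> * nrm n (\<lambda>i. \<Psi> c' t i - \<Psi> c t i - of_real s * D c d t i)"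
      by (simp only: g1_diff[OF i] g1_scale[OF i]) (simp add: algebra_simps)
  qed (use eta eps M in \<open>auto simp: c'_def\<close>)
  moreover have "\<bar>s\<bar> * (\<bar>s\<bar> * x) = s * (s * x)" for x
    by (simp flip: mult.assoc)
  ultimately show ?thesis by (simp add: c'_def power2_eq_square mult_ac)
qed

text \<open>The remainder of the expansion of \<open>D\<close> solves the variational equation along \<open>\<Psi> c\<close>, forced by the Taylor
remainder of \<open>g1\<close> and by \<open>g2\<close> applied to differences that are already known to be of first or second order. All these
are products of growth \<open>3 \<eta>\<close>.\<close>

lemma D_expansion:
  assumes "0 < r"
  shows "\<exists>K\<ge>0. \<forall>s. growth (3 * \<eta>) ((r + K * \<bar>s\<bar>) * \<bar>s\<bar>)
     (\<lambda>t i. D (\<lambda>i. c i + of_real s * e i) d t i - D c d t i - of_real s * E c e d t i)"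
proof -
  let ?N = "real n"
  let ?C = "2 * ((2 * ?N * nrm n e) * (2 * ?N * nrm n d)) / \<eta>"
  have "0 \<le> ?C" using eta by simp
  then obtain r' where r': "0 < r'" "r' * ?C \<le> r" using small_factor \<open>0 < r\<close> by blast
  obtain K where K: "0 \<le> K" "\<And>z z' v i. i < n \<Longrightarrow> cmod (g1 z' v i - g1 z v i - g2 z (\<lambda>i. z' i - z i) v i)
            \<le> (r' + K * nrm n (\<lambda>i. z' i - z i)) * nrm n (\<lambda>i. z' i - z i) * nrm n v"
    using g1_deriv[OF r'(1)] by blast
  \<comment> \<open>Bounds for the products in the forcing: \<open>?k1\<close> and \<open>?k2\<close> for the Taylor remainder of \<open>g1\<close>, \<open>?k3\<close> for \<open>g2\<close> applied to the
    change of \<open>D\<close>, \<open>?k4\<close> for \<open>g2\<close> applied to the remainder of \<open>\<Psi>\<close>.\<close>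
  let ?k1 = "(2 * ?N * nrm n e) * (2 * ?N * nrm n d)"
  let ?k2 = "2 * ?N * nrm n e * K"
  let ?k3 = "M * (2 * ?N * nrm n e) * (?N * (8 * M * ?N\<^sup>2 * nrm n e * nrm n d / \<eta>))"
  let ?k4 = "M * (?N * (8 * M * ?N\<^sup>2 * (nrm n e)\<^sup>2 / \<eta>)) * (2 * ?N * nrm n d)"
  define k where "k = 2 * ((?k2 * ?k1 + ?k3 + ?k4) / \<eta>)"
  have main: "growth (3 * \<eta>) ((r + k * \<bar>s\<bar>) * \<bar>s\<bar>)
     (\<lambda>t i. D (\<lambda>i. c i + of_real s * e i) d t i - D c d t i - of_real s * E c e d t i)" for s
  proof -
    define c' where "c' = (\<lambda>i. c i + of_real s * e i)"
    have c': "nrm n (\<lambda>i. c' i - c i) = \<bar>s\<bar> * nrm n e" by (simp add: c'_def nrm_scale)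
    let ?\<kappa> = "((r' + ?k2 * \<bar>s\<bar>) * ?k1 + (?k3 + ?k4) * \<bar>s\<bar>) * \<bar>s\<bar>"
    have sE: "response (\<lambda>i. 0) (\<lambda>t i. of_real s * (g1 (\<Psi> c t) (E c e d t) i + g2 (\<Psi> c t) (D c e t) (D c d t) i))
        (\<lambda>t i. of_real s * E c e d t i)"
      using response_lincomb[OF E_response E_response, where a = "of_real s" and b = 0] by simp
    have sEg: "growth (3 * \<eta>) (\<bar>s\<bar> * (8 * M * (real n)\<^sup>2 * nrm n e * nrm n d / \<eta>)) (\<lambda>t i. of_real s * E c e d t i)"
      using eta by (intro growth_scale growth_weight_mono[OF E_growth]) simp
    have g: "growth (3 * \<eta>) (8 * M * ?N\<^sup>2 * nrm n (\<lambda>i. c' i - c i) * nrm n d / \<eta>) (\<lambda>t i. D c' d t i - D c d t i)"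
      using growth_weight_mono[OF D_growth_diff, of "3 * \<eta>"] eta by simp
    have pD: "nrm n (D a d t) \<le> (2 * ?N * nrm n d) * W t ^ 1" for a d t using D_nrm by simp
    have pP: "nrm n (\<lambda>i. \<Psi> c' t i - \<Psi> c t i) \<le> (2 * ?N * nrm n e * \<bar>s\<bar>) * W t ^ 1" for t
      using Psi_nrm[of c' t c] unfolding c' by (simp add: mult_ac)
    have pDD: "nrm n (\<lambda>i. D c' d t i - D c d t i) \<le> ?N * (8 * M * ?N\<^sup>2 * nrm n e * nrm n d / \<eta>) * \<bar>s\<bar> * W t ^ 2" for t
      using growth_nrm[OF D_growth_diff[of c' c d], of t] unfolding c' W_sq by (simp add: mult_ac)
    have pPP: "nrm n (\<lambda>i. \<Psi> c' t i - \<Psi> c t i - of_real s * D c e t i)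
        \<le> ?N * (8 * M * ?N\<^sup>2 * (nrm n e)\<^sup>2 / \<eta>) * s\<^sup>2 * W t ^ 2" for t
      using growth_nrm[OF Psi_expansion[of e s c], of t] unfolding c'_def W_sq by (simp add: mult_ac)
    have "growth (3 * \<eta>) (2 * (0 + ?\<kappa> / \<eta>)) (\<lambda>t i. (D c' d t i - D c d t i) - of_real s * E c e d t i)"
    proof (rule response_stable[OF response_diff[OF D_response D_response] g sE sEg])
      fix t i assume i: "i < n"
      let ?P = "\<lambda>i. \<Psi> c' t i - \<Psi> c t i"
      have 1: "cmod (g1 (\<Psi> c' t) (D c' d t) i - g1 (\<Psi> c t) (D c' d t) i - g2 (\<Psi> c t) ?P (D c' d t) i)
          \<le> (r' + ?k2 * \<bar>s\<bar>) * ?k1 * \<bar>s\<bar> * W t ^ 3" (is "?x1 \<le> _")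
      proof -
        have "r' + K * nrm n ?P \<le> r' * W t ^ 1 + K * ((2 * ?N * nrm n e * \<bar>s\<bar>) * W t ^ 1)"
          using pP[of t] K(1) W_ge_1[of t] r' by (intro add_mono mult_left_mono) auto
        also have "\<dots> = (r' + ?k2 * \<bar>s\<bar>) * W t ^ 1" by (simp add: algebra_simps)
        finally have a: "r' + K * nrm n ?P \<le> (r' + ?k2 * \<bar>s\<bar>) * W t ^ 1" .
        have b: "nrm n ?P * nrm n (D c' d t) \<le> (?k1 * \<bar>s\<bar>) * W t ^ 2"
          using bilinear_weight[OF pP[of t] pD[of c' d t] _ _ zero_le_one order_refl, where k = 2] by (simp add: mult_ac)
        have "?x1 \<le> 1 * (r' + K * nrm n ?P) * (nrm n ?P * nrm n (D c' d t))"
          using K(2)[OF i, of "\<Psi> c' t" "D c' d t" "\<Psi> c t"] by (simp add: mult.assoc)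
        also have "\<dots> \<le> 1 * (r' + ?k2 * \<bar>s\<bar>) * (?k1 * \<bar>s\<bar>) * W t ^ 3"
          by (rule bilinear_weight[OF a b]) (use r' K(1) in auto)
        finally show ?thesis by (simp add: mult_ac)
      qed
      have 2: "cmod (g2 (\<Psi> c t) ?P (\<lambda>i. D c' d t i - D c d t i) i) \<le> ?k3 * \<bar>s\<bar> * \<bar>s\<bar> * W t ^ 3" (is "?x2 \<le> _")
      proof -
        have "?x2 \<le> M * nrm n ?P * nrm n (\<lambda>i. D c' d t i - D c d t i)" using g2_bound[OF i] .
        also have "\<dots> \<le> M * (2 * ?N * nrm n e * \<bar>s\<bar>) * (?N * (8 * M * ?N\<^sup>2 * nrm n e * nrm n d / \<eta>) * \<bar>s\<bar>) * W t ^ 3"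
          by (rule bilinear_weight[OF pP pDD]) (use M eta in auto)
        finally show ?thesis by (simp add: mult_ac)
      qed
      have 3: "cmod (g2 (\<Psi> c t) (\<lambda>i. ?P i - of_real s * D c e t i) (D c d t) i) \<le> ?k4 * \<bar>s\<bar> * \<bar>s\<bar> * W t ^ 3" (is "?x3 \<le> _")
      proof -
        have "?x3 \<le> M * nrm n (\<lambda>i. ?P i - of_real s * D c e t i) * nrm n (D c d t)" using g2_bound[OF i] .
        also have "\<dots> \<le> M * (?N * (8 * M * ?N\<^sup>2 * (nrm n e)\<^sup>2 / \<eta>) * s\<^sup>2) * (2 * ?N * nrm n d) * W t ^ 3"
          by (rule bilinear_weight[OF pPP pD]) (use M eta in auto)
        also have "s\<^sup>2 = \<bar>s\<bar> * \<bar>s\<bar>" by (simp add: power2_eq_square)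
        finally show ?thesis by (simp add: mult_ac)
      qed
      have 4: "cmod (g1 (\<Psi> c t) (\<lambda>i. (D c' d t i - D c d t i) - of_real s * E c e d t i) i)
          \<le> \<epsilon> * nrm n (\<lambda>i. (D c' d t i - D c d t i) - of_real s * E c e d t i)" using g1_bound[OF i] .
      have "cmod ((g1 (\<Psi> c' t) (D c' d t) i - g1 (\<Psi> c t) (D c' d t) i - g2 (\<Psi> c t) ?P (D c' d t) i)
          + g2 (\<Psi> c t) ?P (\<lambda>i. D c' d t i - D c d t i) i
          + g2 (\<Psi> c t) (\<lambda>i. ?P i - of_real s * D c e t i) (D c d t) i
          + g1 (\<Psi> c t) (\<lambda>i. (D c' d t i - D c d t i) - of_real s * E c e d t i) i)
        \<le> (r' + ?k2 * \<bar>s\<bar>) * ?k1 * \<bar>s\<bar> * W t ^ 3 + ?k3 * \<bar>s\<bar> * \<bar>s\<bar> * W t ^ 3 + ?k4 * \<bar>s\<bar> * \<bar>s\<bar> * W t ^ 3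
          + \<epsilon> * nrm n (\<lambda>i. (D c' d t i - D c d t i) - of_real s * E c e d t i)"
        using 1 2 3 4 by (intro norm_triangle_mono)
      also have "(g1 (\<Psi> c' t) (D c' d t) i - g1 (\<Psi> c t) (D c' d t) i - g2 (\<Psi> c t) ?P (D c' d t) i)
          + g2 (\<Psi> c t) ?P (\<lambda>i. D c' d t i - D c d t i) i
          + g2 (\<Psi> c t) (\<lambda>i. ?P i - of_real s * D c e t i) (D c d t) i
          + g1 (\<Psi> c t) (\<lambda>i. (D c' d t i - D c d t i) - of_real s * E c e d t i) i
        = g1 (\<Psi> c' t) (D c' d t) i - g1 (\<Psi> c t) (D c d t) i
            - of_real s * (g1 (\<Psi> c t) (E c e d t) i + g2 (\<Psi> c t) (D c e t) (D c d t) i)"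
        using g2_diff_left[OF i, of "\<Psi> c t" ?P "\<lambda>i. of_real s * D c e t i" "D c d t"]
        by (simp add: g1_diff[OF i] g1_scale[OF i] g2_diff_right[OF i] g2_scale_left[OF i] distrib_left)
      finally show "cmod (g1 (\<Psi> c' t) (D c' d t) i - g1 (\<Psi> c t) (D c d t) i
            - of_real s * (g1 (\<Psi> c t) (E c e d t) i + g2 (\<Psi> c t) (D c e t) (D c d t) i))
        \<le> ?\<kappa> * exp (3 * \<eta> * \<bar>t\<bar>) + \<epsilon> * nrm n (\<lambda>i. (D c' d t i - D c d t i) - of_real s * E c e d t i)"
        by (simp add: W_cube algebra_simps)
    next
      show "0 \<le> ?\<kappa>" using r' K(1) M eta
        by (intro mult_nonneg_nonneg add_nonneg_nonneg divide_nonneg_nonneg) auto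
    qed (use eta eps in auto)
    moreover have "2 * (0 + ?\<kappa> / \<eta>) \<le> (r + k * \<bar>s\<bar>) * \<bar>s\<bar>"
    proof -
      have "2 * (0 + ?\<kappa> / \<eta>) = (r' * ?C + k * \<bar>s\<bar>) * \<bar>s\<bar>"
        by (simp add: k_def algebra_simps add_divide_distrib)
      also have "\<dots> \<le> (r + k * \<bar>s\<bar>) * \<bar>s\<bar>"
        using r'(2) by (intro mult_right_mono add_right_mono) auto
      finally show ?thesis .
    qed
    ultimately show ?thesis unfolding c'_def by (rule growth_mono)
  qed
  have "0 \<le> k" unfolding k_def using K(1) M eta
    by (intro mult_nonneg_nonneg add_nonneg_nonneg divide_nonneg_nonneg) auto
  with main show ?thesis by blast
qed

text \<open>The difference of two second derivatives solves the variational equation along \<open>\<Psi> c\<close>; its forcing collects the change of the base point in \<open>g1\<close> and \<open>g2\<close>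
and the change of the two first derivatives. Only the modulus of continuity of \<open>g2\<close> contributes the part
\<open>r\<close> that does not shrink with \<open>c' - c\<close>.\<close>

lemma E_growth_diff:
  assumes "0 < r"
  shows "\<exists>K\<ge>0. \<forall>c'. growth (3 * \<eta>) (r + K * nrm n (\<lambda>i. c' i - c i)) (\<lambda>t i. E c' d e t i - E c d e t i)"
proof -
  let ?N = "real n"
  let ?kd = "2 * ?N * nrm n d" and ?ke = "2 * ?N * nrm n e"
  let ?C = "2 * (?kd * ?ke) / \<eta>"
  have "0 \<le> ?C" using eta by simp
  then obtain r' where r': "0 < r'" "r' * ?C \<le> r" using small_factor \<open>0 < r\<close> by blast
  obtain K where K: "0 \<le> K" "\<And>z z' v w i. i < n \<Longrightarrow> cmod (g2 z' v w i - g2 z v w i)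
            \<le> (r' + K * nrm n (\<lambda>i. z' i - z i)) * nrm n v * nrm n w"
    using g2_cont[OF r'(1)] by blast
  let ?E = "8 * M * ?N\<^sup>2 * nrm n d * nrm n e / \<eta>"
  let ?k1 = "M * (2 * ?N) * (?N * ?E)"
  let ?k2 = "K * (2 * ?N) * (?kd * ?ke)"
  let ?k3 = "M * (?N * (8 * M * ?N\<^sup>2 * nrm n d / \<eta>)) * ?ke"
  let ?k4 = "M * ?kd * (?N * (8 * M * ?N\<^sup>2 * nrm n e / \<eta>))"
  define k where "k = 2 * ((?k1 + ?k2 + ?k3 + ?k4) / \<eta>)"
  have main: "growth (3 * \<eta>) (r + k * nrm n (\<lambda>i. c' i - c i)) (\<lambda>t i. E c' d e t i - E c d e t i)" for c'
  proof -
    define \<delta> where "\<delta> = nrm n (\<lambda>i. c' i - c i)"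
    have \<delta>: "0 \<le> \<delta>" by (simp add: \<delta>_def)
    let ?\<kappa> = "r' * (?kd * ?ke) + (?k1 + ?k2 + ?k3 + ?k4) * \<delta>"
    have g: "growth (3 * \<eta>) ?E (E c d e)" for c
      using growth_weight_mono[OF E_growth, of "3 * \<eta>"] eta by simp
    have pD: "nrm n (D a d t) \<le> (2 * ?N * nrm n d) * W t ^ 1" for a d t using D_nrm by simp
    have pP: "nrm n (\<lambda>i. \<Psi> c' t i - \<Psi> c t i) \<le> (2 * ?N * \<delta>) * W t ^ 1" for t
      using Psi_nrm[of c' t c] by (simp add: \<delta>_def)
    have pDD: "nrm n (\<lambda>i. D c' d t i - D c d t i) \<le> (?N * (8 * M * ?N\<^sup>2 * nrm n d / \<eta>) * \<delta>) * W t ^ 2" for t d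
      using growth_nrm[OF D_growth_diff[of c' c d], of t] unfolding \<delta>_def W_sq by (simp add: mult_ac)
    have pE: "nrm n (E c' d e t) \<le> ?N * ?E * W t ^ 2" for t
      using growth_nrm[OF E_growth[of d e c'], of t] unfolding W_sq by simp
    have "growth (3 * \<eta>) (2 * (0 + ?\<kappa> / \<eta>)) (\<lambda>t i. E c' d e t i - E c d e t i)"
    proof (rule response_stable[OF E_response g E_response g])
      fix t i assume i: "i < n"
      have 1: "cmod (g1 (\<Psi> c' t) (E c' d e t) i - g1 (\<Psi> c t) (E c' d e t) i) \<le> ?k1 * \<delta> * W t ^ 3" (is "?x1 \<le> _")
      proof -
        have "?x1 \<le> M * nrm n (\<lambda>i. \<Psi> c' t i - \<Psi> c t i) * nrm n (E c' d e t)" using g1_lip[OF i] .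
        also have "\<dots> \<le> M * (2 * ?N * \<delta>) * (?N * ?E) * W t ^ 3"
          by (rule bilinear_weight[OF pP pE]) (use M eta \<delta> in auto)
        finally show ?thesis by (simp add: mult_ac)
      qed
      have 2: "cmod (g2 (\<Psi> c' t) (D c' d t) (D c' e t) i - g2 (\<Psi> c t) (D c' d t) (D c' e t) i)
          \<le> (r' * (?kd * ?ke) + ?k2 * \<delta>) * W t ^ 3" (is "?x2 \<le> _")
      proof -
        have "r' + K * nrm n (\<lambda>i. \<Psi> c' t i - \<Psi> c t i) \<le> r' * W t ^ 1 + K * ((2 * ?N * \<delta>) * W t ^ 1)"
          using pP[of t] K(1) W_ge_1[of t] r' by (intro add_mono mult_left_mono) auto
        also have "\<dots> = (r' + K * (2 * ?N * \<delta>)) * W t ^ 1" by (simp add: algebra_simps)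
        finally have a: "r' + K * nrm n (\<lambda>i. \<Psi> c' t i - \<Psi> c t i) \<le> (r' + K * (2 * ?N * \<delta>)) * W t ^ 1" .
        have b: "nrm n (D c' d t) * nrm n (D c' e t) \<le> (?kd * ?ke) * W t ^ 2"
          using bilinear_weight[OF pD[of c' d t] pD[of c' e t] _ _ zero_le_one order_refl, where k = 2] by (simp add: mult_ac)
        have "?x2 \<le> 1 * (r' + K * nrm n (\<lambda>i. \<Psi> c' t i - \<Psi> c t i)) * (nrm n (D c' d t) * nrm n (D c' e t))"
          using K(2)[OF i] by (simp add: mult.assoc)
        also have "\<dots> \<le> 1 * (r' + K * (2 * ?N * \<delta>)) * (?kd * ?ke) * W t ^ 3"
          by (rule bilinear_weight[OF a b]) (use r' K(1) \<delta> in auto)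
        finally show ?thesis by (simp add: algebra_simps)
      qed
      have 3: "cmod (g2 (\<Psi> c t) (\<lambda>i. D c' d t i - D c d t i) (D c' e t) i) \<le> ?k3 * \<delta> * W t ^ 3" (is "?x3 \<le> _")
      proof -
        have "?x3 \<le> M * nrm n (\<lambda>i. D c' d t i - D c d t i) * nrm n (D c' e t)" using g2_bound[OF i] .
        also have "\<dots> \<le> M * (?N * (8 * M * ?N\<^sup>2 * nrm n d / \<eta>) * \<delta>) * ?ke * W t ^ 3"
          by (rule bilinear_weight[OF pDD pD]) (use M eta \<delta> in auto)
        finally show ?thesis by (simp add: mult_ac)
      qed
      have 4: "cmod (g2 (\<Psi> c t) (D c d t) (\<lambda>i. D c' e t i - D c e t i) i) \<le> ?k4 * \<delta> * W t ^ 3" (is "?x4 \<le> _")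
      proof -
        have "?x4 \<le> M * nrm n (D c d t) * nrm n (\<lambda>i. D c' e t i - D c e t i)" using g2_bound[OF i] .
        also have "\<dots> \<le> M * ?kd * (?N * (8 * M * ?N\<^sup>2 * nrm n e / \<eta>) * \<delta>) * W t ^ 3"
          by (rule bilinear_weight[OF pD pDD]) (use M eta \<delta> in auto)
        finally show ?thesis by (simp add: mult_ac)
      qed
      have 5: "cmod (g1 (\<Psi> c t) (\<lambda>i. E c' d e t i - E c d e t i) i)
          \<le> \<epsilon> * nrm n (\<lambda>i. E c' d e t i - E c d e t i)" using g1_bound[OF i] .
      have "cmod ((g1 (\<Psi> c' t) (E c' d e t) i - g1 (\<Psi> c t) (E c' d e t) i)
          + (g2 (\<Psi> c' t) (D c' d t) (D c' e t) i - g2 (\<Psi> c t) (D c' d t) (D c' e t) i)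
          + g2 (\<Psi> c t) (\<lambda>i. D c' d t i - D c d t i) (D c' e t) i
          + g2 (\<Psi> c t) (D c d t) (\<lambda>i. D c' e t i - D c e t i) i
          + g1 (\<Psi> c t) (\<lambda>i. E c' d e t i - E c d e t i) i)
        \<le> ?k1 * \<delta> * W t ^ 3 + (r' * (?kd * ?ke) + ?k2 * \<delta>) * W t ^ 3 + ?k3 * \<delta> * W t ^ 3 + ?k4 * \<delta> * W t ^ 3
          + \<epsilon> * nrm n (\<lambda>i. E c' d e t i - E c d e t i)"
        using 1 2 3 4 5 by (intro norm_triangle_mono)
      also have "(g1 (\<Psi> c' t) (E c' d e t) i - g1 (\<Psi> c t) (E c' d e t) i)
          + (g2 (\<Psi> c' t) (D c' d t) (D c' e t) i - g2 (\<Psi> c t) (D c' d t) (D c' e t) i)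
          + g2 (\<Psi> c t) (\<lambda>i. D c' d t i - D c d t i) (D c' e t) i
          + g2 (\<Psi> c t) (D c d t) (\<lambda>i. D c' e t i - D c e t i) i
          + g1 (\<Psi> c t) (\<lambda>i. E c' d e t i - E c d e t i) i
        = g1 (\<Psi> c' t) (E c' d e t) i + g2 (\<Psi> c' t) (D c' d t) (D c' e t) i
          - (g1 (\<Psi> c t) (E c d e t) i + g2 (\<Psi> c t) (D c d t) (D c e t) i)"
        by (simp add: g1_diff[OF i] g2_diff_right[OF i] g2_diff_left[OF i])
      finally show "cmod (g1 (\<Psi> c' t) (E c' d e t) i + g2 (\<Psi> c' t) (D c' d t) (D c' e t) i
          - (g1 (\<Psi> c t) (E c d e t) i + g2 (\<Psi> c t) (D c d t) (D c e t) i))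
        \<le> ?\<kappa> * exp (3 * \<eta> * \<bar>t\<bar>) + \<epsilon> * nrm n (\<lambda>i. E c' d e t i - E c d e t i)"
        by (simp add: W_cube algebra_simps)
    next
      show "0 \<le> ?\<kappa>" using r' K(1) M eta \<delta>
        by (intro mult_nonneg_nonneg add_nonneg_nonneg divide_nonneg_nonneg) auto
    qed (use eta eps in auto)
    moreover have "2 * (0 + ?\<kappa> / \<eta>) \<le> r + k * \<delta>"
    proof -
      have "2 * (0 + ?\<kappa> / \<eta>) = r' * ?C + k * \<delta>"
        by (simp add: k_def algebra_simps add_divide_distrib)
      then show ?thesis using r'(2) by simp
    qed
    ultimately show ?thesis unfolding \<delta>_def by (rule growth_mono)
  qed
  have "0 \<le> k" unfolding k_def using K(1) M eta
    by (intro mult_nonneg_nonneg add_nonneg_nonneg divide_nonneg_nonneg) auto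
  with main show ?thesis by blast
qed

lemma quadratic_vector_derivative:
  fixes f :: "real \<Rightarrow> complex"
  assumes "\<And>r. 0 < r \<Longrightarrow> \<exists>K\<ge>0. \<forall>s. cmod (f s - f 0 - of_real s * y) \<le> (r + K * \<bar>s\<bar>) * \<bar>s\<bar>"
  shows "(f has_vector_derivative y) (at 0)"
  unfolding has_vector_derivative_def has_derivative_at
proof
  show "bounded_linear (\<lambda>x. x *\<^sub>R y)" by (rule bounded_linear_scaleR_left)
  show "(\<lambda>h. norm (f (0 + h) - f 0 - h *\<^sub>R y) / norm h) \<midarrow>0\<rightarrow> 0"
    unfolding tendsto_iff eventually_at
  proof (intro allI impI)
    fix r :: real assume "0 < r"
    then obtain K where K: "0 \<le> K" "\<forall>s. cmod (f s - f 0 - of_real s * y) \<le> (r / 2 + K * \<bar>s\<bar>) * \<bar>s\<bar>"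
      using assms[of "r / 2"] by auto
    show "\<exists>d>0. \<forall>x\<in>UNIV. x \<noteq> 0 \<and> dist x 0 < d \<longrightarrow> dist (norm (f (0 + x) - f 0 - x *\<^sub>R y) / norm x) 0 < r"
    proof (intro exI[of _ "r / (2 * (K + 1))"] conjI ballI impI)
      show "0 < r / (2 * (K + 1))" using \<open>0 < r\<close> K by simp
      fix x :: real assume x: "x \<noteq> 0 \<and> dist x 0 < r / (2 * (K + 1))"
      have "K * \<bar>x\<bar> \<le> (K + 1) * \<bar>x\<bar>" by (intro mult_right_mono) auto
      also have "\<dots> < r / 2" using x K by (simp add: field_simps)
      finally have "r / 2 + K * \<bar>x\<bar> < r" by simp
      then have "(r / 2 + K * \<bar>x\<bar>) * \<bar>x\<bar> < r * \<bar>x\<bar>" using x by (intro mult_strict_right_mono) auto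
      with K(2)[rule_format, of x] have "cmod (f x - f 0 - of_real x * y) < r * \<bar>x\<bar>" by linarith
      then show "dist (norm (f (0 + x) - f 0 - x *\<^sub>R y) / norm x) 0 < r"
        using x by (simp add: divide_less_eq scaleR_conv_of_real)
    qed
  qed
qed

lemma growth_at_zero: "growth \<mu> C u \<Longrightarrow> i < n \<Longrightarrow> cmod (u 0 i) \<le> C"
  using growthD[of \<mu> C u i 0] by simp

lemma Psi_derivative:
  assumes i: "i < n"
  shows "((\<lambda>s. \<Psi> (\<lambda>i. c i + of_real s * d i) 0 i) has_vector_derivative D c d 0 i) (at 0)"
proof (rule quadratic_vector_derivative)
  fix r :: real assume "0 < r"
  let ?K = "8 * M * (real n)\<^sup>2 * (nrm n d)\<^sup>2 / \<eta>"
  have "cmod (\<Psi> (\<lambda>i. c i + of_real s * d i) 0 i - \<Psi> c 0 i - of_real s * D c d 0 i) \<le> (r + ?K * \<bar>s\<bar>) * \<bar>s\<bar>" for s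
  proof -
    have "?K * s\<^sup>2 = ?K * \<bar>s\<bar> * \<bar>s\<bar>" by (simp add: power2_eq_square mult.assoc)
    also have "\<dots> \<le> (r + ?K * \<bar>s\<bar>) * \<bar>s\<bar>" using \<open>0 < r\<close> by (intro mult_right_mono) auto
    finally show ?thesis using growth_at_zero[OF Psi_expansion[of d s c] i] by linarith
  qed
  moreover have "0 \<le> ?K" using M eta by simp
  ultimately show "\<exists>K\<ge>0. \<forall>s. cmod (\<Psi> (\<lambda>i. c i + of_real s * d i) 0 i - \<Psi> (\<lambda>i. c i + of_real 0 * d i) 0 i - of_real s * D c d 0 i)
      \<le> (r + K * \<bar>s\<bar>) * \<bar>s\<bar>"
    by (intro exI[of _ ?K]) simp
qed

lemma D_derivative:
  assumes i: "i < n"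
  shows "((\<lambda>s. D (\<lambda>i. c i + of_real s * e i) d 0 i) has_vector_derivative E c e d 0 i) (at 0)"
proof (rule quadratic_vector_derivative)
  fix r :: real assume "0 < r"
  then obtain K where K: "0 \<le> K" "\<forall>s. growth (3 * \<eta>) ((r + K * \<bar>s\<bar>) * \<bar>s\<bar>)
     (\<lambda>t i. D (\<lambda>i. c i + of_real s * e i) d t i - D c d t i - of_real s * E c e d t i)"
    using D_expansion[of r c e d] by blast
  then show "\<exists>K\<ge>0. \<forall>s. cmod (D (\<lambda>i. c i + of_real s * e i) d 0 i - D (\<lambda>i. c i + of_real 0 * e i) d 0 i - of_real s * E c e d 0 i)
      \<le> (r + K * \<bar>s\<bar>) * \<bar>s\<bar>"
    using growth_at_zero[OF K(2)[rule_format] i] by (intro exI[of _ K]) simp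
qed

lemma Psi_lipschitz: "i < n \<Longrightarrow> cmod (\<Psi> c' 0 i - \<Psi> c 0 i) \<le> 2 * nrm n (\<lambda>i. c' i - c i)"
  using growth_at_zero[OF Psi_growth_diff] .

lemma D_lipschitz:
  "i < n \<Longrightarrow> cmod (D c' d 0 i - D c d 0 i) \<le> 8 * M * (real n)\<^sup>2 * nrm n (\<lambda>i. c' i - c i) * nrm n d / \<eta>"
  using growth_at_zero[OF D_growth_diff] .

lemma E_continuity:
  assumes i: "i < n" and "0 < r"
  shows "\<exists>K\<ge>0. \<forall>c'. cmod (E c' d e 0 i - E c d e 0 i) \<le> r + K * nrm n (\<lambda>i. c' i - c i)"
  using E_growth_diff[OF \<open>0 < r\<close>, of c d e] growth_at_zero[OF _ i] by blast

text \<open>Uniqueness holds in the larger class of growth \<open>4 \<eta>\<close>; bounded orbits belong to it.\<close>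

lemma Psi_unique:
  assumes u: "response c (\<lambda>t. g (u t)) u" "growth (4 * \<eta>) C u" and i: "i < n"
  shows "u t i = \<Psi> c t i"
proof -
  obtain C' where "growth \<eta> C' (\<Psi> c)" using Psi_growth by blast
  then have C': "growth (4 * \<eta>) C' (\<Psi> c)" by (rule growth_weight_mono) (use eta in auto)
  have "growth (4 * \<eta>) (2 * (0 + 0 / \<eta>)) (\<lambda>t i. u t i - \<Psi> c t i)"
    by (rule response_stable[OF u Psi_response C' _ _ _ _ _ eps]) (use eta g_lip in auto)
  from growthD[OF this i, of t] show ?thesis by simp
qed

lemma D_center: "i < n \<Longrightarrow> Re (lam i) = 0 \<Longrightarrow> D c d 0 i = d i"
  using D_response[of d c] by (simp add: response_def green_def)

lemma Psi_zero: "i < n \<Longrightarrow> \<Psi> (\<lambda>_. 0) t i = 0"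
proof -
  have "response (\<lambda>_. 0) (\<lambda>t. g (\<lambda>_. 0)) (\<lambda>t _. 0)"
    using zero_response(1) g_zero by (simp add: response_def)
  from Psi_unique[OF this zero_response(2)] show "i < n \<Longrightarrow> \<Psi> (\<lambda>_. 0) t i = 0" by simp
qed

lemma g1_base_cong:
  assumes "i < n" "\<And>j. j < n \<Longrightarrow> z j = z' j"
  shows "g1 z v i = g1 z' v i"
proof -
  have "nrm n (\<lambda>i. z i - z' i) = 0" using assms by (simp add: nrm_def)
  then have "cmod (g1 z v i - g1 z' v i) \<le> 0"
    using g1_lip[OF assms(1), of z v z'] by simp
  then show ?thesis by simp
qed

text \<open>At the origin the hyperbolic components of the variational equation do not involve the centre components. So they
form by themselves a homogeneous system whose slowly growing solution is zero. This makes the graph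
tangent to the centre subspace.\<close>

lemma D_zero_hyperbolic:
  assumes decoupled: "\<And>v i. i < n \<Longrightarrow> Re (lam i) \<noteq> 0 \<Longrightarrow>
      g1 (\<lambda>_. 0) v i = g1 (\<lambda>_. 0) (\<lambda>j. if Re (lam j) = 0 then 0 else v j) i"
    and i: "i < n" "Re (lam i) \<noteq> 0"
  shows "D (\<lambda>_. 0) d 0 i = 0"
proof -
  \<comment> \<open>The hyperbolic components of \<open>D\<close>, continued by zero, solve the homogeneous problem.\<close>
  define w where "w t j = (if Re (lam j) = 0 then 0 else D (\<lambda>_. 0) d t j)" for t j
  define f where "f t j = (if Re (lam j) = 0 then 0 else g1 (\<lambda>_. 0) (w t) j)" for t j
  have "g1 (\<Psi> (\<lambda>_. 0) t) (D (\<lambda>_. 0) d t) j = g1 (\<lambda>_. 0) (w t) j" if "j < n" "Re (lam j) \<noteq> 0" for t j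
  proof -
    have "g1 (\<Psi> (\<lambda>_. 0) t) (D (\<lambda>_. 0) d t) j = g1 (\<lambda>_. 0) (D (\<lambda>_. 0) d t) j"
      by (rule g1_base_cong) (use that Psi_zero in auto)
    then show ?thesis using decoupled[OF that] by (simp add: w_def[abs_def])
  qed
  note hyp = this
  have w: "response (\<lambda>_. 0) f w"
    unfolding response_def
  proof (intro allI impI)
    fix j assume j: "j < n"
    show "green \<eta> (lam j) 0 (\<lambda>t. f t j) (\<lambda>t. w t j)"
    proof (cases "Re (lam j) = 0")
      case True
      then show ?thesis using zero_response(1) j by (simp add: f_def w_def response_def)
    next
      case False
      then have "f t j = g1 (\<Psi> (\<lambda>_. 0) t) (D (\<lambda>_. 0) d t) j" "w t j = D (\<lambda>_. 0) d t j" for t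
        using hyp[OF j False] by (simp_all add: f_def w_def)
      moreover have "green \<eta> (lam j) (d j) (\<lambda>t. g1 (\<Psi> (\<lambda>_. 0) t) (D (\<lambda>_. 0) d t) j) (\<lambda>t. D (\<lambda>_. 0) d t j)"
        using D_response[of d "\<lambda>_. 0"] j by (simp add: response_def)
      ultimately show ?thesis using False by (simp add: green_def)
    qed
  qed
  have "growth \<eta> (2 * nrm n d) w"
    using D_growth[of d "\<lambda>_. 0"] by (auto simp: growth_def w_def)
  note gw = this
  have "growth \<eta> (2 * (0 + 0 / \<eta>)) (\<lambda>t i. w t i - 0)"
    by (rule response_stable[OF w gw zero_response _ _ _ _ _ eps]) (use eta eps g1_bound in \<open>auto simp: f_def\<close>)
  from growthD[OF this i(1), of 0] show ?thesis using i by (simp add: w_def)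
qed

end

section \<open>A twice differentiable truncation of the identity\<close>

lemma pospow_derivative:
  assumes "2 \<le> k"
  shows "((\<lambda>t. max 0 t ^ k) has_real_derivative real k * max 0 t ^ (k - 1)) (at t)"
proof -
  consider "t < 0" | "t = 0" | "0 < t" by linarith
  then show ?thesis
  proof cases
    case 1
    have "\<forall>\<^sub>F v in nhds t. max 0 v ^ k = 0"
      using eventually_nhds_in_open[of "{..<0}" t] 1 assms by (auto elim!: eventually_mono simp: max_def)
    from DERIV_cong_ev[OF refl this refl]
    have "((\<lambda>t. max 0 t ^ k) has_real_derivative 0) (at t)" by simp
    moreover have z: "real k * max 0 t ^ (k - 1) = 0" using 1 assms by (simp add: max_absorb1 zero_power)
    ultimately show ?thesis unfolding z by simp
  next
    case 2
    have "\<bar>max 0 v ^ k - max 0 0 ^ k - (v - 0) * 0\<bar> \<le> 1 * (v - 0)\<^sup>2" if v: "\<bar>v - 0\<bar> < 1" for v :: real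
    proof -
      have "max 0 v ^ k \<le> max 0 v ^ 2" using v assms by (intro power_decreasing) auto
      also have "\<dots> \<le> v\<^sup>2" by (simp add: max_def)
      finally show ?thesis using assms by (simp add: zero_power)
    qed
    then have "((\<lambda>t. max 0 t ^ k) has_real_derivative 0) (at 0)"
      by (intro derivative_from_second_order[of 1 0 _ 0 1]) auto
    then show ?thesis using 2 assms by (simp add: zero_power)
  next
    case 3
    have "\<forall>\<^sub>F v in nhds t. max 0 v ^ k = v ^ k"
      using eventually_nhds_in_open[of "{0<..}" t] 3 by (auto elim!: eventually_mono simp: max_def)
    then have "((\<lambda>t. max 0 t ^ k) has_real_derivative real k * t ^ (k - 1)) (at t) \<longleftrightarrow>
        ((\<lambda>t. t ^ k) has_real_derivative real k * t ^ (k - 1)) (at t)"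
      by (intro DERIV_cong_ev) auto
    moreover have "((\<lambda>t. t ^ k) has_real_derivative real k * t ^ (k - 1)) (at t)"
      by (auto intro!: derivative_eq_intros)
    ultimately show ?thesis using 3 by (simp add: max_def)
  qed
qed

text \<open>The antiderivative of \<open>truncate1\<close>, which in turn is the antiderivative of the piecewise linear hat functions in
\<open>truncate2\<close>: the identity on \<open>[-1, 1]\<close>, constant outside \<open>[-3, 3]\<close>. Written with powers of positive parts it
is differentiated without case distinctions.\<close>

definition truncate :: "real \<Rightarrow> real" where
  "truncate t = t - (max 0 (t - 1) ^ 3 - 2 * max 0 (t - 2) ^ 3 + max 0 (t - 3) ^ 3) / 6
     + (max 0 (- t - 1) ^ 3 - 2 * max 0 (- t - 2) ^ 3 + max 0 (- t - 3) ^ 3) / 6"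

definition truncate1 :: "real \<Rightarrow> real" where
  "truncate1 t = 1 - (max 0 (t - 1) ^ 2 - 2 * max 0 (t - 2) ^ 2 + max 0 (t - 3) ^ 2) / 2
     - (max 0 (- t - 1) ^ 2 - 2 * max 0 (- t - 2) ^ 2 + max 0 (- t - 3) ^ 2) / 2"

definition truncate2 :: "real \<Rightarrow> real" where
  "truncate2 t = - (max 0 (t - 1) - 2 * max 0 (t - 2) + max 0 (t - 3))
     + (max 0 (- t - 1) - 2 * max 0 (- t - 2) + max 0 (- t - 3))"

lemma pospow_shift_derivative:
  assumes "2 \<le> k" "(f has_real_derivative d) (at t)"
  shows "((\<lambda>t. max 0 (f t) ^ k) has_real_derivative real k * max 0 (f t) ^ (k - 1) * d) (at t)"
  using DERIV_chain2[OF pospow_derivative[OF assms(1)] assms(2)] .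

lemma truncate_derivative: "(truncate has_real_derivative truncate1 t) (at t)"
  unfolding truncate_def[abs_def]
  by (rule derivative_eq_intros pospow_shift_derivative refl | simp)+
    (simp add: truncate1_def field_simps)

lemma truncate1_derivative: "(truncate1 has_real_derivative truncate2 t) (at t)"
  unfolding truncate1_def[abs_def]
  by (rule derivative_eq_intros pospow_shift_derivative refl | simp)+
    (simp add: truncate2_def field_simps)

lemma truncate_id: "\<bar>t\<bar> \<le> 1 \<Longrightarrow> truncate t = t"
  by (auto simp: truncate_def max_def)

lemma truncate2_lipschitz: "\<bar>truncate2 s - truncate2 t\<bar> \<le> 8 * \<bar>s - t\<bar>"
  unfolding truncate2_def by (auto simp: max_def abs_if)

lemma truncate2_bound: "\<bar>truncate2 t\<bar> \<le> 1"
  unfolding truncate2_def by (auto simp: max_def abs_if)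

lemma truncate1_bound: "\<bar>truncate1 t\<bar> \<le> 1"
proof -
  have *: "0 \<le> truncate1 t \<and> truncate1 t \<le> 1" if "0 \<le> t" for t
  proof -
    consider "t \<le> 1" | "1 < t" "t \<le> 2" | "2 < t" "t \<le> 3" | "3 < t" by linarith
    then show ?thesis
    proof cases
      case 1 then show ?thesis using that by (auto simp: truncate1_def max_def)
    next
      case 2
      then have "truncate1 t = 1 - (t - 1)\<^sup>2 / 2" by (auto simp: truncate1_def max_def)
      moreover have "(t - 1)\<^sup>2 \<le> 1" using 2 by (intro power_le_one) auto
      ultimately show ?thesis by simp
    next
      case 3
      then have "truncate1 t = (t - 3)\<^sup>2 / 2" by (simp add: truncate1_def max_def power2_eq_square field_simps)
      moreover have "(3 - t)\<^sup>2 \<le> 1" using 3 by (intro power_le_one) auto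
      moreover have "(t - 3)\<^sup>2 = (3 - t)\<^sup>2" by (rule power2_commute)
      moreover have "0 \<le> (t - 3)\<^sup>2" by simp
      ultimately show ?thesis by linarith
    next
      case 4
      then have "truncate1 t = 0" by (auto simp: truncate1_def max_def power2_eq_square algebra_simps)
      then show ?thesis by simp
    qed
  qed
  have "truncate1 (- t) = truncate1 t" by (simp add: truncate1_def algebra_simps)
  then show ?thesis using *[of t] *[of "- t"] by (cases "0 \<le> t") auto
qed

lemma lipschitz_from_derivative:
  fixes f :: "real \<Rightarrow> real"
  assumes "\<And>t. (f has_real_derivative f' t) (at t)" "\<And>t. \<bar>f' t\<bar> \<le> B"
  shows "\<bar>f s - f t\<bar> \<le> B * \<bar>s - t\<bar>"
  using field_differentiable_bound[of UNIV f f' B s t] assms by simp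

lemma truncate_bound: "\<bar>truncate t\<bar> \<le> 3"
proof (cases "\<bar>t\<bar> \<le> 3")
  case True
  have "\<bar>truncate t - truncate 0\<bar> \<le> 1 * \<bar>t - 0\<bar>"
    by (rule lipschitz_from_derivative[OF truncate_derivative truncate1_bound])
  then show ?thesis using True truncate_id[of 0] by simp
next
  case False
  then consider "3 < t" | "t < - 3" by linarith
  then have "truncate t = 2 \<or> truncate t = - 2"
    by cases (simp_all add: truncate_def max_def power3_eq_cube field_simps)
  then show ?thesis by auto
qed

text \<open>Rescaling: the derivative stays bounded by \<open>1\<close> however small the cube is, while the second derivative grows like
\<open>1 / \<delta>\<close>, which is harmless because only its finiteness is used.\<close>

lemma truncation:
  assumes "0 < \<delta>"
  shows "\<exists>h h1 h2 c. (\<forall>t. (h has_real_derivative h1 t) (at t)) \<and> (\<forall>t. (h1 has_real_derivative h2 t) (at t)) \<and>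
    (\<forall>t. \<bar>h t\<bar> \<le> 3 * \<delta>) \<and> (\<forall>t. \<bar>h1 t\<bar> \<le> 1) \<and> (\<forall>t. \<bar>h2 t\<bar> \<le> c) \<and>
    (\<forall>s t. \<bar>h2 s - h2 t\<bar> \<le> c * \<bar>s - t\<bar>) \<and> (\<forall>t. \<bar>t\<bar> \<le> \<delta> \<longrightarrow> h t = (t::real)) \<and> h1 0 = (1::real)"
proof -
  define h where "h t = \<delta> * truncate (t / \<delta>)" for t
  define h1 where "h1 t = truncate1 (t / \<delta>)" for t
  define h2 where "h2 t = truncate2 (t / \<delta>) / \<delta>" for t
  have s: "((\<lambda>t. t / \<delta>) has_real_derivative 1 / \<delta>) (at t)" for t
    using assms by (auto intro!: derivative_eq_intros)
  have 1: "(h has_real_derivative h1 t) (at t)" for t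
    unfolding h_def[abs_def] h1_def using DERIV_cmult[OF DERIV_chain2[OF truncate_derivative s], of \<delta>] assms by simp
  have 2: "(h1 has_real_derivative h2 t) (at t)" for t
    unfolding h1_def[abs_def] h2_def using DERIV_chain2[OF truncate1_derivative s] by simp
  have 3: "\<bar>h t\<bar> \<le> 3 * \<delta>" for t
    using mult_left_mono[OF truncate_bound[of "t / \<delta>"], of \<delta>] assms by (simp add: h_def abs_mult mult.commute)
  have 4: "\<bar>h1 t\<bar> \<le> 1" for t by (simp add: h1_def truncate1_bound)
  have 5: "\<bar>h2 t\<bar> \<le> 1 / \<delta>" for t
    using divide_right_mono[OF truncate2_bound[of "t / \<delta>"], of \<delta>] assms by (simp add: h2_def)
  have 6: "\<bar>h2 s - h2 t\<bar> \<le> 8 / \<delta>\<^sup>2 * \<bar>s - t\<bar>" for s t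
  proof -
    have "\<bar>h2 s - h2 t\<bar> = \<bar>truncate2 (s / \<delta>) - truncate2 (t / \<delta>)\<bar> / \<delta>"
      using assms by (simp add: h2_def flip: diff_divide_distrib)
    also have "\<dots> \<le> 8 * \<bar>s / \<delta> - t / \<delta>\<bar> / \<delta>" using assms by (intro divide_right_mono truncate2_lipschitz) auto
    also have "\<dots> = 8 / \<delta>\<^sup>2 * \<bar>s - t\<bar>" using assms by (simp add: power2_eq_square flip: diff_divide_distrib)
    finally show ?thesis .
  qed
  have 7: "h t = t" if "\<bar>t\<bar> \<le> \<delta>" for t using truncate_id[of "t / \<delta>"] that assms by (simp add: h_def)
  define c where "c = max (1 / \<delta>) (8 / \<delta>\<^sup>2)"
  have "\<bar>h2 t\<bar> \<le> c" for t using 5[of t] by (simp add: c_def)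
  moreover have "\<bar>h2 s - h2 t\<bar> \<le> c * \<bar>s - t\<bar>" for s t
    using 6[of s t] mult_right_mono[of "8 / \<delta>\<^sup>2" c "\<bar>s - t\<bar>"] by (simp add: c_def)
  moreover have "h1 0 = 1" by (simp add: h1_def truncate1_def max_def)
  ultimately show ?thesis using 1 2 3 4 7
    by (intro exI[where x = h] exI[where x = h1] exI[where x = h2] exI[where x = c]) simp
qed

section \<open>Cutting off a nonlinearity that is flat at the origin\<close>

definition l1 :: "nat \<Rightarrow> (nat \<Rightarrow> real) \<Rightarrow> (nat \<Rightarrow> real) \<Rightarrow> real" where
  "l1 r x y = (\<Sum>i<r. \<bar>y i - x i\<bar>)"

lemma l1_nonneg [simp]: "0 \<le> l1 r x y"
  by (simp add: l1_def sum_nonneg)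

lemma l1_coordinate: "i < r \<Longrightarrow> \<bar>y i - x i\<bar> \<le> l1 r x y"
  unfolding l1_def by (rule member_le_sum) auto

text \<open>Bounded with an affine modulus of continuity; on compact cubes this holds for every continuous function, and it is
stable under sums, products and composition with Lipschitz maps.\<close>

definition tame :: "nat \<Rightarrow> (nat \<Rightarrow> real) set \<Rightarrow> ((nat \<Rightarrow> real) \<Rightarrow> real) \<Rightarrow> bool" where
  "tame r X f \<longleftrightarrow> (\<exists>B\<ge>0. \<forall>x\<in>X. \<bar>f x\<bar> \<le> B) \<and>
     (\<forall>e>0. \<exists>K\<ge>0. \<forall>x\<in>X. \<forall>y\<in>X. \<bar>f y - f x\<bar> \<le> e + K * l1 r x y)"

lemma tame_boundE:
  assumes "tame r X f" obtains B where "0 \<le> B" "\<And>x. x \<in> X \<Longrightarrow> \<bar>f x\<bar> \<le> B"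
  using assms unfolding tame_def by blast

lemma tame_modulusE:
  assumes "tame r X f" "0 < e"
  obtains K where "0 \<le> K" "\<And>x y. x \<in> X \<Longrightarrow> y \<in> X \<Longrightarrow> \<bar>f y - f x\<bar> \<le> e + K * l1 r x y"
  using assms unfolding tame_def by blast

lemma tame_lipschitz:
  assumes "0 \<le> B" "\<And>x. x \<in> X \<Longrightarrow> \<bar>f x\<bar> \<le> B" "0 \<le> K" "\<And>x y. x \<in> X \<Longrightarrow> y \<in> X \<Longrightarrow> \<bar>f y - f x\<bar> \<le> K * l1 r x y"
  shows "tame r X f"
proof -
  have "\<bar>f y - f x\<bar> \<le> e + K * l1 r x y" if "x \<in> X" "y \<in> X" "0 < e" for x y e
    using assms(4)[OF that(1,2)] that(3) by linarith
  then show ?thesis unfolding tame_def using assms(1-3) by blast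
qed

lemma tame_add:
  assumes f: "tame r X f" and g: "tame r X g" shows "tame r X (\<lambda>x. f x + g x)"
proof -
  obtain A B where A: "0 \<le> A" "\<And>x. x \<in> X \<Longrightarrow> \<bar>f x\<bar> \<le> A" and B: "0 \<le> B" "\<And>x. x \<in> X \<Longrightarrow> \<bar>g x\<bar> \<le> B"
    using tame_boundE[OF f] tame_boundE[OF g] by metis
  have "\<bar>f x + g x\<bar> \<le> A + B" if "x \<in> X" for x using A(2)[OF that] B(2)[OF that] by linarith
  moreover have "\<exists>K\<ge>0. \<forall>x\<in>X. \<forall>y\<in>X. \<bar>f y + g y - (f x + g x)\<bar> \<le> e + K * l1 r x y" if e: "0 < e" for e :: real
  proof -
    obtain K where K: "0 \<le> K" "\<And>x y. x \<in> X \<Longrightarrow> y \<in> X \<Longrightarrow> \<bar>f y - f x\<bar> \<le> e / 2 + K * l1 r x y"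
      using tame_modulusE[OF f, of "e / 2"] e by auto
    obtain K' where K': "0 \<le> K'" "\<And>x y. x \<in> X \<Longrightarrow> y \<in> X \<Longrightarrow> \<bar>g y - g x\<bar> \<le> e / 2 + K' * l1 r x y"
      using tame_modulusE[OF g, of "e / 2"] e by auto
    have "\<bar>f y + g y - (f x + g x)\<bar> \<le> e + (K + K') * l1 r x y" if "x \<in> X" "y \<in> X" for x y
      using K(2)[OF that] K'(2)[OF that] by (simp add: distrib_right)
    then show ?thesis using K(1) K'(1) by (intro exI[of _ "K + K'"]) auto
  qed
  ultimately show ?thesis unfolding tame_def using A(1) B(1) by (intro conjI exI[of _ "A + B"]) auto
qed

lemma tame_mult:
  assumes f: "tame r X f" and g: "tame r X g" shows "tame r X (\<lambda>x. f x * g x)"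
proof -
  obtain A B where A: "0 \<le> A" "\<And>x. x \<in> X \<Longrightarrow> \<bar>f x\<bar> \<le> A" and B: "0 \<le> B" "\<And>x. x \<in> X \<Longrightarrow> \<bar>g x\<bar> \<le> B"
    using tame_boundE[OF f] tame_boundE[OF g] by metis
  have "\<bar>f x * g x\<bar> \<le> A * B" if "x \<in> X" for x
    unfolding abs_mult using A(2)[OF that] B(2)[OF that] A(1) by (intro mult_mono) auto
  moreover have "\<exists>K\<ge>0. \<forall>x\<in>X. \<forall>y\<in>X. \<bar>f y * g y - f x * g x\<bar> \<le> e + K * l1 r x y" if e: "0 < e" for e :: real
  proof -
    define e1 where "e1 = e / (A + B + 1)"
    have e1: "0 < e1" "e1 * (A + B) \<le> e"
    proof -
      show "0 < e1" using e A(1) B(1) by (simp add: e1_def)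
      have "e1 * (A + B) \<le> e1 * (A + B + 1)" using \<open>0 < e1\<close> by simp
      also have "\<dots> = e" using A(1) B(1) by (simp add: e1_def)
      finally show "e1 * (A + B) \<le> e" .
    qed
    obtain K where K: "0 \<le> K" "\<And>x y. x \<in> X \<Longrightarrow> y \<in> X \<Longrightarrow> \<bar>f y - f x\<bar> \<le> e1 + K * l1 r x y"
      using tame_modulusE[OF f e1(1)] by metis
    obtain K' where K': "0 \<le> K'" "\<And>x y. x \<in> X \<Longrightarrow> y \<in> X \<Longrightarrow> \<bar>g y - g x\<bar> \<le> e1 + K' * l1 r x y"
      using tame_modulusE[OF g e1(1)] by metis
    have "\<bar>f y * g y - f x * g x\<bar> \<le> e + (K * B + A * K') * l1 r x y" if xy: "x \<in> X" "y \<in> X" for x y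
    proof -
      have "f y * g y - f x * g x = (f y - f x) * g y + f x * (g y - g x)" by (simp add: algebra_simps)
      then have "\<bar>f y * g y - f x * g x\<bar> \<le> \<bar>f y - f x\<bar> * \<bar>g y\<bar> + \<bar>f x\<bar> * \<bar>g y - g x\<bar>"
        using abs_triangle_ineq[of "(f y - f x) * g y" "f x * (g y - g x)"] by (simp add: abs_mult)
      also have "\<dots> \<le> (e1 + K * l1 r x y) * B + A * (e1 + K' * l1 r x y)"
        using K(2)[OF xy] K'(2)[OF xy] A(2)[OF xy(1)] B(2)[OF xy(2)] A(1) B(1) K(1) K'(1) e1(1)
        by (intro add_mono mult_mono) auto
      also have "\<dots> = e1 * (A + B) + (K * B + A * K') * l1 r x y" by (simp add: algebra_simps)
      finally show ?thesis using e1(2) by linarith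
    qed
    then show ?thesis using K(1) K'(1) A(1) B(1) by (intro exI[of _ "K * B + A * K'"]) auto
  qed
  ultimately show ?thesis unfolding tame_def using A(1) B(1) by (intro conjI exI[of _ "A * B"]) auto
qed

lemma cube_compact: "compact (cube r a)"
proof -
  define T where "T i = (if i < r then {- a..a} else {0::real})" for i :: nat
  have "(x i \<in> T i) \<longleftrightarrow> (i < r \<longrightarrow> \<bar>x i\<bar> \<le> a) \<and> (r \<le> i \<longrightarrow> x i = 0)" for x i
    by (auto simp: T_def not_less)
  then have mem: "x \<in> cube r a \<longleftrightarrow> (\<forall>i. x i \<in> T i)" for x by (auto simp: cube_def Eucl_iff)
  have "cube r a = (\<Pi>\<^sub>E i\<in>UNIV. T i)"
  proof (rule Set.set_eqI)
    fix x show "x \<in> cube r a \<longleftrightarrow> x \<in> (\<Pi>\<^sub>E i\<in>UNIV. T i)"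
      unfolding mem PiE_UNIV_domain Pi_iff by (simp only: ball_UNIV)
  qed
  moreover have "compactin (product_topology (\<lambda>i. euclidean) UNIV) (\<Pi>\<^sub>E i\<in>UNIV. T i)"
    unfolding compactin_PiE by (intro disjI2 ballI) (simp add: T_def)
  ultimately show ?thesis by (simp only: euclidean_product_topology compactin_euclidean_iff)
qed

text \<open>Below the \<open>\<delta>\<close> of uniform continuity the difference is at most \<open>e\<close>; beyond it, the bound \<open>2 B\<close> is dominated by \<open>K\<close> times the
distance.\<close>

lemma tame_on_cube:
  assumes W: "cube r a \<subseteq> W" "W \<subseteq> Eucl r"
    and f: "continuous_map (subtopology (Euclidean_space r) W) euclideanreal f"
  shows "tame r (cube r a) f"
proof -
  have cE: "cube r a \<subseteq> Eucl r" by (auto simp: cube_def)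
  have "continuous_map (subtopology (Euclidean_space r) (cube r a)) euclideanreal f"
    using f W(1) by (rule continuous_map_from_subtopology_mono)
  then have "continuous_map (top_of_set (cube r a)) euclideanreal f"
    unfolding Euclidean_space_def euclidean_product_topology subtopology_subtopology
    using cE by (simp add: topspace_Euclidean_space Int_absorb1)
  then have cont: "continuous_on (cube r a) f" by simp
  obtain B where B: "\<And>x. x \<in> cube r a \<Longrightarrow> \<bar>f x\<bar> \<le> B"
    using compact_imp_bounded[OF compact_continuous_image[OF cont cube_compact]]
    unfolding bounded_iff by auto
  have uc: "uniformly_continuous_on (cube r a) f"
    by (rule compact_uniformly_continuous[OF cont cube_compact])
  have "\<exists>K\<ge>0. \<forall>x\<in>cube r a. \<forall>y\<in>cube r a. \<bar>f y - f x\<bar> \<le> e + K * l1 r x y" if e: "0 < e" for e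
  proof -
    obtain d where d: "0 < d" "\<And>x y. x \<in> cube r a \<Longrightarrow> y \<in> cube r a \<Longrightarrow> dist y x < d \<Longrightarrow> dist (f y) (f x) < e"
      using uc e unfolding uniformly_continuous_on_def by metis
    obtain d' where d': "0 < d'" "\<And>x y. x \<in> Eucl r \<Longrightarrow> y \<in> Eucl r \<Longrightarrow> box_close r d' x y \<Longrightarrow> dist x y < d"
      using box_close_imp_dist[OF d(1), of r] by metis
    define K where "K = 2 * \<bar>B\<bar> / d'"
    have K: "0 \<le> K" using d'(1) by (simp add: K_def)
    have "\<bar>f y - f x\<bar> \<le> e + K * l1 r x y" if xy: "x \<in> cube r a" "y \<in> cube r a" for x y
    proof (cases "box_close r d' x y")
      case True
      then have "dist y x < d" using d'(2)[of x y] xy cE by (auto simp: dist_commute)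
      then have "\<bar>f y - f x\<bar> < e" using d(2)[OF xy] by (simp add: dist_real_def)
      moreover have "0 \<le> K * l1 r x y" using K by simp
      ultimately show ?thesis by linarith
    next
      case False
      then obtain i where "i < r" "d' \<le> \<bar>y i - x i\<bar>" by (auto simp: box_close_def not_less)
      then have "d' \<le> l1 r x y" using l1_coordinate[of i r y x] by linarith
      then have "K * d' \<le> K * l1 r x y" using K by (intro mult_left_mono)
      moreover have "\<bar>f y - f x\<bar> \<le> 2 * \<bar>B\<bar>" using B[OF xy(1)] B[OF xy(2)] by linarith
      moreover have "K * d' = 2 * \<bar>B\<bar>" using d'(1) by (simp add: K_def)
      ultimately show ?thesis using e by linarith
    qed
    then show ?thesis using K by blast
  qed
  moreover have "\<bar>f x\<bar> \<le> \<bar>B\<bar>" if "x \<in> cube r a" for x using B[OF that] by linarith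
  ultimately show ?thesis unfolding tame_def by (intro conjI exI[of _ "\<bar>B\<bar>"]) auto
qed

text \<open>Mean value theorem along a segment with a formal gradient \<open>G\<close>; the intermediate point is no farther from \<open>x\<close> than
\<open>y\<close>, which is all that moduli of continuity need.\<close>

lemma segment_mvt:
  assumes "\<And>t. 0 \<le> t \<Longrightarrow> t \<le> 1 \<Longrightarrow>
      ((\<lambda>t. F (\<lambda>i. x i + t * (y i - x i))) has_real_derivative (\<Sum>l<r. G (\<lambda>i. x i + t * (y i - x i)) l * (y l - x l))) (at t)"
    and x: "x \<in> Eucl r" "y \<in> Eucl r"
  shows "\<exists>z\<in>Eucl r. l1 r x z \<le> l1 r x y \<and> F y - F x = (\<Sum>l<r. G z l * (y l - x l))"
proof -
  define p where "p t = (\<lambda>i. x i + t * (y i - x i))" for t :: real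
  obtain t where t: "0 < t" "t < 1" "F (p 1) - F (p 0) = (1 - 0) * (\<Sum>l<r. G (p t) l * (y l - x l))"
    using MVT2[of 0 1 "\<lambda>t. F (p t)" "\<lambda>t. \<Sum>l<r. G (p t) l * (y l - x l)"] assms(1) by (auto simp: p_def)
  have "l1 r x (p t) \<le> l1 r x y"
    unfolding l1_def
  proof (rule sum_mono)
    fix i
    show "\<bar>p t i - x i\<bar> \<le> \<bar>y i - x i\<bar>"
      using t mult_right_mono[of "\<bar>t\<bar>" 1 "\<bar>y i - x i\<bar>"] by (simp add: p_def abs_mult)
  qed
  moreover have "p t \<in> Eucl r" using x by (auto simp: p_def Eucl_iff)
  moreover have "p 1 = y" "p 0 = x" by (auto simp: p_def)
  ultimately show ?thesis using t by auto
qed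

lemma weighted_sum_bound:
  assumes "\<And>l. l < r \<Longrightarrow> \<bar>c l\<bar> \<le> B"
  shows "\<bar>\<Sum>l<r. c l * (y l - x l)\<bar> \<le> B * l1 r x y"
proof -
  have "\<bar>\<Sum>l<r. c l * (y l - x l)\<bar> \<le> (\<Sum>l<r. \<bar>c l * (y l - x l)\<bar>)" by (rule sum_abs)
  also have "\<dots> \<le> (\<Sum>l<r. B * \<bar>y l - x l\<bar>)"
    using assms by (intro sum_mono) (auto simp: abs_mult intro!: mult_right_mono)
  finally show ?thesis by (simp add: l1_def sum_distrib_left)
qed

text \<open>A function on the whole of \<open>\<real>\<^sup>r\<close> with gradient \<open>F1\<close> and Hessian \<open>F2\<close>, vanishing to first order at the origin, whose gradient is
everywhere at most \<open>\<epsilon>\<close>, with all the Taylor estimates that \<open>C\<^sup>2\<close> regularity gives, uniformly in the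
points.\<close>

definition flat_extension ::
  "nat \<Rightarrow> real \<Rightarrow> ((nat \<Rightarrow> real) \<Rightarrow> real) \<Rightarrow> ((nat \<Rightarrow> real) \<Rightarrow> nat \<Rightarrow> real) \<Rightarrow> ((nat \<Rightarrow> real) \<Rightarrow> nat \<Rightarrow> nat \<Rightarrow> real) \<Rightarrow> real \<Rightarrow> bool" where
  "flat_extension r \<epsilon> F F1 F2 M \<longleftrightarrow> 0 \<le> M \<and> F origin = 0 \<and> (\<forall>l<r. F1 origin l = 0) \<and>
     (\<forall>x\<in>Eucl r. \<forall>l<r. \<bar>F1 x l\<bar> \<le> \<epsilon>) \<and>
     (\<forall>x\<in>Eucl r. \<forall>y\<in>Eucl r. \<bar>F y - F x\<bar> \<le> \<epsilon> * l1 r x y) \<and>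
     (\<forall>x\<in>Eucl r. \<forall>y\<in>Eucl r. \<bar>F y - F x - (\<Sum>l<r. F1 x l * (y l - x l))\<bar> \<le> M * (l1 r x y)\<^sup>2) \<and>
     (\<forall>x\<in>Eucl r. \<forall>y\<in>Eucl r. \<forall>l<r. \<bar>F1 y l - F1 x l\<bar> \<le> M * l1 r x y) \<and>
     (\<forall>x\<in>Eucl r. \<forall>l<r. \<forall>m<r. \<bar>F2 x l m\<bar> \<le> M) \<and>
     (\<forall>e>0. \<exists>K\<ge>0. \<forall>x\<in>Eucl r. \<forall>y\<in>Eucl r. \<forall>l<r.
        \<bar>F1 y l - F1 x l - (\<Sum>m<r. F2 x l m * (y m - x m))\<bar> \<le> (e + K * l1 r x y) * l1 r x y) \<and>
     (\<forall>e>0. \<exists>K\<ge>0. \<forall>x\<in>Eucl r. \<forall>y\<in>Eucl r. \<forall>l<r. \<forall>m<r.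
        \<bar>F2 y l m - F2 x l m\<bar> \<le> e + K * l1 r x y)"

text \<open>All the uniform estimates follow from mean value representations of the increments of \<open>F\<close> and \<open>F1\<close> and from the tameness
of the Hessian.\<close>

lemma flat_extensionI:
  assumes F0: "F origin = 0" "\<And>l. l < r \<Longrightarrow> F1 origin l = 0"
    and F1: "\<And>x l. x \<in> Eucl r \<Longrightarrow> l < r \<Longrightarrow> \<bar>F1 x l\<bar> \<le> \<epsilon>"
    and dF: "\<And>x y. x \<in> Eucl r \<Longrightarrow> y \<in> Eucl r \<Longrightarrow>
      \<exists>z\<in>Eucl r. l1 r x z \<le> l1 r x y \<and> F y - F x = (\<Sum>l<r. F1 z l * (y l - x l))"
    and dF1: "\<And>x y l. x \<in> Eucl r \<Longrightarrow> y \<in> Eucl r \<Longrightarrow> l < r \<Longrightarrow>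
      \<exists>z\<in>Eucl r. l1 r x z \<le> l1 r x y \<and> F1 y l - F1 x l = (\<Sum>m<r. F2 z l m * (y m - x m))"
    and F2: "\<And>l m. l < r \<Longrightarrow> m < r \<Longrightarrow> tame r (Eucl r) (\<lambda>x. F2 x l m)"
  shows "\<exists>M. flat_extension r \<epsilon> F F1 F2 M"
proof -
  have "\<exists>B\<ge>0. \<forall>x\<in>Eucl r. \<bar>F2 x l m\<bar> \<le> B" if "l < r" "m < r" for l m
    using F2[OF that] by (auto simp: tame_def)
  then obtain B where B: "\<And>l m. l < r \<Longrightarrow> m < r \<Longrightarrow> 0 \<le> B l m \<and> (\<forall>x\<in>Eucl r. \<bar>F2 x l m\<bar> \<le> B l m)" by metis
  define M where "M = (\<Sum>l<r. \<Sum>m<r. B l m)"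
  have le_M: "B l m \<le> M" if "l < r" "m < r" for l m
  proof -
    have "B l m \<le> (\<Sum>m<r. B l m)" using B that by (intro member_le_sum) auto
    also have "\<dots> \<le> M" unfolding M_def using B that
      by (intro member_le_sum[of l "{..<r}" "\<lambda>l. \<Sum>m<r. B l m"] sum_nonneg) auto
    finally show ?thesis .
  qed
  have M: "0 \<le> M" unfolding M_def using B by (intro sum_nonneg) auto
  have F2M: "\<bar>F2 x l m\<bar> \<le> M" if "x \<in> Eucl r" "l < r" "m < r" for x l m
    using B[OF that(2,3)] le_M[OF that(2,3)] that(1) by force
  have mod: "\<exists>K\<ge>0. \<forall>x\<in>Eucl r. \<forall>y\<in>Eucl r. \<forall>l<r. \<forall>m<r. \<bar>F2 y l m - F2 x l m\<bar> \<le> e + K * l1 r x y" if e: "0 < e" for e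
  proof -
    have "\<exists>K\<ge>0. \<forall>x\<in>Eucl r. \<forall>y\<in>Eucl r. \<bar>F2 y l m - F2 x l m\<bar> \<le> e + K * l1 r x y" if "l < r" "m < r" for l m
      using F2[OF that] e by (auto simp: tame_def)
    then obtain K where K: "\<And>l m. l < r \<Longrightarrow> m < r \<Longrightarrow> 0 \<le> K l m \<and>
        (\<forall>x\<in>Eucl r. \<forall>y\<in>Eucl r. \<bar>F2 y l m - F2 x l m\<bar> \<le> e + K l m * l1 r x y)" by metis
    define K' where "K' = (\<Sum>l<r. \<Sum>m<r. K l m)"
    have "\<bar>F2 y l m - F2 x l m\<bar> \<le> e + K' * l1 r x y" if xy: "x \<in> Eucl r" "y \<in> Eucl r" and lm: "l < r" "m < r" for x y l m
    proof -
      have "K l m \<le> (\<Sum>m<r. K l m)" using K lm by (intro member_le_sum) auto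
      also have "\<dots> \<le> K'" unfolding K'_def using K lm
        by (intro member_le_sum[of l "{..<r}" "\<lambda>l. \<Sum>m<r. K l m"] sum_nonneg) auto
      finally have "K l m * l1 r x y \<le> K' * l1 r x y" by (intro mult_right_mono) auto
      then show ?thesis using K[OF lm] xy by force
    qed
    moreover have "0 \<le> K'" unfolding K'_def using K by (intro sum_nonneg) auto
    ultimately show ?thesis by blast
  qed
  have lip1: "\<bar>F1 y l - F1 x l\<bar> \<le> M * l1 r x y" if xy: "x \<in> Eucl r" "y \<in> Eucl r" and l: "l < r" for x y l
  proof -
    obtain z where z: "z \<in> Eucl r" "F1 y l - F1 x l = (\<Sum>m<r. F2 z l m * (y m - x m))" using dF1[OF xy l] by blast
    show ?thesis unfolding z(2) by (rule weighted_sum_bound) (use F2M z(1) l in auto)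
  qed
  have lip: "\<bar>F y - F x\<bar> \<le> \<epsilon> * l1 r x y" if xy: "x \<in> Eucl r" "y \<in> Eucl r" for x y
  proof -
    obtain z where z: "z \<in> Eucl r" "F y - F x = (\<Sum>l<r. F1 z l * (y l - x l))" using dF[OF xy] by blast
    show ?thesis unfolding z(2) by (rule weighted_sum_bound) (use F1 z(1) in auto)
  qed
  have taylor: "\<bar>F y - F x - (\<Sum>l<r. F1 x l * (y l - x l))\<bar> \<le> M * (l1 r x y)\<^sup>2" if xy: "x \<in> Eucl r" "y \<in> Eucl r" for x y
  proof -
    obtain z where z: "z \<in> Eucl r" "l1 r x z \<le> l1 r x y" "F y - F x = (\<Sum>l<r. F1 z l * (y l - x l))" using dF[OF xy] by blast
    have "F y - F x - (\<Sum>l<r. F1 x l * (y l - x l)) = (\<Sum>l<r. (F1 z l - F1 x l) * (y l - x l))"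
      unfolding z(3) by (simp add: left_diff_distrib sum_subtractf)
    also have "\<bar>\<dots>\<bar> \<le> (M * l1 r x y) * l1 r x y"
    proof (rule weighted_sum_bound)
      fix l assume "l < r"
      then have "\<bar>F1 z l - F1 x l\<bar> \<le> M * l1 r x z" using lip1 xy z(1) by blast
      also have "\<dots> \<le> M * l1 r x y" using z(2) M by (rule mult_left_mono)
      finally show "\<bar>F1 z l - F1 x l\<bar> \<le> M * l1 r x y" .
    qed
    finally show ?thesis by (simp add: power2_eq_square mult.assoc)
  qed
  have mod1: "\<exists>K\<ge>0. \<forall>x\<in>Eucl r. \<forall>y\<in>Eucl r. \<forall>l<r.
        \<bar>F1 y l - F1 x l - (\<Sum>m<r. F2 x l m * (y m - x m))\<bar> \<le> (e + K * l1 r x y) * l1 r x y" if e: "0 < e" for e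
  proof -
    obtain K where K: "0 \<le> K" "\<forall>x\<in>Eucl r. \<forall>y\<in>Eucl r. \<forall>l<r. \<forall>m<r. \<bar>F2 y l m - F2 x l m\<bar> \<le> e + K * l1 r x y"
      using mod[OF e] by blast
    have "\<bar>F1 y l - F1 x l - (\<Sum>m<r. F2 x l m * (y m - x m))\<bar> \<le> (e + K * l1 r x y) * l1 r x y"
      if xy: "x \<in> Eucl r" "y \<in> Eucl r" and l: "l < r" for x y l
    proof -
      obtain z where z: "z \<in> Eucl r" "l1 r x z \<le> l1 r x y" "F1 y l - F1 x l = (\<Sum>m<r. F2 z l m * (y m - x m))"
        using dF1[OF xy l] by blast
      have "F1 y l - F1 x l - (\<Sum>m<r. F2 x l m * (y m - x m)) = (\<Sum>m<r. (F2 z l m - F2 x l m) * (y m - x m))"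
        unfolding z(3) by (simp add: left_diff_distrib sum_subtractf)
      also have "\<bar>\<dots>\<bar> \<le> (e + K * l1 r x y) * l1 r x y"
      proof (rule weighted_sum_bound)
        fix m assume "m < r"
        then have "\<bar>F2 z l m - F2 x l m\<bar> \<le> e + K * l1 r x z" using K(2) xy z(1) l by blast
        also have "\<dots> \<le> e + K * l1 r x y" using z(2) K(1) by (simp add: mult_left_mono)
        finally show "\<bar>F2 z l m - F2 x l m\<bar> \<le> e + K * l1 r x y" .
      qed
      finally show ?thesis .
    qed
    then show ?thesis using K(1) by blast
  qed
  have "flat_extension r \<epsilon> F F1 F2 M"
    unfolding flat_extension_def
    by (intro conjI) (use M F0 F1 lip taylor lip1 F2M mod1 mod in blast)+
  then show ?thesis by blast
qed

text \<open>Compose \<open>f\<close> with the truncation \<open>\<Theta>\<close> of each coordinate. The range of \<open>\<Theta>\<close> is a small cube, where the gradient of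
\<open>f\<close> is small because it vanishes at the origin; and \<open>\<Theta>\<close> does not increase it, since its own derivative is at
most \<open>1\<close>. Composition avoids the product with a bump function, whose derivative would have to be balanced against the size
of \<open>f\<close>.\<close>

lemma cutoff:
  assumes W: "openin (Euclidean_space r) W" "origin \<in> W" and f: "Ck_scalar 2 r W f"
    and f0: "f origin = 0" "\<And>l. l < r \<Longrightarrow> partial_deriv l f origin = 0" and \<epsilon>: "0 < \<epsilon>"
  shows "\<exists>\<delta>0>0. \<forall>\<delta>. 0 < \<delta> \<longrightarrow> \<delta> \<le> \<delta>0 \<longrightarrow>
    (\<exists>F F1 F2 M. flat_extension r \<epsilon> F F1 F2 M \<and> (\<forall>x\<in>cube r \<delta>. F x = f x))"
proof -
  have WE: "W \<subseteq> Eucl r" using W openin_subset by blast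
  have f1: "Ck_scalar 1 r W f" "\<And>l. l < r \<Longrightarrow> Ck_scalar 1 r W (partial_deriv l f)"
    using f by (auto simp: numeral_2_eq_2)
  have f2: "continuous_map (subtopology (Euclidean_space r) W) euclideanreal (partial_deriv m (partial_deriv l f))" if "l < r" "m < r" for l m
    using f that by (auto simp: numeral_2_eq_2)
  obtain d0 where d0: "d0 > 0" "\<forall>y\<in>Eucl r. box_close r d0 origin y \<longrightarrow> y \<in> W"
    using W unfolding openin_Eucl_iff by blast
  have "\<exists>d>0. \<forall>y\<in>W. box_close r d origin y \<longrightarrow> \<bar>partial_deriv l f y - partial_deriv l f origin\<bar> < \<epsilon>" if "l < r" for l
    using Ck_scalar_continuous[OF f1(2)[OF that]] W(2) \<epsilon> by (simp add: continuous_Eucl_iff[OF WE])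
  then obtain d where d: "\<And>l. l < r \<Longrightarrow> d l > 0 \<and> (\<forall>y\<in>W. box_close r (d l) origin y \<longrightarrow> \<bar>partial_deriv l f y - partial_deriv l f origin\<bar> < \<epsilon>)"
    by metis
  \<comment> \<open>The truncation takes values up to \<open>3 \<delta>\<close>, whence the bound \<open>d' / 4\<close> for \<open>\<delta>\<close>.\<close>
  define d' where "d' = Min (insert d0 (d ` {..<r}))"
  have d': "d' > 0" "d' \<le> d0" "\<And>l. l < r \<Longrightarrow> d' \<le> d l" using d0 d by (auto simp: d'_def)
  have main: "\<exists>F F1 F2 M. flat_extension r \<epsilon> F F1 F2 M \<and> (\<forall>x\<in>cube r \<delta>. F x = f x)" if \<delta>: "0 < \<delta>" "\<delta> \<le> d' / 4" for \<delta>
  proof -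
    have bc: "box_close r d' origin x" if "x \<in> cube r (3 * \<delta>)" for x
      unfolding box_close_def
    proof (intro allI impI)
      fix i assume "i < r"
      then have "\<bar>x i\<bar> \<le> 3 * \<delta>" using that by (simp add: cube_def)
      then show "\<bar>x i - 0\<bar> < d'" using \<delta> d'(1) by linarith
    qed
    have cW: "cube r (3 * \<delta>) \<subseteq> W"
      using bc d0(2) box_close_mono[OF _ d'(2)] by (auto simp: cube_def)
    obtain h h1 h2 c where h: "\<And>t. (h has_real_derivative h1 t) (at t)" "\<And>t. (h1 has_real_derivative h2 t) (at t)"
      "\<And>t. \<bar>h t\<bar> \<le> 3 * \<delta>" "\<And>t. \<bar>h1 t\<bar> \<le> 1" "\<And>t. \<bar>h2 t\<bar> \<le> c" "\<And>s t. \<bar>h2 s - h2 t\<bar> \<le> c * \<bar>s - t\<bar>"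
      "\<And>t. \<bar>t\<bar> \<le> \<delta> \<Longrightarrow> h t = t" "h1 0 = 1"
      using truncation[OF \<delta>(1)] by metis
    have c: "0 \<le> c" using order_trans[OF abs_ge_zero h(5)] .
    define \<Theta> where "\<Theta> x = (\<lambda>i. if i < r then h (x i) else 0)" for x :: "nat \<Rightarrow> real"
    have \<Theta>: "\<Theta> x \<in> cube r (3 * \<delta>)" for x by (auto simp: \<Theta>_def cube_def Eucl_iff h(3))
    have h_lip: "\<bar>h s - h t\<bar> \<le> 1 * \<bar>s - t\<bar>" for s t by (rule lipschitz_from_derivative[OF h(1,4)])
    have h1_lip: "\<bar>h1 s - h1 t\<bar> \<le> c * \<bar>s - t\<bar>" for s t by (rule lipschitz_from_derivative[OF h(2,5)])
    have \<Theta>_lip: "l1 r (\<Theta> x) (\<Theta> y) \<le> l1 r x y" for x y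
      unfolding l1_def using h_lip by (intro sum_mono) (auto simp: \<Theta>_def)
    define F where "F x = f (\<Theta> x)" for x
    define F1 where "F1 x l = partial_deriv l f (\<Theta> x) * h1 (x l)" for x l
    define F2 where "F2 x l m = partial_deriv m (partial_deriv l f) (\<Theta> x) * h1 (x m) * h1 (x l) +
        (if l = m then partial_deriv l f (\<Theta> x) * h2 (x l) else 0)" for x l m
    have curve: "((\<lambda>t. \<Theta> (\<lambda>i. x i + t * (y i - x i)) i) has_real_derivative h1 (x i + t * (y i - x i)) * (y i - x i)) (at t)"
      if "i < r" for x y i t
      unfolding \<Theta>_def using that by (auto intro!: derivative_eq_intros DERIV_chain2[OF h(1)])
    have along: "((\<lambda>t. f' (\<Theta> (\<lambda>i. x i + t * (y i - x i)))) has_real_derivative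
        (\<Sum>m<r. partial_deriv m f' (\<Theta> (\<lambda>i. x i + t * (y i - x i))) * (h1 (x m + t * (y m - x m)) * (y m - x m)))) (at t)"
      if "Ck_scalar 1 r W f'" for f' x y t
      using \<Theta> cW by (intro C1_chain[OF W(1) that _ curve]) (auto simp: cube_def)
    have tame_\<Theta>: "tame r (Eucl r) (\<lambda>x. f' (\<Theta> x))" if "continuous_map (subtopology (Euclidean_space r) W) euclideanreal f'" for f'
    proof -
      have t: "tame r (cube r (3 * \<delta>)) f'" by (rule tame_on_cube[OF cW WE that])
      have "\<exists>K\<ge>0. \<forall>x\<in>Eucl r. \<forall>y\<in>Eucl r. \<bar>f' (\<Theta> y) - f' (\<Theta> x)\<bar> \<le> e + K * l1 r x y" if e: "0 < e" for e
      proof -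
        obtain K where K: "0 \<le> K" "\<And>x y. x \<in> cube r (3 * \<delta>) \<Longrightarrow> y \<in> cube r (3 * \<delta>) \<Longrightarrow> \<bar>f' y - f' x\<bar> \<le> e + K * l1 r x y"
          using tame_modulusE[OF t e] by metis
        have "\<bar>f' (\<Theta> y) - f' (\<Theta> x)\<bar> \<le> e + K * l1 r x y" for x y
          using K(2)[OF \<Theta>[of x] \<Theta>[of y]] mult_left_mono[OF \<Theta>_lip[of x y] K(1)] by linarith
        then show ?thesis using K(1) by blast
      qed
      moreover obtain B where "0 \<le> B" "\<And>x. x \<in> cube r (3 * \<delta>) \<Longrightarrow> \<bar>f' x\<bar> \<le> B" using tame_boundE[OF t] by metis
      ultimately show ?thesis unfolding tame_def using \<Theta> by blast
    qed
    have tame_h1: "tame r (Eucl r) (\<lambda>x. h1 (x l))" if "l < r" for l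
    proof (rule tame_lipschitz[OF zero_le_one _ c])
      show "\<bar>h1 (y l) - h1 (x l)\<bar> \<le> c * l1 r x y" for x y
        using h1_lip[of "y l" "x l"] mult_left_mono[OF l1_coordinate[OF that, of y x] c] by linarith
    qed (rule h(4))
    have tame_h2: "tame r (Eucl r) (\<lambda>x. h2 (x l))" if "l < r" for l
    proof (rule tame_lipschitz[OF c _ c])
      show "\<bar>h2 (y l) - h2 (x l)\<bar> \<le> c * l1 r x y" for x y
        using h(6)[of "y l" "x l"] mult_left_mono[OF l1_coordinate[OF that, of y x] c] by linarith
    qed (rule h(5))
    have tame_0: "tame r (Eucl r) (\<lambda>x. 0)" by (rule tame_lipschitz[of 0 _ _ 0]) auto
    have \<Theta>0: "\<Theta> origin = origin" using h(7)[of 0] \<delta>(1) by (auto simp: \<Theta>_def)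
    have "\<exists>M. flat_extension r \<epsilon> F F1 F2 M"
    proof (rule flat_extensionI)
      show "F origin = 0" "\<And>l. l < r \<Longrightarrow> F1 origin l = 0" using f0 \<Theta>0 by (auto simp: F_def F1_def)
      show "\<bar>F1 x l\<bar> \<le> \<epsilon>" if "l < r" for x l
      proof -
        have "\<Theta> x \<in> W" using \<Theta> cW by blast
        then have "\<bar>partial_deriv l f (\<Theta> x)\<bar> \<le> \<epsilon>"
          using d[OF that] box_close_mono[OF bc[OF \<Theta>] d'(3)[OF that]] f0(2)[OF that] by force
        from mult_mono[OF this h(4)[of "x l"]] show ?thesis using \<epsilon> by (simp add: F1_def abs_mult)
      qed
      show "\<exists>z\<in>Eucl r. l1 r x z \<le> l1 r x y \<and> F y - F x = (\<Sum>l<r. F1 z l * (y l - x l))"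
        if "x \<in> Eucl r" "y \<in> Eucl r" for x y
      proof (rule segment_mvt[OF _ that])
        show "((\<lambda>t. F (\<lambda>i. x i + t * (y i - x i))) has_real_derivative
            (\<Sum>l<r. F1 (\<lambda>i. x i + t * (y i - x i)) l * (y l - x l))) (at t)" for t
          using along[OF f1(1), of x y t] unfolding F_def F1_def by (simp only: mult.assoc)
      qed
      show "\<exists>z\<in>Eucl r. l1 r x z \<le> l1 r x y \<and> F1 y l - F1 x l = (\<Sum>m<r. F2 z l m * (y m - x m))"
        if "x \<in> Eucl r" "y \<in> Eucl r" and l: "l < r" for x y l
      proof (rule segment_mvt[where F = "\<lambda>x. F1 x l" and G = "\<lambda>x m. F2 x l m", OF _ that(1,2)])
        fix t :: real
        let ?p = "\<lambda>t i. x i + t * (y i - x i)"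
        have "((\<lambda>t. h1 (?p t l)) has_real_derivative h2 (?p t l) * (y l - x l)) (at t)"
          by (auto intro!: derivative_eq_intros DERIV_chain2[OF h(2)])
        from DERIV_mult[OF along[OF f1(2)[OF l], of x y t] this]
        have "((\<lambda>t. F1 (?p t) l) has_real_derivative
            (\<Sum>m<r. partial_deriv m (partial_deriv l f) (\<Theta> (?p t)) * (h1 (?p t m) * (y m - x m))) * h1 (?p t l) +
            h2 (?p t l) * (y l - x l) * partial_deriv l f (\<Theta> (?p t))) (at t)"
          unfolding F1_def .
        moreover have "(\<Sum>m<r. F2 (?p t) l m * (y m - x m)) =
            (\<Sum>m<r. partial_deriv m (partial_deriv l f) (\<Theta> (?p t)) * (h1 (?p t m) * (y m - x m))) * h1 (?p t l) +
            h2 (?p t l) * (y l - x l) * partial_deriv l f (\<Theta> (?p t))"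
        proof -
          have "(\<Sum>m<r. F2 (?p t) l m * (y m - x m)) =
            (\<Sum>m<r. partial_deriv m (partial_deriv l f) (\<Theta> (?p t)) * (h1 (?p t m) * (y m - x m)) * h1 (?p t l) +
              (if m = l then h2 (?p t l) * (y l - x l) * partial_deriv l f (\<Theta> (?p t)) else 0))"
            by (rule sum.cong) (auto simp: F2_def algebra_simps)
          then show ?thesis using l by (simp add: sum.distrib sum_distrib_right)
        qed
        ultimately show "((\<lambda>t. F1 (?p t) l) has_real_derivative (\<Sum>m<r. F2 (?p t) l m * (y m - x m))) (at t)" by simp
      qed
      show "tame r (Eucl r) (\<lambda>x. F2 x l m)" if "l < r" "m < r" for l m
        unfolding F2_def using that tame_0
        by (cases "l = m") (auto intro!: tame_add tame_mult tame_\<Theta> f2 Ck_scalar_continuous[OF f1(2)] tame_h1 tame_h2)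
    qed
    moreover have "F x = f x" if "x \<in> cube r \<delta>" for x
    proof -
      have "\<Theta> x = x" using that h(7) by (auto simp: \<Theta>_def cube_def Eucl_iff)
      then show ?thesis by (simp add: F_def)
    qed
    ultimately show ?thesis by blast
  qed
  show ?thesis using main d'(1) by (intro exI[of _ "d' / 4"]) auto
qed

section \<open>The truncated field in complex eigencoordinates\<close>

lemma flat_extension_conjuncts:
  assumes "flat_extension r \<epsilon> F F1 F2 M"
  shows "0 \<le> M" "F origin = 0" "\<forall>l<r. F1 origin l = 0"
    "\<forall>x\<in>Eucl r. \<forall>l<r. \<bar>F1 x l\<bar> \<le> \<epsilon>"
    "\<forall>x\<in>Eucl r. \<forall>y\<in>Eucl r. \<bar>F y - F x\<bar> \<le> \<epsilon> * l1 r x y"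
    "\<forall>x\<in>Eucl r. \<forall>y\<in>Eucl r. \<bar>F y - F x - (\<Sum>l<r. F1 x l * (y l - x l))\<bar> \<le> M * (l1 r x y)\<^sup>2"
    "\<forall>x\<in>Eucl r. \<forall>y\<in>Eucl r. \<forall>l<r. \<bar>F1 y l - F1 x l\<bar> \<le> M * l1 r x y"
    "\<forall>x\<in>Eucl r. \<forall>l<r. \<forall>m<r. \<bar>F2 x l m\<bar> \<le> M"
    "\<forall>e>0. \<exists>K\<ge>0. \<forall>x\<in>Eucl r. \<forall>y\<in>Eucl r. \<forall>l<r.
        \<bar>F1 y l - F1 x l - (\<Sum>m<r. F2 x l m * (y m - x m))\<bar> \<le> (e + K * l1 r x y) * l1 r x y"
    "\<forall>e>0. \<exists>K\<ge>0. \<forall>x\<in>Eucl r. \<forall>y\<in>Eucl r. \<forall>l<r. \<forall>m<r.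
        \<bar>F2 y l m - F2 x l m\<bar> \<le> e + K * l1 r x y"
  by (insert assms[unfolded flat_extension_def], (elim conjE, assumption)+)

lemmas flat_extensionD = flat_extension_conjuncts[rule_format]

text \<open>Finitely many moduli with the same \<open>b\<close> have a common constant, their sum.\<close>

lemma uniform_modulus:
  fixes n :: nat and a :: "nat \<Rightarrow> 's \<Rightarrow> real" and b d :: "'s \<Rightarrow> real"
  assumes "\<And>k. k < n \<Longrightarrow> \<exists>K\<ge>0. \<forall>s\<in>S. a k s \<le> b s + K * d s" and d: "\<And>s. s \<in> S \<Longrightarrow> 0 \<le> d s"
  shows "\<exists>K\<ge>0. \<forall>k<n. \<forall>s\<in>S. a k s \<le> b s + K * d s"
proof -
  obtain K where K: "\<And>k. k < n \<Longrightarrow> 0 \<le> K k \<and> (\<forall>s\<in>S. a k s \<le> b s + K k * d s)" using assms(1) by metis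
  have le: "K k \<le> (\<Sum>k<n. K k)" if "k < n" for k using K that by (intro member_le_sum) auto
  have "a k s \<le> b s + (\<Sum>k<n. K k) * d s" if k: "k < n" "s \<in> S" for k s
  proof -
    have "a k s \<le> b s + K k * d s" using K k by blast
    also have "\<dots> \<le> b s + (\<Sum>k<n. K k) * d s" using le[OF k(1)] d[OF k(2)] by (intro add_left_mono mult_right_mono)
    finally show ?thesis .
  qed
  moreover have "0 \<le> (\<Sum>k<n. K k)" using K by (intro sum_nonneg) auto
  ultimately show ?thesis by blast
qed

text \<open>The truncated nonlinearity \<open>F\<close> in complex coordinates \<open>z = P' y\<close>, \<open>y = P z\<close>. The off-diagonal part \<open>N\<close> of the linear field is
counted as part of the perturbation, so that only diagonal linear parts have to be treated.\<close>

locale truncated_field =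
  fixes n :: nat and P P' N :: "nat \<Rightarrow> nat \<Rightarrow> complex"
    and F :: "nat \<Rightarrow> (nat \<Rightarrow> real) \<Rightarrow> real" and F1 :: "nat \<Rightarrow> (nat \<Rightarrow> real) \<Rightarrow> nat \<Rightarrow> real"
    and F2 :: "nat \<Rightarrow> (nat \<Rightarrow> real) \<Rightarrow> nat \<Rightarrow> nat \<Rightarrow> real" and MF :: "nat \<Rightarrow> real" and \<epsilon> \<epsilon>1 cP cP' :: real
  assumes flat: "\<And>k. k < n \<Longrightarrow> flat_extension n \<epsilon>1 (F k) (F1 k) (F2 k) (MF k)"
    and N: "\<And>i j. i < n \<Longrightarrow> j < n \<Longrightarrow> cmod (N i j) \<le> \<epsilon> / 2"
    and pos: "0 \<le> \<epsilon>" "0 \<le> \<epsilon>1" and small: "cP' * (\<epsilon>1 * cP) \<le> \<epsilon> / 2"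
    and cP: "cP = (\<Sum>l<n. \<Sum>j<n. cmod (P l j))" and cP': "cP' = (\<Sum>i<n. \<Sum>k<n. cmod (P' i k))"
begin

text \<open>Back to real coordinates. Taking real parts extends the field from the image of \<open>\<real>\<^sup>n\<close>, on which orbits of the real
system run, to all complex vectors, so that no reality condition has to be carried along.\<close>

definition Y :: "(nat \<Rightarrow> complex) \<Rightarrow> nat \<Rightarrow> real" where
  "Y z l = (if l < n then Re (\<Sum>j<n. P l j * z j) else 0)"

definition g :: "(nat \<Rightarrow> complex) \<Rightarrow> nat \<Rightarrow> complex" where
  "g z i = (\<Sum>j<n. N i j * z j) + (\<Sum>k<n. P' i k * of_real (F k (Y z)))"

definition g1 :: "(nat \<Rightarrow> complex) \<Rightarrow> (nat \<Rightarrow> complex) \<Rightarrow> nat \<Rightarrow> complex" where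
  "g1 z v i = (\<Sum>j<n. N i j * v j) + (\<Sum>k<n. P' i k * of_real (\<Sum>l<n. F1 k (Y z) l * Y v l))"

definition g2 :: "(nat \<Rightarrow> complex) \<Rightarrow> (nat \<Rightarrow> complex) \<Rightarrow> (nat \<Rightarrow> complex) \<Rightarrow> nat \<Rightarrow> complex" where
  "g2 z v w i = (\<Sum>k<n. P' i k * of_real (\<Sum>l<n. (\<Sum>q<n. F2 k (Y z) l q * Y v q) * Y w l))"

lemma cP_nonneg: "0 \<le> cP" "0 \<le> cP'"
  unfolding cP cP' by (auto intro!: sum_nonneg)

lemma Y_Eucl [simp]: "Y z \<in> Eucl n"
  by (simp add: Y_def Eucl_iff)

lemma Y_diff: "Y (\<lambda>i. v' i - v i) l = Y v' l - Y v l"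
  by (simp add: Y_def right_diff_distrib sum_subtractf)

lemma Y_scale: "Y (\<lambda>i. of_real a * v i) l = a * Y v l"
proof -
  have "(\<Sum>j<n. P l j * (of_real a * v j)) = of_real a * (\<Sum>j<n. P l j * v j)"
    by (simp add: sum_distrib_left mult_ac)
  then show ?thesis by (simp add: Y_def)
qed

lemma Y_bound: "(\<Sum>l<n. \<bar>Y v l\<bar>) \<le> cP * nrm n v"
proof -
  have "\<bar>Y v l\<bar> \<le> (\<Sum>j<n. cmod (P l j)) * nrm n v" if "l < n" for l
  proof -
    have "\<bar>Y v l\<bar> \<le> cmod (\<Sum>j<n. P l j * v j)" using that by (simp only: Y_def if_True abs_Re_le_cmod)
    also have "\<dots> \<le> (\<Sum>j<n. cmod (P l j) * cmod (v j))" by (rule order_trans[OF norm_sum]) (simp add: norm_mult)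
    also have "\<dots> \<le> (\<Sum>j<n. cmod (P l j) * nrm n v)" by (intro sum_mono mult_left_mono) (auto simp: cmod_le_nrm)
    finally show ?thesis by (simp add: sum_distrib_right)
  qed
  then have "(\<Sum>l<n. \<bar>Y v l\<bar>) \<le> (\<Sum>l<n. (\<Sum>j<n. cmod (P l j)) * nrm n v)" by (intro sum_mono) auto
  then show ?thesis by (simp add: cP sum_distrib_right)
qed

lemma l1_Y: "l1 n (Y z) (Y z') \<le> cP * nrm n (\<lambda>i. z' i - z i)"
  using Y_bound[of "\<lambda>i. z' i - z i"] by (simp add: l1_def Y_diff)

lemma sum_Y_bound:
  assumes "\<And>l. l < n \<Longrightarrow> \<bar>c l\<bar> \<le> B" "0 \<le> B"
  shows "\<bar>\<Sum>l<n. c l * Y v l\<bar> \<le> B * (cP * nrm n v)"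
proof -
  have "\<bar>\<Sum>l<n. c l * Y v l\<bar> \<le> B * l1 n (\<lambda>_. 0) (Y v)"
    using weighted_sum_bound[of n c B "Y v" "\<lambda>_. 0"] assms(1) by simp
  also have "\<dots> \<le> B * (cP * nrm n v)" using Y_bound[of v] assms(2) by (intro mult_left_mono) (auto simp: l1_def)
  finally show ?thesis .
qed

lemma P'_sum_bound:
  assumes "i < n" "\<And>k. k < n \<Longrightarrow> \<bar>x k\<bar> \<le> B" "0 \<le> B"
  shows "cmod (\<Sum>k<n. P' i k * of_real (x k)) \<le> cP' * B"
proof -
  have "cmod (\<Sum>k<n. P' i k * of_real (x k)) \<le> (\<Sum>k<n. cmod (P' i k) * \<bar>x k\<bar>)"
    by (rule order_trans[OF norm_sum]) (simp add: norm_mult)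
  also have "\<dots> \<le> (\<Sum>k<n. cmod (P' i k) * B)" using assms(2) by (intro sum_mono mult_left_mono) auto
  also have "\<dots> = (\<Sum>k<n. cmod (P' i k)) * B" by (simp add: sum_distrib_right)
  also have "\<dots> \<le> cP' * B"
    unfolding cP' using assms by (intro mult_right_mono member_le_sum[of i "{..<n}" "\<lambda>i. \<Sum>k<n. cmod (P' i k)"] sum_nonneg) auto
  finally show ?thesis .
qed

lemma N_sum_bound: "i < n \<Longrightarrow> cmod (\<Sum>j<n. N i j * v j) \<le> \<epsilon> / 2 * nrm n v"
proof -
  assume i: "i < n"
  have "cmod (\<Sum>j<n. N i j * v j) \<le> (\<Sum>j<n. cmod (N i j) * cmod (v j))"
    by (rule order_trans[OF norm_sum]) (simp add: norm_mult)
  also have "\<dots> \<le> (\<Sum>j<n. \<epsilon> / 2 * cmod (v j))" using N[OF i] by (intro sum_mono mult_right_mono) auto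
  finally show ?thesis by (simp add: nrm_def sum_distrib_left)
qed

definition MM :: real where "MM = (\<Sum>k<n. MF k)"

lemma MF_le: "k < n \<Longrightarrow> MF k \<le> MM"
  unfolding MM_def using flat_extensionD(1)[OF flat] by (intro member_le_sum) auto

lemma MM_nonneg: "0 \<le> MM"
  unfolding MM_def using flat_extensionD(1)[OF flat] by (intro sum_nonneg) auto

lemma half_bound:
  assumes "i < n" "cmod a \<le> \<epsilon> / 2 * nrm n v" "cmod b \<le> cP' * (\<epsilon>1 * (cP * nrm n v))"
  shows "cmod (a + b) \<le> \<epsilon> * nrm n v"
proof -
  have "cP' * (\<epsilon>1 * (cP * nrm n v)) = (cP' * (\<epsilon>1 * cP)) * nrm n v" by (simp add: mult.assoc)
  also have "\<dots> \<le> \<epsilon> / 2 * nrm n v" using small by (intro mult_right_mono) auto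
  finally show ?thesis using norm_triangle_ineq[of a b] assms by linarith
qed

lemma N_diff: "(\<Sum>j<n. N i j * (v' j - v j)) = (\<Sum>j<n. N i j * v' j) - (\<Sum>j<n. N i j * v j)"
  by (simp add: right_diff_distrib sum_subtractf)

lemma P'_diff: "(\<Sum>k<n. P' i k * of_real (x k)) - (\<Sum>k<n. P' i k * of_real (y k)) = (\<Sum>k<n. P' i k * of_real (x k - y k))"
  by (simp add: right_diff_distrib sum_subtractf)

lemma P'_scale: "(\<Sum>k<n. P' i k * of_real (a * x k)) = of_real a * (\<Sum>k<n. P' i k * of_real (x k))"
  by (simp add: sum_distrib_left mult_ac)

lemma g_zero: "g (\<lambda>_. 0) i = 0"
proof -
  have "Y (\<lambda>_. 0) = origin" by (simp add: Y_def fun_eq_iff)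
  then have "(\<Sum>k<n. P' i k * of_real (F k (Y (\<lambda>_. 0)))) = 0"
    using flat_extensionD(2)[OF flat] by (intro sum.neutral) auto
  then show ?thesis by (simp add: g_def)
qed

lemma g_lip: "i < n \<Longrightarrow> cmod (g z' i - g z i) \<le> \<epsilon> * nrm n (\<lambda>i. z' i - z i)"
proof -
  assume i: "i < n"
  have eq: "g z' i - g z i = (\<Sum>j<n. N i j * (z' j - z j)) + (\<Sum>k<n. P' i k * of_real (F k (Y z') - F k (Y z)))"
    unfolding g_def N_diff P'_diff[symmetric] by simp
  show ?thesis unfolding eq
  proof (rule half_bound[OF i N_sum_bound[OF i] P'_sum_bound[OF i]])
    fix k assume "k < n"
    then have "\<bar>F k (Y z') - F k (Y z)\<bar> \<le> \<epsilon>1 * l1 n (Y z) (Y z')" using flat_extensionD(5)[OF flat] by simp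
    also have "\<dots> \<le> \<epsilon>1 * (cP * nrm n (\<lambda>i. z' i - z i))" using l1_Y pos by (intro mult_left_mono)
    finally show "\<bar>F k (Y z') - F k (Y z)\<bar> \<le> \<epsilon>1 * (cP * nrm n (\<lambda>i. z' i - z i))" .
  qed (use pos cP_nonneg in auto)
qed

definition M :: real where "M = cP' * MM * cP * cP"

lemma M_nonneg: "0 \<le> M"
  unfolding M_def using MM_nonneg cP_nonneg by auto

lemma g_deriv: "i < n \<Longrightarrow> cmod (g z' i - g z i - g1 z (\<lambda>i. z' i - z i) i) \<le> M * (nrm n (\<lambda>i. z' i - z i))\<^sup>2"
proof -
  assume i: "i < n"
  let ?d = "nrm n (\<lambda>i. z' i - z i)"
  have eq: "g z' i - g z i - g1 z (\<lambda>i. z' i - z i) i =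
      (\<Sum>k<n. P' i k * of_real (F k (Y z') - F k (Y z) - (\<Sum>l<n. F1 k (Y z) l * (Y z' l - Y z l))))"
    unfolding g_def g1_def N_diff Y_diff P'_diff[symmetric] by simp
  have "cmod (\<Sum>k<n. P' i k * of_real (F k (Y z') - F k (Y z) - (\<Sum>l<n. F1 k (Y z) l * (Y z' l - Y z l)))) \<le> cP' * (MM * (cP * ?d)\<^sup>2)"
  proof (rule P'_sum_bound[OF i])
    fix k assume k: "k < n"
    have "\<bar>F k (Y z') - F k (Y z) - (\<Sum>l<n. F1 k (Y z) l * (Y z' l - Y z l))\<bar> \<le> MF k * (l1 n (Y z) (Y z'))\<^sup>2"
      using flat_extensionD(6)[OF flat[OF k]] by simp
    also have "\<dots> \<le> MM * (cP * ?d)\<^sup>2"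
      using MF_le[OF k] l1_Y MM_nonneg by (intro mult_mono power_mono) auto
    finally show "\<bar>F k (Y z') - F k (Y z) - (\<Sum>l<n. F1 k (Y z) l * (Y z' l - Y z l))\<bar> \<le> MM * (cP * ?d)\<^sup>2" .
  qed (use MM_nonneg in auto)
  also have "cP' * (MM * (cP * ?d)\<^sup>2) = M * ?d\<^sup>2" by (simp add: M_def power2_eq_square mult_ac)
  finally show ?thesis unfolding eq .
qed

lemma g1_diff: "g1 z (\<lambda>i. v' i - v i) i = g1 z v' i - g1 z v i"
proof -
  have "(\<Sum>l<n. F1 k (Y z) l * (Y v' l - Y v l)) = (\<Sum>l<n. F1 k (Y z) l * Y v' l) - (\<Sum>l<n. F1 k (Y z) l * Y v l)" for k
    by (simp add: right_diff_distrib sum_subtractf)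
  then show ?thesis unfolding g1_def N_diff Y_diff by (simp add: right_diff_distrib sum_subtractf del: of_real_sum)
qed

lemma g1_scale: "g1 z (\<lambda>i. of_real a * v i) i = of_real a * g1 z v i"
proof -
  have "(\<Sum>l<n. F1 k (Y z) l * (a * Y v l)) = a * (\<Sum>l<n. F1 k (Y z) l * Y v l)" for k
    by (simp add: sum_distrib_left mult_ac)
  note F = this
  have "(\<Sum>j<n. N i j * (of_real a * v j)) = of_real a * (\<Sum>j<n. N i j * v j)"
    by (simp add: sum_distrib_left mult_ac)
  then show ?thesis unfolding g1_def Y_scale F P'_scale distrib_left by simp
qed

lemma g1_bound: "i < n \<Longrightarrow> cmod (g1 z v i) \<le> \<epsilon> * nrm n v"
  unfolding g1_def
proof (rule half_bound[OF _ N_sum_bound P'_sum_bound])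
  fix k assume "k < n"
  then show "\<bar>\<Sum>l<n. F1 k (Y z) l * Y v l\<bar> \<le> \<epsilon>1 * (cP * nrm n v)"
    using flat_extensionD(4)[OF flat] pos by (intro sum_Y_bound) auto
qed (use pos cP_nonneg in auto)

lemma F1_diff_sum:
  "(\<Sum>l<n. F1 k (Y z') l * Y v l) - (\<Sum>l<n. F1 k (Y z) l * Y v l) = (\<Sum>l<n. (F1 k (Y z') l - F1 k (Y z) l) * Y v l)"
  by (simp add: left_diff_distrib sum_subtractf)

lemma g1_lip: "i < n \<Longrightarrow> cmod (g1 z' v i - g1 z v i) \<le> M * nrm n (\<lambda>i. z' i - z i) * nrm n v"
proof -
  assume i: "i < n"
  let ?d = "nrm n (\<lambda>i. z' i - z i)"
  have eq: "g1 z' v i - g1 z v i = (\<Sum>k<n. P' i k * of_real (\<Sum>l<n. (F1 k (Y z') l - F1 k (Y z) l) * Y v l))"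
    unfolding g1_def F1_diff_sum[symmetric] P'_diff[symmetric] by simp
  have "cmod (g1 z' v i - g1 z v i) \<le> cP' * ((MM * (cP * ?d)) * (cP * nrm n v))"
    unfolding eq
  proof (rule P'_sum_bound[OF i], rule sum_Y_bound)
    fix k l assume k: "k < n" and l: "l < n"
    have "\<bar>F1 k (Y z') l - F1 k (Y z) l\<bar> \<le> MF k * l1 n (Y z) (Y z')" using flat_extensionD(7)[OF flat[OF k]] l by simp
    also have "\<dots> \<le> MM * (cP * ?d)" using MF_le[OF k] l1_Y MM_nonneg by (intro mult_mono) auto
    finally show "\<bar>F1 k (Y z') l - F1 k (Y z) l\<bar> \<le> MM * (cP * ?d)" .
  qed (use MM_nonneg cP_nonneg in auto)
  then show ?thesis by (simp add: M_def mult_ac)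
qed

lemma absorb_constant:
  assumes "0 < e" shows "\<exists>e'>0. e' * (cP' * cP * cP) \<le> e"
  using small_factor[of "cP' * cP * cP" e] assms cP_nonneg by simp

lemma g1_deriv:
  assumes "0 < e"
  shows "\<exists>K\<ge>0. \<forall>z z' v. \<forall>i<n. cmod (g1 z' v i - g1 z v i - g2 z (\<lambda>i. z' i - z i) v i)
            \<le> (e + K * nrm n (\<lambda>i. z' i - z i)) * nrm n (\<lambda>i. z' i - z i) * nrm n v"
proof -
  obtain e' where e': "0 < e'" "e' * (cP' * cP * cP) \<le> e" using absorb_constant[OF assms] by blast
  let ?S = "Eucl n \<times> Eucl n \<times> {..<n}"
  have "\<exists>K\<ge>0. \<forall>k<n. \<forall>s\<in>?S. (case s of (x, y, l) \<Rightarrow> \<bar>F1 k y l - F1 k x l - (\<Sum>m<n. F2 k x l m * (y m - x m))\<bar>)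
      \<le> (case s of (x, y, l) \<Rightarrow> e' * l1 n x y) + K * (case s of (x, y, l) \<Rightarrow> (l1 n x y)\<^sup>2)"
  proof (rule uniform_modulus)
    fix k assume "k < n"
    from flat_extensionD(9)[OF flat[OF this] e'(1)]
    show "\<exists>K\<ge>0. \<forall>s\<in>?S. (case s of (x, y, l) \<Rightarrow> \<bar>F1 k y l - F1 k x l - (\<Sum>m<n. F2 k x l m * (y m - x m))\<bar>)
      \<le> (case s of (x, y, l) \<Rightarrow> e' * l1 n x y) + K * (case s of (x, y, l) \<Rightarrow> (l1 n x y)\<^sup>2)"
      by (auto simp: distrib_right power2_eq_square mult.assoc)
  qed auto
  then obtain K where K: "0 \<le> K" and K2: "\<And>k x y l. k < n \<Longrightarrow> x \<in> Eucl n \<Longrightarrow> y \<in> Eucl n \<Longrightarrow> l < n \<Longrightarrow>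
      \<bar>F1 k y l - F1 k x l - (\<Sum>m<n. F2 k x l m * (y m - x m))\<bar> \<le> e' * l1 n x y + K * (l1 n x y)\<^sup>2"
    by (fastforce simp del: topspace_Euclidean_space)
  let ?K = "K * cP * (cP' * cP * cP)"
  have "cmod (g1 z' v i - g1 z v i - g2 z (\<lambda>i. z' i - z i) v i)
      \<le> (e + ?K * nrm n (\<lambda>i. z' i - z i)) * nrm n (\<lambda>i. z' i - z i) * nrm n v" if i: "i < n" for z z' v i
  proof -
    let ?d = "nrm n (\<lambda>i. z' i - z i)"
    have "(\<Sum>l<n. (F1 k (Y z') l - F1 k (Y z) l) * Y v l) - (\<Sum>l<n. (\<Sum>q<n. F2 k (Y z) l q * (Y z' q - Y z q)) * Y v l) =
       (\<Sum>l<n. (F1 k (Y z') l - F1 k (Y z) l - (\<Sum>q<n. F2 k (Y z) l q * (Y z' q - Y z q))) * Y v l)" for k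
      by (simp add: left_diff_distrib sum_subtractf)
    then have eq: "g1 z' v i - g1 z v i - g2 z (\<lambda>i. z' i - z i) v i = (\<Sum>k<n. P' i k * of_real
        (\<Sum>l<n. (F1 k (Y z') l - F1 k (Y z) l - (\<Sum>q<n. F2 k (Y z) l q * (Y z' q - Y z q))) * Y v l))"
      unfolding g1_def g2_def Y_diff using P'_diff[symmetric] F1_diff_sum[symmetric] by (simp add: P'_diff del: of_real_sum of_real_diff)
    have "cmod (g1 z' v i - g1 z v i - g2 z (\<lambda>i. z' i - z i) v i) \<le> cP' * ((e' * (cP * ?d) + K * (cP * ?d)\<^sup>2) * (cP * nrm n v))"
      unfolding eq
    proof (rule P'_sum_bound[OF i], rule sum_Y_bound)
      fix k l assume k: "k < n" and l: "l < n"
      have "\<bar>F1 k (Y z') l - F1 k (Y z) l - (\<Sum>q<n. F2 k (Y z) l q * (Y z' q - Y z q))\<bar> \<le> e' * l1 n (Y z) (Y z') + K * (l1 n (Y z) (Y z'))\<^sup>2"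
        by (rule K2[OF k Y_Eucl Y_Eucl l])
      also have "\<dots> \<le> e' * (cP * ?d) + K * (cP * ?d)\<^sup>2"
        using l1_Y e'(1) K by (intro add_mono mult_left_mono power_mono) auto
      finally show "\<bar>F1 k (Y z') l - F1 k (Y z) l - (\<Sum>q<n. F2 k (Y z) l q * (Y z' q - Y z q))\<bar> \<le> e' * (cP * ?d) + K * (cP * ?d)\<^sup>2" .
    qed (use K e'(1) cP_nonneg in auto)
    also have "\<dots> = (e' * (cP' * cP * cP) + ?K * ?d) * ?d * nrm n v"
      by (simp add: power2_eq_square algebra_simps)
    also have "\<dots> \<le> (e + ?K * ?d) * ?d * nrm n v" using e'(2) by (intro mult_right_mono) auto
    finally show ?thesis .
  qed
  moreover have "0 \<le> ?K" using K cP_nonneg by simp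
  ultimately show ?thesis by blast
qed

lemma g2_diff_left: "g2 z (\<lambda>i. v' i - v i) w i = g2 z v' w i - g2 z v w i"
proof -
  have "(\<Sum>l<n. (\<Sum>q<n. F2 k (Y z) l q * (Y v' q - Y v q)) * Y w l) =
     (\<Sum>l<n. (\<Sum>q<n. F2 k (Y z) l q * Y v' q) * Y w l) - (\<Sum>l<n. (\<Sum>q<n. F2 k (Y z) l q * Y v q) * Y w l)" for k
    by (simp add: right_diff_distrib left_diff_distrib sum_subtractf)
  then show ?thesis unfolding g2_def Y_diff by (simp only: P'_diff)
qed

lemma g2_diff_right: "g2 z v (\<lambda>i. w' i - w i) i = g2 z v w' i - g2 z v w i"
proof -
  have "(\<Sum>l<n. (\<Sum>q<n. F2 k (Y z) l q * Y v q) * (Y w' l - Y w l)) =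
     (\<Sum>l<n. (\<Sum>q<n. F2 k (Y z) l q * Y v q) * Y w' l) - (\<Sum>l<n. (\<Sum>q<n. F2 k (Y z) l q * Y v q) * Y w l)" for k
    by (simp add: right_diff_distrib sum_subtractf)
  then show ?thesis unfolding g2_def Y_diff by (simp only: P'_diff)
qed

lemma g2_scale_left: "g2 z (\<lambda>i. of_real a * v i) w i = of_real a * g2 z v w i"
proof -
  have "(\<Sum>l<n. (\<Sum>q<n. F2 k (Y z) l q * (a * Y v q)) * Y w l) = a * (\<Sum>l<n. (\<Sum>q<n. F2 k (Y z) l q * Y v q) * Y w l)" for k
    by (simp add: sum_distrib_left sum_distrib_right mult_ac)
  note F = this
  show ?thesis unfolding g2_def Y_scale F P'_scale ..
qed

lemma g2_bound: "i < n \<Longrightarrow> cmod (g2 z v w i) \<le> M * nrm n v * nrm n w"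
proof -
  assume i: "i < n"
  have "cmod (g2 z v w i) \<le> cP' * ((MM * (cP * nrm n v)) * (cP * nrm n w))"
    unfolding g2_def
  proof (rule P'_sum_bound[OF i], rule sum_Y_bound, rule sum_Y_bound)
    fix k l q assume k: "k < n" and "l < n" "q < n"
    then show "\<bar>F2 k (Y z) l q\<bar> \<le> MM" using flat_extensionD(8)[OF flat[OF k]] MF_le[OF k] Y_Eucl by (meson order_trans)
  qed (use MM_nonneg cP_nonneg in auto)
  then show ?thesis by (simp add: M_def mult_ac)
qed

lemma g2_cont:
  assumes "0 < e"
  shows "\<exists>K\<ge>0. \<forall>z z' v w. \<forall>i<n. cmod (g2 z' v w i - g2 z v w i) \<le> (e + K * nrm n (\<lambda>i. z' i - z i)) * nrm n v * nrm n w"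
proof -
  obtain e' where e': "0 < e'" "e' * (cP' * cP * cP) \<le> e" using absorb_constant[OF assms] by blast
  let ?S = "Eucl n \<times> Eucl n \<times> {..<n} \<times> {..<n}"
  have "\<exists>K\<ge>0. \<forall>k<n. \<forall>s\<in>?S. (case s of (x, y, l, q) \<Rightarrow> \<bar>F2 k y l q - F2 k x l q\<bar>)
      \<le> (case s of (x, y, l, q) \<Rightarrow> e') + K * (case s of (x, y, l, q) \<Rightarrow> l1 n x y)"
  proof (rule uniform_modulus)
    fix k assume "k < n"
    from flat_extensionD(10)[OF flat[OF this] e'(1)]
    show "\<exists>K\<ge>0. \<forall>s\<in>?S. (case s of (x, y, l, q) \<Rightarrow> \<bar>F2 k y l q - F2 k x l q\<bar>)
      \<le> (case s of (x, y, l, q) \<Rightarrow> e') + K * (case s of (x, y, l, q) \<Rightarrow> l1 n x y)" by auto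
  qed auto
  then obtain K where K: "0 \<le> K" and K2: "\<And>k x y l q. k < n \<Longrightarrow> x \<in> Eucl n \<Longrightarrow> y \<in> Eucl n \<Longrightarrow> l < n \<Longrightarrow> q < n \<Longrightarrow>
      \<bar>F2 k y l q - F2 k x l q\<bar> \<le> e' + K * l1 n x y"
    by (fastforce simp del: topspace_Euclidean_space)
  let ?K = "K * cP * (cP' * cP * cP)"
  have "cmod (g2 z' v w i - g2 z v w i) \<le> (e + ?K * nrm n (\<lambda>i. z' i - z i)) * nrm n v * nrm n w" if i: "i < n" for z z' v w i
  proof -
    let ?d = "nrm n (\<lambda>i. z' i - z i)"
    have "(\<Sum>l<n. (\<Sum>q<n. F2 k (Y z') l q * Y v q) * Y w l) - (\<Sum>l<n. (\<Sum>q<n. F2 k (Y z) l q * Y v q) * Y w l) =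
       (\<Sum>l<n. (\<Sum>q<n. (F2 k (Y z') l q - F2 k (Y z) l q) * Y v q) * Y w l)" for k
      by (simp add: left_diff_distrib sum_subtractf)
    then have eq: "g2 z' v w i - g2 z v w i =
        (\<Sum>k<n. P' i k * of_real (\<Sum>l<n. (\<Sum>q<n. (F2 k (Y z') l q - F2 k (Y z) l q) * Y v q) * Y w l))"
      unfolding g2_def by (simp only: P'_diff)
    have "cmod (g2 z' v w i - g2 z v w i) \<le> cP' * (((e' + K * (cP * ?d)) * (cP * nrm n v)) * (cP * nrm n w))"
      unfolding eq
    proof (rule P'_sum_bound[OF i], rule sum_Y_bound, rule sum_Y_bound)
      fix k l q assume k: "k < n" and l: "l < n" and q: "q < n"
      have "\<bar>F2 k (Y z') l q - F2 k (Y z) l q\<bar> \<le> e' + K * l1 n (Y z) (Y z')" by (rule K2[OF k Y_Eucl Y_Eucl l q])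
      also have "\<dots> \<le> e' + K * (cP * ?d)" using l1_Y K by (intro add_left_mono mult_left_mono)
      finally show "\<bar>F2 k (Y z') l q - F2 k (Y z) l q\<bar> \<le> e' + K * (cP * ?d)" .
    qed (use K e'(1) cP_nonneg in auto)
    also have "\<dots> = (e' * (cP' * cP * cP) + ?K * ?d) * nrm n v * nrm n w"
      by (simp add: algebra_simps)
    also have "\<dots> \<le> (e + ?K * ?d) * nrm n v * nrm n w" using e'(2) by (intro mult_right_mono) auto
    finally show ?thesis .
  qed
  moreover have "0 \<le> ?K" using K cP_nonneg by simp
  ultimately show ?thesis by blast
qed

lemma truncation_perturbs_diagonal:
  assumes "gapped n lam \<eta>" "\<epsilon> * real n \<le> \<eta> / 2"
  shows "perturbed n lam \<eta> \<epsilon> M g g1 g2"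
proof -
  interpret gapped n lam \<eta> by (rule assms(1))
  show ?thesis
    by unfold_locales
      ((rule pos(1) assms(2) M_nonneg g_zero g_lip g_deriv g1_diff g1_scale g1_bound g1_lip g1_deriv
        g2_diff_left g2_diff_right g2_scale_left g2_bound g2_cont; assumption?)+)
qed

lemma g1_origin: "g1 (\<lambda>_. 0) v i = (\<Sum>j<n. N i j * v j)"
proof -
  have "Y (\<lambda>_. 0) = origin" by (simp add: Y_def fun_eq_iff)
  then have "(\<Sum>l<n. F1 k (Y (\<lambda>_. 0)) l * Y v l) = 0" if "k < n" for k
    using flat_extensionD(3)[OF flat[OF that]] by (intro sum.neutral) auto
  then show ?thesis by (simp add: g1_def del: of_real_sum)
qed

end

section \<open>Regularity of the centre graph\<close>

text \<open>An affine modulus with arbitrarily small constant term implies continuity.\<close>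

lemma continuous_from_modulus:
  assumes "\<And>x e. x \<in> Eucl m \<Longrightarrow> 0 < e \<Longrightarrow> \<exists>K\<ge>0. \<forall>y\<in>Eucl m. \<bar>h y - h x\<bar> \<le> e + K * l1 m x y"
  shows "continuous_map (subtopology (Euclidean_space m) (Eucl m)) euclideanreal h"
  unfolding continuous_Eucl_iff[OF order_refl]
proof (intro ballI allI impI)
  fix x and e :: real assume x: "x \<in> Eucl m" and e: "0 < e"
  obtain K where K: "0 \<le> K" "\<forall>y\<in>Eucl m. \<bar>h y - h x\<bar> \<le> e / 2 + K * l1 m x y"
    using assms[OF x, of "e / 2"] e by auto
  define d where "d = e / (2 * (K * real m + 1))"
  have pos: "0 < K * real m + 1" using K(1) by (simp add: add_nonneg_pos)
  have d: "0 < d" "K * real m * d < e / 2"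
  proof -
    show "0 < d" using e pos by (simp add: d_def)
    have "x * (e / (2 * x)) = e / 2" if "0 < x" for x using that by simp
    from this[OF pos] have "(K * real m + 1) * d = e / 2" by (simp only: d_def)
    then show "K * real m * d < e / 2" using \<open>0 < d\<close> by (simp add: distrib_right)
  qed
  have "\<bar>h y - h x\<bar> < e" if y: "y \<in> Eucl m" "box_close m d x y" for y
  proof -
    have "l1 m x y \<le> real m * d"
      unfolding l1_def using sum_bounded_above[of "{..<m}" "\<lambda>i. \<bar>y i - x i\<bar>" d] y(2)
      by (simp add: box_close_def less_imp_le)
    then have "K * l1 m x y \<le> K * (real m * d)" using K(1) by (rule mult_left_mono)
    then show ?thesis using K(2)[rule_format, OF y(1)] d(2) by (simp add: mult.assoc)
  qed
  then show "\<exists>d>0. \<forall>y\<in>Eucl m. box_close m d x y \<longrightarrow> \<bar>h y - h x\<bar> < e" using d(1) by blast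
qed

context perturbed
begin

text \<open>Eigencoordinates, given by the matrix \<open>C\<close>, of the point of the centre subspace with real coordinates \<open>\<xi>\<close>.\<close>

definition coord :: "nat \<Rightarrow> (nat \<Rightarrow> nat \<Rightarrow> complex) \<Rightarrow> (nat \<Rightarrow> real) \<Rightarrow> nat \<Rightarrow> complex" where
  "coord m C \<xi> i = (\<Sum>a<m. C i a * of_real (\<xi> a))"

lemma coord_upd:
  assumes "a < m"
  shows "coord m C (\<xi>(a := t)) = (\<lambda>i. coord m C \<xi> i + of_real (t - \<xi> a) * C i a)"
proof
  fix i
  have "coord m C (\<xi>(a := t)) i = (\<Sum>b<m. C i b * of_real (\<xi> b) + (if b = a then of_real (t - \<xi> a) * C i a else 0))"
    unfolding coord_def by (intro sum.cong) (auto simp: algebra_simps)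
  then show "coord m C (\<xi>(a := t)) i = coord m C \<xi> i + of_real (t - \<xi> a) * C i a"
    using assms by (simp add: coord_def sum.distrib)
qed

lemma coord_lipschitz:
  "\<exists>K\<ge>0. \<forall>\<xi> \<xi>'. nrm n (\<lambda>i. coord m C \<xi>' i - coord m C \<xi> i) \<le> K * l1 m \<xi> \<xi>'"
proof (intro exI conjI allI)
  let ?K = "\<Sum>i<n. \<Sum>a<m. cmod (C i a)"
  show "0 \<le> ?K" by (intro sum_nonneg) auto
  fix \<xi> \<xi>'
  have "cmod (coord m C \<xi>' i - coord m C \<xi> i) \<le> (\<Sum>a<m. cmod (C i a)) * l1 m \<xi> \<xi>'" for i
  proof -
    have "coord m C \<xi>' i - coord m C \<xi> i = (\<Sum>a<m. C i a * of_real (\<xi>' a - \<xi> a))"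
      by (simp add: coord_def sum_subtractf right_diff_distrib)
    then have "cmod (coord m C \<xi>' i - coord m C \<xi> i) \<le> (\<Sum>a<m. cmod (C i a * of_real (\<xi>' a - \<xi> a)))"
      by (simp only: norm_sum)
    also have "\<dots> \<le> (\<Sum>a<m. cmod (C i a) * l1 m \<xi> \<xi>')"
    proof (rule sum_mono)
      fix a assume "a \<in> {..<m}"
      then have "\<bar>\<xi>' a - \<xi> a\<bar> \<le> l1 m \<xi> \<xi>'" by (intro l1_coordinate) simp
      from mult_left_mono[OF this, of "cmod (C i a)"]
      show "cmod (C i a * of_real (\<xi>' a - \<xi> a)) \<le> cmod (C i a) * l1 m \<xi> \<xi>'"
        unfolding norm_mult norm_of_real by simp
    qed
    finally show ?thesis by (simp add: sum_distrib_right)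
  qed
  then have "nrm n (\<lambda>i. coord m C \<xi>' i - coord m C \<xi> i) \<le> (\<Sum>i<n. (\<Sum>a<m. cmod (C i a)) * l1 m \<xi> \<xi>')"
    unfolding nrm_def by (intro sum_mono)
  then show "nrm n (\<lambda>i. coord m C \<xi>' i - coord m C \<xi> i) \<le> ?K * l1 m \<xi> \<xi>'"
    by (simp add: sum_distrib_right)
qed

text \<open>Both for \<open>\<Psi>\<close> and for \<open>D\<close>, partial derivatives with respect to \<open>\<xi>\<close> are directional derivatives with respect to the centre
data in the direction of a column of \<open>C\<close>.\<close>

lemma real_part_partial:
  assumes "\<And>i. i < n \<Longrightarrow> ((\<lambda>s. X (\<lambda>i. coord m C \<xi> i + of_real s * C i a) i) has_vector_derivative Z i) (at 0)" and a: "a < m"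
  shows "((\<lambda>t. Re (\<Sum>i<n. p i * X (coord m C (\<xi>(a := t))) i)) has_real_derivative Re (\<Sum>i<n. p i * Z i)) (at (\<xi> a))"
proof -
  have "((\<lambda>s. \<Sum>i<n. p i * X (\<lambda>i. coord m C \<xi> i + of_real s * C i a) i) has_vector_derivative (\<Sum>i<n. p i * Z i)) (at 0)"
    using assms(1) by (intro has_vector_derivative_sum has_vector_derivative_mult_right) auto
  from bounded_linear.has_vector_derivative[OF bounded_linear_Re this]
  have d: "((\<lambda>s. Re (\<Sum>i<n. p i * X (\<lambda>i. coord m C \<xi> i + of_real s * C i a) i)) has_real_derivative Re (\<Sum>i<n. p i * Z i)) (at (\<xi> a - \<xi> a))"
    by (simp only: has_real_derivative_iff_has_vector_derivative diff_self)
  have s: "((\<lambda>t. t - \<xi> a) has_real_derivative 1) (at (\<xi> a))" by (auto intro!: derivative_eq_intros)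
  from DERIV_chain2[OF d s] show ?thesis unfolding coord_upd[OF a] by (simp only: mult_1_right)
qed

lemma real_part_continuous:
  assumes "\<And>c e i. 0 < e \<Longrightarrow> i < n \<Longrightarrow> \<exists>K\<ge>0. \<forall>c'. cmod (X c' i - X c i) \<le> e + K * nrm n (\<lambda>i. c' i - c i)"
  shows "continuous_map (subtopology (Euclidean_space m) (Eucl m)) euclideanreal (\<lambda>\<xi>. Re (\<Sum>i<n. p i * X (coord m C \<xi>) i))"
proof (rule continuous_from_modulus)
  fix \<xi> and e :: real assume e: "0 < e"
  obtain L where L: "0 \<le> L" "\<And>\<xi> \<xi>'. nrm n (\<lambda>i. coord m C \<xi>' i - coord m C \<xi> i) \<le> L * l1 m \<xi> \<xi>'"
    using coord_lipschitz[of m C] by metis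
  define q where "q = (\<Sum>i<n. cmod (p i))"
  have q: "0 \<le> q" by (simp add: q_def sum_nonneg)
  obtain e' where e': "0 < e'" "e' * q \<le> e" using small_factor[OF q e] by blast
  have "\<forall>i. \<exists>K. i < n \<longrightarrow> 0 \<le> K \<and> (\<forall>c'. cmod (X c' i - X (coord m C \<xi>) i) \<le> e' + K * nrm n (\<lambda>i. c' i - coord m C \<xi> i))"
    using assms[OF e'(1)] by metis
  then obtain K where K: "\<And>i. i < n \<Longrightarrow> 0 \<le> K i \<and> (\<forall>c'. cmod (X c' i - X (coord m C \<xi>) i) \<le> e' + K i * nrm n (\<lambda>i. c' i - coord m C \<xi> i))"
    by metis
  define k where "k = (\<Sum>i<n. cmod (p i) * K i) * L"
  have "\<bar>Re (\<Sum>i<n. p i * X (coord m C \<xi>') i) - Re (\<Sum>i<n. p i * X (coord m C \<xi>) i)\<bar> \<le> e + k * l1 m \<xi> \<xi>'" for \<xi>'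
  proof -
    let ?N = "nrm n (\<lambda>i. coord m C \<xi>' i - coord m C \<xi> i)"
    have "(\<Sum>i<n. p i * X (coord m C \<xi>') i) - (\<Sum>i<n. p i * X (coord m C \<xi>) i) = (\<Sum>i<n. p i * (X (coord m C \<xi>') i - X (coord m C \<xi>) i))"
      by (simp add: right_diff_distrib sum_subtractf)
    then have "\<bar>Re (\<Sum>i<n. p i * X (coord m C \<xi>') i) - Re (\<Sum>i<n. p i * X (coord m C \<xi>) i)\<bar>
        = \<bar>Re (\<Sum>i<n. p i * (X (coord m C \<xi>') i - X (coord m C \<xi>) i))\<bar>"
      by (simp only: minus_complex.simps(1)[symmetric])
    also have "\<dots> \<le> cmod (\<Sum>i<n. p i * (X (coord m C \<xi>') i - X (coord m C \<xi>) i))" by (rule abs_Re_le_cmod)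
    also have "\<dots> \<le> (\<Sum>i<n. cmod (p i * (X (coord m C \<xi>') i - X (coord m C \<xi>) i)))" by (rule norm_sum)
    also have "\<dots> \<le> (\<Sum>i<n. cmod (p i) * (e' + K i * ?N))"
    proof (rule sum_mono)
      fix i assume "i \<in> {..<n}"
      then have "cmod (X (coord m C \<xi>') i - X (coord m C \<xi>) i) \<le> e' + K i * ?N" using K[of i] by simp
      from mult_left_mono[OF this, of "cmod (p i)"]
      show "cmod (p i * (X (coord m C \<xi>') i - X (coord m C \<xi>) i)) \<le> cmod (p i) * (e' + K i * ?N)" by (simp only: norm_mult norm_ge_zero)
    qed
    also have "\<dots> = e' * q + (\<Sum>i<n. cmod (p i) * K i) * ?N"
      by (simp add: q_def distrib_left sum.distrib sum_distrib_left sum_distrib_right mult_ac)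
    also have "\<dots> \<le> e + (\<Sum>i<n. cmod (p i) * K i) * (L * l1 m \<xi> \<xi>')"
      using e'(2) L(2) K by (intro add_mono mult_left_mono sum_nonneg) auto
    finally show ?thesis by (simp only: k_def mult.assoc)
  qed
  moreover have "0 \<le> k" unfolding k_def using K L(1) by (intro mult_nonneg_nonneg sum_nonneg) auto
  ultimately show "\<exists>K\<ge>0. \<forall>y\<in>Eucl m. \<bar>Re (\<Sum>i<n. p i * X (coord m C y) i) - Re (\<Sum>i<n. p i * X (coord m C \<xi>) i)\<bar> \<le> e + K * l1 m \<xi> y"
    by (intro exI[of _ k]) simp
qed

lemma chart_partial:
  assumes "a < m"
  shows "((\<lambda>t. Re (\<Sum>i<n. p i * \<Psi> (coord m C (\<xi>(a := t))) 0 i)) has_real_derivative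
      Re (\<Sum>i<n. p i * D (coord m C \<xi>) (\<lambda>i. C i a) 0 i)) (at (\<xi> a))"
  by (rule real_part_partial[where X = "\<lambda>c. \<Psi> c 0", OF Psi_derivative assms])

lemma chart_partial2:
  assumes "b < m"
  shows "((\<lambda>t. Re (\<Sum>i<n. p i * D (coord m C (\<xi>(b := t))) d 0 i)) has_real_derivative
      Re (\<Sum>i<n. p i * E (coord m C \<xi>) (\<lambda>i. C i b) d 0 i)) (at (\<xi> b))"
  by (rule real_part_partial[where X = "\<lambda>c. D c d 0", OF D_derivative assms])

lemma chart_partial_deriv:
  assumes "a < m"
  shows "partial_deriv a (\<lambda>\<xi>. Re (\<Sum>i<n. p i * \<Psi> (coord m C \<xi>) 0 i)) =
    (\<lambda>\<xi>. Re (\<Sum>i<n. p i * D (coord m C \<xi>) (\<lambda>i. C i a) 0 i))"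
  unfolding partial_deriv_def[abs_def] by (rule ext) (rule DERIV_imp_deriv[OF chart_partial[OF assms]])

text \<open>First and second partial derivatives are given by \<open>D\<close> and \<open>E\<close>, and these depend continuously on the centre data.\<close>

lemma chart_C2: "Ck_scalar 2 m (Eucl m) (\<lambda>\<xi>. Re (\<Sum>i<n. p i * \<Psi> (coord m C \<xi>) 0 i))"
proof -
  have c0: "continuous_map (subtopology (Euclidean_space m) (Eucl m)) euclideanreal (\<lambda>\<xi>. Re (\<Sum>i<n. p i * \<Psi> (coord m C \<xi>) 0 i))"
  proof (rule real_part_continuous)
    show "\<exists>K\<ge>0. \<forall>c'. cmod (\<Psi> c' 0 i - \<Psi> c 0 i) \<le> e + K * nrm n (\<lambda>i. c' i - c i)" if "0 < e" "i < n" for c e i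
    proof (intro exI[of _ 2] conjI allI)
      fix c' show "cmod (\<Psi> c' 0 i - \<Psi> c 0 i) \<le> e + 2 * nrm n (\<lambda>i. c' i - c i)"
        using Psi_lipschitz[OF that(2), of c' c] that(1) by linarith
    qed simp
  qed
  have c1: "continuous_map (subtopology (Euclidean_space m) (Eucl m)) euclideanreal (\<lambda>\<xi>. Re (\<Sum>i<n. p i * D (coord m C \<xi>) d 0 i))" for d
  proof (rule real_part_continuous)
    show "\<exists>K\<ge>0. \<forall>c'. cmod (D c' d 0 i - D c d 0 i) \<le> e + K * nrm n (\<lambda>i. c' i - c i)" if "0 < e" "i < n" for c e i
    proof (intro exI[of _ "8 * M * (real n)\<^sup>2 * nrm n d / \<eta>"] conjI allI)
      fix c' show "cmod (D c' d 0 i - D c d 0 i) \<le> e + 8 * M * (real n)\<^sup>2 * nrm n d / \<eta> * nrm n (\<lambda>i. c' i - c i)"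
        using D_lipschitz[OF that(2), of c' d c] that(1) by (simp add: mult_ac)
    qed (use M eta in simp)
  qed
  have c2: "continuous_map (subtopology (Euclidean_space m) (Eucl m)) euclideanreal (\<lambda>\<xi>. Re (\<Sum>i<n. p i * E (coord m C \<xi>) e d 0 i))" for e d
    by (rule real_part_continuous) (rule E_continuity)
  have second: "partial_deriv b (\<lambda>\<xi>. Re (\<Sum>i<n. p i * D (coord m C \<xi>) d 0 i)) =
    (\<lambda>\<xi>. Re (\<Sum>i<n. p i * E (coord m C \<xi>) (\<lambda>i. C i b) d 0 i))" if "b < m" for b d
    unfolding partial_deriv_def[abs_def] by (rule ext) (rule DERIV_imp_deriv[OF chart_partial2[OF that]])
  have 1: "Ck_scalar (Suc 0) m (Eucl m) (\<lambda>\<xi>. Re (\<Sum>i<n. p i * D (coord m C \<xi>) d 0 i))" for d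
    unfolding Ck_scalar.simps
  proof (intro conjI allI impI ballI c1)
    fix b assume b: "b < m"
    show "(\<lambda>t. Re (\<Sum>i<n. p i * D (coord m C (\<xi>(b := t))) d 0 i)) field_differentiable at (\<xi> b)" for \<xi>
      unfolding field_differentiable_def by (rule exI, rule chart_partial2[OF b])
    show "continuous_map (subtopology (Euclidean_space m) (Eucl m)) euclideanreal
        (partial_deriv b (\<lambda>\<xi>. Re (\<Sum>i<n. p i * D (coord m C \<xi>) d 0 i)))"
      unfolding second[OF b] by (rule c2)
  qed
  show ?thesis
    unfolding numeral_2_eq_2 Ck_scalar.simps(2)[of "Suc 0"]
  proof (intro conjI allI impI ballI c0)
    fix a assume a: "a < m"
    show "(\<lambda>t. Re (\<Sum>i<n. p i * \<Psi> (coord m C (\<xi>(a := t))) 0 i)) field_differentiable at (\<xi> a)" for \<xi>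
      unfolding field_differentiable_def by (rule exI, rule chart_partial[OF a])
    show "Ck_scalar (Suc 0) m (Eucl m) (partial_deriv a (\<lambda>\<xi>. Re (\<Sum>i<n. p i * \<Psi> (coord m C \<xi>) 0 i)))"
      unfolding chart_partial_deriv[OF a] by (rule 1)
  qed
qed

end

section \<open>The centre subspace of a real matrix\<close>

text \<open>From here on \<open>$\<close> and \<open>$$\<close> are entries of the vectors and matrices of variable dimension.\<close>

unbundle no vec_syntax

lemma jordan_matrix_shape:
  fixes n_as :: "(nat \<times> 'a :: field) list"
  assumes "i < sum_list (map fst n_as)" "j < sum_list (map fst n_as)" "i \<noteq> j" "jordan_matrix n_as $$ (i, j) \<noteq> 0"
  shows "j = Suc i \<and> jordan_matrix n_as $$ (i, j) = 1 \<and> jordan_matrix n_as $$ (i, i) = jordan_matrix n_as $$ (j, j)"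
  using assms
proof (induction n_as arbitrary: i j)
  case (Cons na n_as)
  obtain n a where na: "na = (n, a)" by force
  let ?m = "sum_list (map fst n_as)"
  have J: "jordan_matrix (na # n_as) $$ (i, j) = (if i < n then if j < n then jordan_block n a $$ (i, j) else 0
      else if j < n then 0 else jordan_matrix n_as $$ (i - n, j - n))" if "i < n + ?m" "j < n + ?m" for i j
    unfolding na jordan_matrix_Cons using that by (subst index_mat_four_block) auto
  have ij: "i < n + ?m" "j < n + ?m" using Cons.prems na by auto
  show ?case
  proof (cases "i < n")
    case True
    then have "j < n" using Cons.prems(4) J[OF ij] by (auto split: if_splits)
    then show ?thesis using True Cons.prems(3,4) J[OF ij] J[OF ij(1,1)] J[OF ij(2,2)] by (auto split: if_splits)
  next
    case False
    then have j: "\<not> j < n" using Cons.prems(4) J[OF ij] by (auto split: if_splits)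
    have "j - n = Suc (i - n) \<and> jordan_matrix n_as $$ (i - n, j - n) = 1 \<and>
        jordan_matrix n_as $$ (i - n, i - n) = jordan_matrix n_as $$ (j - n, j - n)"
      using False j ij Cons.prems(3,4) J[OF ij] by (intro Cons.IH) auto
    then show ?thesis using False j J[OF ij] J[OF ij(1,1)] J[OF ij(2,2)] by auto
  qed
qed simp

lemma mult_index_sum:
  assumes "A \<in> carrier_mat n k" "B \<in> carrier_mat k m" "i < n" "j < m"
  shows "(A * B) $$ (i, j) = (\<Sum>l<k. A $$ (i, l) * B $$ (l, j))"
  using assms by (auto simp: scalar_prod_def atLeast0LessThan)

lemma mult_vec_index_sum:
  assumes "A \<in> carrier_mat n k" "v \<in> carrier_vec k" "i < n"
  shows "(A *\<^sub>v v) $ i = (\<Sum>l<k. A $$ (i, l) * v $ l)"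
  using assms by (auto simp: scalar_prod_def atLeast0LessThan)

text \<open>A solution of the Sylvester equation \<open>J M = M J'\<close> does not mix different eigenvalues. With \<open>J\<close> and \<open>J'\<close> upper triangular and
off-diagonal entries only between equal eigenvalues, each entry of \<open>M\<close> is determined by the entries below and to the left of it, so the induction runs from the
lower left corner.\<close>

lemma sylvester_zero:
  fixes J J' M :: "'a :: field mat"
  assumes J: "J \<in> carrier_mat n n" "J' \<in> carrier_mat n n" "M \<in> carrier_mat n n" and eq: "J * M = M * J'"
    and up: "\<And>i k. i < n \<Longrightarrow> k < n \<Longrightarrow> i \<noteq> k \<Longrightarrow> J $$ (i, k) \<noteq> 0 \<Longrightarrow> i < k \<and> J $$ (i, i) = J $$ (k, k)"
    and up': "\<And>i k. i < n \<Longrightarrow> k < n \<Longrightarrow> i \<noteq> k \<Longrightarrow> J' $$ (i, k) \<noteq> 0 \<Longrightarrow> i < k \<and> J' $$ (i, i) = J' $$ (k, k)"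
    and ij: "i < n" "j < n" and ne: "J $$ (i, i) \<noteq> J' $$ (j, j)"
  shows "M $$ (i, j) = 0"
  using ij ne
proof (induction "n - i + j" arbitrary: i j rule: less_induct)
  case less
  have "J $$ (i, k) * M $$ (k, j) = 0" if k: "k < n" "k \<noteq> i" for k
  proof (cases "J $$ (i, k) = 0")
    case False
    then have "i < k" "J $$ (i, i) = J $$ (k, k)" using up[OF less.prems(1) k(1)] k(2) by auto
    then have "M $$ (k, j) = 0" using less k by (intro less.hyps) auto
    then show ?thesis by simp
  qed simp
  then have "(\<Sum>k\<in>{..<n} - {i}. J $$ (i, k) * M $$ (k, j)) = 0" by (intro sum.neutral) blast
  then have 1: "(\<Sum>k<n. J $$ (i, k) * M $$ (k, j)) = J $$ (i, i) * M $$ (i, j)"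
    using sum.remove[of "{..<n}" i "\<lambda>k. J $$ (i, k) * M $$ (k, j)"] less.prems(1) by simp
  have "M $$ (i, k) * J' $$ (k, j) = 0" if k: "k < n" "k \<noteq> j" for k
  proof (cases "J' $$ (k, j) = 0")
    case False
    then have "k < j" "J' $$ (k, k) = J' $$ (j, j)" using up'[OF k(1) less.prems(2)] k(2) by auto
    then have "M $$ (i, k) = 0" using less k by (intro less.hyps) auto
    then show ?thesis by simp
  qed simp
  then have "(\<Sum>k\<in>{..<n} - {j}. M $$ (i, k) * J' $$ (k, j)) = 0" by (intro sum.neutral) blast
  then have 2: "(\<Sum>k<n. M $$ (i, k) * J' $$ (k, j)) = M $$ (i, j) * J' $$ (j, j)"
    using sum.remove[of "{..<n}" j "\<lambda>k. M $$ (i, k) * J' $$ (k, j)"] less.prems(2) by simp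
  have "(J * M) $$ (i, j) = (M * J') $$ (i, j)" using eq by simp
  then have "J $$ (i, i) * M $$ (i, j) = M $$ (i, j) * J' $$ (j, j)"
    using mult_index_sum[OF J(1,3) less.prems(1,2)] mult_index_sum[OF J(3,2) less.prems(1,2)] 1 2 by simp
  then show ?case using less.prems(3) by (simp add: mult.commute)
qed

text \<open>Rank factorization: among all representations of \<open>R\<close> as a sum of products of a column and a row take a shortest
one. Its columns and its rows are then linearly independent, because a linear relation would allow one term to be
removed. So \<open>Q (L Q - 1) L = R R - R = 0\<close> can be cancelled on both sides.\<close>

lemma idempotent_factorization:
  fixes R :: "'a :: field mat"
  assumes R: "R \<in> carrier_mat n n" and idem: "R * R = R"
  shows "\<exists>m Q L. Q \<in> carrier_mat n m \<and> L \<in> carrier_mat m n \<and> R = Q * L \<and> L * Q = 1\<^sub>m m"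
proof -
  define fact where "fact A \<longleftrightarrow> finite A \<and> (\<exists>q l. \<forall>i<n. \<forall>j<n. R $$ (i, j) = (\<Sum>a\<in>A. q i a * l a j))" for A :: "nat set"
  have factI: "fact B" if "finite B" "\<And>i j. i < n \<Longrightarrow> j < n \<Longrightarrow> R $$ (i, j) = (\<Sum>a\<in>B. q i a * l a j)" for B q l
    unfolding fact_def
    by (rule conjI[OF that(1)], rule exI[of _ q], rule exI[of _ l], intro allI impI, rule that(2))
  have "fact {..<n}"
  proof (rule factI[of _ "\<lambda>i a. R $$ (i, a)" "\<lambda>a j. if a = j then 1 else 0"])
    fix i j assume j: "j < n"
    have "(\<Sum>a<n. R $$ (i, a) * (if a = j then 1 else 0)) = (\<Sum>a<n. if a = j then R $$ (i, a) else 0)"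
      by (rule sum.cong) auto
    then show "R $$ (i, j) = (\<Sum>a<n. R $$ (i, a) * (if a = j then 1 else 0))" using j by simp
  qed simp
  then obtain A where A: "fact A" and min: "\<And>B. fact B \<Longrightarrow> card A \<le> card B"
    using ex_has_least_nat[of fact "{..<n}" card] by blast
  have fin: "finite A" using A by (simp add: fact_def)
  obtain q l where ql: "\<And>i j. i < n \<Longrightarrow> j < n \<Longrightarrow> R $$ (i, j) = (\<Sum>a\<in>A. q i a * l a j)"
    using A unfolding fact_def by blast
  have indep_q: "x a = 0" if x: "\<And>i. i < n \<Longrightarrow> (\<Sum>a\<in>A. q i a * x a) = 0" and a: "a \<in> A" for x a
  proof (rule ccontr)
    assume xa: "x a \<noteq> 0"
    have "R $$ (i, j) = (\<Sum>b\<in>A - {a}. q i b * (l b j - x b / x a * l a j))" if ij: "i < n" "j < n" for i j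
    proof -
      have "q i a * x a + (\<Sum>b\<in>A - {a}. q i b * x b) = 0"
        using x[OF ij(1)] sum.remove[OF fin a, of "\<lambda>b. q i b * x b"] by simp
      then have "q i a * x a = - (\<Sum>b\<in>A - {a}. q i b * x b)" by (simp only: eq_neg_iff_add_eq_0)
      then have "q i a = - (\<Sum>b\<in>A - {a}. q i b * x b) / x a"
        by (metis nonzero_mult_div_cancel_right xa)
      then have "q i a * l a j = - (\<Sum>b\<in>A - {a}. q i b * (x b / x a * l a j))"
        by (simp add: sum_distrib_left sum_distrib_right sum_divide_distrib mult_ac)
      then show ?thesis unfolding ql[OF ij] sum.remove[OF fin a]
        by (simp add: right_diff_distrib sum_subtractf)
    qed
    then have "fact (A - {a})" by (rule factI[of "A - {a}" q "\<lambda>b j. l b j - x b / x a * l a j", OF finite_Diff[OF fin]])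
    from min[OF this] show False using card_Diff1_less[OF fin a] by simp
  qed
  have indep_l: "y a = 0" if y: "\<And>j. j < n \<Longrightarrow> (\<Sum>a\<in>A. y a * l a j) = 0" and a: "a \<in> A" for y a
  proof (rule ccontr)
    assume ya: "y a \<noteq> 0"
    have "R $$ (i, j) = (\<Sum>b\<in>A - {a}. (q i b - q i a * (y b / y a)) * l b j)" if ij: "i < n" "j < n" for i j
    proof -
      have "y a * l a j + (\<Sum>b\<in>A - {a}. y b * l b j) = 0"
        using y[OF ij(2)] sum.remove[OF fin a, of "\<lambda>b. y b * l b j"] by simp
      then have "y a * l a j = - (\<Sum>b\<in>A - {a}. y b * l b j)" by (simp only: eq_neg_iff_add_eq_0)
      then have "l a j = - (\<Sum>b\<in>A - {a}. y b * l b j) / y a"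
        by (metis nonzero_mult_div_cancel_left ya)
      then have "q i a * l a j = - (\<Sum>b\<in>A - {a}. q i a * (y b / y a) * l b j)"
        by (simp add: sum_distrib_left sum_divide_distrib mult_ac)
      then show ?thesis unfolding ql[OF ij] sum.remove[OF fin a]
        by (simp add: left_diff_distrib sum_subtractf)
    qed
    then have "fact (A - {a})" by (rule factI[of "A - {a}" "\<lambda>i b. q i b - q i a * (y b / y a)" l, OF finite_Diff[OF fin]])
    from min[OF this] show False using card_Diff1_less[OF fin a] by simp
  qed
  define m where "m = card A"
  obtain h where h: "bij_betw h {..<m} A"
    using ex_bij_betw_nat_finite[OF fin] by (auto simp: m_def atLeast0LessThan)
  have hA: "h a \<in> A" if "a < m" for a using h that by (auto simp: bij_betw_def)
  have reindex: "(\<Sum>a\<in>A. f a) = (\<Sum>a<m. f (h a))" for f :: "nat \<Rightarrow> 'a"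
    using sum.reindex_bij_betw[OF h] by metis
  define Q where "Q = mat n m (\<lambda>(i, a). q i (h a))"
  define L where "L = mat m n (\<lambda>(a, j). l (h a) j)"
  have Q: "Q \<in> carrier_mat n m" and L: "L \<in> carrier_mat m n" by (auto simp: Q_def L_def)
  have RQL: "R = Q * L"
  proof (rule eq_matI)
    fix i j assume "i < dim_row (Q * L)" "j < dim_col (Q * L)"
    then have ij: "i < n" "j < n" using Q L by auto
    show "R $$ (i, j) = (Q * L) $$ (i, j)"
      unfolding mult_index_sum[OF Q L ij] ql[OF ij] reindex using ij by (auto simp: Q_def L_def intro!: sum.cong)
  qed (use R Q L in auto)
  \<comment> \<open>\<open>Q X L = 0\<close>; independence of the columns removes \<open>Q\<close>, independence of the rows removes \<open>L\<close>.\<close>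
  define X where "X = L * Q - 1\<^sub>m m"
  have X: "X \<in> carrier_mat m m" using L Q by (auto simp: X_def)
  have "Q * (X * L) = Q * ((L * Q) * L - L)"
    using L Q by (simp add: X_def minus_mult_distrib_mat[of _ m m])
  also have "\<dots> = Q * ((L * Q) * L) - Q * L"
    using L Q by (intro mult_minus_distrib_mat) auto
  also have "Q * ((L * Q) * L) = R * R"
    using L Q by (simp add: RQL assoc_mult_mat[of _ n m _ n _ m] assoc_mult_mat[of _ m n _ m _ n] assoc_mult_mat[of _ n m _ n _ n])
  finally have QXL: "Q * (X * L) = 0\<^sub>m n n" using R idem RQL by simp
  have XLc: "X * L \<in> carrier_mat m n" using X L by auto
  have XL: "(X * L) $$ (a, j) = 0" if "a < m" "j < n" for a j
  proof -
    define x where "x = (\<lambda>b. (X * L) $$ (inv_into {..<m} h b, j))"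
    have xh: "x (h b) = (X * L) $$ (b, j)" if "b < m" for b
      using h that by (simp add: x_def bij_betw_def inv_into_f_f)
    have "(\<Sum>b\<in>A. q i b * x b) = 0" if i: "i < n" for i
    proof -
      have "(\<Sum>b\<in>A. q i b * x b) = (\<Sum>b<m. Q $$ (i, b) * (X * L) $$ (b, j))"
        unfolding reindex using i by (intro sum.cong) (auto simp: Q_def xh)
      also have "\<dots> = (Q * (X * L)) $$ (i, j)" using mult_index_sum[OF Q XLc i \<open>j < n\<close>] by simp
      finally show ?thesis using QXL i \<open>j < n\<close> by simp
    qed
    from indep_q[OF this hA[OF \<open>a < m\<close>]] show ?thesis using xh \<open>a < m\<close> by simp
  qed
  have "X $$ (a, b) = 0" if ab: "a < m" "b < m" for a b
  proof -
    define y where "y = (\<lambda>b. X $$ (a, inv_into {..<m} h b))"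
    have yh: "y (h b) = X $$ (a, b)" if "b < m" for b
      using h that by (simp add: y_def bij_betw_def inv_into_f_f)
    have "(\<Sum>b\<in>A. y b * l b j) = 0" if j: "j < n" for j
    proof -
      have "(\<Sum>b\<in>A. y b * l b j) = (\<Sum>b<m. X $$ (a, b) * L $$ (b, j))"
        unfolding reindex using j by (intro sum.cong) (auto simp: L_def yh)
      also have "\<dots> = (X * L) $$ (a, j)" using mult_index_sum[OF X L ab(1) j] by simp
      finally show ?thesis using XL[OF ab(1) j] by simp
    qed
    from indep_l[OF this hA[OF ab(2)]] show ?thesis using yh ab by simp
  qed
  then have "L * Q = 1\<^sub>m m"
    using L Q by (intro eq_matI) (force simp: X_def)+
  then show ?thesis using Q L RQL by blast
qed

lemma cnj_hom: "comm_ring_hom cnj"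
  by unfold_locales auto

lemma map_cnj_mult:
  assumes "A \<in> carrier_mat n k" "B \<in> carrier_mat k m"
  shows "map_mat cnj (A * B) = map_mat cnj A * map_mat cnj B"
proof -
  interpret comm_ring_hom cnj by (rule cnj_hom)
  show ?thesis by (rule mat_hom_mult[OF assms])
qed

lemma cmat_mult:
  assumes "A \<in> carrier_mat n k" "B \<in> carrier_mat k m"
  shows "cmat (A * B) = cmat A * cmat B"
  using of_real_hom.mat_hom_mult[OF assms] .

lemma cmat_inject: "cmat A = cmat B \<Longrightarrow> A = B"
  using of_real_hom.mat_hom_inj by blast

text \<open>In Jordan coordinates, the spectral projection onto the eigenvalues on the imaginary axis.\<close>

definition center_projection :: "nat \<Rightarrow> complex mat \<Rightarrow> complex mat" where
  "center_projection n J = mat n n (\<lambda>(i, j). if i = j \<and> Re (J $$ (i, i)) = 0 then 1 else 0)"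

lemma center_projection_carrier [simp]: "center_projection n J \<in> carrier_mat n n"
  by (simp add: center_projection_def)

lemma center_projection_left:
  assumes "M \<in> carrier_mat n k" "i < n" "j < k"
  shows "(center_projection n J * M) $$ (i, j) = (if Re (J $$ (i, i)) = 0 then M $$ (i, j) else 0)"
proof -
  have "(center_projection n J * M) $$ (i, j) = (\<Sum>l<n. if l = i then (if Re (J $$ (i, i)) = 0 then M $$ (l, j) else 0) else 0)"
    unfolding mult_index_sum[OF center_projection_carrier assms]
    by (rule sum.cong) (use assms in \<open>auto simp: center_projection_def\<close>)
  then show ?thesis using assms by simp
qed

lemma center_projection_right:
  assumes "M \<in> carrier_mat k n" "i < k" "j < n"
  shows "(M * center_projection n J) $$ (i, j) = (if Re (J $$ (j, j)) = 0 then M $$ (i, j) else 0)"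
proof -
  have "(M * center_projection n J) $$ (i, j) = (\<Sum>l<n. if l = j then (if Re (J $$ (j, j)) = 0 then M $$ (i, l) else 0) else 0)"
    unfolding mult_index_sum[OF assms(1) center_projection_carrier assms(2,3)]
    by (rule sum.cong) (use assms in \<open>auto simp: center_projection_def\<close>)
  then show ?thesis using assms by simp
qed

lemma center_projection_commutes:
  assumes M: "M \<in> carrier_mat n n"
    and "\<And>i j. i < n \<Longrightarrow> j < n \<Longrightarrow> M $$ (i, j) \<noteq> 0 \<Longrightarrow> Re (J $$ (i, i)) = Re (J $$ (j, j))"
  shows "M * center_projection n J = center_projection n J * M"
proof (rule eq_matI)
  fix i j assume "i < dim_row (center_projection n J * M)" "j < dim_col (center_projection n J * M)"
  then have ij: "i < n" "j < n" using M by (auto simp: center_projection_def)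
  show "(M * center_projection n J) $$ (i, j) = (center_projection n J * M) $$ (i, j)"
    unfolding center_projection_left[OF M ij] center_projection_right[OF M ij]
    using assms(2)[OF ij] by (cases "M $$ (i, j) = 0") simp_all
qed (use M in \<open>auto simp: center_projection_def\<close>)

text \<open>The spectral projection \<open>Z = P I P'\<close> of a real matrix is real: complex conjugation carries a Jordan basis
\<open>P\<close> of \<open>S\<close> to the basis \<open>cnj P\<close> with the conjugate Jordan form, whose diagonal has the same real parts; the transition
matrix \<open>M = P' (cnj P)\<close> does not mix different eigenvalues and therefore commutes with the projection \<open>I\<close>. The matrices \<open>Q\<close>
and \<open>L\<close> are the rank factorization of the real projection.\<close>

lemma center_splitting:
  fixes S :: "real mat"
  assumes S: "S \<in> carrier_mat n n"
  shows "\<exists>J P P' m Q L. {J, P, P'} \<subseteq> carrier_mat n n \<and> P * P' = 1\<^sub>m n \<and> P' * P = 1\<^sub>m n \<and> P' * cmat S = J * P' \<and>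
    (\<forall>i<n. \<forall>j<n. i \<noteq> j \<longrightarrow> J $$ (i, j) \<noteq> 0 \<longrightarrow> j = Suc i \<and> J $$ (i, j) = 1 \<and> J $$ (i, i) = J $$ (j, j)) \<and>
    Q \<in> carrier_mat n m \<and> L \<in> carrier_mat m n \<and> L * Q = 1\<^sub>m m \<and>
    S * Q = Q * (L * S * Q) \<and>
    P' * cmat Q = center_projection n J * (P' * cmat Q) \<and>
    center_projection n J * P' = P' * cmat (Q * L)"
proof -
  define A where "A = cmat S"
  have A: "A \<in> carrier_mat n n" using S by (simp add: A_def)
  obtain as where "char_poly A = (\<Prod>a\<leftarrow>as. [:- a, 1:])" using char_poly_factorized[OF A] by blast
  from jordan_nf_exists[OF A this] obtain n_as where "jordan_nf A n_as" by blast
  then obtain P P' where sim: "similar_mat_wit A (jordan_matrix n_as) P P'"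
    unfolding jordan_nf_def similar_mat_def by blast
  define J where "J = jordan_matrix n_as"
  note simD = similar_mat_witD2[OF A sim, folded J_def]
  have PP': "P * P' = 1\<^sub>m n" and P'P: "P' * P = 1\<^sub>m n" and APJ: "A = P * J * P'"
    and J: "J \<in> carrier_mat n n" and P: "P \<in> carrier_mat n n" and P': "P' \<in> carrier_mat n n"
    using simD by auto
  have dim: "sum_list (map fst n_as) = n" using J by (auto simp: J_def)
  have shape: "j = Suc i \<and> J $$ (i, j) = 1 \<and> J $$ (i, i) = J $$ (j, j)"
    if "i < n" "j < n" "i \<noteq> j" "J $$ (i, j) \<noteq> 0" for i j
    using jordan_matrix_shape[of i n_as j] that unfolding dim J_def by blast
  have closed [simp]: "X * Y \<in> carrier_mat n n" if "X \<in> carrier_mat n n" "Y \<in> carrier_mat n n" for X Y :: "complex mat"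
    using that by (rule mult_carrier_mat)
  note assoc = assoc_mult_mat[of _ n n _ n _ n]
  have AP: "A * P = P * J"
    using P P' J by (simp add: APJ assoc P'P)
  have P'A: "P' * A = J * P'"
  proof -
    have "P' * A = (P' * P) * (J * P')" using P P' J by (simp add: APJ assoc del: P'P)
    then show ?thesis using P'P P' J by simp
  qed
  let ?I = "center_projection n J"
  define cP where "cP = map_mat cnj P"
  define cP' where "cP' = map_mat cnj P'"
  define cJ where "cJ = map_mat cnj J"
  have cc: "cP \<in> carrier_mat n n" "cP' \<in> carrier_mat n n" "cJ \<in> carrier_mat n n"
    using P P' J by (auto simp: cP_def cP'_def cJ_def)
  have cA: "map_mat cnj A = A" by (rule eq_matI) (auto simp: A_def)
  have cone: "map_mat cnj (1\<^sub>m n) = 1\<^sub>m n" by (rule eq_matI) auto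
  have cPP': "cP * cP' = 1\<^sub>m n" using map_cnj_mult[OF P P'] PP' cone by (simp add: cP_def cP'_def)
  have AcP: "A * cP = cP * cJ" using map_cnj_mult[OF A P] map_cnj_mult[OF P J] AP cA by (simp add: cP_def cJ_def)
  \<comment> \<open>The transition matrix from the conjugate Jordan basis to the given one.\<close>
  define M where "M = P' * cP"
  have M: "M \<in> carrier_mat n n" using P' cc by (simp add: M_def)
  have JM: "J * M = M * cJ"
  proof -
    have "J * M = (J * P') * cP" unfolding M_def by (rule assoc_mult_mat[symmetric, OF J P' cc(1)])
    also have "\<dots> = (P' * A) * cP" by (simp only: P'A)
    also have "\<dots> = P' * (A * cP)" by (rule assoc_mult_mat[OF P' A cc(1)])
    also have "\<dots> = P' * (cP * cJ)" by (simp only: AcP)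
    also have "\<dots> = M * cJ" unfolding M_def by (rule assoc_mult_mat[symmetric, OF P' cc(1,3)])
    finally show ?thesis .
  qed
  have MI: "M * ?I = ?I * M"
  proof (rule center_projection_commutes[OF M])
    fix i j assume ij: "i < n" "j < n" "M $$ (i, j) \<noteq> 0"
    have "J $$ (i, i) = cJ $$ (j, j)"
    proof (rule ccontr)
      assume ne: "J $$ (i, i) \<noteq> cJ $$ (j, j)"
      have "M $$ (i, j) = 0"
      proof (rule sylvester_zero[OF J cc(3) M JM _ _ ij(1,2) ne])
        show "i < k \<and> J $$ (i, i) = J $$ (k, k)" if "i < n" "k < n" "i \<noteq> k" "J $$ (i, k) \<noteq> 0" for i k
          using shape[OF that] by simp
        show "i < k \<and> cJ $$ (i, i) = cJ $$ (k, k)" if "i < n" "k < n" "i \<noteq> k" "cJ $$ (i, k) \<noteq> 0" for i k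
          using shape[of i k] that J by (auto simp: cJ_def)
      qed
      then show False using ij(3) by simp
    qed
    then show "Re (J $$ (i, i)) = Re (J $$ (j, j))" using ij J by (simp add: cJ_def)
  qed
  define Z where "Z = P * ?I * P'"
  have Z: "Z \<in> carrier_mat n n" unfolding Z_def
    by (rule mult_carrier_mat[OF mult_carrier_mat[OF P center_projection_carrier] P'])
  have cI: "map_mat cnj ?I = ?I" by (rule eq_matI) (auto simp: center_projection_def)
  have II: "?I * ?I = ?I"
  proof (rule eq_matI)
    fix i j assume "i < dim_row ?I" "j < dim_col ?I"
    then have ij: "i < n" "j < n" by (auto simp: center_projection_def)
    show "(?I * ?I) $$ (i, j) = ?I $$ (i, j)"
      unfolding center_projection_left[OF center_projection_carrier ij] using ij by (auto simp: center_projection_def)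
  qed (auto simp: center_projection_def)
  have JI: "J * ?I = ?I * J"
  proof (rule center_projection_commutes[OF J])
    fix i j assume "i < n" "j < n" "J $$ (i, j) \<noteq> 0"
    then show "Re (J $$ (i, i)) = Re (J $$ (j, j))" using shape by (cases "i = j") auto
  qed
  have P'Z: "P' * Z = ?I * P'"
  proof -
    have "P' * Z = (P' * P) * (?I * P')" using P P' by (simp add: Z_def assoc del: P'P)
    then show ?thesis using P'P P' by (simp add: left_mult_one_mat[of _ n n])
  qed
  have ZZ: "Z * Z = Z"
  proof -
    have "Z * Z = P * ?I * (P' * Z)" using P P' Z by (simp add: Z_def assoc)
    also have "\<dots> = P * (?I * ?I) * P'" using P P' by (simp add: P'Z assoc del: II)
    finally show ?thesis by (simp add: II Z_def)
  qed
  have AZ: "A * Z = Z * A"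
  proof -
    have "A * Z = (A * P) * (?I * P')" using A P P' by (simp add: Z_def assoc)
    also have "\<dots> = P * (J * ?I) * P'" using P P' J by (simp add: AP assoc)
    also have "\<dots> = P * ?I * (J * P')" using P P' J by (simp add: JI assoc)
    also have "\<dots> = Z * A" using P P' A by (simp add: P'A[symmetric] Z_def assoc)
    finally show ?thesis .
  qed
  define cZ where "cZ = map_mat cnj Z"
  have cZ: "cZ = cP * ?I * cP'"
    unfolding cZ_def Z_def using map_cnj_mult[of "P * ?I" n n P' n] map_cnj_mult[of P n n ?I n] P P'
    by (simp add: cP_def cP'_def cI)
  have PM: "P * M = cP"
  proof -
    have "P * M = (P * P') * cP" using P P' cc by (simp add: M_def assoc del: PP')
    then show ?thesis using PP' cc by simp
  qed
  have "cZ = P * (M * ?I) * cP'" using P M cc by (simp add: cZ assoc flip: PM)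
  also have "\<dots> = P * ?I * (P' * (cP * cP'))" using P M cc P' by (simp add: MI assoc) (simp add: M_def assoc P' cc)
  also have "\<dots> = Z" using P P' by (simp add: cPP' Z_def)
  finally have cZZ: "map_mat cnj Z = Z" by (simp add: cZ_def)
  define R where "R = map_mat Re Z"
  have R: "R \<in> carrier_mat n n" using Z by (simp add: R_def)
  have RZ: "cmat R = Z"
  proof (rule eq_matI)
    fix i j assume ij: "i < dim_row Z" "j < dim_col Z"
    have "map_mat cnj Z $$ (i, j) = Z $$ (i, j)" using cZZ by simp
    then have "cnj (Z $$ (i, j)) = Z $$ (i, j)" using ij by simp
    then have "of_real (Re (Z $$ (i, j))) = Z $$ (i, j)" by (metis Reals_cnj_iff of_real_Re)
    then show "cmat R $$ (i, j) = Z $$ (i, j)" using ij by (simp add: R_def)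
  qed (auto simp: R_def)
  have RR: "R * R = R" by (rule cmat_inject) (simp add: cmat_mult[OF R R] RZ ZZ)
  have SR: "S * R = R * S" by (rule cmat_inject) (use AZ in \<open>simp add: cmat_mult[OF R S] cmat_mult[OF S R] RZ A_def\<close>)
  obtain m Q L where QL: "Q \<in> carrier_mat n m" "L \<in> carrier_mat m n" "R = Q * L" "L * Q = 1\<^sub>m m"
    using idempotent_factorization[OF R RR] by blast
  note Q = QL(1) and L = QL(2)
  have RQ: "R * Q = Q"
  proof -
    have "R * Q = Q * (L * Q)" using Q L by (simp add: QL(3) assoc_mult_mat[of _ n m _ n _ m] del: QL(4))
    then show ?thesis using Q by (simp add: QL(4))
  qed
  have SQ: "S * Q = Q * (L * S * Q)"
  proof -
    have "S * Q = S * R * Q" using S R Q RQ by (simp add: assoc_mult_mat[of _ n n _ n _ m])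
    also have "\<dots> = (Q * L) * (S * Q)" using S R Q SR by (simp add: assoc_mult_mat[of _ n n _ n _ m] QL(3))
    also have "\<dots> = Q * (L * (S * Q))" using S Q L by (intro assoc_mult_mat) auto
    also have "L * (S * Q) = L * S * Q" using S Q L by (intro assoc_mult_mat[symmetric]) auto
    finally show ?thesis .
  qed
  have cQ: "cmat Q \<in> carrier_mat n m" using Q by simp
  have 1: "P' * cmat Q = ?I * (P' * cmat Q)"
  proof -
    have "P' * cmat Q = P' * (Z * cmat Q)" using cmat_mult[OF R Q] RQ RZ by simp
    also have "\<dots> = P' * Z * cmat Q" using P' Z cQ by (intro assoc_mult_mat[symmetric]) auto
    also have "\<dots> = ?I * (P' * cmat Q)" unfolding P'Z by (rule assoc_mult_mat[OF center_projection_carrier P' cQ])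
    finally show ?thesis .
  qed
  have 2: "?I * P' = P' * cmat (Q * L)" using P'Z RZ QL(3) by simp
  show ?thesis
    by (rule exI[of _ J], rule exI[of _ P], rule exI[of _ P'], rule exI[of _ m], rule exI[of _ Q], rule exI[of _ L])
      (use J P P' PP' P'P P'A[unfolded A_def] shape Q L QL(4) SQ 1 2 in \<open>intro conjI, auto\<close>)
qed

text \<open>For an eigenvector \<open>v\<close> of \<open>L S Q\<close>, the vector \<open>w = P' Q v\<close> is an eigenvector of the triangular \<open>J\<close> in the range of the centre
projection. The last nonzero entry of \<open>w\<close> identifies the eigenvalue with a diagonal entry of \<open>J\<close> on the imaginary axis.\<close>

lemma center_restriction_eigenvalue:
  fixes S :: "real mat"
  assumes S: "S \<in> carrier_mat n n" and J: "J \<in> carrier_mat n n" and P: "P \<in> carrier_mat n n" and P': "P' \<in> carrier_mat n n"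
    and PP': "P * P' = 1\<^sub>m n" and P'S: "P' * cmat S = J * P'"
    and up: "\<And>i j. i < n \<Longrightarrow> j < n \<Longrightarrow> j < i \<Longrightarrow> J $$ (i, j) = 0"
    and Q: "Q \<in> carrier_mat n m" and L: "L \<in> carrier_mat m n" and LQ: "L * Q = 1\<^sub>m m"
    and SQ: "S * Q = Q * (L * S * Q)" and center: "P' * cmat Q = center_projection n J * (P' * cmat Q)"
    and ev: "eigenvalue (cmat (L * S * Q)) p"
  shows "Re p = 0"
proof -
  define T where "T = L * S * Q"
  have T: "T \<in> carrier_mat m m" using L S Q by (auto simp: T_def)
  from ev obtain v where v: "v \<in> carrier_vec m" "v \<noteq> 0\<^sub>v m" "cmat T *\<^sub>v v = p \<cdot>\<^sub>v v"
    using T by (auto simp: eigenvalue_def eigenvector_def T_def[symmetric])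
  have c: "cmat S \<in> carrier_mat n n" "cmat Q \<in> carrier_mat n m" "cmat L \<in> carrier_mat m n" "cmat T \<in> carrier_mat m m"
    using S Q L T by auto
  define w where "w = P' *\<^sub>v (cmat Q *\<^sub>v v)"
  have qv: "cmat Q *\<^sub>v v \<in> carrier_vec n" by (rule mult_mat_vec_carrier[OF c(2) v(1)])
  have w: "w \<in> carrier_vec n" unfolding w_def by (rule mult_mat_vec_carrier[OF P' qv])
  have "cmat S * cmat Q = cmat Q * cmat T"
    using cmat_mult[OF S Q] cmat_mult[OF Q T] SQ by (simp add: T_def)
  then have Sqv: "cmat S *\<^sub>v (cmat Q *\<^sub>v v) = p \<cdot>\<^sub>v (cmat Q *\<^sub>v v)"
    using assoc_mult_mat_vec[OF c(1,2) v(1)] assoc_mult_mat_vec[OF c(2,4) v(1)] mult_mat_vec[OF c(2) v(1)] v(3) by simp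
  have Jw: "J *\<^sub>v w = p \<cdot>\<^sub>v w"
  proof -
    have "J *\<^sub>v w = (P' * cmat S) *\<^sub>v (cmat Q *\<^sub>v v)"
      unfolding w_def P'S by (rule assoc_mult_mat_vec[symmetric, OF J P' qv])
    also have "\<dots> = P' *\<^sub>v (cmat S *\<^sub>v (cmat Q *\<^sub>v v))" by (rule assoc_mult_mat_vec[OF P' c(1) qv])
    also have "\<dots> = p \<cdot>\<^sub>v w" unfolding Sqv w_def by (rule mult_mat_vec[OF P' qv])
    finally show ?thesis .
  qed
  have w_ne: "\<exists>i<n. w $ i \<noteq> 0"
  proof (rule ccontr)
    assume "\<not> (\<exists>i<n. w $ i \<noteq> 0)"
    then have w0: "w = 0\<^sub>v n" using w by (intro eq_vecI) auto
    have "cmat Q *\<^sub>v v = (P * P') *\<^sub>v (cmat Q *\<^sub>v v)" using PP' qv by simp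
    also have "\<dots> = P *\<^sub>v w" unfolding w_def by (rule assoc_mult_mat_vec[OF P P' qv])
    also have "\<dots> = 0\<^sub>v n" unfolding w0 using P by (intro eq_vecI) auto
    finally have q0: "cmat Q *\<^sub>v v = 0\<^sub>v n" .
    have "cmat (L * Q) = 1\<^sub>m m" unfolding LQ by (rule eq_matI) auto
    then have "v = (cmat L * cmat Q) *\<^sub>v v" using cmat_mult[OF L Q] v by simp
    also have "\<dots> = cmat L *\<^sub>v (cmat Q *\<^sub>v v)" by (rule assoc_mult_mat_vec[OF c(3,2) v(1)])
    also have "\<dots> = 0\<^sub>v m" unfolding q0 using c(3) by (intro eq_vecI) auto
    finally show False using v(2) by simp
  qed
  \<comment> \<open>Row \<open>i\<close> of \<open>J w = p w\<close> contains only the diagonal term.\<close>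
  define i where "i = Max {i. i < n \<and> w $ i \<noteq> 0}"
  have "i \<in> {i. i < n \<and> w $ i \<noteq> 0}" unfolding i_def using w_ne by (intro Max_in) auto
  then have i: "i < n" "w $ i \<noteq> 0" by auto
  have above: "w $ j = 0" if "j < n" "i < j" for j
  proof (rule ccontr)
    assume "w $ j \<noteq> 0"
    then have "j \<le> i" unfolding i_def using that(1) by (intro Max_ge) auto
    then show False using that by simp
  qed
  have "Re (J $$ (i, i)) = 0"
  proof (rule ccontr)
    assume ne: "Re (J $$ (i, i)) \<noteq> 0"
    have c2: "P' * cmat Q \<in> carrier_mat n m" by (rule mult_carrier_mat[OF P' c(2)])
    have "w $ i = ((P' * cmat Q) *\<^sub>v v) $ i" unfolding w_def by (simp add: assoc_mult_mat_vec[OF P' c(2) v(1)])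
    also have "\<dots> = (\<Sum>l<m. (P' * cmat Q) $$ (i, l) * v $ l)" by (rule mult_vec_index_sum[OF c2 v(1) i(1)])
    also have "\<dots> = 0"
    proof (rule sum.neutral, rule ballI)
      fix l assume "l \<in> {..<m}"
      then have "(P' * cmat Q) $$ (i, l) = 0"
        using center_projection_left[OF c2 i(1), of l J] ne center by simp
      then show "(P' * cmat Q) $$ (i, l) * v $ l = 0" by simp
    qed
    finally show False using i(2) by simp
  qed
  moreover have "J $$ (i, i) = p"
  proof -
    have "p * w $ i = (J *\<^sub>v w) $ i" using Jw w i(1) by simp
    also have "\<dots> = (\<Sum>l<n. J $$ (i, l) * w $ l)" by (rule mult_vec_index_sum[OF J w i(1)])
    also have "\<dots> = J $$ (i, i) * w $ i + (\<Sum>l\<in>{..<n} - {i}. J $$ (i, l) * w $ l)"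
      using i(1) by (intro sum.remove) auto
    also have "(\<Sum>l\<in>{..<n} - {i}. J $$ (i, l) * w $ l) = 0"
    proof (rule sum.neutral, rule ballI)
      fix l assume "l \<in> {..<n} - {i}"
      then show "J $$ (i, l) * w $ l = 0" using above[of l] up[OF i(1), of l] by (cases "l < i") auto
    qed
    finally show ?thesis using i(2) by simp
  qed
  ultimately show ?thesis by simp
qed

text \<open>Scaling the Jordan basis by powers of \<open>\<epsilon>\<close> multiplies the superdiagonal entries \<open>1\<close> of the Jordan form by \<open>\<epsilon>\<close>, while the
diagonal \<open>lam\<close>, the centre subspace and its coordinates \<open>Q\<close>, \<open>L\<close> are fixed beforehand. This order of quantifiers is needed: the
size of \<open>\<epsilon>\<close> is chosen according to the spectral gap of \<open>lam\<close>. The last two clauses say that \<open>Q\<close> has centre components only,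
and that \<open>L\<close> reads off the centre components of an arbitrary vector.\<close>

lemma center_coordinates:
  fixes S :: "real mat"
  assumes S: "S \<in> carrier_mat n n"
  shows "\<exists>lam m Q L. Q \<in> carrier_mat n m \<and> L \<in> carrier_mat m n \<and> L * Q = 1\<^sub>m m \<and>
    S * Q = Q * (L * S * Q) \<and>
    (\<forall>p. eigenvalue (cmat (L * S * Q)) p \<longrightarrow> Re p = 0) \<and>
    (\<forall>\<epsilon>>0. \<exists>P P' N :: nat \<Rightarrow> nat \<Rightarrow> complex.
      (\<forall>i<n. \<forall>j<n. (\<Sum>k<n. P i k * P' k j) = (if i = j then 1 else 0)) \<and>
      (\<forall>i<n. \<forall>j<n. (\<Sum>k<n. P' i k * of_real (S $$ (k, j))) = lam i * P' i j + (\<Sum>k<n. N i k * P' k j)) \<and>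
      (\<forall>i<n. \<forall>j<n. cmod (N i j) \<le> \<epsilon> \<and> (N i j \<noteq> 0 \<longrightarrow> lam i = lam j)) \<and>
      (\<forall>i<n. Re (lam i) \<noteq> 0 \<longrightarrow> (\<forall>a<m. (\<Sum>k<n. P' i k * of_real (Q $$ (k, a))) = 0)) \<and>
      (\<forall>i<n. Re (lam i) = 0 \<longrightarrow> (\<forall>j<n. P' i j = (\<Sum>a<m. (\<Sum>k<n. P' i k * of_real (Q $$ (k, a))) * of_real (L $$ (a, j))))))"
proof -
  obtain J P P' m Q L where *: "{J, P, P'} \<subseteq> carrier_mat n n" "P * P' = 1\<^sub>m n" "P' * P = 1\<^sub>m n" and P'S: "P' * cmat S = J * P'"
    and shape: "\<forall>i<n. \<forall>j<n. i \<noteq> j \<longrightarrow> J $$ (i, j) \<noteq> 0 \<longrightarrow> j = Suc i \<and> J $$ (i, j) = 1 \<and> J $$ (i, i) = J $$ (j, j)"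
    and Q: "Q \<in> carrier_mat n m" and L: "L \<in> carrier_mat m n" and LQ: "L * Q = 1\<^sub>m m"
    and SQ: "S * Q = Q * (L * S * Q)"
    and cen: "P' * cmat Q = center_projection n J * (P' * cmat Q)"
    and cen': "center_projection n J * P' = P' * cmat (Q * L)"
    using center_splitting[OF S] by (elim exE conjE) (rule that)
  have c: "J \<in> carrier_mat n n" "P \<in> carrier_mat n n" "P' \<in> carrier_mat n n" using *(1) by auto
  have cS: "cmat S \<in> carrier_mat n n" and cQ: "cmat Q \<in> carrier_mat n m" and cL: "cmat L \<in> carrier_mat m n"
    using S Q L by auto
  define lam where "lam i = J $$ (i, i)" for i
  have scaled: "\<exists>P P' N :: nat \<Rightarrow> nat \<Rightarrow> complex.
      (\<forall>i<n. \<forall>j<n. (\<Sum>k<n. P i k * P' k j) = (if i = j then 1 else 0)) \<and>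
      (\<forall>i<n. \<forall>j<n. (\<Sum>k<n. P' i k * of_real (S $$ (k, j))) = lam i * P' i j + (\<Sum>k<n. N i k * P' k j)) \<and>
      (\<forall>i<n. \<forall>j<n. cmod (N i j) \<le> \<epsilon> \<and> (N i j \<noteq> 0 \<longrightarrow> lam i = lam j)) \<and>
      (\<forall>i<n. Re (lam i) \<noteq> 0 \<longrightarrow> (\<forall>a<m. (\<Sum>k<n. P' i k * of_real (Q $$ (k, a))) = 0)) \<and>
      (\<forall>i<n. Re (lam i) = 0 \<longrightarrow> (\<forall>j<n. P' i j = (\<Sum>a<m. (\<Sum>k<n. P' i k * of_real (Q $$ (k, a))) * of_real (L $$ (a, j)))))"
    if \<epsilon>: "0 < \<epsilon>" for \<epsilon> :: real
  proof -
    define e where "e = complex_of_real \<epsilon>"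
    have e: "e \<noteq> 0" "cmod e = \<epsilon>" using \<epsilon> by (auto simp: e_def)
    \<comment> \<open>Column \<open>j\<close> of the basis is scaled by \<open>\<epsilon>\<^sup>j\<close>, so the entry of \<open>J\<close> at \<open>(i, i + 1)\<close> is multiplied by \<open>\<epsilon>\<close>.\<close>
    define p where "p i j = P $$ (i, j) * e ^ j" for i j
    define p' where "p' i j = P' $$ (i, j) / e ^ i" for i j
    define N where "N i j = (if i = j then 0 else J $$ (i, j) * e ^ j / e ^ i)" for i j
    have a1: "(\<Sum>k<n. p i k * p' k j) = (if i = j then 1 else 0)" if "i < n" "j < n" for i j
    proof -
      have "(\<Sum>k<n. p i k * p' k j) = (P * P') $$ (i, j)"
        unfolding mult_index_sum[OF c(2,3) that] using e by (intro sum.cong) (auto simp: p_def p'_def)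
      then show ?thesis using *(2) that by simp
    qed
    have a2: "(\<Sum>k<n. p' i k * of_real (S $$ (k, j))) = lam i * p' i j + (\<Sum>k<n. N i k * p' k j)" if "i < n" "j < n" for i j
    proof -
      have "(\<Sum>k<n. p' i k * of_real (S $$ (k, j))) = (P' * cmat S) $$ (i, j) / e ^ i"
        unfolding mult_index_sum[OF c(3) cS that] sum_divide_distrib using S that
        by (intro sum.cong) (auto simp: p'_def)
      also have "\<dots> = (\<Sum>k<n. J $$ (i, k) * P' $$ (k, j) / e ^ i)"
        unfolding P'S mult_index_sum[OF c(1,3) that] sum_divide_distrib ..
      also have "\<dots> = (\<Sum>k<n. (if k = i then lam i * p' i j else 0) + N i k * p' k j)"
        using e by (intro sum.cong) (auto simp: p'_def N_def lam_def)
      finally show ?thesis using that by (simp add: sum.distrib)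
    qed
    have a3: "cmod (N i j) \<le> \<epsilon> \<and> (N i j \<noteq> 0 \<longrightarrow> lam i = lam j)" if ij: "i < n" "j < n" for i j
    proof (cases "i = j \<or> J $$ (i, j) = 0")
      case True then show ?thesis using \<epsilon> by (auto simp: N_def)
    next
      case False
      then have "j = Suc i" "J $$ (i, j) = 1" "J $$ (i, i) = J $$ (j, j)" using shape ij by auto
      then show ?thesis using e by (simp add: N_def lam_def)
    qed
    have pQ: "(\<Sum>k<n. p' i k * of_real (Q $$ (k, a))) = (P' * cmat Q) $$ (i, a) / e ^ i" if "i < n" "a < m" for i a
      unfolding mult_index_sum[OF c(3) cQ that] sum_divide_distrib using Q that
      by (intro sum.cong) (auto simp: p'_def)
    have cPQ: "P' * cmat Q \<in> carrier_mat n m" by (rule mult_carrier_mat[OF c(3) cQ])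
    have a4: "(\<Sum>k<n. p' i k * of_real (Q $$ (k, a))) = 0" if "i < n" "Re (lam i) \<noteq> 0" "a < m" for i a
      unfolding pQ[OF that(1,3)] using center_projection_left[OF cPQ that(1,3), of J] that(2) cen by (simp add: lam_def)
    have a5: "p' i j = (\<Sum>a<m. (\<Sum>k<n. p' i k * of_real (Q $$ (k, a))) * of_real (L $$ (a, j)))"
      if "i < n" "Re (lam i) = 0" "j < n" for i j
    proof -
      have "P' $$ (i, j) = (center_projection n J * P') $$ (i, j)"
        using center_projection_left[OF c(3) that(1,3), of J] that(2) by (simp add: lam_def)
      also have "center_projection n J * P' = P' * cmat Q * cmat L"
        unfolding cen' cmat_mult[OF Q L] by (rule assoc_mult_mat[symmetric, OF c(3) cQ cL])
      also have "(P' * cmat Q * cmat L) $$ (i, j) = (\<Sum>a<m. (P' * cmat Q) $$ (i, a) * cmat L $$ (a, j))"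
        by (rule mult_index_sum[OF cPQ cL that(1,3)])
      finally have "p' i j = (\<Sum>a<m. (P' * cmat Q) $$ (i, a) * cmat L $$ (a, j)) / e ^ i" by (simp add: p'_def)
      also have "\<dots> = (\<Sum>a<m. (\<Sum>k<n. p' i k * of_real (Q $$ (k, a))) * of_real (L $$ (a, j)))"
        unfolding sum_divide_distrib using L that by (intro sum.cong) (auto simp: pQ)
      finally show ?thesis .
    qed
    show ?thesis
      by (rule exI[of _ p], rule exI[of _ p'], rule exI[of _ N], intro conjI allI impI
          a1 a2 a3[THEN conjunct1] a3[THEN conjunct2, rule_format] a4 a5; assumption)
  qed
  have evs: "Re q = 0" if "eigenvalue (cmat (L * S * Q)) q" for q
  proof (rule center_restriction_eigenvalue[OF S c *(2) P'S _ Q L LQ SQ cen that])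
    show "J $$ (i, j) = 0" if "i < n" "j < n" "j < i" for i j
    proof (rule ccontr)
      assume "J $$ (i, j) \<noteq> 0"
      then have "j = Suc i" using shape[rule_format, of i j] that by simp
      then show False using that by simp
    qed
  qed
  show ?thesis
    by (rule exI[of _ lam], rule exI[of _ m], rule exI[of _ Q], rule exI[of _ L],
        intro conjI Q L LQ SQ allI impI evs scaled; assumption)
qed

section \<open>Small complete orbits lie on a graph over the centre subspace\<close>

lemma spectral_gap_exists:
  fixes lam :: "nat \<Rightarrow> complex"
  shows "\<exists>\<eta>>0. gapped n lam \<eta>"
proof -
  define \<eta> where "\<eta> = Min (insert 1 ((\<lambda>i. if Re (lam i) = 0 then 1 else \<bar>Re (lam i)\<bar> / 8) ` {..<n}))"
  have pos: "0 < \<eta>" unfolding \<eta>_def by (subst Min_gr_iff) auto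
  have "gap \<eta> (lam i)" if "i < n" for i
  proof -
    have "\<eta> \<le> (if Re (lam i) = 0 then 1 else \<bar>Re (lam i)\<bar> / 8)" unfolding \<eta>_def using that by (intro Min_le) auto
    then show ?thesis using pos by (auto simp: gap_def split: if_splits)
  qed
  then show ?thesis using pos by (auto simp: gapped_def)
qed

text \<open>Properties that hold for all sufficiently small radii can be combined.\<close>

lemma common_radius:
  fixes n :: nat and R :: "nat \<Rightarrow> real \<Rightarrow> bool"
  assumes "\<And>k. k < n \<Longrightarrow> \<exists>\<delta>0>0. \<forall>\<delta>. 0 < \<delta> \<longrightarrow> \<delta> \<le> \<delta>0 \<longrightarrow> R k \<delta>"
  shows "\<exists>\<delta>>0. \<forall>k<n. R k \<delta>"
proof -
  obtain \<delta>0 where \<delta>0: "\<And>k. k < n \<Longrightarrow> 0 < \<delta>0 k \<and> (\<forall>\<delta>. 0 < \<delta> \<longrightarrow> \<delta> \<le> \<delta>0 k \<longrightarrow> R k \<delta>)"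
    using assms by metis
  define \<delta> where "\<delta> = Min (insert 1 (\<delta>0 ` {..<n}))"
  have \<delta>: "0 < \<delta>" unfolding \<delta>_def using \<delta>0 by (subst Min_gr_iff) auto
  have "\<delta> \<le> \<delta>0 k" if "k < n" for k unfolding \<delta>_def using that by (intro Min_le) auto
  then show ?thesis using \<delta>0 \<delta> by blast
qed

lemma flat_extension_family:
  assumes W: "openin (Euclidean_space n) W" "origin \<in> W"
    and f: "\<And>k. k < n \<Longrightarrow> Ck_scalar 2 n W (f k)" "\<And>k. k < n \<Longrightarrow> f k origin = 0"
      "\<And>k l. k < n \<Longrightarrow> l < n \<Longrightarrow> partial_deriv l (f k) origin = 0" and \<epsilon>: "0 < \<epsilon>"
  shows "\<exists>\<delta> F F1 F2 M. 0 < \<delta> \<and> (\<forall>k<n. flat_extension n \<epsilon> (F k) (F1 k) (F2 k) (M k)) \<and> (\<forall>k<n. \<forall>x\<in>cube n \<delta>. F k x = f k x)"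
proof -
  define R where "R k \<delta> G \<longleftrightarrow> (case G of (F, F1, F2, M) \<Rightarrow> flat_extension n \<epsilon> F F1 F2 M \<and> (\<forall>x\<in>cube n \<delta>. F x = f k x))"
    for k \<delta> G
  have RI: "\<exists>G. R k \<delta> G" if "\<exists>F F1 F2 M. flat_extension n \<epsilon> F F1 F2 M \<and> (\<forall>x\<in>cube n \<delta>. F x = f k x)" for k \<delta>
  proof -
    from that obtain F F1 F2 M where G: "flat_extension n \<epsilon> F F1 F2 M \<and> (\<forall>x\<in>cube n \<delta>. F x = f k x)"
      by (elim exE) (rule that)
    have "R k \<delta> (F, F1, F2, M)" unfolding R_def case_prod_conv by (rule G)
    then show ?thesis by (rule exI)
  qed
  have "\<exists>\<delta>0>0. \<forall>\<delta>. 0 < \<delta> \<longrightarrow> \<delta> \<le> \<delta>0 \<longrightarrow> (\<exists>G. R k \<delta> G)" if k: "k < n" for k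
  proof -
    have "\<exists>\<delta>0>0. \<forall>\<delta>. 0 < \<delta> \<longrightarrow> \<delta> \<le> \<delta>0 \<longrightarrow>
        (\<exists>F F1 F2 M. flat_extension n \<epsilon> F F1 F2 M \<and> (\<forall>x\<in>cube n \<delta>. F x = f k x))"
      by (rule cutoff[OF W f(1)[OF k] f(2)[OF k] _ \<epsilon>]) (rule f(3)[OF k])
    then obtain \<delta>0 where \<delta>0: "0 < \<delta>0" and ext: "\<forall>\<delta>. 0 < \<delta> \<longrightarrow> \<delta> \<le> \<delta>0 \<longrightarrow>
        (\<exists>F F1 F2 M. flat_extension n \<epsilon> F F1 F2 M \<and> (\<forall>x\<in>cube n \<delta>. F x = f k x))"
      by (elim exE conjE) (rule that)
    show ?thesis
    proof (intro exI[of _ \<delta>0] conjI allI impI)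
      fix \<delta> assume "0 < \<delta>" "\<delta> \<le> \<delta>0"
      then show "\<exists>G. R k \<delta> G" by (intro RI ext[rule_format])
    qed (rule \<delta>0)
  qed
  from common_radius[of n "\<lambda>k \<delta>. \<exists>G. R k \<delta> G", OF this] obtain \<delta> where \<delta>: "0 < \<delta>" "\<forall>k<n. \<exists>G. R k \<delta> G" by blast
  define G where "G k = (SOME G. R k \<delta> G)" for k
  have G: "R k \<delta> (G k)" if "k < n" for k
    unfolding G_def by (rule someI_ex) (rule \<delta>(2)[rule_format, OF that])
  have "flat_extension n \<epsilon> (fst (G k)) (fst (snd (G k))) (fst (snd (snd (G k)))) (snd (snd (snd (G k)))) \<and>
      (\<forall>x\<in>cube n \<delta>. fst (G k) x = f k x)" if "k < n" for k
    by (rule G[OF that, unfolded R_def case_prod_beta])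
  note res = this
  show ?thesis
  proof (rule exI[of _ \<delta>], rule exI[of _ "\<lambda>k. fst (G k)"], rule exI[of _ "\<lambda>k. fst (snd (G k))"],
      rule exI[of _ "\<lambda>k. fst (snd (snd (G k)))"], rule exI[of _ "\<lambda>k. snd (snd (snd (G k)))"], intro conjI allI impI)
    fix k assume k: "k < n"
    show "flat_extension n \<epsilon> (fst (G k)) (fst (snd (G k))) (fst (snd (snd (G k)))) (snd (snd (snd (G k))))"
      by (rule conjunct1[OF res[OF k]])
    show "\<forall>x\<in>cube n \<delta>. fst (G k) x = f k x" by (rule conjunct2[OF res[OF k]])
  qed (rule \<delta>(1))
qed

lemma nonlinear_part:
  assumes W: "openin (Euclidean_space n) W" "origin \<in> W" and s: "Ck_map 2 n n W s" "s origin = origin" and k: "k < n"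
  defines "f \<equiv> \<lambda>x. s x k - (\<Sum>l<n. jacobian n n s origin $$ (k, l) * x l)"
  shows "Ck_scalar 2 n W f" "f origin = 0" "\<And>l. l < n \<Longrightarrow> partial_deriv l f origin = 0"
proof -
  have sk: "Ck_scalar 2 n W (\<lambda>x. s x k)" using s(1) k by (simp add: Ck_map_def)
  show "Ck_scalar 2 n W f"
    unfolding f_def by (intro Ck_scalar_diff[OF W(1) sk] Ck_scalar_sum[OF W(1)] Ck_scalar_cmult[OF W(1)] Ck_scalar_coordinate[OF W(1)])
  show "f origin = 0" using s(2) by (simp add: f_def)
  fix l assume l: "l < n"
  have s1: "((\<lambda>t. s (origin(l := t)) k) has_real_derivative partial_deriv l (\<lambda>x. s x k) origin) (at 0)"
    using partial_DERIV[of 1 n W "\<lambda>x. s x k" origin l] sk W(2) l by (simp add: numeral_2_eq_2)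
  have "(\<Sum>j<n. jacobian n n s origin $$ (k, j) * (origin(l := t)) j) = jacobian n n s origin $$ (k, l) * t" for t
  proof -
    have "(\<Sum>j<n. jacobian n n s origin $$ (k, j) * (origin(l := t)) j) = (\<Sum>j<n. if j = l then jacobian n n s origin $$ (k, l) * t else 0)"
      by (rule sum.cong) auto
    then show ?thesis using l by simp
  qed
  then have lin: "(\<lambda>t. f (origin(l := t))) = (\<lambda>t. s (origin(l := t)) k - jacobian n n s origin $$ (k, l) * t)"
    by (simp add: f_def)
  have "((\<lambda>t. f (origin(l := t))) has_real_derivative partial_deriv l (\<lambda>x. s x k) origin - jacobian n n s origin $$ (k, l)) (at 0)"
    unfolding lin by (intro DERIV_diff[OF s1]) (auto intro!: derivative_eq_intros)
  moreover have "jacobian n n s origin $$ (k, l) = partial_deriv l (\<lambda>x. s x k) origin" using k l by (simp add: jacobian_def)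
  ultimately have "((\<lambda>t. f (origin(l := t))) has_real_derivative 0) (at 0)" by simp
  then show "partial_deriv l f origin = 0" unfolding partial_deriv_def by (simp add: DERIV_imp_deriv)
qed

text \<open>The matrix \<open>L\<close> as a map from \<open>\<real>\<^sup>n\<close> to \<open>\<real>\<^sup>m\<close>, both regarded as sequences that vanish eventually.\<close>

definition lin_map :: "nat \<Rightarrow> nat \<Rightarrow> real mat \<Rightarrow> (nat \<Rightarrow> real) \<Rightarrow> nat \<Rightarrow> real" where
  "lin_map m n L y a = (if a < m then \<Sum>k<n. L $$ (a, k) * y k else 0)"

text \<open>The map \<open>p\<close> sends centre coordinates \<open>\<xi>\<close> to the value at time \<open>0\<close> of the slowly growing solution of the truncated equation with these
centre data. A complete orbit in the cube, where the truncation changes nothing, is bounded, hence slowly growing, and by uniqueness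
starts at \<open>p\<close> of its own centre coordinates.\<close>

theorem center_graph:
  assumes W: "openin (Euclidean_space n) W" "origin \<in> W" and s: "Ck_map 2 n n W s" "s origin = origin"
  defines "S \<equiv> jacobian n n s origin"
  shows "\<exists>m Q L p \<delta>. Q \<in> carrier_mat n m \<and> L \<in> carrier_mat m n \<and> L * Q = 1\<^sub>m m \<and>
    S * Q = Q * (L * S * Q) \<and>
    (\<forall>q. eigenvalue (cmat (L * S * Q)) q \<longrightarrow> Re q = 0) \<and>
    Ck_map 2 m n (Eucl m) p \<and> p origin = origin \<and>
    (\<forall>k<n. \<forall>a<m. partial_deriv a (\<lambda>\<xi>. p \<xi> k) origin = Q $$ (k, a)) \<and> 0 < \<delta> \<and>
    (\<forall>\<zeta>. (\<forall>t. \<zeta> t \<in> cube n \<delta> \<and> (\<forall>k<n. ((\<lambda>t. \<zeta> t k) has_real_derivative s (\<zeta> t) k) (at t))) \<longrightarrow>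
       \<zeta> 0 = p (lin_map m n L (\<zeta> 0)))"
proof -
  have S: "S \<in> carrier_mat n n" by (simp add: S_def jacobian_def)
  obtain lam m Q L where Q: "Q \<in> carrier_mat n m" and L: "L \<in> carrier_mat m n" and LQ: "L * Q = 1\<^sub>m m"
    and SQ: "S * Q = Q * (L * S * Q)"
    and ev: "\<forall>q. eigenvalue (cmat (L * S * Q)) q \<longrightarrow> Re q = 0"
    and coords: "\<forall>\<epsilon>>0. \<exists>P P' N :: nat \<Rightarrow> nat \<Rightarrow> complex.
      (\<forall>i<n. \<forall>j<n. (\<Sum>k<n. P i k * P' k j) = (if i = j then 1 else 0)) \<and>
      (\<forall>i<n. \<forall>j<n. (\<Sum>k<n. P' i k * of_real (S $$ (k, j))) = lam i * P' i j + (\<Sum>k<n. N i k * P' k j)) \<and>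
      (\<forall>i<n. \<forall>j<n. cmod (N i j) \<le> \<epsilon> \<and> (N i j \<noteq> 0 \<longrightarrow> lam i = lam j)) \<and>
      (\<forall>i<n. Re (lam i) \<noteq> 0 \<longrightarrow> (\<forall>a<m. (\<Sum>k<n. P' i k * of_real (Q $$ (k, a))) = 0)) \<and>
      (\<forall>i<n. Re (lam i) = 0 \<longrightarrow> (\<forall>j<n. P' i j = (\<Sum>a<m. (\<Sum>k<n. P' i k * of_real (Q $$ (k, a))) * of_real (L $$ (a, j)))))"
    using center_coordinates[OF S] by (elim exE conjE) (rule that)
  obtain \<eta> where \<eta>: "0 < \<eta>" "gapped n lam \<eta>" using spectral_gap_exists by blast
  \<comment> \<open>Half of \<open>\<epsilon>\<close> goes to the off-diagonal linear part and half to the truncated nonlinearity.\<close>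
  define \<epsilon> where "\<epsilon> = \<eta> / (2 * (real n + 1))"
  have \<epsilon>: "0 < \<epsilon>" "\<epsilon> * real n \<le> \<eta> / 2"
  proof -
    show "0 < \<epsilon>" using \<eta>(1) by (simp add: \<epsilon>_def)
    have half: "\<eta> / (2 * x) * x = \<eta> / 2" if "0 < x" for x using that by simp
    have "0 < real n + 1" by simp
    from half[OF this] have "\<epsilon> * (real n + 1) = \<eta> / 2" by (simp only: \<epsilon>_def)
    then show "\<epsilon> * real n \<le> \<eta> / 2" using \<open>0 < \<epsilon>\<close> by (simp add: distrib_left)
  qed
  obtain P P' N :: "nat \<Rightarrow> nat \<Rightarrow> complex" where
    PP': "\<forall>i<n. \<forall>j<n. (\<Sum>k<n. P i k * P' k j) = (if i = j then 1 else 0)"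
    and P'S: "\<forall>i<n. \<forall>j<n. (\<Sum>k<n. P' i k * of_real (S $$ (k, j))) = lam i * P' i j + (\<Sum>k<n. N i k * P' k j)"
    and N: "\<forall>i<n. \<forall>j<n. cmod (N i j) \<le> \<epsilon> / 2 \<and> (N i j \<noteq> 0 \<longrightarrow> lam i = lam j)"
    and hyp: "\<forall>i<n. Re (lam i) \<noteq> 0 \<longrightarrow> (\<forall>a<m. (\<Sum>k<n. P' i k * of_real (Q $$ (k, a))) = 0)"
    and cen: "\<forall>i<n. Re (lam i) = 0 \<longrightarrow> (\<forall>j<n. P' i j = (\<Sum>a<m. (\<Sum>k<n. P' i k * of_real (Q $$ (k, a))) * of_real (L $$ (a, j))))"
    using coords[rule_format, OF half_gt_zero[OF \<epsilon>(1)]] by (elim exE conjE) (rule that)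
  define cP where "cP = (\<Sum>l<n. \<Sum>j<n. cmod (P l j))"
  define cP' where "cP' = (\<Sum>i<n. \<Sum>k<n. cmod (P' i k))"
  have c: "0 \<le> cP" "0 \<le> cP'" unfolding cP_def cP'_def by (auto intro!: sum_nonneg)
  obtain \<epsilon>1 where \<epsilon>1: "0 < \<epsilon>1" "\<epsilon>1 * (cP' * cP) \<le> \<epsilon> / 2"
    using small_factor[of "cP' * cP" "\<epsilon> / 2"] c \<epsilon>(1) by auto
  define f where "f k = (\<lambda>x. s x k - (\<Sum>l<n. S $$ (k, l) * x l))" for k
  have f: "Ck_scalar 2 n W (f k)" "f k origin = 0" "\<And>l. l < n \<Longrightarrow> partial_deriv l (f k) origin = 0" if "k < n" for k
    unfolding f_def S_def using nonlinear_part[OF W s that] by - assumption+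
  have "\<exists>\<delta> F F1 F2 M. 0 < \<delta> \<and> (\<forall>k<n. flat_extension n \<epsilon>1 (F k) (F1 k) (F2 k) (M k)) \<and> (\<forall>k<n. \<forall>x\<in>cube n \<delta>. F k x = f k x)"
    by (rule flat_extension_family[OF W _ _ _ \<epsilon>1(1)]) (rule f(1) f(2) f(3); assumption)+
  then obtain \<delta> F F1 F2 MF where \<delta>: "0 < \<delta>" and flat: "\<forall>k<n. flat_extension n \<epsilon>1 (F k) (F1 k) (F2 k) (MF k)"
    and Ff: "\<forall>k<n. \<forall>x\<in>cube n \<delta>. F k x = f k x"
    by (elim exE conjE) (rule that)
  have "truncated_field n P P' N F F1 F2 MF \<epsilon> \<epsilon>1 cP cP'"
  proof
    show "cP' * (\<epsilon>1 * cP) \<le> \<epsilon> / 2" using \<epsilon>1(2) by (simp add: mult_ac)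
  qed (use flat N \<epsilon>(1) \<epsilon>1(1) in \<open>auto simp: cP_def cP'_def\<close>)
  then interpret T: truncated_field n P P' N F F1 F2 MF \<epsilon> \<epsilon>1 cP cP' .
  interpret perturbed n lam \<eta> \<epsilon> T.M T.g T.g1 T.g2 by (rule T.truncation_perturbs_diagonal[OF \<eta>(2) \<epsilon>(2)])
  define C where "C i a = (\<Sum>k<n. P' i k * of_real (Q $$ (k, a)))" for i a
  define p where "p \<xi> k = (if k < n then Re (\<Sum>i<n. P k i * \<Psi> (coord m C \<xi>) 0 i) else 0)" for \<xi> k
  have pk: "(\<lambda>\<xi>. p \<xi> k) = (\<lambda>\<xi>. Re (\<Sum>i<n. P k i * \<Psi> (coord m C \<xi>) 0 i))" if "k < n" for k
    using that by (simp add: p_def)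
  have p2: "Ck_map 2 m n (Eucl m) p"
    unfolding Ck_map_def
  proof (intro conjI allI impI)
    show "p ` Eucl m \<subseteq> Eucl n" by (auto simp: p_def Eucl_iff)
    show "Ck_scalar 2 m (Eucl m) (\<lambda>\<xi>. p \<xi> k)" if "k < n" for k unfolding pk[OF that] by (rule chart_C2)
  qed
  have coord0: "coord m C origin = (\<lambda>_. 0)" by (rule ext) (simp add: coord_def)
  have p0: "p origin = origin"
  proof
    fix k
    have "(\<Sum>i<n. P k i * \<Psi> (coord m C origin) 0 i) = 0"
      unfolding coord0 using Psi_zero by (intro sum.neutral) auto
    then show "p origin k = 0" by (simp only: p_def zero_complex.simps if_cancel)
  qed
  have dp: "partial_deriv a (\<lambda>\<xi>. p \<xi> k) origin = Q $$ (k, a)" if k: "k < n" and a: "a < m" for k a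
  proof -
    have decoupled: "T.g1 (\<lambda>_. 0) v i = T.g1 (\<lambda>_. 0) (\<lambda>j. if Re (lam j) = 0 then 0 else v j) i"
      if "i < n" "Re (lam i) \<noteq> 0" for v i
      unfolding T.g1_origin
    proof (rule sum.cong[OF refl])
      fix j assume "j \<in> {..<n}"
      then show "N i j * v j = N i j * (if Re (lam j) = 0 then 0 else v j)"
        using N[rule_format, OF that(1), of j] that(2) by (cases "N i j = 0") auto
    qed
    have D: "D (\<lambda>_. 0) (\<lambda>i. C i a) 0 i = C i a" if i: "i < n" for i
    proof (cases "Re (lam i) = 0")
      case True then show ?thesis by (rule D_center[OF i])
    next
      case False
      then have "C i a = 0" using hyp i a by (simp add: C_def)
      then show ?thesis using D_zero_hyperbolic[OF decoupled i False] by simp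
    qed
    have "(\<Sum>i<n. P k i * C i a) = (\<Sum>l<n. (\<Sum>i<n. P k i * P' i l) * of_real (Q $$ (l, a)))"
      unfolding C_def sum_distrib_left sum_distrib_right by (subst sum.swap) (simp add: mult.assoc)
    also have "\<dots> = (\<Sum>l<n. if k = l then of_real (Q $$ (l, a)) else 0)"
      using PP' k by (intro sum.cong) auto
    also have "\<dots> = of_real (Q $$ (k, a))" using k by simp
    finally have PC: "(\<Sum>i<n. P k i * C i a) = of_real (Q $$ (k, a))" .
    have "partial_deriv a (\<lambda>\<xi>. p \<xi> k) origin = Re (\<Sum>i<n. P k i * D (\<lambda>_. 0) (\<lambda>i. C i a) 0 i)"
      unfolding pk[OF k] chart_partial_deriv[OF a] coord0 ..
    also have "(\<Sum>i<n. P k i * D (\<lambda>_. 0) (\<lambda>i. C i a) 0 i) = (\<Sum>i<n. P k i * C i a)"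
      using D by (intro sum.cong) auto
    finally show ?thesis unfolding PC by simp
  qed
  have graph: "\<zeta> 0 = p (lin_map m n L (\<zeta> 0))"
    if \<zeta>: "\<forall>t. \<zeta> t \<in> cube n \<delta> \<and> (\<forall>k<n. ((\<lambda>t. \<zeta> t k) has_real_derivative s (\<zeta> t) k) (at t))" for \<zeta>
  proof -
    define z where "z t i = (\<Sum>k<n. P' i k * of_real (\<zeta> t k))" for t i
    define \<xi> where "\<xi> = lin_map m n L (\<zeta> 0)"
    have Pz: "(\<Sum>i<n. P k i * z t i) = of_real (\<zeta> t k)" if k: "k < n" for t k
    proof -
      have "(\<Sum>i<n. P k i * z t i) = (\<Sum>l<n. (\<Sum>i<n. P k i * P' i l) * of_real (\<zeta> t l))"
        unfolding z_def sum_distrib_left sum_distrib_right by (subst sum.swap) (simp add: mult.assoc)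
      also have "\<dots> = (\<Sum>l<n. if k = l then of_real (\<zeta> t l) else 0)" using PP' k by (intro sum.cong) auto
      finally show ?thesis using k by simp
    qed
    have Yz: "T.Y (z t) = \<zeta> t" for t
    proof
      fix k show "T.Y (z t) k = \<zeta> t k"
      proof (cases "k < n")
        case True then show ?thesis unfolding T.Y_def Pz[OF True] by simp
      next
        case False
        then show ?thesis using \<zeta> by (simp add: T.Y_def cube_def Eucl_iff)
      qed
    qed
    have rhs: "(\<Sum>k<n. P' i k * of_real (s (\<zeta> t) k)) = lam i * z t i + T.g (z t) i" if i: "i < n" for t i
    proof -
      have sk: "s (\<zeta> t) k = F k (\<zeta> t) + (\<Sum>l<n. S $$ (k, l) * \<zeta> t l)" if "k < n" for k
        using Ff that \<zeta> by (simp add: f_def)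
      have "(\<Sum>k<n. P' i k * of_real (s (\<zeta> t) k))
          = (\<Sum>k<n. P' i k * of_real (F k (\<zeta> t))) + (\<Sum>k<n. \<Sum>l<n. P' i k * of_real (S $$ (k, l)) * of_real (\<zeta> t l))"
        unfolding sum.distrib[symmetric] by (intro sum.cong) (auto simp: sk distrib_left sum_distrib_left mult.assoc)
      also have "(\<Sum>k<n. \<Sum>l<n. P' i k * of_real (S $$ (k, l)) * of_real (\<zeta> t l)) =
          (\<Sum>l<n. (\<Sum>k<n. P' i k * of_real (S $$ (k, l))) * of_real (\<zeta> t l))"
        unfolding sum_distrib_right by (rule sum.swap)
      also have "\<dots> = (\<Sum>l<n. (lam i * P' i l + (\<Sum>k<n. N i k * P' k l)) * of_real (\<zeta> t l))"
        using P'S i by (intro sum.cong) auto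
      also have "\<dots> = lam i * z t i + (\<Sum>l<n. \<Sum>k<n. N i k * (P' k l * of_real (\<zeta> t l)))"
        by (simp add: z_def distrib_right sum.distrib sum_distrib_left sum_distrib_right mult.assoc)
      also have "(\<Sum>l<n. \<Sum>k<n. N i k * (P' k l * of_real (\<zeta> t l))) = (\<Sum>k<n. N i k * z t k)"
        unfolding z_def sum_distrib_left by (rule sum.swap)
      finally show ?thesis unfolding T.g_def Yz by (simp add: algebra_simps)
    qed
    have zb: "cmod (z t i) \<le> cP' * \<delta>" if "i < n" for t i
      unfolding z_def using \<zeta> \<delta> that by (intro T.P'_sum_bound) (auto simp: cube_def)
    \<comment> \<open>The orbit is bounded in the eigencoordinates.\<close>
    have growth: "growth (4 * \<eta>) (cP' * \<delta>) z"
    proof (rule growthI)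
      fix t i assume "i < n"
      have "cmod (z t i) \<le> cP' * \<delta> * 1" using zb[OF \<open>i < n\<close>] by simp
      also have "\<dots> \<le> cP' * \<delta> * exp (4 * \<eta> * \<bar>t\<bar>)" using c \<delta> \<eta>(1) by (intro mult_left_mono) auto
      finally show "cmod (z t i) \<le> cP' * \<delta> * exp (4 * \<eta> * \<bar>t\<bar>)" .
    qed
    have dz: "((\<lambda>t. z t i) has_vector_derivative lam i * z t i + T.g (z t) i) (at t)" if i: "i < n" for i t
    proof -
      have "((\<lambda>t. \<Sum>k<n. P' i k * of_real (\<zeta> t k)) has_vector_derivative (\<Sum>k<n. P' i k * of_real (s (\<zeta> t) k))) (at t)"
      proof (intro has_vector_derivative_sum has_vector_derivative_mult_right)
        fix k assume "k \<in> {..<n}"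
        then have "((\<lambda>t. \<zeta> t k) has_vector_derivative s (\<zeta> t) k) (at t)"
          using \<zeta> by (simp add: has_real_derivative_iff_has_vector_derivative)
        from bounded_linear.has_vector_derivative[OF bounded_linear_of_real this]
        show "((\<lambda>t. complex_of_real (\<zeta> t k)) has_vector_derivative complex_of_real (s (\<zeta> t) k)) (at t)" .
      qed
      then have d: "((\<lambda>t. z t i) has_vector_derivative (\<Sum>k<n. P' i k * of_real (s (\<zeta> t) k))) (at t)"
        unfolding z_def .
      note e = rhs[OF i, of t]
      show ?thesis using d unfolding e .
    qed
    have resp: "response (coord m C \<xi>) (\<lambda>t. T.g (z t)) z"
      unfolding response_def green_def
    proof (intro allI impI conjI)
      fix i t assume i: "i < n"
      show "((\<lambda>t. z t i) has_vector_derivative lam i * z t i + T.g (z t) i) (at t)" by (rule dz[OF i])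
    next
      fix i assume i: "i < n" and re: "Re (lam i) = 0"
      have row: "P' i l = (\<Sum>a<m. C i a * of_real (L $$ (a, l)))" if "l < n" for l
        unfolding C_def by (rule cen[rule_format, OF i re that])
      have "z 0 i = (\<Sum>l<n. (\<Sum>a<m. C i a * of_real (L $$ (a, l))) * of_real (\<zeta> 0 l))"
        unfolding z_def
      proof (rule sum.cong[OF refl])
        fix l assume "l \<in> {..<n}"
        then have "l < n" by simp
        show "P' i l * complex_of_real (\<zeta> 0 l) = (\<Sum>a<m. C i a * of_real (L $$ (a, l))) * of_real (\<zeta> 0 l)"
          by (simp only: row[OF \<open>l < n\<close>])
      qed
      also have "\<dots> = (\<Sum>a<m. \<Sum>l<n. C i a * of_real (L $$ (a, l)) * of_real (\<zeta> 0 l))"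
        unfolding sum_distrib_right by (rule sum.swap)
      also have "\<dots> = (\<Sum>a<m. C i a * of_real (\<xi> a))"
        by (intro sum.cong) (auto simp: \<xi>_def lin_map_def sum_distrib_left mult.assoc)
      finally show "z 0 i = coord m C \<xi> i" by (simp add: coord_def)
    next
      fix i assume "i < n"
      then show "\<exists>B. \<forall>t. cmod (z t i) \<le> B * exp (4 * \<eta> * \<bar>t\<bar>)" using growthD[OF growth] by blast
    qed
    show ?thesis
      unfolding \<xi>_def[symmetric]
    proof
      fix k show "\<zeta> 0 k = p \<xi> k"
      proof (cases "k < n")
        case True
        have "(\<Sum>i<n. P k i * \<Psi> (coord m C \<xi>) 0 i) = (\<Sum>i<n. P k i * z 0 i)"
          using Psi_unique[OF resp growth] by (intro sum.cong) auto
        also have "\<dots> = of_real (\<zeta> 0 k)" by (rule Pz[OF True])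
        finally have "Re (\<Sum>i<n. P k i * \<Psi> (coord m C \<xi>) 0 i) = \<zeta> 0 k" by (simp only: Re_complex_of_real)
        then show ?thesis using True by (simp only: p_def if_True)
      next
        case False then show ?thesis using \<zeta> by (simp add: p_def cube_def Eucl_iff)
      qed
    qed
  qed
  show ?thesis
    by (rule exI[of _ m], rule exI[of _ Q], rule exI[of _ L], rule exI[of _ p], rule exI[of _ \<delta>])
      (intro conjI allI impI, fact Q, fact L, fact LQ, fact SQ, rule ev[rule_format], assumption, fact p2, fact p0,
        rule dp, assumption+, fact \<delta>, rule graph, assumption)
qed

section \<open>Reduction of the immersed system\<close>

text \<open>Stability with the radius \<open>\<epsilon>'\<close>, kept inside the cube on which the field is Lipschitz.\<close>

lemma small_complete_orbits:
  assumes sys: "autonomous_system r (W, s, \<gamma>)" and stable: "lyapunov_stable_origin r (W, s, \<gamma>)"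
    and nw: "\<forall>w\<in>W. nonwandering r (W, s, \<gamma>) w" and \<epsilon>: "0 < \<epsilon>"
  shows "\<exists>\<delta>>0. \<forall>w\<in>W. eucl_norm r w < \<delta> \<longrightarrow> (\<exists>X. X 0 = w \<and> (\<forall>t. X t \<in> Eucl r \<and> eucl_norm r (X t) \<le> \<epsilon> \<and>
    (\<forall>i<r. ((\<lambda>u. X u i) has_real_derivative s (X t) i) (at t))))"
proof -
  have W: "openin (Euclidean_space r) W" "origin \<in> W" and s: "Ck_map 1 r r W s" "s origin = origin"
    using sys Ck_map_SucD[of 1 r r W s] by (auto simp: numeral_2_eq_2)
  obtain \<rho> \<Lambda> where \<rho>: "0 < \<rho>" "0 \<le> \<Lambda>" "cube r \<rho> \<subseteq> W"
    and lip: "\<forall>x\<in>cube r \<rho>. \<forall>y\<in>cube r \<rho>. \<forall>i<r. \<bar>s x i - s y i\<bar> \<le> \<Lambda> * (\<Sum>j<r. \<bar>x j - y j\<bar>)"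
    using lipschitz_on_cube[OF W s(1)] by blast
  interpret lipschitz_field r s \<rho> \<Lambda> by unfold_locales (use \<rho> lip s(2) in auto)
  define \<epsilon>' where "\<epsilon>' = min \<epsilon> (\<rho> / 2)"
  have \<epsilon>': "0 < \<epsilon>'" "\<epsilon>' \<le> \<epsilon>" "\<epsilon>' < \<rho>" using \<epsilon> \<rho>(1) by (auto simp: \<epsilon>'_def)
  obtain \<delta> where \<delta>: "0 < \<delta>" "\<And>w t. w \<in> W \<Longrightarrow> eucl_norm r w < \<delta> \<Longrightarrow> 0 \<le> t \<Longrightarrow> \<exists>v. flows_to r W s t w v \<and> eucl_norm r v < \<epsilon>'"
    using stable \<epsilon>'(1) by auto
  have "\<exists>X. X 0 = w \<and> (\<forall>t. X t \<in> Eucl r \<and> eucl_norm r (X t) \<le> \<epsilon> \<and>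
      (\<forall>i<r. ((\<lambda>u. X u i) has_real_derivative s (X t) i) (at t)))" if w: "w \<in> W" "eucl_norm r w < \<delta>" for w
  proof -
    have "\<exists>X. X 0 = w \<and> (\<forall>t. X t \<in> Eucl r \<and> eucl_norm r (X t) \<le> \<epsilon>' \<and>
        (\<forall>i<r. ((\<lambda>u. X u i) has_real_derivative s (X t) i) (at t)))"
      by (rule complete_orbit[OF W(1) \<epsilon>'(3) _ nw[rule_format, OF w(1)] w]) (rule \<delta>(2))
    then obtain X where "X 0 = w" "\<forall>t. X t \<in> Eucl r \<and> eucl_norm r (X t) \<le> \<epsilon>' \<and>
        (\<forall>i<r. ((\<lambda>u. X u i) has_real_derivative s (X t) i) (at t))" by (elim exE conjE) (rule that)
    then show ?thesis using \<epsilon>'(2) by (intro exI[of _ X]) (auto intro: order_trans)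
  qed
  then show ?thesis using \<delta>(1) by blast
qed

lemma openin_eucl_norm_ball:
  assumes U: "openin (Euclidean_space r) U"
  shows "openin (Euclidean_space r) {w \<in> U. eucl_norm r w < \<delta>}"
  unfolding openin_Eucl_iff
proof (intro conjI ballI)
  have UE: "U \<subseteq> Eucl r" using U openin_subset by blast
  then show "{w \<in> U. eucl_norm r w < \<delta>} \<subseteq> Eucl r" by blast
  fix w assume w: "w \<in> {w \<in> U. eucl_norm r w < \<delta>}"
  obtain d where d: "0 < d" "\<forall>y\<in>Eucl r. box_close r d w y \<longrightarrow> y \<in> U"
    using U w unfolding openin_Eucl_iff by blast
  define \<kappa> where "\<kappa> = min d ((\<delta> - eucl_norm r w) / (real r + 1))"
  have \<kappa>: "0 < \<kappa>" "\<kappa> \<le> d" "(real r + 1) * \<kappa> \<le> \<delta> - eucl_norm r w"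
  proof -
    show "0 < \<kappa>" "\<kappa> \<le> d" using d(1) w by (auto simp: \<kappa>_def)
    have "\<kappa> \<le> (\<delta> - eucl_norm r w) / (real r + 1)" by (simp add: \<kappa>_def)
    then show "(real r + 1) * \<kappa> \<le> \<delta> - eucl_norm r w" by (simp add: pos_le_divide_eq mult.commute)
  qed
  have "eucl_norm r v < \<delta>" if "box_close r \<kappa> w v" for v
  proof -
    have "eucl_norm r v \<le> eucl_norm r w + real r * \<kappa>" by (rule eucl_norm_box[OF that])
    also have "\<dots> < eucl_norm r w + (real r + 1) * \<kappa>" using \<kappa>(1) by simp
    finally show ?thesis using \<kappa>(3) by simp
  qed
  then show "\<exists>d>0. \<forall>y\<in>Eucl r. box_close r d w y \<longrightarrow> y \<in> {w \<in> U. eucl_norm r w < \<delta>}"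
    using d(2) \<kappa>(1) box_close_mono[OF _ \<kappa>(2)] by blast
qed

text \<open>Continuity of \<open>\<tau>\<close> at the origin, in the norms in which orbits are measured on either side.\<close>

lemma small_image:
  assumes U: "openin (Euclidean_space r) U" "origin \<in> U" and \<tau>: "Ck_map 1 r n U \<tau>" "\<tau> origin = origin" and \<delta>: "0 < \<delta>"
  shows "\<exists>\<epsilon>>0. \<forall>x\<in>Eucl r. eucl_norm r x \<le> \<epsilon> \<longrightarrow> x \<in> U \<and> \<tau> x \<in> cube n \<delta>"
proof -
  obtain \<rho> \<Lambda> where \<rho>: "0 < \<rho>" "0 \<le> \<Lambda>" "cube r \<rho> \<subseteq> U"
    and lip: "\<forall>x\<in>cube r \<rho>. \<forall>y\<in>cube r \<rho>. \<forall>i<n. \<bar>\<tau> x i - \<tau> y i\<bar> \<le> \<Lambda> * (\<Sum>j<r. \<bar>x j - y j\<bar>)"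
    using lipschitz_on_cube[OF U \<tau>(1)] by blast
  obtain \<epsilon> where \<epsilon>: "0 < \<epsilon>" "\<epsilon> \<le> \<rho>" "\<epsilon> * (\<Lambda> * real r) \<le> \<delta>"
  proof -
    obtain e where "0 < e" "e * (\<Lambda> * real r) \<le> \<delta>" using small_factor[of "\<Lambda> * real r" \<delta>] \<rho>(2) \<delta> by auto
    moreover from this have "min e \<rho> * (\<Lambda> * real r) \<le> \<delta>"
      using \<rho>(2) mult_right_mono[of "min e \<rho>" e "\<Lambda> * real r"] by auto
    ultimately show ?thesis using that[of "min e \<rho>"] \<rho>(1) by auto
  qed
  show ?thesis
  proof (intro exI[of _ \<epsilon>] conjI ballI impI)
    fix x assume x: "x \<in> Eucl r" "eucl_norm r x \<le> \<epsilon>"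
    have xi: "\<bar>x i\<bar> \<le> \<epsilon>" if "i < r" for i
      using member_le_L2_set[of "{..<r}" i "\<lambda>i. \<bar>x i\<bar>"] that x(2) by (simp add: L2_set_def)
    then have c: "x \<in> cube r \<rho>" using x(1) \<epsilon>(2) by (force simp: cube_def)
    then show xU: "x \<in> U" using \<rho>(3) by blast
    have c0: "origin \<in> cube r \<rho>" using \<rho>(1) by (simp add: cube_def origin_Eucl)
    have "\<bar>\<tau> x i\<bar> \<le> \<delta>" if "i < n" for i
    proof -
      have "\<bar>\<tau> x i\<bar> \<le> \<Lambda> * (\<Sum>j<r. \<bar>x j\<bar>)" using lip[rule_format, OF c c0 that] \<tau>(2) by simp
      also have "(\<Sum>j<r. \<bar>x j\<bar>) \<le> real r * \<epsilon>"
        using sum_bounded_above[of "{..<r}" "\<lambda>i. \<bar>x i\<bar>" \<epsilon>] xi by simp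
      finally have "\<bar>\<tau> x i\<bar> \<le> \<Lambda> * (real r * \<epsilon>)" using \<rho>(2) by (simp add: mult_left_mono)
      then show ?thesis using \<epsilon>(3) by (simp add: mult_ac)
    qed
    moreover have "\<tau> x \<in> Eucl n" using \<tau>(1) xU by (auto simp: Ck_map_def)
    ultimately show "\<tau> x \<in> cube n \<delta>" by (simp add: cube_def)
  qed (rule \<epsilon>(1))
qed

lemma jacobian_vec_index:
  assumes "i < n"
  shows "(jacobian n r \<tau> w *\<^sub>v Matrix.vec r v) $ i = (\<Sum>j<r. partial_deriv j (\<lambda>y. \<tau> y i) w * v j)"
proof -
  have "jacobian n r \<tau> w \<in> carrier_mat n r" by (simp add: jacobian_def)
  from mult_vec_index_sum[OF this _ assms, of "Matrix.vec r v"] show ?thesis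
    using assms by (simp add: jacobian_def)
qed

text \<open>The chain rule turns the differential equation of the immersion into the statement that orbits go to orbits.\<close>

lemma immersion_maps_orbits:
  assumes U: "openin (Euclidean_space r) U" and \<tau>: "Ck_map 1 r n U \<tau>"
    and eq: "\<And>w. w \<in> U \<Longrightarrow> jacobian n r \<tau> w *\<^sub>v Matrix.vec r (s w) = Matrix.vec n (s' (\<tau> w))"
    and X: "\<And>t. X t \<in> U" "\<And>t i. i < r \<Longrightarrow> ((\<lambda>u. X u i) has_real_derivative s (X t) i) (at t)" and k: "k < n"
  shows "((\<lambda>u. \<tau> (X u) k) has_real_derivative s' (\<tau> (X t)) k) (at t)"
proof -
  have "((\<lambda>u. \<tau> (X u) k) has_real_derivative (\<Sum>j<r. partial_deriv j (\<lambda>y. \<tau> y k) (X t) * s (X t) j)) (at t)"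
  proof (rule C1_chain[OF U, where f = "\<lambda>y. \<tau> y k"])
    show "Ck_scalar 1 r U (\<lambda>y. \<tau> y k)" using \<tau> k by (simp add: Ck_map_def)
    show "X t \<in> U" by (rule X)
    show "\<forall>\<^sub>F t in at t. X t \<in> Eucl r" using X(1) U openin_subset by (intro always_eventually) blast
  qed (rule X(2))
  moreover have "(\<Sum>j<r. partial_deriv j (\<lambda>y. \<tau> y k) (X t) * s (X t) j) = s' (\<tau> (X t)) k"
    using jacobian_vec_index[OF k, of r \<tau> "X t" "s (X t)"] eq[OF X(1)[of t]] k by simp
  ultimately show ?thesis by simp
qed

text \<open>The left inverse \<open>L\<close> makes \<open>Q\<close> injective, and \<open>S Q = Q T\<close> says that \<open>Q\<close> intertwines \<open>T\<close> with \<open>S\<close> on its range.\<close>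

lemma image_of_invariant_factor:
  fixes S T Q L :: "real mat"
  assumes S: "S \<in> carrier_mat n n" and T: "T \<in> carrier_mat m m" and Q: "Q \<in> carrier_mat n m"
    and L: "L \<in> carrier_mat m n" and LQ: "L * Q = 1\<^sub>m m" and SQ: "S * Q = Q * T"
  defines "V \<equiv> (\<lambda>x. Q *\<^sub>v x) ` carrier_vec m"
  shows "invariant_subspace n S V" "isomorphic_to_restriction T m S V"
proof -
  have comm: "S *\<^sub>v (Q *\<^sub>v x) = Q *\<^sub>v (T *\<^sub>v x)" if "x \<in> carrier_vec m" for x
    using assoc_mult_mat_vec[OF S Q that] assoc_mult_mat_vec[OF Q T that] SQ by simp
  have left: "L *\<^sub>v (Q *\<^sub>v x) = x" if "x \<in> carrier_vec m" for x
    using assoc_mult_mat_vec[OF L Q that] LQ that by simp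
  have inv: "\<forall>v\<in>V. S *\<^sub>v v \<in> V" using comm T by (auto simp: V_def)
  interpret vec_space "TYPE(real)" n .
  have "VectorSpace.subspace class_ring V (module_vec TYPE(real) n)"
  proof (rule subspace.intro[OF vectorspace_axioms])
    show "submodule class_ring V (module_vec TYPE(real) n)"
    proof (rule submodule.intro)
      show "module class_ring (module_vec TYPE(real) n)" by (rule module_axioms)
      show "V \<subseteq> carrier (module_vec TYPE(real) n)" using Q by (auto simp: V_def module_vec_simps)
      show "\<zero>\<^bsub>module_vec TYPE(real) n\<^esub> \<in> V"
        unfolding V_def using Q by (auto simp: module_vec_simps intro!: image_eqI[of _ _ "0\<^sub>v m"])
      show "v \<oplus>\<^bsub>module_vec TYPE(real) n\<^esub> w \<in> V" if "v \<in> V" "w \<in> V" for v w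
        using that mult_add_distrib_mat_vec[OF Q, symmetric] by (auto simp: V_def module_vec_simps)
      show "c \<odot>\<^bsub>module_vec TYPE(real) n\<^esub> v \<in> V" if "c \<in> carrier class_ring" "v \<in> V" for c v
        using that mult_mat_vec[OF Q, symmetric] by (auto simp: V_def module_vec_simps)
    qed
  qed
  with inv show "invariant_subspace n S V" by (simp add: invariant_subspace_def)
  have "bij_betw (\<lambda>x. Q *\<^sub>v x) (carrier_vec m) V"
    unfolding bij_betw_def V_def using left by (auto intro!: inj_on_inverseI[where g = "\<lambda>x. L *\<^sub>v x"])
  then show "isomorphic_to_restriction T m S V"
    unfolding isomorphic_to_restriction_def
    by (intro exI[of _ "\<lambda>x. Q *\<^sub>v x"] conjI ballI allI)
      (auto simp: mult_add_distrib_mat_vec[OF Q] mult_mat_vec[OF Q] comm)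
qed

text \<open>An eigenvector \<open>v\<close> of \<open>T\<close> in the kernel of \<open>\<Gamma> Q\<close> yields the eigenvector \<open>Q v\<close> of \<open>S\<close> in the kernel of \<open>\<Gamma>\<close> for the same
eigenvalue; it is nonzero since \<open>L (Q v) = v\<close>.\<close>

lemma detectable_factor:
  fixes \<Gamma> S T Q L :: "real mat"
  assumes S: "S \<in> carrier_mat n n" and T: "T \<in> carrier_mat m m" and Q: "Q \<in> carrier_mat n m"
    and L: "L \<in> carrier_mat m n" and LQ: "L * Q = 1\<^sub>m m" and SQ: "S * Q = Q * T"
    and \<Gamma>: "\<Gamma> \<in> carrier_mat q n" and det: "detectable \<Gamma> S"
  shows "detectable (\<Gamma> * Q) T"
  unfolding detectable_def
proof
  assume "\<exists>v p. eigenvector (cmat T) v p \<and> cmat (\<Gamma> * Q) *\<^sub>v v = 0\<^sub>v (dim_row (\<Gamma> * Q)) \<and> 0 \<le> Re p"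
  then obtain v p where v: "v \<in> carrier_vec m" "v \<noteq> 0\<^sub>v m" "cmat T *\<^sub>v v = p \<cdot>\<^sub>v v"
    and out: "cmat (\<Gamma> * Q) *\<^sub>v v = 0\<^sub>v q" and p: "0 \<le> Re p"
    using T \<Gamma> by (auto simp: eigenvector_def)
  have c: "cmat S \<in> carrier_mat n n" "cmat Q \<in> carrier_mat n m" "cmat L \<in> carrier_mat m n" "cmat T \<in> carrier_mat m m"
    "cmat \<Gamma> \<in> carrier_mat q n" using S Q L T \<Gamma> by auto
  define w where "w = cmat Q *\<^sub>v v"
  have w: "w \<in> carrier_vec n" unfolding w_def by (rule mult_mat_vec_carrier[OF c(2) v(1)])
  have "cmat S * cmat Q = cmat Q * cmat T"
    using cmat_mult[OF S Q] cmat_mult[OF Q T] SQ by simp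
  then have Sw: "cmat S *\<^sub>v w = p \<cdot>\<^sub>v w"
    using assoc_mult_mat_vec[OF c(1,2) v(1)] assoc_mult_mat_vec[OF c(2,4) v(1)] mult_mat_vec[OF c(2) v(1)] v(3)
    by (simp add: w_def)
  have "cmat (L * Q) = 1\<^sub>m m" unfolding LQ by (rule eq_matI) auto
  then have Lw: "cmat L *\<^sub>v w = v"
    using assoc_mult_mat_vec[OF c(3,2) v(1)] cmat_mult[OF L Q] v(1) by (simp add: w_def)
  have "w \<noteq> 0\<^sub>v n"
  proof
    assume "w = 0\<^sub>v n"
    then have "cmat L *\<^sub>v w = 0\<^sub>v m" using c(3) by (intro eq_vecI) auto
    then show False using Lw v(2) by simp
  qed
  moreover have "cmat \<Gamma> *\<^sub>v w = 0\<^sub>v q"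
    using assoc_mult_mat_vec[OF c(5,2) v(1)] cmat_mult[OF \<Gamma> Q] out by (simp add: w_def)
  ultimately show False
    using det Sw w p S \<Gamma> unfolding detectable_def eigenvector_def by auto
qed

text \<open>The chain rule at the origin, where the derivative of \<open>p\<close> is \<open>Q\<close>, gives both linearizations.\<close>

lemma pullback_system:
  assumes sys: "autonomous_system n (W, s, \<gamma>)" and L: "L \<in> carrier_mat m n" and Q: "Q \<in> carrier_mat n m"
    and p: "Ck_map 2 m n (Eucl m) p" "p origin = origin"
    and dp: "\<forall>k<n. \<forall>a<m. partial_deriv a (\<lambda>\<xi>. p \<xi> k) origin = Q $$ (k, a)"
  defines "\<pi> \<equiv> lin_map m n L"
  defines "W' \<equiv> {\<xi> \<in> Eucl m. p \<xi> \<in> W}"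
  shows "autonomous_system m (W', \<lambda>\<xi>. \<pi> (s (p \<xi>)), \<lambda>\<xi>. \<gamma> (p \<xi>))"
    and "lin_dyn m (W', \<lambda>\<xi>. \<pi> (s (p \<xi>)), \<lambda>\<xi>. \<gamma> (p \<xi>)) = L * lin_dyn n (W, s, \<gamma>) * Q"
    and "lin_out m (W', \<lambda>\<xi>. \<pi> (s (p \<xi>)), \<lambda>\<xi>. \<gamma> (p \<xi>)) = lin_out n (W, s, \<gamma>) * Q"
proof -
  have W: "openin (Euclidean_space n) W" "origin \<in> W" and s: "Ck_map 2 n n W s" "s origin = origin"
    and \<gamma>: "Ck_scalar 2 n W \<gamma>" "\<gamma> origin = 0" using sys by auto
  have W'E: "W' \<subseteq> Eucl m" by (auto simp: W'_def)
  have W': "openin (Euclidean_space m) W'"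
    unfolding openin_Eucl_iff
  proof (intro conjI ballI)
    show "W' \<subseteq> Eucl m" by (rule W'E)
    fix \<xi> assume "\<xi> \<in> W'"
    then have \<xi>: "\<xi> \<in> Eucl m" "p \<xi> \<in> W" by (auto simp: W'_def)
    obtain d where d: "0 < d" "\<forall>y\<in>Eucl n. box_close n d (p \<xi>) y \<longrightarrow> y \<in> W"
      using W \<xi>(2) unfolding openin_Eucl_iff by blast
    have "\<exists>e>0. \<forall>\<eta>\<in>Eucl m. box_close m e \<xi> \<eta> \<longrightarrow> \<bar>p \<eta> k - p \<xi> k\<bar> < d" if "k < n" for k
    proof -
      have "continuous_map (subtopology (Euclidean_space m) (Eucl m)) euclideanreal (\<lambda>\<xi>. p \<xi> k)"
        by (rule Ck_scalar_continuous[of 2]) (use p(1) that in \<open>simp add: Ck_map_def\<close>)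
      then show ?thesis unfolding continuous_Eucl_iff[OF order_refl] using \<xi>(1) d(1) by blast
    qed
    then obtain e where e: "\<And>k. k < n \<Longrightarrow> 0 < e k \<and> (\<forall>\<eta>\<in>Eucl m. box_close m (e k) \<xi> \<eta> \<longrightarrow> \<bar>p \<eta> k - p \<xi> k\<bar> < d)"
      by metis
    define e' where "e' = Min (insert 1 (e ` {..<n}))"
    have e'0: "0 < e'" unfolding e'_def using e by (subst Min_gr_iff) auto
    have e'le: "e' \<le> e k" if "k < n" for k unfolding e'_def using that by (intro Min_le) auto
    have "\<eta> \<in> W'" if \<eta>: "\<eta> \<in> Eucl m" "box_close m e' \<xi> \<eta>" for \<eta>
    proof -
      have "box_close n d (p \<xi>) (p \<eta>)"
        unfolding box_close_def using e e'le box_close_mono[OF \<eta>(2)] \<eta>(1) by blast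
      moreover have "p \<eta> \<in> Eucl n" using p(1) \<eta>(1) by (auto simp: Ck_map_def)
      ultimately show ?thesis using d(2) \<eta>(1) by (simp add: W'_def)
    qed
    then show "\<exists>e>0. \<forall>\<eta>\<in>Eucl m. box_close m e \<xi> \<eta> \<longrightarrow> \<eta> \<in> W'" using e'0 by blast
  qed
  have o: "origin \<in> W'" using p(2) W(2) by (simp add: W'_def origin_Eucl)
  have pW: "p ` W' \<subseteq> W" by (auto simp: W'_def)
  have p': "Ck_map 2 m n W' p"
    unfolding Ck_map_def
  proof (intro conjI allI impI)
    show "p ` W' \<subseteq> Eucl n" using p(1) W'E unfolding Ck_map_def by blast
    show "Ck_scalar 2 m W' (\<lambda>x. p x i)" if "i < n" for i
      using p(1) that by (auto simp: Ck_map_def intro: Ck_scalar_subset[OF W'E])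
  qed
  have sp: "Ck_scalar 2 m W' (\<lambda>\<xi>. s (p \<xi>) k)" if "k < n" for k
    by (rule Ck_scalar_compose[OF W' W(1) pW p', where f = "\<lambda>y. s y k"]) (use s(1) that in \<open>simp add: Ck_map_def\<close>)
  have \<pi>a: "(\<lambda>\<xi>. \<pi> (s (p \<xi>)) a) = (\<lambda>\<xi>. \<Sum>k<n. L $$ (a, k) * s (p \<xi>) k)" if "a < m" for a
    using that by (simp add: \<pi>_def lin_map_def)
  have "Ck_map 2 m m W' (\<lambda>\<xi>. \<pi> (s (p \<xi>)))"
    unfolding Ck_map_def
  proof (intro conjI allI impI)
    show "(\<lambda>\<xi>. \<pi> (s (p \<xi>))) ` W' \<subseteq> Eucl m" by (auto simp: \<pi>_def lin_map_def Eucl_iff)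
    show "Ck_scalar 2 m W' (\<lambda>\<xi>. \<pi> (s (p \<xi>)) a)" if "a < m" for a
      unfolding \<pi>a[OF that] by (intro Ck_scalar_sum[OF W'] Ck_scalar_cmult[OF W'] sp) simp
  qed
  moreover have \<pi>0: "\<pi> (s (p origin)) = origin" by (rule ext) (simp add: \<pi>_def lin_map_def p(2) s(2))
  moreover have "Ck_scalar 2 m W' (\<lambda>\<xi>. \<gamma> (p \<xi>))" by (rule Ck_scalar_compose[OF W' W(1) pW p' \<gamma>(1)])
  ultimately show "autonomous_system m (W', \<lambda>\<xi>. \<pi> (s (p \<xi>)), \<lambda>\<xi>. \<gamma> (p \<xi>))"
    using W' o p(2) \<gamma>(2) \<pi>0 by simp
  have p1: "Ck_map (Suc 1) m n W' p" using p' by (simp add: numeral_2_eq_2)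
  have chain: "partial_deriv a (\<lambda>\<xi>. f (p \<xi>)) origin = (\<Sum>l<n. partial_deriv l f origin * Q $$ (l, a))"
    if f: "Ck_scalar 2 n W f" and a: "a < m" for f a
  proof -
    have "Ck_scalar (Suc 1) n W f" using f by (simp add: numeral_2_eq_2)
    from partial_deriv_compose[OF W' W(1) p1 pW this o a] show ?thesis using dp a p(2) by simp
  qed
  show "lin_out m (W', \<lambda>\<xi>. \<pi> (s (p \<xi>)), \<lambda>\<xi>. \<gamma> (p \<xi>)) = lin_out n (W, s, \<gamma>) * Q"
  proof (rule eq_matI)
    fix i j assume ij: "i < dim_row (lin_out n (W, s, \<gamma>) * Q)" "j < dim_col (lin_out n (W, s, \<gamma>) * Q)"
    then have ij: "i < 1" "j < m" using Q by (auto simp: jacobian_def)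
    have c: "lin_out n (W, s, \<gamma>) \<in> carrier_mat 1 n" by (simp add: jacobian_def)
    show "lin_out m (W', \<lambda>\<xi>. \<pi> (s (p \<xi>)), \<lambda>\<xi>. \<gamma> (p \<xi>)) $$ (i, j) = (lin_out n (W, s, \<gamma>) * Q) $$ (i, j)"
      unfolding mult_index_sum[OF c Q ij] using ij chain[OF \<gamma>(1) ij(2)] by (simp add: jacobian_def)
  qed (use Q in \<open>auto simp: jacobian_def\<close>)
  show "lin_dyn m (W', \<lambda>\<xi>. \<pi> (s (p \<xi>)), \<lambda>\<xi>. \<gamma> (p \<xi>)) = L * lin_dyn n (W, s, \<gamma>) * Q"
  proof (rule eq_matI)
    let ?S = "lin_dyn n (W, s, \<gamma>)"
    have cS: "?S \<in> carrier_mat n n" by (simp add: jacobian_def)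
    have cLS: "L * ?S \<in> carrier_mat m n" by (rule mult_carrier_mat[OF L cS])
    fix b a assume "b < dim_row (L * ?S * Q)" "a < dim_col (L * ?S * Q)"
    then have b: "b < m" and a: "a < m" using Q L by auto
    have D: "((\<lambda>t. \<Sum>k<n. L $$ (b, k) * s (p (origin(a := t))) k) has_real_derivative
        (\<Sum>k<n. L $$ (b, k) * partial_deriv a (\<lambda>\<xi>. s (p \<xi>) k) origin)) (at 0)"
    proof (intro DERIV_sum DERIV_cmult)
      fix k assume "k \<in> {..<n}"
      then have "Ck_scalar (Suc 1) m W' (\<lambda>\<xi>. s (p \<xi>) k)" using sp by (simp add: numeral_2_eq_2)
      from partial_DERIV[OF this o a]
      show "((\<lambda>t. s (p (origin(a := t))) k) has_real_derivative partial_deriv a (\<lambda>\<xi>. s (p \<xi>) k) origin) (at 0)" .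
    qed
    have "partial_deriv a (\<lambda>\<xi>. \<pi> (s (p \<xi>)) b) origin = (\<Sum>k<n. L $$ (b, k) * partial_deriv a (\<lambda>\<xi>. s (p \<xi>) k) origin)"
      unfolding \<pi>a[OF b] partial_deriv_def[of a "\<lambda>\<xi>. \<Sum>k<n. L $$ (b, k) * s (p \<xi>) k"] by (rule DERIV_imp_deriv[OF D])
    also have "\<dots> = (\<Sum>k<n. L $$ (b, k) * (\<Sum>l<n. ?S $$ (k, l) * Q $$ (l, a)))"
    proof (rule sum.cong[OF refl])
      fix k assume k: "k \<in> {..<n}"
      have "partial_deriv a (\<lambda>\<xi>. s (p \<xi>) k) origin = (\<Sum>l<n. partial_deriv l (\<lambda>y. s y k) origin * Q $$ (l, a))"
        by (rule chain[of "\<lambda>y. s y k", OF _ a]) (use s(1) k in \<open>simp add: Ck_map_def\<close>)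
      then show "L $$ (b, k) * partial_deriv a (\<lambda>\<xi>. s (p \<xi>) k) origin = L $$ (b, k) * (\<Sum>l<n. ?S $$ (k, l) * Q $$ (l, a))"
        using k by (simp add: jacobian_def)
    qed
    also have "\<dots> = (\<Sum>k<n. \<Sum>l<n. L $$ (b, k) * ?S $$ (k, l) * Q $$ (l, a))"
      by (simp only: sum_distrib_left mult.assoc)
    also have "\<dots> = (\<Sum>l<n. (\<Sum>k<n. L $$ (b, k) * ?S $$ (k, l)) * Q $$ (l, a))"
      unfolding sum_distrib_right by (rule sum.swap)
    also have "\<dots> = (L * ?S * Q) $$ (b, a)"
      unfolding mult_index_sum[OF cLS Q b a] using mult_index_sum[OF L cS b] by simp
    finally show "lin_dyn m (W', \<lambda>\<xi>. \<pi> (s (p \<xi>)), \<lambda>\<xi>. \<gamma> (p \<xi>)) $$ (b, a) = (L * ?S * Q) $$ (b, a)"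
      using a b by (simp add: jacobian_def)
  qed (use Q L in \<open>auto simp: jacobian_def\<close>)
qed

text \<open>Since \<open>\<tau> = p \<circ> L \<circ> \<tau>\<close> on \<open>U\<close>, the given immersion factors through \<open>L \<circ> \<tau>\<close>, whose derivative along \<open>s1\<close> is
\<open>L s2(\<tau>) = L s2(p(L \<tau>))\<close>.\<close>

lemma factor_immersion:
  fixes L :: "real mat" and m n :: nat
  assumes U: "openin (Euclidean_space r) U" "U \<subseteq> W1" "origin \<in> U" and \<tau>: "Ck_map 2 r n U \<tau>" "\<tau> ` U \<subseteq> W2" "\<tau> origin = origin"
    and eq: "\<And>w. w \<in> U \<Longrightarrow> jacobian n r \<tau> w *\<^sub>v Matrix.vec r (s1 w) = Matrix.vec n (s2 (\<tau> w))"
    and out: "\<And>w. w \<in> U \<Longrightarrow> \<gamma>1 w = \<gamma>2 (\<tau> w)"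
  defines "\<pi> \<equiv> lin_map m n L"
  assumes graph: "\<And>w. w \<in> U \<Longrightarrow> \<tau> w = p (\<pi> (\<tau> w))"
  shows "locally_immersed r (W1, s1, \<gamma>1) m ({\<xi> \<in> Eucl m. p \<xi> \<in> W2}, \<lambda>\<xi>. \<pi> (s2 (p \<xi>)), \<lambda>\<xi>. \<gamma>2 (p \<xi>))"
  unfolding locally_immersed_def locally_immersed_via.simps
proof (intro exI[of _ "\<lambda>w. \<pi> (\<tau> w)"] exI[of _ U] conjI ballI U)
  have \<pi>E: "\<pi> y \<in> Eucl m" for y by (simp add: \<pi>_def lin_map_def Eucl_iff)
  have \<tau>k: "Ck_scalar 2 r U (\<lambda>w. \<tau> w k)" if "k < n" for k using \<tau>(1) that by (simp add: Ck_map_def)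
  have \<pi>a: "(\<lambda>w. \<pi> (\<tau> w) a) = (\<lambda>w. \<Sum>k<n. L $$ (a, k) * \<tau> w k)" if "a < m" for a
    using that by (simp add: \<pi>_def lin_map_def)
  show "Ck_map 2 r m U (\<lambda>w. \<pi> (\<tau> w))"
    unfolding Ck_map_def
  proof (intro conjI allI impI)
    show "(\<lambda>w. \<pi> (\<tau> w)) ` U \<subseteq> Eucl m" using \<pi>E by blast
    show "Ck_scalar 2 r U (\<lambda>w. \<pi> (\<tau> w) a)" if "a < m" for a
      unfolding \<pi>a[OF that] by (intro Ck_scalar_sum[OF U(1)] Ck_scalar_cmult[OF U(1)] \<tau>k) simp
  qed
  show "(\<lambda>w. \<pi> (\<tau> w)) ` U \<subseteq> {\<xi> \<in> Eucl m. p \<xi> \<in> W2}"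
  proof (rule image_subsetI)
    fix w assume "w \<in> U"
    then have "p (\<pi> (\<tau> w)) \<in> W2" using graph[symmetric] \<tau>(2) by auto
    then show "\<pi> (\<tau> w) \<in> {\<xi> \<in> Eucl m. p \<xi> \<in> W2}" using \<pi>E by simp
  qed
  show "\<pi> (\<tau> origin) = origin" by (rule ext) (simp add: \<pi>_def lin_map_def \<tau>(3))
  fix w assume w: "w \<in> U"
  show "\<gamma>1 w = \<gamma>2 (p (\<pi> (\<tau> w)))" using out[OF w] graph[OF w, symmetric] by simp
  show "jacobian m r (\<lambda>w. \<pi> (\<tau> w)) w *\<^sub>v Matrix.vec r (s1 w) = Matrix.vec m (\<pi> (s2 (p (\<pi> (\<tau> w)))))"
  proof (rule eq_vecI)
    fix a assume "a < dim_vec (Matrix.vec m (\<pi> (s2 (p (\<pi> (\<tau> w))))))"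
    then have a: "a < m" by simp
    have d: "partial_deriv j (\<lambda>w. \<pi> (\<tau> w) a) w = (\<Sum>k<n. L $$ (a, k) * partial_deriv j (\<lambda>w. \<tau> w k) w)" if j: "j < r" for j
      unfolding \<pi>a[OF a] partial_deriv_def[of j "\<lambda>w. \<Sum>k<n. L $$ (a, k) * \<tau> w k"]
    proof (intro DERIV_imp_deriv DERIV_sum DERIV_cmult)
      fix k assume "k \<in> {..<n}"
      then have "Ck_scalar (Suc 1) r U (\<lambda>w. \<tau> w k)" using \<tau>k by (simp add: numeral_2_eq_2)
      from partial_DERIV[OF this w j]
      show "((\<lambda>t. \<tau> (w(j := t)) k) has_real_derivative partial_deriv j (\<lambda>w. \<tau> w k) w) (at (w j))" .
    qed
    have "(jacobian m r (\<lambda>w. \<pi> (\<tau> w)) w *\<^sub>v Matrix.vec r (s1 w)) $ a =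
        (\<Sum>j<r. (\<Sum>k<n. L $$ (a, k) * partial_deriv j (\<lambda>w. \<tau> w k) w) * s1 w j)"
      unfolding jacobian_vec_index[OF a] using d by (intro sum.cong) auto
    also have "\<dots> = (\<Sum>k<n. \<Sum>j<r. L $$ (a, k) * partial_deriv j (\<lambda>w. \<tau> w k) w * s1 w j)"
      unfolding sum_distrib_right by (rule sum.swap)
    also have "\<dots> = (\<Sum>k<n. L $$ (a, k) * (\<Sum>j<r. partial_deriv j (\<lambda>w. \<tau> w k) w * s1 w j))"
      by (simp only: sum_distrib_left mult.assoc)
    also have "\<dots> = (\<Sum>k<n. L $$ (a, k) * s2 (\<tau> w) k)"
    proof (rule sum.cong[OF refl])
      fix k assume "k \<in> {..<n}"
      then have k: "k < n" by simp
      show "L $$ (a, k) * (\<Sum>j<r. partial_deriv j (\<lambda>w. \<tau> w k) w * s1 w j) = L $$ (a, k) * s2 (\<tau> w) k"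
        using jacobian_vec_index[OF k, of r \<tau> w "s1 w"] eq[OF w] k by simp
    qed
    also have "\<dots> = \<pi> (s2 (p (\<pi> (\<tau> w)))) a" unfolding graph[OF w, symmetric] using a by (simp add: \<pi>_def lin_map_def)
    finally show "(jacobian m r (\<lambda>w. \<pi> (\<tau> w)) w *\<^sub>v Matrix.vec r (s1 w)) $ a = Matrix.vec m (\<pi> (s2 (p (\<pi> (\<tau> w))))) $ a"
      using a by simp
  qed (simp add: jacobian_def)
qed

theorem proposition3p2:
  fixes r1 r2 :: nat
    and W1 W2 :: "(nat \<Rightarrow> real) set"
    and s1 s2 \<tau> :: "(nat \<Rightarrow> real) \<Rightarrow> nat \<Rightarrow> real"
    and \<gamma>1 \<gamma>2 :: "(nat \<Rightarrow> real) \<Rightarrow> real"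
  assumes "autonomous_system r1 (W1, s1, \<gamma>1)"
    and "lyapunov_stable_origin r1 (W1, s1, \<gamma>1)"
    and "\<forall>w0\<in>W1. nonwandering r1 (W1, s1, \<gamma>1) w0"
    and "autonomous_system r2 (W2, s2, \<gamma>2)"
    and "locally_immersed_via \<tau> r1 (W1, s1, \<gamma>1) r2 (W2, s2, \<gamma>2)"
  shows "\<exists>r3 W3 s3 \<gamma>3.
    autonomous_system r3 (W3, s3, \<gamma>3) \<and>
    locally_immersed r1 (W1, s1, \<gamma>1) r3 (W3, s3, \<gamma>3) \<and>
    (\<exists>V. invariant_subspace r2 (lin_dyn r2 (W2, s2, \<gamma>2)) V \<and>
         isomorphic_to_restriction (lin_dyn r3 (W3, s3, \<gamma>3)) r3 (lin_dyn r2 (W2, s2, \<gamma>2)) V) \<and>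
    (\<forall>p. eigenvalue (cmat (lin_dyn r3 (W3, s3, \<gamma>3))) p \<longrightarrow> Re p = 0) \<and>
    (detectable (lin_out r2 (W2, s2, \<gamma>2)) (lin_dyn r2 (W2, s2, \<gamma>2)) \<longrightarrow>
     detectable (lin_out r3 (W3, s3, \<gamma>3)) (lin_dyn r3 (W3, s3, \<gamma>3)))"
proof -
  note sys1 = assms(1) and sys2 = assms(4)
  have W2: "openin (Euclidean_space r2) W2" "origin \<in> W2" and s2: "Ck_map 2 r2 r2 W2 s2" "s2 origin = origin"
    using sys2 by auto
  obtain U where U: "openin (Euclidean_space r1) U" "U \<subseteq> W1" "origin \<in> U"
    and \<tau>: "Ck_map 2 r1 r2 U \<tau>" "\<tau> ` U \<subseteq> W2" "\<tau> origin = origin"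
    and eq: "\<forall>w\<in>U. jacobian r2 r1 \<tau> w *\<^sub>v Matrix.vec r1 (s1 w) = Matrix.vec r2 (s2 (\<tau> w)) \<and> \<gamma>1 w = \<gamma>2 (\<tau> w)"
    using assms(5)[unfolded locally_immersed_via.simps] by (elim exE conjE) (rule that)
  have \<tau>1: "Ck_map 1 r1 r2 U \<tau>" using \<tau>(1) Ck_map_SucD[of 1] by (simp add: numeral_2_eq_2)
  let ?S = "lin_dyn r2 (W2, s2, \<gamma>2)" and ?\<Gamma> = "lin_out r2 (W2, s2, \<gamma>2)"
  obtain m Q L p \<delta> where Q: "Q \<in> carrier_mat r2 m" and L: "L \<in> carrier_mat m r2" and LQ: "L * Q = 1\<^sub>m m"
    and SQ: "?S * Q = Q * (L * ?S * Q)" and ev: "\<forall>q. eigenvalue (cmat (L * ?S * Q)) q \<longrightarrow> Re q = 0"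
    and p: "Ck_map 2 m r2 (Eucl m) p" "p origin = origin"
    and dp: "\<forall>k<r2. \<forall>a<m. partial_deriv a (\<lambda>\<xi>. p \<xi> k) origin = Q $$ (k, a)" and \<delta>: "0 < \<delta>"
    and graph: "\<forall>\<zeta>. (\<forall>t. \<zeta> t \<in> cube r2 \<delta> \<and> (\<forall>k<r2. ((\<lambda>t. \<zeta> t k) has_real_derivative s2 (\<zeta> t) k) (at t))) \<longrightarrow>
       \<zeta> 0 = p (lin_map m r2 L (\<zeta> 0))"
    using center_graph[OF W2 s2, folded lin_dyn.simps[of r2 W2 s2 \<gamma>2]] by (elim exE conjE) (rule that)
  obtain \<epsilon> where \<epsilon>: "0 < \<epsilon>" "\<forall>x\<in>Eucl r1. eucl_norm r1 x \<le> \<epsilon> \<longrightarrow> x \<in> U \<and> \<tau> x \<in> cube r2 \<delta>"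
    using small_image[OF U(1,3) \<tau>1 \<tau>(3) \<delta>] by blast
  obtain d where d: "0 < d" and orbit: "\<forall>w\<in>W1. eucl_norm r1 w < d \<longrightarrow> (\<exists>X. X 0 = w \<and>
      (\<forall>t. X t \<in> Eucl r1 \<and> eucl_norm r1 (X t) \<le> \<epsilon> \<and> (\<forall>i<r1. ((\<lambda>u. X u i) has_real_derivative s1 (X t) i) (at t))))"
    using small_complete_orbits[OF sys1 assms(2) assms(3) \<epsilon>(1)] by (elim exE conjE) (rule that)
  \<comment> \<open>On this neighbourhood every point lies on a small complete orbit.\<close>
  define U' where "U' = {w \<in> U. eucl_norm r1 w < d}"
  have U': "openin (Euclidean_space r1) U'" "U' \<subseteq> W1" "origin \<in> U'" "U' \<subseteq> U"
    using openin_eucl_norm_ball[OF U(1)] U(2,3) d by (auto simp: U'_def L2_set_def)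
  have on_graph: "\<tau> w = p (lin_map m r2 L (\<tau> w))" if w: "w \<in> U'" for w
  proof -
    have "w \<in> W1" "eucl_norm r1 w < d" using w U'(2) by (auto simp: U'_def)
    from orbit[rule_format, OF this] obtain X where X0: "X 0 = w" and X: "\<forall>t. X t \<in> Eucl r1 \<and> eucl_norm r1 (X t) \<le> \<epsilon> \<and>
        (\<forall>i<r1. ((\<lambda>u. X u i) has_real_derivative s1 (X t) i) (at t))"
      by (elim exE conjE) (rule that)
    have XU: "X t \<in> U" "\<tau> (X t) \<in> cube r2 \<delta>" for t using X \<epsilon>(2) by blast+
    have "((\<lambda>u. \<tau> (X u) k) has_real_derivative s2 (\<tau> (X t)) k) (at t)" if "k < r2" for t k
      by (rule immersion_maps_orbits[OF U(1) \<tau>1 _ XU(1) _ that, where s = s1]) (use eq X in auto)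
    then have "\<tau> (X 0) = p (lin_map m r2 L (\<tau> (X 0)))"
      using XU(2) by (intro graph[rule_format, of "\<lambda>t. \<tau> (X t)"]) blast
    then show ?thesis unfolding X0 .
  qed
  have \<tau>': "Ck_map 2 r1 r2 U' \<tau>" "\<tau> ` U' \<subseteq> W2"
    using \<tau>(1,2) U'(4) by (auto simp: Ck_map_def intro: Ck_scalar_subset[OF U'(4)])
  have imm: "locally_immersed r1 (W1, s1, \<gamma>1) m ({\<xi> \<in> Eucl m. p \<xi> \<in> W2}, \<lambda>\<xi>. lin_map m r2 L (s2 (p \<xi>)), \<lambda>\<xi>. \<gamma>2 (p \<xi>))"
    by (rule factor_immersion[where L = L and n = r2 and m = m, OF U'(1-3) \<tau>' \<tau>(3) _ _ on_graph])
      (use eq U'(4) in blast)+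
  note sys3 = pullback_system[OF sys2 L Q p dp]
  have cS: "?S \<in> carrier_mat r2 r2" and c\<Gamma>: "?\<Gamma> \<in> carrier_mat 1 r2" by (simp_all add: jacobian_def)
  have cT: "L * ?S * Q \<in> carrier_mat m m" by (rule mult_carrier_mat[OF mult_carrier_mat[OF L cS] Q])
  note lin = cS cT Q L LQ SQ
  let ?W3 = "{\<xi> \<in> Eucl m. p \<xi> \<in> W2}" and ?s3 = "\<lambda>\<xi>. lin_map m r2 L (s2 (p \<xi>))" and ?\<gamma>3 = "\<lambda>\<xi>. \<gamma>2 (p \<xi>)"
  have "invariant_subspace r2 ?S ((\<lambda>x. Q *\<^sub>v x) ` carrier_vec m) \<and>
      isomorphic_to_restriction (lin_dyn m (?W3, ?s3, ?\<gamma>3)) m ?S ((\<lambda>x. Q *\<^sub>v x) ` carrier_vec m)"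
    unfolding sys3(2) by (intro conjI image_of_invariant_factor[OF lin])
  moreover have "\<forall>q. eigenvalue (cmat (lin_dyn m (?W3, ?s3, ?\<gamma>3))) q \<longrightarrow> Re q = 0"
    unfolding sys3(2) by (rule ev)
  moreover have "detectable ?\<Gamma> ?S \<longrightarrow> detectable (lin_out m (?W3, ?s3, ?\<gamma>3)) (lin_dyn m (?W3, ?s3, ?\<gamma>3))"
    unfolding sys3(2,3) by (intro impI detectable_factor[OF lin c\<Gamma>])
  ultimately have "autonomous_system m (?W3, ?s3, ?\<gamma>3) \<and> locally_immersed r1 (W1, s1, \<gamma>1) m (?W3, ?s3, ?\<gamma>3) \<and>
      (\<exists>V. invariant_subspace r2 ?S V \<and> isomorphic_to_restriction (lin_dyn m (?W3, ?s3, ?\<gamma>3)) m ?S V) \<and>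
      (\<forall>q. eigenvalue (cmat (lin_dyn m (?W3, ?s3, ?\<gamma>3))) q \<longrightarrow> Re q = 0) \<and>
      (detectable ?\<Gamma> ?S \<longrightarrow> detectable (lin_out m (?W3, ?s3, ?\<gamma>3)) (lin_dyn m (?W3, ?s3, ?\<gamma>3)))"
    by (intro conjI exI[of _ "(\<lambda>x. Q *\<^sub>v x) ` carrier_vec m"] sys3(1) imm) (elim conjE, assumption)+
  then show ?thesis 
    by - (rule exI[of _ m], rule exI[of _ ?W3], rule exI[of _ ?s3], rule exI[of _ ?\<gamma>3], assumption)
qed

end
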